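(* Let $G$ be a virtually $s$-step nilpotent group ($s\ge 1$) with a finite generating set $S$, and let $H$ be a torsion-free, $s$-step nilpotent, finite-index, normal subgroup of $G$. Let $F=G/H$, and let the multiset $A(S)\subset\mathbb{Q}^d$ and the polytope $P(S)=\mathrm{Conv}(A(S)^F)$ be as defined in the context. If no two elements of the multiset $A(S)$ lie on a common facet of $P(S)$, then the geodesic growth of $(G,S)$ is subexponential. More precisely: (1) if $s\le 2$, then $\gamma_{\mathrm{geod}}^{(G,S)}$ is bounded above by a polynomial; (2) if $s\ge 3$, then $\gamma_{\mathrm{geod}}^{(G,S)}(n)\preceq \exp\!\big(n^{\alpha_s}\log(n)\big)$, where $0<\alpha_s<1$ is the explicit constant defined in the context (e.g. $\alpha_3=3/5$). Otherwise (i.e. if two elements of $A(S)$ lie on a common facet of $P(S)$), the geodesic growth of $(G,S)$ is exponential, i.e. $\gamma_{\mathrm{geod}}^{(G,S)}(n)\succeq\exp(n)$.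
   Context: Generating sets generate $G$ as a monoid. For a word $w\in S^*$, $\ell(w)$ is its length and $\overline w\in G$ its evaluation. The word norm is $\|g\|_S=\min\{\ell(w): w\in S^*,\ \overline w=g\}$. A word $w\in S^*$ is a geodesic if $\ell(w)=\|\overline w\|_S$, and $\gamma_{\mathrm{geod}}^{(G,S)}(n)=\#\{w\in S^*: w \text{ geodesic},\ \ell(w)\le n\}$. For functions $f,g$ on positive integers, $f\preceq g$ means there is $C>0$ with $f(n)\le C g(Cn)+C$ for all $n\geq 1$; $f\succeq g$ means $g\preceq f$. The isolator of the commutator subgroup is $[[H,H]]=\{h\in H:\exists n>0,\ h^n\in[H,H]\}$. Let $\pi\colon H\to H/[[H,H]]\simeq\mathbb{Z}^d$ be the quotient map; the finite group $F=G/H$ acts on $H/[[H,H]]\simeq\mathbb{Z}^d$ by conjugation (and hence linearly on $\mathbb{Q}^d$, $\mathbb{R}^d$). $\mathrm{Sch}(H\backslash G,S)$ is the Schreier graph: vertices are the cosets $Hg$, with an edge labelled $s$ from $Hg$ to $Hgs$ for each $s\in S$. Since $H$ is normal, a word $a\in S^*$ labels a simple cycle based at the vertex $H$ if and only if it labels a simple cycle based at any other vertex; in this case we say that $a$ is a simple cycle (of length $\ge1$; loops and cycles of length 2 are allowed), and then $\overline a\in H$. Define the multiset $$A(S)=\left\{\frac{\pi(\overline a)}{\ell(a)}\in\mathbb{Q}^d \;:\; a\in S^* \text{ labels a simple cycle in } \mathrm{Sch}(H\backslash G,S)\right\},$$ in which a point $p$ appears as many times as there are simple cycles $a\in S^*$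 (as words) with $p=\pi(\overline a)/\ell(a)$. Thus two "elements" of $A(S)$ are those associated with two distinct simple cycles, possibly equal as points. $A^F$ denotes the union of the orbits of the points of $A$ under $F$, and $P(S)=\mathrm{Conv}(A(S)^F)\subset\mathbb{R}^d$. The constants are defined by $\alpha_2=0$ and $\alpha_s=\dfrac{1-\frac1s\alpha_{s-1}}{2-\alpha_{s-1}-\frac1s}$ for $s\ge 3$. *)

theory Defs
  imports
    "HOL-Analysis.Analysis"
    "HOL-Algebra.Generated_Groups"
    "HOL-Computational_Algebra.Polynomial"
    "HOL-Library.Multiset"
begin

definition word_eval :: "('a, 'b) monoid_scheme \<Rightarrow> 'a list \<Rightarrow> 'a" where
  "word_eval G w = foldr (mult G) w \<one>\<^bsub>G\<^esub>"

definition monoid_generating :: "('a, 'b) monoid_scheme \<Rightarrow> 'a set \<Rightarrow> bool" where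
  "monoid_generating G S \<longleftrightarrow> S \<subseteq> carrier G \<and> word_eval G ` lists S = carrier G"

definition word_norm :: "('a, 'b) monoid_scheme \<Rightarrow> 'a set \<Rightarrow> 'a \<Rightarrow> nat" where
  "word_norm G S g = (LEAST n. \<exists>w \<in> lists S. word_eval G w = g \<and> length w = n)"

definition geodesic_word :: "('a, 'b) monoid_scheme \<Rightarrow> 'a set \<Rightarrow> 'a list \<Rightarrow> bool" where
  "geodesic_word G S w \<longleftrightarrow> w \<in> lists S \<and> length w = word_norm G S (word_eval G w)"

definition geodesic_growth :: "('a, 'b) monoid_scheme \<Rightarrow> 'a set \<Rightarrow> nat \<Rightarrow> nat" where
  "geodesic_growth G S n = card {w. geodesic_word G S w \<and> length w \<le> n}"

text \<open>Growth functions are only meaningful at positive integers, so the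
  constant is a positive integer and \<open>C * n\<close> is again an admissible argument.\<close>

definition growth_le :: "(nat \<Rightarrow> real) \<Rightarrow> (nat \<Rightarrow> real) \<Rightarrow> bool" where
  "growth_le f g \<longleftrightarrow> (\<exists>C::nat. C > 0 \<and> (\<forall>n\<ge>1. f n \<le> real C * g (C * n) + real C))"

definition subexponential :: "(nat \<Rightarrow> real) \<Rightarrow> bool" where
  "subexponential f \<longleftrightarrow> (\<lambda>n. root n (f n)) \<longlonglongrightarrow> 1"

definition polynomially_bounded :: "(nat \<Rightarrow> real) \<Rightarrow> bool" where
  "polynomially_bounded f \<longleftrightarrow> (\<exists>p :: real poly. \<forall>n\<ge>1. f n \<le> poly p (real n))"

definition torsion_free :: "('a, 'b) monoid_scheme \<Rightarrow> 'a set \<Rightarrow> bool" where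
  "torsion_free G H \<longleftrightarrow> (\<forall>h\<in>H. \<forall>n::nat. n > 0 \<longrightarrow> h [^]\<^bsub>G\<^esub> n = \<one>\<^bsub>G\<^esub> \<longrightarrow> h = \<one>\<^bsub>G\<^esub>)"

text \<open>The lower central series of a subgroup, indexed from \<open>0\<close>:
  \<open>lower_central G H 0 = H\<close> is the term usually written \<open>\<gamma>\<^sub>1(H)\<close>.\<close>

primrec lower_central :: "('a, 'b) monoid_scheme \<Rightarrow> 'a set \<Rightarrow> nat \<Rightarrow> 'a set" where
  "lower_central G H 0 = H"
| "lower_central G H (Suc k) =
     generate G (\<Union>x\<in>lower_central G H k. \<Union>y\<in>H. {x \<otimes>\<^bsub>G\<^esub> y \<otimes>\<^bsub>G\<^esub> inv\<^bsub>G\<^esub> x \<otimes>\<^bsub>G\<^esub> inv\<^bsub>G\<^esub> y})"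

text \<open>Nilpotent of class exactly \<open>s\<close>.\<close>

definition step_nilpotent :: "('a, 'b) monoid_scheme \<Rightarrow> 'a set \<Rightarrow> nat \<Rightarrow> bool" where
  "step_nilpotent G H s \<longleftrightarrow>
     lower_central G H s = {\<one>\<^bsub>G\<^esub>} \<and> (\<forall>k<s. lower_central G H k \<noteq> {\<one>\<^bsub>G\<^esub>})"

definition isolator :: "('a, 'b) monoid_scheme \<Rightarrow> 'a set \<Rightarrow> 'a set" where
  "isolator G H = {h \<in> H. \<exists>n::nat. n > 0 \<and> h [^]\<^bsub>G\<^esub> n \<in> derived G H}"

text \<open>The group \<open>\<int>\<^sup>d\<close>, realised as the integer points of \<open>\<real>\<^sup>d\<close>.\<close>

definition int_lattice :: "(real ^ 'd) monoid" where
  "int_lattice = \<lparr>carrier = {v. \<forall>i. v $ i \<in> \<int>}, mult = (+), one = 0\<rparr>"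

abbreviation abelianization :: "('a, 'b) monoid_scheme \<Rightarrow> 'a set \<Rightarrow> 'a set monoid" where
  "abelianization G H \<equiv> G\<lparr>carrier := H\<rparr> Mod isolator G H"

text \<open>The projection \<open>\<pi>\<close>, for a chosen identification \<open>\<phi>\<close> of
  \<open>abelianization G H\<close> with \<open>\<int>\<^sup>d\<close>.\<close>

definition ab_proj ::
  "('a, 'b) monoid_scheme \<Rightarrow> 'a set \<Rightarrow> ('a set \<Rightarrow> real ^ 'd) \<Rightarrow> 'a \<Rightarrow> real ^ 'd" where
  "ab_proj G H \<phi> h = \<phi> (isolator G H #>\<^bsub>G\<^esub> h)"

text \<open>The linear extension to \<open>\<real>\<^sup>d\<close> of the conjugation action of an element
  \<open>X\<close> of \<open>G Mod H\<close>; it is well defined by \<open>conj_action_wd\<close> below.\<close>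

definition conj_action ::
  "('a, 'b) monoid_scheme \<Rightarrow> 'a set \<Rightarrow> ('a set \<Rightarrow> real ^ 'd) \<Rightarrow> 'a set \<Rightarrow> real ^ 'd \<Rightarrow> real ^ 'd" where
  "conj_action G H \<phi> X = (THE L. linear L \<and>
     (\<forall>g\<in>X. \<forall>h\<in>H. L (ab_proj G H \<phi> h) = ab_proj G H \<phi> (g \<otimes>\<^bsub>G\<^esub> h \<otimes>\<^bsub>G\<^esub> inv\<^bsub>G\<^esub> g)))"

text \<open>The Schreier graph has vertex set \<open>rcosets\<^bsub>G\<^esub> H\<close> and the following labelled edges.\<close>

definition schreier_edges ::
  "('a, 'b) monoid_scheme \<Rightarrow> 'a set \<Rightarrow> 'a set \<Rightarrow> ('a set \<times> 'a \<times> 'a set) set" where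
  "schreier_edges G H S =
     {(H #>\<^bsub>G\<^esub> g, s, H #>\<^bsub>G\<^esub> (g \<otimes>\<^bsub>G\<^esub> s)) | g s. g \<in> carrier G \<and> s \<in> S}"

text \<open>The list \<open>vs\<close> contains the pairwise distinct vertices visited by the closed walk
  labelled \<open>a\<close>, the final return to \<open>v\<close> being omitted.\<close>

definition labels_simple_cycle ::
  "('a, 'b) monoid_scheme \<Rightarrow> 'a set \<Rightarrow> 'a set \<Rightarrow> 'a set \<Rightarrow> 'a list \<Rightarrow> bool" where
  "labels_simple_cycle G H S v a \<longleftrightarrow> a \<noteq> [] \<and>
     (\<exists>vs. length vs = length a \<and> vs ! 0 = v \<and> distinct vs \<and>
        (\<forall>i<length a. (vs ! i, a ! i, vs ! (Suc i mod length a)) \<in> schreier_edges G H S))"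

definition simple_cycles :: "('a, 'b) monoid_scheme \<Rightarrow> 'a set \<Rightarrow> 'a set \<Rightarrow> 'a list set" where
  "simple_cycles G H S = {a \<in> lists S. labels_simple_cycle G H S H a}"

text \<open>\<open>mset_set\<close> is empty on infinite sets; see \<open>finite_simple_cycles\<close> below.\<close>

definition cycle_points ::
  "('a, 'b) monoid_scheme \<Rightarrow> 'a set \<Rightarrow> ('a set \<Rightarrow> real ^ 'd) \<Rightarrow> 'a set \<Rightarrow> (real ^ 'd) multiset" where
  "cycle_points G H \<phi> S =
     image_mset (\<lambda>a. ab_proj G H \<phi> (word_eval G a) /\<^sub>R real (length a))
       (mset_set (simple_cycles G H S))"

definition cycle_polytope ::
  "('a, 'b) monoid_scheme \<Rightarrow> 'a set \<Rightarrow> ('a set \<Rightarrow> real ^ 'd) \<Rightarrow> 'a set \<Rightarrow> (real ^ 'd) set" where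
  "cycle_polytope G H \<phi> S =
     convex hull {conj_action G H \<phi> X p | X p.
       X \<in> carrier (G Mod H) \<and> p \<in># cycle_points G H \<phi> S}"

text \<open>\<open>{#p, q#} \<subseteq># A\<close> says that \<open>p\<close> and \<open>q\<close> come from two distinct
  simple cycles; they may coincide as points.\<close>

definition two_on_common_facet ::
  "('a, 'b) monoid_scheme \<Rightarrow> 'a set \<Rightarrow> ('a set \<Rightarrow> real ^ 'd) \<Rightarrow> 'a set \<Rightarrow> bool" where
  "two_on_common_facet G H \<phi> S \<longleftrightarrow>
     (\<exists>p q D. {#p, q#} \<subseteq># cycle_points G H \<phi> S \<and>
        D facet_of cycle_polytope G H \<phi> S \<and> p \<in> D \<and> q \<in> D)"

text \<open>Only the values at \<open>s \<ge> 2\<close> are meaningful.\<close>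

fun growth_exponent :: "nat \<Rightarrow> real" where
  "growth_exponent s = (if s \<le> 2 then 0 else
     (1 - 1 / real s * growth_exponent (s - 1)) / (2 - growth_exponent (s - 1) - 1 / real s))"

declare growth_exponent.simps [simp del]

lemma growth_exponent_3: "growth_exponent 3 = 3 / 5"
  by (simp add: growth_exponent.simps[of 3] growth_exponent.simps[of 2])

lemma finite_simple_cycles:
  assumes "finite S" and "finite (rcosets\<^bsub>G\<^esub> H)"
  shows "finite (simple_cycles G H S)"
proof (rule finite_subset)
  show "finite {a. set a \<subseteq> S \<and> length a \<le> card (rcosets\<^bsub>G\<^esub> H)}"
    by (rule finite_lists_length_le[OF assms(1)])
  show "simple_cycles G H S \<subseteq> {a. set a \<subseteq> S \<and> length a \<le> card (rcosets\<^bsub>G\<^esub> H)}"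
  proof clarsimp
    fix a assume a: "a \<in> simple_cycles G H S"
    then obtain vs where vs: "length vs = length a" "distinct vs"
      "\<forall>i<length a. (vs ! i, a ! i, vs ! (Suc i mod length a)) \<in> schreier_edges G H S"
      by (auto simp: simple_cycles_def labels_simple_cycle_def)
    have "set vs \<subseteq> rcosets\<^bsub>G\<^esub> H"
    proof
      fix x assume "x \<in> set vs"
      then obtain i where "i < length a" "x = vs ! i" using vs(1) by (metis in_set_conv_nth)
      then obtain g where "g \<in> carrier G" "x = H #>\<^bsub>G\<^esub> g"
        using vs(3) unfolding schreier_edges_def by blast
      then show "x \<in> rcosets\<^bsub>G\<^esub> H"
        unfolding RCOSETS_def by blast
    qed
    then have "length a \<le> card (rcosets\<^bsub>G\<^esub> H)"
      using vs(1,2) assms(2) by (metis card_mono distinct_card)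
    moreover have "set a \<subseteq> S" using a by (auto simp: simple_cycles_def)
    ultimately show "set a \<subseteq> S \<and> length a \<le> card (rcosets\<^bsub>G\<^esub> H)" by simp
  qed
qed

lemma normal_isolator:
  assumes "group G" "H \<lhd> G"
  shows "isolator G H \<lhd> G"
proof -
  interpret group G by fact
  interpret H: normal H G by fact
  let ?D = "derived G H" and ?K = "G\<lparr>carrier := H\<rparr>"
  let ?Q = "?K Mod ?D"
  interpret D: normal ?D G by (rule derived_is_normal[OF assms(2)])
  have DK: "?D \<lhd> ?K" by (rule derived_subgroup_is_normal[OF H.subgroup_axioms])
  interpret K: group ?K by (rule subgroup_imp_group[OF H.subgroup_axioms])
  interpret DK: normal ?D ?K by (rule DK)
  interpret Q: comm_group ?Q
    by (rule derived_quot_of_subgroup_is_comm_group[OF H.subgroup_axioms])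
  let ?p = "\<lambda>h. ?D #>\<^bsub>?K\<^esub> h"
  have phom: "?p \<in> hom ?K ?Q" by (rule DK.r_coset_hom_Mod)
  interpret p: group_hom ?K ?Q ?p
    using K.is_group Q.is_group phom unfolding group_hom_def group_hom_axioms_def by blast
  have pow: "?p x [^]\<^bsub>?Q\<^esub> n = \<one>\<^bsub>?Q\<^esub> \<longleftrightarrow> x [^]\<^bsub>G\<^esub> n \<in> ?D" if "x \<in> H" for x and n :: nat
  proof -
    have xn: "x [^]\<^bsub>?K\<^esub> n = x [^]\<^bsub>G\<^esub> n" by (simp add: nat_pow_def)
    have xH: "x [^]\<^bsub>G\<^esub> n \<in> H" using K.nat_pow_closed[of x n] that xn by simp
    have "?p x [^]\<^bsub>?Q\<^esub> n = ?p (x [^]\<^bsub>G\<^esub> n)"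
      using p.hom_nat_pow[of x n] that xn by simp
    also have "\<dots> = \<one>\<^bsub>?Q\<^esub> \<longleftrightarrow> x [^]\<^bsub>G\<^esub> n \<in> ?D"
      using xH H.subset coset_join1[of ?D "x [^]\<^bsub>G\<^esub> n"] coset_join2[of "x [^]\<^bsub>G\<^esub> n" ?D]
        D.subgroup_axioms by (auto simp: FactGroup_def r_coset_def)
    finally show ?thesis .
  qed
  have iso: "isolator G H = {x \<in> H. \<exists>n::nat. n > 0 \<and> ?p x [^]\<^bsub>?Q\<^esub> n = \<one>\<^bsub>?Q\<^esub>}"
    using pow by (auto simp: isolator_def)
  have "subgroup (isolator G H) G"
  proof (rule subgroupI)
    show "isolator G H \<subseteq> carrier G" using H.subset by (auto simp: isolator_def)
    have "\<one>\<^bsub>G\<^esub> \<in> isolator G H"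
      using D.one_closed by (auto simp: isolator_def intro!: exI[of _ 1])
    then show "isolator G H \<noteq> {}" by blast
  next
    fix x assume "x \<in> isolator G H"
    then obtain n :: nat where n: "x \<in> H" "n > 0" "x [^]\<^bsub>G\<^esub> n \<in> ?D" by (auto simp: isolator_def)
    then have "inv\<^bsub>G\<^esub> (x [^]\<^bsub>G\<^esub> n) \<in> ?D" by blast
    then have "(inv\<^bsub>G\<^esub> x) [^]\<^bsub>G\<^esub> n \<in> ?D" using n H.subset by (metis nat_pow_inv subsetD)
    then show "inv\<^bsub>G\<^esub> x \<in> isolator G H" using n by (auto simp: isolator_def)
  next
    fix x y assume "x \<in> isolator G H" "y \<in> isolator G H"
    then obtain m n :: nat where *: "x \<in> H" "y \<in> H" "m > 0" "n > 0"
      "?p x [^]\<^bsub>?Q\<^esub> m = \<one>\<^bsub>?Q\<^esub>" "?p y [^]\<^bsub>?Q\<^esub> n = \<one>\<^bsub>?Q\<^esub>" by (auto simp: iso)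
    have c: "?p x \<in> carrier ?Q" "?p y \<in> carrier ?Q" using * p.hom_closed by auto
    have pe: "?p (x \<otimes>\<^bsub>G\<^esub> y) = ?p x \<otimes>\<^bsub>?Q\<^esub> ?p y" using p.hom_mult[of x y] * by simp
    have "?p x [^]\<^bsub>?Q\<^esub> (m * n) = \<one>\<^bsub>?Q\<^esub>"
      using c * by (simp add: Q.nat_pow_pow[symmetric] del: mult_FactGroup one_FactGroup)
    moreover have "?p y [^]\<^bsub>?Q\<^esub> (m * n) = \<one>\<^bsub>?Q\<^esub>"
      using c * by (simp add: Q.nat_pow_pow[symmetric] mult.commute[of m] del: mult_FactGroup one_FactGroup)
    ultimately have "(?p x \<otimes>\<^bsub>?Q\<^esub> ?p y) [^]\<^bsub>?Q\<^esub> (m * n) = \<one>\<^bsub>?Q\<^esub>"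
      using Q.pow_mult_distrib[OF Q.m_comm[OF c] c, of "m * n"] by (simp del: mult_FactGroup one_FactGroup)
    then show "x \<otimes>\<^bsub>G\<^esub> y \<in> isolator G H"
      using * pe unfolding iso by (auto intro!: exI[of _ "m * n"] simp del: mult_FactGroup one_FactGroup)
  qed
  moreover have "g \<otimes>\<^bsub>G\<^esub> x \<otimes>\<^bsub>G\<^esub> inv\<^bsub>G\<^esub> g \<in> isolator G H"
    if g: "g \<in> carrier G" and x: "x \<in> isolator G H" for g x
  proof -
    obtain n :: nat where n: "x \<in> H" "n > 0" "x [^]\<^bsub>G\<^esub> n \<in> ?D" using x by (auto simp: isolator_def)
    have xc: "x \<in> carrier G" using n H.subset by blast
    have canc: "inv\<^bsub>G\<^esub> g \<otimes>\<^bsub>G\<^esub> (g \<otimes>\<^bsub>G\<^esub> z) = z" if "z \<in> carrier G" for z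
      using g that by (simp add: m_assoc[symmetric])
    have "(g \<otimes>\<^bsub>G\<^esub> x \<otimes>\<^bsub>G\<^esub> inv\<^bsub>G\<^esub> g) [^]\<^bsub>G\<^esub> k = g \<otimes>\<^bsub>G\<^esub> x [^]\<^bsub>G\<^esub> k \<otimes>\<^bsub>G\<^esub> inv\<^bsub>G\<^esub> g" for k :: nat
    proof (induction k)
      case (Suc k)
      have "(g \<otimes>\<^bsub>G\<^esub> x [^]\<^bsub>G\<^esub> k \<otimes>\<^bsub>G\<^esub> inv\<^bsub>G\<^esub> g) \<otimes>\<^bsub>G\<^esub> (g \<otimes>\<^bsub>G\<^esub> x \<otimes>\<^bsub>G\<^esub> inv\<^bsub>G\<^esub> g)
          = g \<otimes>\<^bsub>G\<^esub> (x [^]\<^bsub>G\<^esub> k \<otimes>\<^bsub>G\<^esub> x) \<otimes>\<^bsub>G\<^esub> inv\<^bsub>G\<^esub> g"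
        using g xc by (simp add: m_assoc canc)
      then show ?case using Suc by simp
    qed (use g in simp)
    then show ?thesis
      using n g D.inv_op_closed2 H.inv_op_closed2 by (auto simp: isolator_def)
  qed
  ultimately show ?thesis by (auto simp: normal_inv_iff)
qed

lemma ab_proj_props:
  fixes \<phi> :: "'a set \<Rightarrow> real ^ 'd"
  assumes "group G" "H \<lhd> G"
    and "\<phi> \<in> iso (abelianization G H) (int_lattice :: (real ^ 'd) monoid)"
  shows "\<And>x y. x \<in> H \<Longrightarrow> y \<in> H \<Longrightarrow>
            ab_proj G H \<phi> (x \<otimes>\<^bsub>G\<^esub> y) = ab_proj G H \<phi> x + ab_proj G H \<phi> y"
    and "ab_proj G H \<phi> ` H = {v. \<forall>i. v $ i \<in> \<int>}"
    and "\<And>x y. x \<in> H \<Longrightarrow> y \<in> H \<Longrightarrow>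
            ab_proj G H \<phi> x = ab_proj G H \<phi> y \<longleftrightarrow> x \<otimes>\<^bsub>G\<^esub> inv\<^bsub>G\<^esub> y \<in> isolator G H"
proof -
  interpret group G by fact
  interpret H: normal H G by fact
  interpret I: normal "isolator G H" G by (rule normal_isolator[OF assms(1,2)])
  have coset: "isolator G H #>\<^bsub>G\<lparr>carrier := H\<rparr>\<^esub> h = isolator G H #>\<^bsub>G\<^esub> h" for h
    by (simp add: r_coset_def)
  have car: "carrier (abelianization G H) = (\<lambda>h. isolator G H #>\<^bsub>G\<^esub> h) ` H"
    by (auto simp: FactGroup_def RCOSETS_def coset)
  have hom: "\<phi> \<in> hom (abelianization G H) int_lattice"
    and bij: "bij_betw \<phi> (carrier (abelianization G H)) (carrier (int_lattice :: (real ^ 'd) monoid))"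
    using assms(3) by (auto simp: iso_def)
  show "ab_proj G H \<phi> (x \<otimes>\<^bsub>G\<^esub> y) = ab_proj G H \<phi> x + ab_proj G H \<phi> y"
    if "x \<in> H" "y \<in> H" for x y
  proof -
    have "\<phi> ((isolator G H #>\<^bsub>G\<^esub> x) <#>\<^bsub>G\<^esub> (isolator G H #>\<^bsub>G\<^esub> y))
        = \<phi> (isolator G H #>\<^bsub>G\<^esub> x) + \<phi> (isolator G H #>\<^bsub>G\<^esub> y)"
      using hom that car by (force simp: hom_def int_lattice_def FactGroup_def set_mult_def)
    then show ?thesis
      using that H.subset by (simp add: ab_proj_def I.rcos_sum subsetD)
  qed
  have "ab_proj G H \<phi> ` H = \<phi> ` carrier (abelianization G H)"
    by (auto simp: car ab_proj_def image_image)
  then show "ab_proj G H \<phi> ` H = {v. \<forall>i. v $ i \<in> \<int>}"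
    using bij by (simp add: bij_betw_def int_lattice_def)
  show "ab_proj G H \<phi> x = ab_proj G H \<phi> y \<longleftrightarrow> x \<otimes>\<^bsub>G\<^esub> inv\<^bsub>G\<^esub> y \<in> isolator G H"
    if "x \<in> H" "y \<in> H" for x y
  proof -
    have c: "x \<in> carrier G" "y \<in> carrier G" using that H.subset by auto
    have "ab_proj G H \<phi> x = ab_proj G H \<phi> y \<longleftrightarrow> isolator G H #>\<^bsub>G\<^esub> x = isolator G H #>\<^bsub>G\<^esub> y"
      unfolding ab_proj_def
      using inj_on_eq_iff[OF bij_betw_imp_inj_on[OF bij]] that unfolding car by blast
    also have "\<dots> \<longleftrightarrow> x \<otimes>\<^bsub>G\<^esub> inv\<^bsub>G\<^esub> y \<in> isolator G H"
    proof -
      have "x \<in> isolator G H #>\<^bsub>G\<^esub> y \<longleftrightarrow> x \<otimes>\<^bsub>G\<^esub> inv\<^bsub>G\<^esub> y \<in> isolator G H"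
        by (rule I.rcos_module[OF group_axioms c(2,1)])
      then show ?thesis
        using repr_independence[OF _ c(2) I.subgroup_axioms, of x] rcos_self[OF c(1) I.subgroup_axioms] by auto
    qed
    finally show ?thesis .
  qed
qed

lemma conj_action_wd:
  fixes \<phi> :: "'a set \<Rightarrow> real ^ 'd"
  assumes "group G" "H \<lhd> G"
    and "\<phi> \<in> iso (abelianization G H) (int_lattice :: (real ^ 'd) monoid)"
    and "X \<in> carrier (G Mod H)"
  shows "\<exists>!L. linear L \<and>
     (\<forall>g\<in>X. \<forall>h\<in>H. L (ab_proj G H \<phi> h) = ab_proj G H \<phi> (g \<otimes>\<^bsub>G\<^esub> h \<otimes>\<^bsub>G\<^esub> inv\<^bsub>G\<^esub> g))"
proof -
  interpret group G by fact
  interpret H: normal H G by fact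
  interpret I: normal "isolator G H" G by (rule normal_isolator[OF assms(1,2)])
  let ?pi = "ab_proj G H \<phi>"
  note add = ab_proj_props(1)[OF assms(1-3)] and img = ab_proj_props(2)[OF assms(1-3)]
    and eq = ab_proj_props(3)[OF assms(1-3)]
  obtain c where c: "c \<in> carrier G" "X = H #>\<^bsub>G\<^esub> c"
    using assms(4) by (auto simp: FactGroup_def RCOSETS_def)
  have Hc: "h \<in> carrier G" if "h \<in> H" for h using that H.subset by blast
  have cH: "g \<otimes>\<^bsub>G\<^esub> h \<otimes>\<^bsub>G\<^esub> inv\<^bsub>G\<^esub> g \<in> H" if "g \<in> carrier G" "h \<in> H" for g h
    using that by (rule H.inv_op_closed2)
  have canc: "inv\<^bsub>G\<^esub> c \<otimes>\<^bsub>G\<^esub> (c \<otimes>\<^bsub>G\<^esub> z) = z" if "z \<in> carrier G" for z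
    using c(1) that by (simp add: m_assoc[symmetric])
  have one: "?pi \<one>\<^bsub>G\<^esub> = 0" using add[of "\<one>\<^bsub>G\<^esub>" "\<one>\<^bsub>G\<^esub>"] by simp
  have inn: "?pi (k \<otimes>\<^bsub>G\<^esub> y \<otimes>\<^bsub>G\<^esub> inv\<^bsub>G\<^esub> k) = ?pi y" if "k \<in> H" "y \<in> H" for k y
  proof -
    have "?pi k + ?pi (inv\<^bsub>G\<^esub> k) = 0" using add[of k "inv\<^bsub>G\<^esub> k"] that one Hc by simp
    then show ?thesis using add that by (simp add: algebra_simps)
  qed
  define \<psi> where "\<psi> h = ?pi (c \<otimes>\<^bsub>G\<^esub> h \<otimes>\<^bsub>G\<^esub> inv\<^bsub>G\<^esub> c)" for h
  have X\<psi>: "?pi (g \<otimes>\<^bsub>G\<^esub> h \<otimes>\<^bsub>G\<^esub> inv\<^bsub>G\<^esub> g) = \<psi> h" if g: "g \<in> X" and h: "h \<in> H" for g h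
  proof -
    obtain k where k: "k \<in> H" "g = k \<otimes>\<^bsub>G\<^esub> c" using g c by (auto simp: r_coset_def)
    have "g \<otimes>\<^bsub>G\<^esub> h \<otimes>\<^bsub>G\<^esub> inv\<^bsub>G\<^esub> g = k \<otimes>\<^bsub>G\<^esub> (c \<otimes>\<^bsub>G\<^esub> h \<otimes>\<^bsub>G\<^esub> inv\<^bsub>G\<^esub> c) \<otimes>\<^bsub>G\<^esub> inv\<^bsub>G\<^esub> k"
      using k c Hc h by (simp add: inv_mult_group m_assoc)
    then show ?thesis using inn[OF k(1) cH[OF c(1) h]] by (simp add: \<psi>_def)
  qed
  have cX: "c \<in> X" using c rcos_self H.subgroup_axioms by blast
  have \<psi>add: "\<psi> (x \<otimes>\<^bsub>G\<^esub> y) = \<psi> x + \<psi> y" if "x \<in> H" "y \<in> H" for x y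
  proof -
    have "c \<otimes>\<^bsub>G\<^esub> (x \<otimes>\<^bsub>G\<^esub> y) \<otimes>\<^bsub>G\<^esub> inv\<^bsub>G\<^esub> c
        = (c \<otimes>\<^bsub>G\<^esub> x \<otimes>\<^bsub>G\<^esub> inv\<^bsub>G\<^esub> c) \<otimes>\<^bsub>G\<^esub> (c \<otimes>\<^bsub>G\<^esub> y \<otimes>\<^bsub>G\<^esub> inv\<^bsub>G\<^esub> c)"
      using c Hc that by (simp add: m_assoc canc)
    then show ?thesis using add cH c that by (simp add: \<psi>_def)
  qed
  have \<psi>eq: "\<psi> x = \<psi> y" if "x \<in> H" "y \<in> H" "?pi x = ?pi y" for x y
  proof -
    have "c \<otimes>\<^bsub>G\<^esub> (x \<otimes>\<^bsub>G\<^esub> inv\<^bsub>G\<^esub> y) \<otimes>\<^bsub>G\<^esub> inv\<^bsub>G\<^esub> c \<in> isolator G H"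
      using eq[OF that(1,2)] that(3) c I.inv_op_closed2 by blast
    moreover have "c \<otimes>\<^bsub>G\<^esub> (x \<otimes>\<^bsub>G\<^esub> inv\<^bsub>G\<^esub> y) \<otimes>\<^bsub>G\<^esub> inv\<^bsub>G\<^esub> c
        = (c \<otimes>\<^bsub>G\<^esub> x \<otimes>\<^bsub>G\<^esub> inv\<^bsub>G\<^esub> c) \<otimes>\<^bsub>G\<^esub> inv\<^bsub>G\<^esub> (c \<otimes>\<^bsub>G\<^esub> y \<otimes>\<^bsub>G\<^esub> inv\<^bsub>G\<^esub> c)"
      using c Hc that canc by (simp add: inv_mult_group m_assoc)
    ultimately show ?thesis
      using eq[of "c \<otimes>\<^bsub>G\<^esub> x \<otimes>\<^bsub>G\<^esub> inv\<^bsub>G\<^esub> c" "c \<otimes>\<^bsub>G\<^esub> y \<otimes>\<^bsub>G\<^esub> inv\<^bsub>G\<^esub> c"] cH c that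
      by (simp add: \<psi>_def)
  qed
  let ?Z = "{v :: real ^ 'd. \<forall>i. v $ i \<in> \<int>}"
  define \<theta> where "\<theta> v = \<psi> (SOME h. h \<in> H \<and> ?pi h = v)" for v
  have \<theta>pi: "\<theta> (?pi h) = \<psi> h" if "h \<in> H" for h
  proof -
    have "(SOME k. k \<in> H \<and> ?pi k = ?pi h) \<in> H \<and> ?pi (SOME k. k \<in> H \<and> ?pi k = ?pi h) = ?pi h"
      by (rule someI[of "\<lambda>k. k \<in> H \<and> ?pi k = ?pi h" h]) (use that in simp)
    then show ?thesis unfolding \<theta>_def using that by (blast intro: \<psi>eq)
  qed
  have \<theta>add: "\<theta> (u + v) = \<theta> u + \<theta> v" if "u \<in> ?Z" "v \<in> ?Z" for u v
  proof -
    have "u \<in> ?pi ` H" "v \<in> ?pi ` H" using that img by auto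
    then obtain x y where xy: "x \<in> H" "y \<in> H" "u = ?pi x" "v = ?pi y" by blast
    have "\<theta> (u + v) = \<theta> (?pi (x \<otimes>\<^bsub>G\<^esub> y))" using add xy by simp
    also have "\<dots> = \<theta> u + \<theta> v" using \<theta>pi \<psi>add[OF xy(1,2)] xy by simp
    finally show ?thesis .
  qed
  have \<theta>0: "\<theta> 0 = 0" using \<theta>add[of 0 0] by simp
  have \<theta>nat: "\<theta> (real n *\<^sub>R v) = real n *\<^sub>R \<theta> v" if "v \<in> ?Z" for n v
  proof (induction n)
    case (Suc n)
    have "\<theta> (real n *\<^sub>R v + v) = \<theta> (real n *\<^sub>R v) + \<theta> v"
      using that by (intro \<theta>add) auto
    then show ?case using Suc by (simp add: scaleR_left_distrib algebra_simps)
  qed (simp add: \<theta>0)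
  have \<theta>neg: "\<theta> (- v) = - \<theta> v" if "v \<in> ?Z" for v
  proof -
    have "\<theta> (v + - v) = \<theta> v + \<theta> (- v)" using that by (intro \<theta>add) auto
    then show ?thesis using \<theta>0 by (simp add: eq_neg_iff_add_eq_0 add.commute)
  qed
  have \<theta>int: "\<theta> (a *\<^sub>R v) = a *\<^sub>R \<theta> v" if a: "a \<in> \<int>" and v: "v \<in> ?Z" for a v
  proof -
    obtain z where z: "a = real_of_int z" using a by (auto elim: Ints_cases)
    show ?thesis
    proof (cases "z \<ge> 0")
      case True
      then have "a = real (nat z)" using z by simp
      then show ?thesis using \<theta>nat[OF v] by simp
    next
      case False
      then have a': "a = - real (nat (- z))" using z by simp
      have "\<theta> (a *\<^sub>R v) = \<theta> (- (real (nat (- z)) *\<^sub>R v))" using a' by simp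
      also have "\<dots> = - \<theta> (real (nat (- z)) *\<^sub>R v)" using v by (intro \<theta>neg) auto
      also have "\<dots> = a *\<^sub>R \<theta> v" using \<theta>nat[OF v, of "nat (- z)"] a' by simp
      finally show ?thesis .
    qed
  qed
  have axZ: "axis i 1 \<in> ?Z" for i by (auto simp: axis_def)
  have \<theta>sum: "\<theta> (\<Sum>i\<in>J. f i) = (\<Sum>i\<in>J. \<theta> (f i))" if "finite J" "\<And>i. f i \<in> ?Z" for J :: "'d set" and f
    using that(1)
  proof (induction J rule: finite_induct)
    case (insert j J)
    have "sum f J \<in> ?Z" using that(2) by auto
    then show ?case using insert \<theta>add[OF that(2)[of j]] by simp
  qed (simp add: \<theta>0)
  define L where "L v = (\<Sum>i\<in>UNIV. (v $ i) *\<^sub>R \<theta> (axis i 1))" for v :: "real ^ 'd"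
  have L: "linear L"
    by (rule linearI) (simp_all add: L_def scaleR_left_distrib sum.distrib scaleR_sum_right)
  have L\<theta>: "L v = \<theta> v" if v: "v \<in> ?Z" for v
  proof -
    have "\<theta> v = \<theta> (\<Sum>i\<in>UNIV. (v $ i) *\<^sub>R axis i 1)"
      using basis_expansion[of v] by (simp add: scalar_mult_eq_scaleR)
    also have "\<dots> = (\<Sum>i\<in>UNIV. \<theta> ((v $ i) *\<^sub>R axis i 1))"
      using v by (intro \<theta>sum) (auto simp: axis_def)
    also have "\<dots> = L v" unfolding L_def using v axZ by (intro sum.cong \<theta>int) auto
    finally show ?thesis by simp
  qed
  have piZ: "?pi h \<in> ?Z" if "h \<in> H" for h using img that by blast
  have Lpi: "L (?pi h) = \<psi> h" if "h \<in> H" for h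
    using L\<theta>[OF piZ[OF that]] \<theta>pi[OF that] by (rule trans)
  show ?thesis
  proof (rule ex1I[of _ L])
    show "linear L \<and> (\<forall>g\<in>X. \<forall>h\<in>H. L (?pi h) = ?pi (g \<otimes>\<^bsub>G\<^esub> h \<otimes>\<^bsub>G\<^esub> inv\<^bsub>G\<^esub> g))"
      using L Lpi X\<psi> by auto
  next
    fix M assume M: "linear M \<and> (\<forall>g\<in>X. \<forall>h\<in>H. M (?pi h) = ?pi (g \<otimes>\<^bsub>G\<^esub> h \<otimes>\<^bsub>G\<^esub> inv\<^bsub>G\<^esub> g))"
    have "M b = L b" if b: "b \<in> Basis" for b
    proof -
      obtain i where "b = axis i 1" using b by (auto simp: Basis_vec_def)
      then have "b \<in> ?pi ` H" using axZ[of i] img by simp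
      then obtain h where h: "h \<in> H" "b = ?pi h" by blast
      have "M (?pi h) = \<psi> h" using M cX h(1) X\<psi>[OF cX h(1)] by metis
      then show ?thesis using h Lpi by simp
    qed
    then show "M = L" using linear_eq_stdbasis[of M L] M L by blast
  qed
qed

end

theory Submission
  imports Defs "HOL-Real_Asymp.Real_Asymp"
begin

text \<open>
  Loop erasure writes a word as a product of loops \<open>p a p\<^sup>-\<^sup>1\<close>, with \<open>p\<close> a simple path and \<open>a\<close> a simple
  cycle of the Schreier graph, followed by a simple path (\<open>word_run\<close>). There are finitely many loops, their
  values lie in \<open>H\<close>, and the lengths of their cycles add up to the length of the word up to a constant. The
  points \<open>\<pi> (p a p\<^sup>-\<^sup>1) / \<ell> a\<close> of the loops are exactly those spanning the polytope (\<open>cycle_polytope_eq\<close>),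
  so the polytope governs the lengths of products of loops in the abelianization.

  Exponential growth: a facet is cut out by a linear functional that is at most a positive constant on the
  polytope, hence bounds word length from below, with equality on every product of cycles whose points lie on
  the facet. If two distinct cycles lie on it, all their products are geodesic, and two simple cycles form a
  prefix code (\<open>exponential_lower_bound\<close>).

  Upper bounds: call a sequence of loops nonoptimal if modulo \<open>[H, H]\<close> it can be replaced by a shorter one. If
  all loops of some set occur often in an optimal sequence, their points lie on a common facet, since otherwise
  their mean could be pushed outwards inside the polytope and so be realised by fewer letters
  (\<open>frequent_loops_on_facet\<close>). When no two cycles lie on a facet, this nearly determines the word: at each vertex
  at most one edge belongs to a cycle on the facet (\<open>good_unique\<close>), and an optimal sequence of loops leaves these
  edges a bounded number of times. Such words are called tame; there are polynomially many of them
  (\<open>tame_count\<close>).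

  It remains to bound the number of tame pieces of a geodesic. Cut the loop sequence of \<open>w\<close> greedily into
  nonoptimal blocks that are optimal up to their last loop, hence tame. Each block can be shortened modulo
  \<open>[H, H]\<close>. In class two the error made by \<open>k\<close> such replacements is absorbed almost completely by conjugating
  the powers of the remaining loops by short elements, and what is left is a central element with exponents
  \<open>O (k)\<close>, of length \<open>O (\<surd>k)\<close>. Hence \<open>k\<close> blocks save about \<open>k\<close> letters (\<open>class2_saving\<close>) and a geodesic has
  boundedly many. For larger class, cut a word of length \<open>n\<close> into pieces of length about \<open>n\<^sup>x\<close>, shorten each of
  them modulo \<open>\<Gamma> i\<close>, and correct the product of the errors in \<open>\<Gamma> i\<close>: a product of \<open>N\<close> elements
  of \<open>\<Gamma> i\<close> of length \<open>m\<close> has, modulo \<open>\<Gamma> (i + 1)\<close>, length only about \<open>N\<^sup>1\<^sup>/\<^sup>s m\<close> with \<open>s = i + 1\<close>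
  (\<open>cheap_Gamma_product\<close>). Balancing the two contributions by the choice of \<open>x\<close> gives the recursion for
  \<open>\<alpha>\<^sub>s\<close> (\<open>short_mod_step\<close>), and a geodesic has \<open>O (n\<^sup>\<alpha>)\<close> tame pieces, each with polynomially many choices.
\<close>

declare in_listsD [rule del] in_listsI [rule del]

section \<open>Words, balls and the Schreier graph\<close>

definition commutator :: "('a, 'b) monoid_scheme \<Rightarrow> 'a \<Rightarrow> 'a \<Rightarrow> 'a" where
  "commutator G x y = x \<otimes>\<^bsub>G\<^esub> y \<otimes>\<^bsub>G\<^esub> inv\<^bsub>G\<^esub> x \<otimes>\<^bsub>G\<^esub> inv\<^bsub>G\<^esub> y"

context group
begin

lemma inv_cancel_left [simp]:
  "x \<in> carrier G \<Longrightarrow> y \<in> carrier G \<Longrightarrow> inv x \<otimes> (x \<otimes> y) = y"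
  by (simp add: m_assoc[symmetric])

lemma cancel_inv_left [simp]:
  "x \<in> carrier G \<Longrightarrow> y \<in> carrier G \<Longrightarrow> x \<otimes> (inv x \<otimes> y) = y"
  by (simp add: m_assoc[symmetric])

lemma word_eval_Nil [simp]: "word_eval G [] = \<one>"
  by (simp add: word_eval_def)

lemma word_eval_Cons [simp]: "word_eval G (x # w) = x \<otimes> word_eval G w"
  by (simp add: word_eval_def)

lemma word_eval_closed [simp]: "set w \<subseteq> carrier G \<Longrightarrow> word_eval G w \<in> carrier G"
  by (induction w) auto

lemma word_eval_append:
  "set u \<subseteq> carrier G \<Longrightarrow> set v \<subseteq> carrier G \<Longrightarrow>
    word_eval G (u @ v) = word_eval G u \<otimes> word_eval G v"
  by (induction u) (auto simp: m_assoc)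

lemma word_eval_replicate: "x \<in> carrier G \<Longrightarrow> word_eval G (replicate n x) = x [^] n"
  by (induction n) (auto simp: nat_pow_Suc2[symmetric] simp del: nat_pow_Suc)

lemma commutator_closed [simp]:
  "x \<in> carrier G \<Longrightarrow> y \<in> carrier G \<Longrightarrow> commutator G x y \<in> carrier G"
  by (simp add: commutator_def)

lemma commutator_swap:
  "x \<in> carrier G \<Longrightarrow> y \<in> carrier G \<Longrightarrow> x \<otimes> y = commutator G x y \<otimes> (y \<otimes> x)"
  by (simp add: commutator_def m_assoc)

lemma inv_commutator:
  "x \<in> carrier G \<Longrightarrow> y \<in> carrier G \<Longrightarrow> inv (commutator G x y) = commutator G y x"
  by (simp add: commutator_def m_assoc inv_mult_group)

lemma normal_coset_eq_iff:
  assumes "N \<lhd> G" "x \<in> carrier G" "y \<in> carrier G"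
  shows "N #> x = N #> y \<longleftrightarrow> x \<otimes> inv y \<in> N"
proof -
  interpret N: normal N G by fact
  have "x \<in> N #> y \<longleftrightarrow> x \<otimes> inv y \<in> N"
    by (rule N.rcos_module[OF group_axioms assms(3,2)])
  then show ?thesis
    using repr_independence[OF _ assms(3) N.subgroup_axioms, of x]
      rcos_self[OF assms(2) N.subgroup_axioms] by auto
qed

lemma normal_coset_one_iff:
  assumes "N \<lhd> G" "x \<in> carrier G"
  shows "N #> x = N \<longleftrightarrow> x \<in> N"
  using normal_coset_eq_iff[OF assms(1,2) one_closed] assms
    normal_imp_subgroup[OF assms(1), THEN subgroup.subset] by simp

end

locale finite_index_pair = group G for G (structure) +
  fixes S H :: "'a set"
  assumes finite_S: "finite S" and gen_S: "monoid_generating G S"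
    and normal_H: "H \<lhd> G" and finite_index: "finite (rcosets H)"

sublocale finite_index_pair \<subseteq> H: normal H G
  by (rule normal_H)

context finite_index_pair
begin

lemma S_carrier: "S \<subseteq> carrier G"
  using gen_S by (simp add: monoid_generating_def)

lemma S_words: "w \<in> lists S \<Longrightarrow> set w \<subseteq> carrier G"
  using S_carrier by (auto simp: in_lists_conv_set)

lemma H_carrier [simp]: "h \<in> H \<Longrightarrow> h \<in> carrier G"
  using H.subset by blast

lemma eval_closed [simp]: "w \<in> lists S \<Longrightarrow> word_eval G w \<in> carrier G"
  by (simp add: S_words)

lemma eval_append [simp]:
  "u \<in> lists S \<Longrightarrow> v \<in> lists S \<Longrightarrow> word_eval G (u @ v) = word_eval G u \<otimes> word_eval G v"
  by (simp add: S_words word_eval_append)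

definition ball :: "nat \<Rightarrow> 'a set" where
  "ball n = {word_eval G w | w. w \<in> lists S \<and> length w \<le> n}"

lemma ball_carrier: "g \<in> ball n \<Longrightarrow> g \<in> carrier G"
  by (auto simp: ball_def)

lemma ball_mono: "g \<in> ball m \<Longrightarrow> m \<le> n \<Longrightarrow> g \<in> ball n"
  unfolding ball_def by force

lemma one_ball: "\<one> \<in> ball n"
  unfolding ball_def by (force intro!: exI[of _ "[]"])

lemma eval_ball: "w \<in> lists S \<Longrightarrow> word_eval G w \<in> ball (length w)"
  by (auto simp: ball_def)

lemma ball_mult: "g \<in> ball m \<Longrightarrow> h \<in> ball n \<Longrightarrow> g \<otimes> h \<in> ball (m + n)"
proof -
  assume "g \<in> ball m" "h \<in> ball n"
  then obtain u v where "u \<in> lists S" "v \<in> lists S" "length u \<le> m" "length v \<le> n"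
    "g = word_eval G u" "h = word_eval G v" by (auto simp: ball_def)
  then show ?thesis
    unfolding ball_def by (auto intro!: exI[of _ "u @ v"])
qed

lemma ball_pow: "g \<in> ball m \<Longrightarrow> g [^] (n::nat) \<in> ball (n * m)"
proof (induction n)
  case (Suc n)
  then show ?case using ball_mult[of "g [^] n" "n * m" g m] by (simp add: add.commute)
qed (simp add: one_ball)

lemma carrier_ball: "g \<in> carrier G \<Longrightarrow> \<exists>n. g \<in> ball n"
proof -
  assume "g \<in> carrier G"
  then obtain w where "w \<in> lists S" "g = word_eval G w"
    using gen_S unfolding monoid_generating_def by blast
  then show ?thesis using eval_ball by blast
qed

lemma finite_in_ball: "finite A \<Longrightarrow> A \<subseteq> carrier G \<Longrightarrow> \<exists>n. A \<subseteq> ball n"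
proof (induction A rule: finite_induct)
  case (insert x A)
  then obtain n m where "A \<subseteq> ball n" "x \<in> ball m" using carrier_ball by blast
  then have "insert x A \<subseteq> ball (max m n)" using ball_mono by (auto intro: ball_mono)
  then show ?case by blast
qed simp

text \<open>Since \<open>S\<close> only generates \<open>G\<close> as a monoid, inversion costs a constant factor.\<close>

lemma ball_inv: "\<exists>C. \<forall>n. \<forall>g\<in>ball n. inv g \<in> ball (C * n)"
proof -
  obtain C where C: "(\<lambda>s. inv s) ` S \<subseteq> ball C"
    using finite_in_ball[of "(\<lambda>s. inv s) ` S"] finite_S S_carrier by auto
  have "inv (word_eval G w) \<in> ball (C * length w)" if "w \<in> lists S" for w
    using that
  proof (induction w)
    case (Cons s w)
    then have s: "s \<in> S" "s \<in> carrier G" "w \<in> lists S" using S_carrier by auto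
    have "inv (word_eval G w) \<otimes> inv s \<in> ball (C * length w + C)"
      using Cons s C by (intro ball_mult) auto
    then show ?case using s eval_closed[of w] by (simp add: inv_mult_group add.commute)
  qed (simp add: one_ball)
  note inv_word = this
  have "inv g \<in> ball (C * n)" if g: "g \<in> ball n" for n g
  proof -
    obtain w where w: "w \<in> lists S" "length w \<le> n" "g = word_eval G w"
      using g by (auto simp: ball_def)
    show ?thesis using ball_mono[OF inv_word[OF w(1)], of "C * n"] w by simp
  qed
  then show ?thesis by blast
qed

definition vx :: "'a list \<Rightarrow> 'a set" where "vx w = H #> word_eval G w"

lemma vx_Nil: "vx [] = H"
  by (simp add: vx_def H.subset)

lemma vx_append: "u \<in> lists S \<Longrightarrow> v \<in> lists S \<Longrightarrow> vx (u @ v) = vx u #> word_eval G v"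
  by (simp add: vx_def coset_mult_assoc H.subset)

lemma vx_append_cong:
  "u \<in> lists S \<Longrightarrow> u' \<in> lists S \<Longrightarrow> v \<in> lists S \<Longrightarrow> vx u = vx u' \<Longrightarrow> vx (u @ v) = vx (u' @ v)"
  by (simp add: vx_append)

lemma H_coset_left_cancel:
  assumes "g \<in> carrier G" "x \<in> carrier G" "y \<in> carrier G"
  shows "H #> (g \<otimes> x) = H #> (g \<otimes> y) \<longleftrightarrow> H #> x = H #> y"
proof -
  have "H #> (g \<otimes> x) = H #> (g \<otimes> y) \<longleftrightarrow> g \<otimes> (x \<otimes> inv y) \<otimes> inv g \<in> H"
    using assms by (subst normal_coset_eq_iff[OF normal_H]) (simp_all add: inv_mult_group m_assoc)
  also have "\<dots> \<longleftrightarrow> x \<otimes> inv y \<in> H"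
  proof
    assume "g \<otimes> (x \<otimes> inv y) \<otimes> inv g \<in> H"
    then have "inv g \<otimes> (g \<otimes> (x \<otimes> inv y) \<otimes> inv g) \<otimes> g \<in> H"
      using assms by (intro H.inv_op_closed1)
    then show "x \<otimes> inv y \<in> H" using assms by (simp add: m_assoc)
  qed (use assms in \<open>intro H.inv_op_closed2; simp\<close>)
  also have "\<dots> \<longleftrightarrow> H #> x = H #> y"
    using assms by (simp add: normal_coset_eq_iff[OF normal_H])
  finally show ?thesis .
qed

text \<open>Left translation by a word is an automorphism of the Schreier graph because \<open>H\<close> is normal; this is why simple
  cycles may be read at any vertex.\<close>

lemma vx_prefix_cancel:
  assumes "p \<in> lists S" "u \<in> lists S" "v \<in> lists S"
  shows "vx (p @ u) = vx (p @ v) \<longleftrightarrow> vx u = vx v"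
  using assms H_coset_left_cancel[of "word_eval G p" "word_eval G u" "word_eval G v"]
  by (simp add: vx_def)

lemma vx_eq_H: "w \<in> lists S \<Longrightarrow> vx w = H \<longleftrightarrow> word_eval G w \<in> H"
  using normal_coset_one_iff[OF normal_H, of "word_eval G w"] by (simp add: vx_def)

lemma simple_cycles_iff:
  "a \<in> simple_cycles G H S \<longleftrightarrow> a \<in> lists S \<and> a \<noteq> [] \<and> word_eval G a \<in> H \<and>
     inj_on (\<lambda>i. vx (take i a)) {..<length a}" (is "?L \<longleftrightarrow> ?R")
proof
  assume L: ?L
  then have a: "a \<in> lists S" "a \<noteq> []" by (auto simp: simple_cycles_def labels_simple_cycle_def)
  from L obtain vs where vs: "length vs = length a" "vs ! 0 = H" "distinct vs"
    "\<forall>i<length a. (vs ! i, a ! i, vs ! (Suc i mod length a)) \<in> schreier_edges G H S"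
    by (auto simp: simple_cycles_def labels_simple_cycle_def)
  have edge: "vs ! (Suc i mod length a) = vs ! i #> (a ! i)" if "i < length a" for i
  proof -
    obtain g where "g \<in> carrier G" "a ! i \<in> S" "vs ! i = H #> g" "vs ! (Suc i mod length a) = H #> (g \<otimes> a ! i)"
      using vs(4) \<open>i < length a\<close> unfolding schreier_edges_def by blast
    then show ?thesis using S_carrier by (simp add: coset_mult_assoc H.subset subsetD)
  qed
  have tk: "take i a \<in> lists S" for i using a(1) by (metis append_in_lists_conv append_take_drop_id)
  have step: "vx (take (Suc i) a) = vx (take i a) #> (a ! i)" if "i < length a" for i
  proof -
    have "a ! i \<in> S" using a(1) that by (auto simp: in_lists_conv_set)
    then show ?thesis
      using that tk[of i] S_carrier by (subst take_Suc_conv_app_nth) (auto simp: vx_append subsetD)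
  qed
  have vsi: "vs ! i = vx (take i a)" if "i < length a" for i using that
  proof (induction i)
    case (Suc i)
    then show ?case using edge[of i] step[of i] by simp
  qed (simp add: vs vx_Nil)
  have "vx a = H"
  proof -
    define n where "n = length a - 1"
    have n: "n < length a" "Suc n = length a" using a(2) by (cases a, auto simp: n_def)+
    have "vx a = vx (take (Suc n) a)" using n by simp
    also have "\<dots> = vs ! (Suc n mod length a)" using step[OF n(1)] vsi[OF n(1)] edge[OF n(1)] by simp
    also have "\<dots> = H" using n vs(2) by simp
    finally show ?thesis .
  qed
  then have "word_eval G a \<in> H" using vx_eq_H[OF a(1)] by simp
  moreover have "inj_on (\<lambda>i. vx (take i a)) {..<length a}"
  proof (rule inj_onI)
    fix i j assume ij: "i \<in> {..<length a}" "j \<in> {..<length a}" "vx (take i a) = vx (take j a)"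
    then have "vs ! i = vs ! j" using vsi by simp
    then show "i = j" using vs(1,3) ij by (simp add: nth_eq_iff_index_eq)
  qed
  ultimately show ?R using a by blast
next
  assume R: ?R
  then have a: "a \<in> lists S" "a \<noteq> []" by auto
  have tk: "take i a \<in> lists S" for i using a(1) by (metis append_in_lists_conv append_take_drop_id)
  let ?vs = "map (\<lambda>i. vx (take i a)) [0..<length a]"
  have "(?vs ! i, a ! i, ?vs ! (Suc i mod length a)) \<in> schreier_edges G H S" if "i < length a" for i
  proof -
    have ai: "a ! i \<in> S" using a(1) that by (auto simp: in_lists_conv_set)
    have "?vs ! (Suc i mod length a) = vx (take (Suc i) a)"
    proof (cases "Suc i = length a")
      case True
      then have "?vs ! (Suc i mod length a) = vx []" using a(2) by simp
      also have "\<dots> = vx a" using R vx_eq_H[OF a(1)] vx_Nil by simp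
      finally show ?thesis using True by simp
    qed (use that in simp)
    also have "\<dots> = H #> (word_eval G (take i a) \<otimes> a ! i)"
      using that tk[of i] ai S_carrier
      by (subst take_Suc_conv_app_nth) (auto simp: vx_def subsetD)
    finally show ?thesis
      using that ai tk[of i] unfolding schreier_edges_def by (auto simp: vx_def)
  qed
  moreover have "distinct ?vs" using R by (auto simp: distinct_map inj_on_def)
  moreover have "?vs ! 0 = H" using a(2) by (simp add: vx_Nil)
  ultimately have "labels_simple_cycle G H S H a"
    unfolding labels_simple_cycle_def using a(2) by (intro conjI exI[of _ ?vs]) auto
  then show ?L using a(1) by (simp add: simple_cycles_def)
qed

section \<open>Loop erasure\<close>

definition simple_path :: "'a list \<Rightarrow> bool" where
  "simple_path u \<longleftrightarrow> u \<in> lists S \<and> inj_on (\<lambda>i. vx (take i u)) {..length u}"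

lemma simple_path_Nil: "simple_path []"
  by (simp add: simple_path_def)

lemma vx_in_rcosets: "w \<in> lists S \<Longrightarrow> vx w \<in> rcosets H"
  by (auto simp: vx_def RCOSETS_def)

lemma take_lists: "w \<in> lists A \<Longrightarrow> take i w \<in> lists A"
  by (metis append_in_lists_conv append_take_drop_id)

lemma drop_lists: "w \<in> lists A \<Longrightarrow> drop i w \<in> lists A"
  by (metis append_in_lists_conv append_take_drop_id)

lemma simple_path_length: "simple_path u \<Longrightarrow> length u < card (rcosets H)"
proof -
  assume u: "simple_path u"
  have "(\<lambda>i. vx (take i u)) ` {..length u} \<subseteq> rcosets H"
    using u vx_in_rcosets take_lists unfolding simple_path_def by blast
  then have "card {..length u} \<le> card (rcosets H)"
    using u card_inj_on_le[OF _ _ finite_index] unfolding simple_path_def by blast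
  then show ?thesis by simp
qed

lemma finite_simple_paths: "finite {u. simple_path u}"
proof (rule finite_subset)
  show "finite {u. set u \<subseteq> S \<and> length u \<le> card (rcosets H)}"
    by (rule finite_lists_length_le[OF finite_S])
  show "{u. simple_path u} \<subseteq> {u. set u \<subseteq> S \<and> length u \<le> card (rcosets H)}"
    using simple_path_length[THEN less_imp_le] by (auto simp: simple_path_def in_lists_conv_set)
qed

text \<open>A loop is a pair of a simple path \<open>p\<close> starting at the vertex \<open>H\<close> and a simple cycle \<open>a\<close>
  to be read at the end of \<open>p\<close>; its value \<open>p a p\<^sup>-\<^sup>1\<close> lies in \<open>H\<close>, and its length does not
  count the connecting path.\<close>

definition loops :: "('a list \<times> 'a list) set" where
  "loops = {p. simple_path p} \<times> simple_cycles G H S"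

definition loop_val :: "'a list \<times> 'a list \<Rightarrow> 'a" where
  "loop_val c = word_eval G (fst c) \<otimes> word_eval G (snd c) \<otimes> inv (word_eval G (fst c))"

definition loop_len :: "'a list \<times> 'a list \<Rightarrow> nat" where "loop_len c = length (snd c)"

definition loops_val :: "('a list \<times> 'a list) list \<Rightarrow> 'a" where
  "loops_val cs = word_eval G (map loop_val cs)"

definition loops_len :: "('a list \<times> 'a list) list \<Rightarrow> nat" where
  "loops_len cs = sum_list (map loop_len cs)"

lemma finite_loops: "finite loops"
  unfolding loops_def
  by (intro finite_cartesian_product finite_simple_paths finite_simple_cycles finite_S finite_index)

lemma loop_val_H: "c \<in> loops \<Longrightarrow> loop_val c \<in> H"
  unfolding loops_def loop_val_def
  by (auto simp: simple_cycles_iff simple_path_def simp del: in_lists_conv_set intro!: H.inv_op_closed2)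

lemma loop_len_pos: "c \<in> loops \<Longrightarrow> 0 < loop_len c"
  by (auto simp: loops_def loop_len_def simple_cycles_iff)

lemma loops_val_Nil [simp]: "loops_val [] = \<one>"
  and loops_val_Cons [simp]: "loops_val (c # cs) = loop_val c \<otimes> loops_val cs"
  by (simp_all add: loops_val_def)

lemma loops_len_simps [simp]: "loops_len [] = 0" "loops_len (c # cs) = loop_len c + loops_len cs"
  "loops_len (cs @ ds) = loops_len cs + loops_len ds"
  by (simp_all add: loops_len_def)

lemma loops_val_H: "cs \<in> lists loops \<Longrightarrow> loops_val cs \<in> H"
  by (induction cs) (auto simp: loop_val_H)

lemma loops_val_append: "cs \<in> lists loops \<Longrightarrow> ds \<in> lists loops \<Longrightarrow>
    loops_val (cs @ ds) = loops_val cs \<otimes> loops_val ds"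
  unfolding loops_val_def by (subst map_append, rule word_eval_append)
    (auto simp: in_lists_conv_set intro!: H_carrier loop_val_H)

lemma length_le_loops_len: "cs \<in> lists loops \<Longrightarrow> length cs \<le> loops_len cs"
  by (induction cs) (auto dest: loop_len_pos)

text \<open>Loop erasure: \<open>run u w cs u'\<close> says that reading \<open>w\<close> letter by letter on top of the stack \<open>u\<close>,
  and popping a simple cycle as soon as a vertex of the stack is revisited, pops the loops \<open>cs\<close>
  and ends with the stack \<open>u'\<close>.\<close>

inductive run :: "'a list \<Rightarrow> 'a list \<Rightarrow> ('a list \<times> 'a list) list \<Rightarrow> 'a list \<Rightarrow> bool" where
  run_Nil: "run u [] [] u"
| run_push: "simple_path (u @ [s]) \<Longrightarrow> run (u @ [s]) w cs u' \<Longrightarrow> run u (s # w) cs u'"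
| run_pop: "s \<in> S \<Longrightarrow> simple_path (p @ q) \<Longrightarrow> vx p = vx (p @ q @ [s]) \<Longrightarrow> run p w cs u' \<Longrightarrow>
     run (p @ q) (s # w) ((p, q @ [s]) # cs) u'"

lemma simple_path_prefix: "simple_path (p @ q) \<Longrightarrow> simple_path p"
proof -
  assume a: "simple_path (p @ q)"
  have "inj_on (\<lambda>i. vx (take i (p @ q))) {..length p}"
    using a unfolding simple_path_def by (auto intro: inj_on_subset)
  moreover have "inj_on (\<lambda>i. vx (take i (p @ q))) {..length p} = inj_on (\<lambda>i. vx (take i p)) {..length p}"
    by (rule inj_on_cong) auto
  ultimately show ?thesis using a unfolding simple_path_def by auto
qed

lemma popped_loop:
  assumes "s \<in> S" "simple_path (p @ q)" "vx p = vx (p @ q @ [s])"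
  shows "(p, q @ [s]) \<in> loops"
proof -
  have l: "p \<in> lists S" "q \<in> lists S" "[s] \<in> lists S" "q @ [s] \<in> lists S"
    using assms(1,2) by (auto simp: simple_path_def)
  have "vx [] = vx (q @ [s])"
    using vx_prefix_cancel[of p "[]" "q @ [s]"] l assms(3) by simp
  then have "word_eval G (q @ [s]) \<in> H" using vx_eq_H[OF l(4)] vx_Nil by simp
  moreover have "inj_on (\<lambda>i. vx (take i (q @ [s]))) {..<length (q @ [s])}"
  proof (rule inj_onI)
    fix i j assume ij: "i \<in> {..<length (q @ [s])}" "j \<in> {..<length (q @ [s])}"
      "vx (take i (q @ [s])) = vx (take j (q @ [s]))"
    then have "vx (take i q) = vx (take j q)" by simp
    then have "vx (p @ take i q) = vx (p @ take j q)"
      using vx_prefix_cancel l take_lists by metis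
    then have "vx (take (length p + i) (p @ q)) = vx (take (length p + j) (p @ q))" by simp
    moreover have "inj_on (\<lambda>i. vx (take i (p @ q))) {..length (p @ q)}"
      using assms(2) by (simp add: simple_path_def)
    ultimately have "length p + i = length p + j"
      using ij(1,2) by (elim inj_onD) auto
    then show "i = j" by simp
  qed
  ultimately show ?thesis
    using l simple_path_prefix[OF assms(2)] by (simp add: loops_def simple_cycles_iff)
qed

lemma run_exists: "simple_path u \<Longrightarrow> w \<in> lists S \<Longrightarrow> \<exists>cs u'. run u w cs u'"
proof (induction w arbitrary: u)
  case Nil
  then show ?case using run_Nil by blast
next
  case (Cons s w)
  have s: "s \<in> S" "w \<in> lists S" "u \<in> lists S" using Cons.prems by (auto simp: simple_path_def)
  show ?case
  proof (cases "\<exists>i\<le>length u. vx (take i u) = vx (u @ [s])")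
    case True
    then obtain i where i: "i \<le> length u" "vx (take i u) = vx (u @ [s])" by blast
    have u: "u = take i u @ drop i u" by simp
    have sp: "simple_path (take i u)" using Cons.prems(1) simple_path_prefix u by metis
    then obtain cs u' where "run (take i u) w cs u'" using Cons.IH s by blast
    then have "run (take i u @ drop i u) (s # w) ((take i u, drop i u @ [s]) # cs) u'"
      using run.run_pop[of s "take i u" "drop i u" w cs u'] s Cons.prems i
      by (simp flip: append_assoc)
    then show ?thesis using u by metis
  next
    case False
    have "inj_on (\<lambda>i. vx (take i (u @ [s]))) {..length (u @ [s])}"
    proof -
      have "inj_on (\<lambda>i. vx (take i (u @ [s]))) {..length u}
          = inj_on (\<lambda>i. vx (take i u)) {..length u}" by (rule inj_on_cong) auto
      then have 1: "inj_on (\<lambda>i. vx (take i (u @ [s]))) {..length u}"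
        using Cons.prems unfolding simple_path_def by blast
      have "{..length (u @ [s])} = insert (Suc (length u)) {..length u}" by auto
      then show ?thesis using 1 False by (auto simp: image_iff)
    qed
    then have "simple_path (u @ [s])" using s by (simp add: simple_path_def)
    then show ?thesis using Cons.IH s run_push by blast
  qed
qed

lemma run_invariants:
  "run u w cs u' \<Longrightarrow> simple_path u \<Longrightarrow>
     w \<in> lists S \<and> cs \<in> lists loops \<and> simple_path u' \<and>
     word_eval G u \<otimes> word_eval G w = loops_val cs \<otimes> word_eval G u' \<and>
     length u + length w = loops_len cs + length u'"
proof (induction rule: run.induct)
  case (run_Nil u)
  then have "u \<in> lists S" by (simp add: simple_path_def)
  then show ?case using run_Nil eval_closed[of u] by simp
next
  case (run_push u s w cs u')
  then have "u \<in> lists S" "s \<in> S" by (auto simp: simple_path_def)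
  then have "word_eval G (u @ [s]) = word_eval G u \<otimes> s" "s \<in> carrier G" "word_eval G u \<in> carrier G"
    using eval_append[of u "[s]"] S_carrier eval_closed[of u] by auto
  moreover have "w \<in> lists S" "word_eval G w \<in> carrier G"
    using run_push eval_closed[of w] by auto
  ultimately show ?case using run_push \<open>s \<in> S\<close> by (auto simp: m_assoc)
next
  case (run_pop s p q w cs u')
  have pl: "(p, q @ [s]) \<in> loops" using popped_loop run_pop by blast
  have sp: "simple_path p" using simple_path_prefix run_pop by blast
  note IH = run_pop.IH[OF sp]
  have l: "p \<in> lists S" "q \<in> lists S" "[s] \<in> lists S" "w \<in> lists S" "u' \<in> lists S"
    using run_pop IH by (auto simp: simple_path_def)
  note c = l[THEN eval_closed]
  have sc: "s \<in> carrier G" using run_pop S_carrier by auto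
  have lv: "loops_val cs \<in> carrier G" using loops_val_H IH by auto
  have "word_eval G (p @ q) \<otimes> word_eval G (s # w)
      = loop_val (p, q @ [s]) \<otimes> (word_eval G p \<otimes> word_eval G w)"
    using c sc l by (simp add: loop_val_def m_assoc)
  also have "\<dots> = loop_val (p, q @ [s]) \<otimes> (loops_val cs \<otimes> word_eval G u')" using IH by simp
  finally show ?case using IH pl c lv loop_val_H[OF pl] run_pop.hyps(1) by (auto simp: m_assoc loop_len_def)
qed

text \<open>Runs are cut at the loops, not at the letters: a block of popped loops accounts for a factor of the word
  together with the stacks before and after it.\<close>

lemma run_split:
  "run u w (cs1 @ cs2) u' \<Longrightarrow> \<exists>w1 w2 v. w = w1 @ w2 \<and> run u w1 cs1 v \<and> run v w2 cs2 u'"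
proof (induction u w "cs1 @ cs2" u' arbitrary: cs1 rule: run.induct)
  case (run_Nil u)
  then show ?case using run.run_Nil by auto
next
  case (run_push u s w u')
  then obtain w1 w2 v where "w = w1 @ w2" "run (u @ [s]) w1 cs1 v" "run v w2 cs2 u'" by blast
  then show ?case using run.run_push[OF run_push(1)] by (metis append_Cons)
next
  case (run_pop s p q w cs u')
  show ?case
  proof (cases cs1)
    case Nil
    then have "run (p @ q) (s # w) cs2 u'"
      using run.run_pop[OF run_pop(1-4)] run_pop(6) by simp
    then show ?thesis using Nil run.run_Nil by blast
  next
    case (Cons c cs1')
    then have *: "c = (p, q @ [s])" "cs = cs1' @ cs2" using run_pop(6) by auto
    then obtain w1 w2 v where "w = w1 @ w2" "run p w1 cs1' v" "run v w2 cs2 u'"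
      using run_pop(5) by blast
    then have "s # w = (s # w1) @ w2" "run (p @ q) (s # w1) cs1 v"
      using run.run_pop[OF run_pop(1-3)] Cons * by auto
    then show ?thesis using \<open>run v w2 cs2 u'\<close> by blast
  qed
qed

lemma word_run:
  assumes "w \<in> lists S"
  obtains cs u where "run [] w cs u" "cs \<in> lists loops" "simple_path u"
    "word_eval G w = loops_val cs \<otimes> word_eval G u" "length w = loops_len cs + length u"
proof -
  obtain cs u where r: "run [] w cs u" using run_exists[OF simple_path_Nil assms] by blast
  show thesis
    using that[OF r] run_invariants[OF r simple_path_Nil] assms eval_closed[of w] by auto
qed

lemma simple_path_to_H: "simple_path u \<Longrightarrow> word_eval G u \<in> H \<Longrightarrow> u = []"
proof (rule ccontr)
  assume u: "simple_path u" "word_eval G u \<in> H" "u \<noteq> []"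
  then have "vx (take (length u) u) = vx (take 0 u)"
    using vx_eq_H[of u] vx_Nil by (simp add: simple_path_def)
  moreover have "inj_on (\<lambda>i. vx (take i u)) {..length u}" using u(1) by (simp add: simple_path_def)
  ultimately have "length u = 0"
    by (elim inj_onD) auto
  then show False using u by simp
qed

lemma H_word_loops:
  assumes "w \<in> lists S" "word_eval G w \<in> H"
  obtains cs where "cs \<in> lists loops" "word_eval G w = loops_val cs" "length w = loops_len cs"
proof -
  obtain cs u where r: "cs \<in> lists loops" "simple_path u"
    "word_eval G w = loops_val cs \<otimes> word_eval G u" "length w = loops_len cs + length u"
    using word_run[OF assms(1)] by blast
  have h: "loops_val cs \<in> H" using loops_val_H r by blast
  have "word_eval G u = inv (loops_val cs) \<otimes> word_eval G w"
    using r h eval_closed[of u] by (auto simp: simple_path_def)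
  then have "word_eval G u \<in> H" using h assms by simp
  then have "u = []" using simple_path_to_H r by blast
  then show thesis using that r h by simp
qed

lemma H_loops:
  assumes "h \<in> H"
  obtains cs where "cs \<in> lists loops" "h = loops_val cs"
proof -
  obtain w where "w \<in> lists S" "h = word_eval G w"
    using assms gen_S H_carrier unfolding monoid_generating_def by (metis imageE)
  then show thesis using H_word_loops that assms by metis
qed

lemma simple_path_to_coset:
  assumes "X \<in> rcosets H"
  obtains p where "simple_path p" "X = vx p"
proof -
  obtain g where g: "g \<in> carrier G" "X = H #> g" using assms by (auto simp: RCOSETS_def)
  then obtain w where w: "w \<in> lists S" "g = word_eval G w"
    using gen_S unfolding monoid_generating_def by (metis imageE)
  obtain cs u where r: "cs \<in> lists loops" "simple_path u"
    "word_eval G w = loops_val cs \<otimes> word_eval G u"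
    using word_run[OF w(1)] by blast
  have "u \<in> lists S" using r by (simp add: simple_path_def)
  then have "H #> g = vx u"
    using r loops_val_H[OF r(1)] coset_mult_assoc[OF H.subset, of "loops_val cs" "word_eval G u"] w
      coset_join2[OF _ H.subgroup_axioms, of "loops_val cs"] eval_closed[of u] by (simp add: vx_def)
  then show thesis using that[OF r(2)] g(2) by simp
qed

lemma loop_realise:
  assumes "c \<in> loops"
  shows "fst c \<in> lists S" "snd c \<in> lists S" "length (fst c) < card (rcosets H)"
    "word_eval G (fst c) \<otimes> word_eval G (snd c) [^] (n::nat) = loop_val c [^] n \<otimes> word_eval G (fst c)"
proof -
  show l: "fst c \<in> lists S" "snd c \<in> lists S" "length (fst c) < card (rcosets H)"
    using assms simple_path_length[of "fst c"]
    by (simp_all add: loops_def mem_Times_iff simple_path_def simple_cycles_iff)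
  note e = l(1,2)[THEN eval_closed]
  have lv: "loop_val c \<in> carrier G" using e by (simp add: loop_val_def)
  have *: "word_eval G (fst c) \<otimes> word_eval G (snd c) = loop_val c \<otimes> word_eval G (fst c)"
    using e by (simp add: loop_val_def m_assoc)
  show "word_eval G (fst c) \<otimes> word_eval G (snd c) [^] n = loop_val c [^] n \<otimes> word_eval G (fst c)"
  proof (induction n)
    case (Suc n)
    have "word_eval G (fst c) \<otimes> word_eval G (snd c) [^] Suc n
        = (word_eval G (fst c) \<otimes> word_eval G (snd c) [^] n) \<otimes> word_eval G (snd c)"
      using e by (simp add: m_assoc)
    also have "\<dots> = loop_val c [^] n \<otimes> (word_eval G (fst c) \<otimes> word_eval G (snd c))"
      using e lv Suc by (simp add: m_assoc)
    finally show ?case using e lv * by (simp add: m_assoc)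
  qed (use e in simp)
qed

end

section \<open>Moving a weight to few positions\<close>

lemma linear_dependence:
  fixes v :: "'j \<Rightarrow> 'b \<Rightarrow> real"
  assumes "finite B" "finite J" "card B < card J"
  shows "\<exists>u. (\<exists>j\<in>J. u j \<noteq> 0) \<and> (\<forall>b\<in>B. (\<Sum>j\<in>J. u j * v j b) = 0)"
  using assms
proof (induction B arbitrary: J v rule: finite_induct)
  case empty
  then have "J \<noteq> {}" by auto
  then show ?case by (intro exI[of _ "\<lambda>_. 1"]) auto
next
  case (insert b B)
  show ?case
  proof (cases "\<forall>j\<in>J. v j b = 0")
    case True
    have "card B < card J" using insert by simp
    then obtain u where "\<exists>j\<in>J. u j \<noteq> 0" "\<forall>b\<in>B. (\<Sum>j\<in>J. u j * v j b) = 0"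
      using insert.IH[OF insert.prems(1), of v] by blast
    then show ?thesis using True by (intro exI[of _ u]) auto
  next
    case False
    then obtain i where i: "i \<in> J" "v i b \<noteq> 0" by blast
    define v' where "v' j c = v j c - v j b / v i b * v i c" for j c
    have "card B < card (J - {i})" using insert i by simp
    then obtain u where u: "\<exists>j\<in>J - {i}. u j \<noteq> 0" "\<And>c. c \<in> B \<Longrightarrow> (\<Sum>j\<in>J - {i}. u j * v' j c) = 0"
      using insert.IH[of "J - {i}" v'] insert.prems(1) by blast
    define w where "w j = (if j = i then - (\<Sum>j\<in>J - {i}. u j * v j b) / v i b else u j)" for j
    have split: "(\<Sum>j\<in>J. w j * v j c) = w i * v i c + (\<Sum>j\<in>J - {i}. u j * v j c)" for c
    proof -
      have "(\<Sum>j\<in>J. w j * v j c) = w i * v i c + (\<Sum>j\<in>J - {i}. w j * v j c)"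
        by (rule sum.remove[OF insert.prems(1) i(1)])
      also have "(\<Sum>j\<in>J - {i}. w j * v j c) = (\<Sum>j\<in>J - {i}. u j * v j c)"
        by (rule sum.cong) (auto simp: w_def)
      finally show ?thesis .
    qed
    have wi: "w i = - (\<Sum>j\<in>J - {i}. u j * v j b) / v i b" by (simp add: w_def)
    have "(\<Sum>j\<in>J. w j * v j b) = 0"
      unfolding split wi using i by simp
    moreover have "(\<Sum>j\<in>J. w j * v j c) = 0" if "c \<in> B" for c
    proof -
      have "(\<Sum>j\<in>J - {i}. u j * v' j c) =
          (\<Sum>j\<in>J - {i}. u j * v j c) - (\<Sum>j\<in>J - {i}. u j * v j b) / v i b * v i c"
      proof -
        have "(\<Sum>j\<in>J - {i}. u j * v' j c) = (\<Sum>j\<in>J - {i}. u j * v j c - u j * v j b / v i b * v i c)"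
          by (rule sum.cong) (simp_all add: v'_def algebra_simps)
        then show ?thesis by (simp only: sum_subtractf sum_distrib_right sum_divide_distrib)
      qed
      then show ?thesis unfolding split wi using u(2)[OF that] by simp
    qed
    moreover have "\<exists>j\<in>J. w j \<noteq> 0" using u(1) by (auto simp: w_def)
    ultimately show ?thesis by blast
  qed
qed

text \<open>As long as more coordinates than constraints are nonzero, a linear dependence among the vectors allows
  moving along a line that keeps all constraints until some coordinate vanishes.\<close>

lemma conic_caratheodory:
  fixes v :: "'j \<Rightarrow> 'b \<Rightarrow> real"
  assumes "finite B" "finite J" "\<And>j. j \<in> J \<Longrightarrow> 0 \<le> t j"
  shows "\<exists>t'. (\<forall>j. 0 \<le> t' j) \<and> {j. t' j \<noteq> 0} \<subseteq> J \<and> card {j. t' j \<noteq> 0} \<le> card B \<and>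
    (\<forall>b\<in>B. (\<Sum>j\<in>J. t' j * v j b) = (\<Sum>j\<in>J. t j * v j b))"
proof -
  define P where "P t' \<longleftrightarrow> (\<forall>j. 0 \<le> t' j) \<and> {j. t' j \<noteq> 0} \<subseteq> J \<and>
    (\<forall>b\<in>B. (\<Sum>j\<in>J. t' j * v j b) = (\<Sum>j\<in>J. t j * v j b))" for t' :: "'j \<Rightarrow> real"
  have "P (\<lambda>j. if j \<in> J then t j else 0)" unfolding P_def using assms by (auto intro!: sum.cong)
  then obtain t' where P: "P t'" and min: "\<And>s. P s \<Longrightarrow> card {j. t' j \<noteq> 0} \<le> card {j. s j \<noteq> 0}"
    using ex_has_least_nat[of P _ "\<lambda>s. card {j. s j \<noteq> 0}"] by blast
  note t' = P[unfolded P_def]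
  have "card {j. t' j \<noteq> 0} \<le> card B"
  proof (rule ccontr)
    let ?I = "{j. t' j \<noteq> 0}"
    assume "\<not> ?thesis"
    moreover have finI: "finite ?I" using t' assms(2) finite_subset by blast
    ultimately obtain u0 where u0: "\<exists>j\<in>?I. u0 j \<noteq> 0" "\<forall>b\<in>B. (\<Sum>j\<in>?I. u0 j * v j b) = 0"
      using linear_dependence[OF assms(1) finI, of v] by auto
    define u where "u = (if \<exists>j\<in>?I. u0 j > 0 then u0 else (\<lambda>j. - u0 j))"
    have upos: "\<exists>j\<in>?I. u j > 0" using u0(1) unfolding u_def by (auto simp: not_less) (metis less_eq_real_def)
    have usum: "(\<Sum>j\<in>?I. u j * v j b) = 0" if "b \<in> B" for b
      using u0(2) that by (auto simp: u_def sum_negf)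
    let ?U = "{j \<in> ?I. u j > 0}"
    define l where "l = Min ((\<lambda>j. t' j / u j) ` ?U)"
    have finU: "finite ?U" "?U \<noteq> {}" using finI upos by auto
    then have "l \<in> (\<lambda>j. t' j / u j) ` ?U"
      unfolding l_def by (intro Min_in) auto
    then obtain i where i: "i \<in> ?U" "l = t' i / u i" by blast
    have l0: "0 \<le> l" using i t' by auto
    define s where "s j = (if j \<in> ?I then t' j - l * u j else 0)" for j
    have s0: "0 \<le> s j" for j
    proof (cases "j \<in> ?U")
      case True
      then have "l \<le> t' j / u j" unfolding l_def using finU by (auto intro: Min_le)
      then show ?thesis using True by (auto simp: s_def field_simps)
    next
      case False
      then have "j \<in> ?I \<Longrightarrow> l * u j \<le> 0" using l0 by (auto simp: mult_le_0_iff)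
      then show ?thesis using t' by (auto simp: s_def intro: order_trans)
    qed
    have IJ: "?I \<subseteq> J" using t' by blast
    have "(\<Sum>j\<in>J. s j * v j b) = (\<Sum>j\<in>J. t' j * v j b)" if "b \<in> B" for b
    proof -
      have "(\<Sum>j\<in>J. s j * v j b) = (\<Sum>j\<in>?I. s j * v j b)"
        by (rule sum.mono_neutral_right[OF assms(2) IJ]) (auto simp: s_def)
      also have "\<dots> = (\<Sum>j\<in>?I. t' j * v j b) - l * (\<Sum>j\<in>?I. u j * v j b)"
        by (simp add: s_def algebra_simps sum_subtractf sum_distrib_left)
      also have "\<dots> = (\<Sum>j\<in>J. t' j * v j b)"
        using usum[OF that] sum.mono_neutral_right[OF assms(2) IJ, of "\<lambda>j. t' j * v j b"] by simp
      finally show ?thesis .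
    qed
    then have "P s" unfolding P_def using s0 IJ t' by (auto simp: s_def)
    then have "card ?I \<le> card {j. s j \<noteq> 0}" by (rule min)
    moreover have "{j. s j \<noteq> 0} \<subset> ?I"
    proof
      show "{j. s j \<noteq> 0} \<subseteq> ?I" by (auto simp: s_def)
      have "s i = 0" "i \<in> ?I" using i by (auto simp: s_def)
      then show "{j. s j \<noteq> 0} \<noteq> ?I" by blast
    qed
    then have "card {j. s j \<noteq> 0} < card ?I" by (rule psubset_card_mono[OF finI])
    ultimately show False by simp
  qed
  then show ?thesis using t' by blast
qed

text \<open>An integral mass \<open>t\<close> on the positions \<open>0..n\<close> is concentrated on few positions, keeping the total mass and
  nearly keeping the moments against \<open>v\<close>: conic Caratheodory for the moments and the total mass, followed by
  rounding down; position \<open>n\<close>, of moment zero, receives the mass lost in rounding.\<close>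

lemma few_positions:
  fixes t :: "nat \<Rightarrow> nat" and v :: "nat \<Rightarrow> 'b \<Rightarrow> nat"
  assumes "finite B" and v: "\<And>j b. j \<le> n \<Longrightarrow> b \<in> B \<Longrightarrow> v j b \<le> V b" and vn: "\<And>b. b \<in> B \<Longrightarrow> v n b = 0"
  shows "\<exists>s. (\<Sum>j\<le>n. s j) = (\<Sum>j\<le>n. t j) \<and> card {j. j \<le> n \<and> s j \<noteq> 0} \<le> card B + 2 \<and>
    (\<forall>b\<in>B. \<bar>int (\<Sum>j\<le>n. t j * v j b) - int (\<Sum>j\<le>n. s j * v j b)\<bar> \<le> int ((card B + 1) * V b))"
proof -
  define v' :: "nat \<Rightarrow> 'b option \<Rightarrow> real" where "v' j c = (case c of None \<Rightarrow> 1 | Some b \<Rightarrow> real (v j b))" for j c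
  let ?B = "insert None (Some ` B)"
  have cB: "card ?B = card B + 1"
    using assms(1) by (simp add: card_image)
  have "\<exists>t'. (\<forall>j. 0 \<le> t' j) \<and> {j. t' j \<noteq> 0} \<subseteq> {..n} \<and> card {j. t' j \<noteq> 0} \<le> card ?B \<and>
    (\<forall>c\<in>?B. (\<Sum>j\<le>n. t' j * v' j c) = (\<Sum>j\<le>n. real (t j) * v' j c))"
    by (rule conic_caratheodory) (simp_all add: assms(1))
  then obtain t' where t'_all: "\<forall>j. 0 \<le> t' j" "{j. t' j \<noteq> 0} \<subseteq> {..n}" "card {j. t' j \<noteq> 0} \<le> card ?B"
    "\<forall>c\<in>?B. (\<Sum>j\<le>n. t' j * v' j c) = (\<Sum>j\<le>n. real (t j) * v' j c)"
    by blast
  note t' = t'_all(1)[rule_format] t'_all(2) t'_all(3)[unfolded cB] t'_all(4)[rule_format]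
  let ?I = "{j. t' j \<noteq> 0}"
  have tot: "(\<Sum>j\<le>n. t' j) = (\<Sum>j\<le>n. real (t j))"
    using t'(4)[of None] by (simp add: v'_def)
  have eq: "(\<Sum>j\<le>n. t' j * real (v j b)) = (\<Sum>j\<le>n. real (t j) * real (v j b))" if "b \<in> B" for b
    using t'(4)[of "Some b"] that by (simp add: v'_def)
  define f where "f j = nat \<lfloor>t' j\<rfloor>" for j
  have f: "real (f j) \<le> t' j" "t' j - real (f j) \<le> 1" for j
    using t'(1)[of j] by (auto simp: f_def) linarith
  have "real (\<Sum>j\<le>n. f j) \<le> (\<Sum>j\<le>n. t' j)" using f(1) by (auto intro: sum_mono)
  also have "\<dots> = real (\<Sum>j\<le>n. t j)" using tot by simp
  finally have fle: "(\<Sum>j\<le>n. f j) \<le> (\<Sum>j\<le>n. t j)" by linarith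
  define s where "s j = (if j = n then f n + ((\<Sum>j\<le>n. t j) - (\<Sum>j\<le>n. f j)) else f j)" for j
  have split: "(\<Sum>j\<le>n. g (s j) j) = (\<Sum>j<n. g (f j) j) + g (s n) n" for g :: "nat \<Rightarrow> nat \<Rightarrow> nat"
  proof -
    have "(\<Sum>j\<le>n. g (s j) j) = (\<Sum>j<n. g (s j) j) + g (s n) n"
      by (simp add: lessThan_Suc_atMost[symmetric])
    also have "(\<Sum>j<n. g (s j) j) = (\<Sum>j<n. g (f j) j)" by (rule sum.cong) (auto simp: s_def)
    finally show ?thesis .
  qed
  have s1: "(\<Sum>j\<le>n. s j) = (\<Sum>j\<le>n. t j)"
    using split[of "\<lambda>x j. x"] fle by (simp add: s_def lessThan_Suc_atMost[symmetric])
  have "{j. j \<le> n \<and> s j \<noteq> 0} \<subseteq> insert n ?I"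
    using t'(1) by (auto simp: s_def f_def split: if_splits)
  then have "card {j. j \<le> n \<and> s j \<noteq> 0} \<le> card (insert n ?I)"
    using finite_subset[OF t'(2)] by (intro card_mono) auto
  also have "\<dots> \<le> card B + 2"
    using t'(3) finite_subset[OF t'(2)] by (simp add: card_insert_if)
  finally have s2: "card {j. j \<le> n \<and> s j \<noteq> 0} \<le> card B + 2" .
  have "\<bar>int (\<Sum>j\<le>n. t j * v j b) - int (\<Sum>j\<le>n. s j * v j b)\<bar> \<le> int ((card B + 1) * V b)" if b: "b \<in> B" for b
  proof -
    have "(\<Sum>j\<le>n. s j * v j b) = (\<Sum>j\<le>n. f j * v j b)"
      using split[of "\<lambda>x j. x * v j b"] vn[OF b] by (simp add: lessThan_Suc_atMost[symmetric])
    then have "real (\<Sum>j\<le>n. t j * v j b) - real (\<Sum>j\<le>n. s j * v j b)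
        = (\<Sum>j\<le>n. (t' j - real (f j)) * real (v j b))"
      using eq[OF b] by (simp add: algebra_simps sum_subtractf)
    also have "\<dots> = (\<Sum>j\<in>?I. (t' j - real (f j)) * real (v j b))"
      by (rule sum.mono_neutral_right) (use t'(2) in \<open>auto simp: f_def\<close>)
    finally have e: "real (\<Sum>j\<le>n. t j * v j b) - real (\<Sum>j\<le>n. s j * v j b) = \<dots>" .
    have "0 \<le> (\<Sum>j\<in>?I. (t' j - real (f j)) * real (v j b))"
      using f by (intro sum_nonneg) auto
    moreover have "(\<Sum>j\<in>?I. (t' j - real (f j)) * real (v j b)) \<le> (\<Sum>j\<in>?I. real (V b))"
    proof (rule sum_mono)
      fix j assume "j \<in> ?I"
      then have "real (v j b) \<le> real (V b)" using t'(2) v[of j b] b by auto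
      then show "(t' j - real (f j)) * real (v j b) \<le> real (V b)"
        using f[of j] mult_mono[of "t' j - real (f j)" 1 "real (v j b)" "real (V b)"] by simp
    qed
    moreover have "(\<Sum>j\<in>?I. real (V b)) \<le> real ((card B + 1) * V b)"
    proof -
      have "real (card ?I * V b) \<le> real ((card B + 1) * V b)"
        using t'(3) by (intro of_nat_mono mult_right_mono) auto
      then show ?thesis by simp
    qed
    ultimately show ?thesis using e by linarith
  qed
  then show ?thesis using s1 s2 by blast
qed

section \<open>Groups of nilpotency class two\<close>

locale class2_group = group K for K (structure) +
  fixes A :: "'c set" and val :: "'c \<Rightarrow> 'a" and wt :: "'c \<Rightarrow> nat"
  assumes finite_A: "finite A" and val_closed: "c \<in> A \<Longrightarrow> val c \<in> carrier K"
    and central: "x \<in> carrier K \<Longrightarrow> y \<in> carrier K \<Longrightarrow> z \<in> carrier K \<Longrightarrow>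
      commutator K x y \<otimes> z = z \<otimes> commutator K x y"
begin

lemma val_closed' [simp]: "c \<in> A \<Longrightarrow> val c \<in> carrier K" by (rule val_closed)

definition Z where "Z = {z \<in> carrier K. \<forall>x\<in>carrier K. z \<otimes> x = x \<otimes> z}"

lemma Z_carrier [simp]: "z \<in> Z \<Longrightarrow> z \<in> carrier K" unfolding Z_def by blast
lemma Z_commute: "z \<in> Z \<Longrightarrow> x \<in> carrier K \<Longrightarrow> z \<otimes> x = x \<otimes> z" unfolding Z_def by blast
lemma ZI: "z \<in> carrier K \<Longrightarrow> (\<And>x. x \<in> carrier K \<Longrightarrow> z \<otimes> x = x \<otimes> z) \<Longrightarrow> z \<in> Z" unfolding Z_def by blast
lemma comm_Z [simp]: "x \<in> carrier K \<Longrightarrow> y \<in> carrier K \<Longrightarrow> commutator K x y \<in> Z"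
  by (rule ZI) (simp_all add: central)
lemma one_Z [simp]: "\<one> \<in> Z" by (rule ZI) simp_all
lemma mult_Z [simp]: "x \<in> Z \<Longrightarrow> y \<in> Z \<Longrightarrow> x \<otimes> y \<in> Z"
proof -
  assume *: "x \<in> Z" "y \<in> Z"
  have "x \<otimes> y \<otimes> z = z \<otimes> (x \<otimes> y)" if "z \<in> carrier K" for z
  proof -
    have "x \<otimes> y \<otimes> z = x \<otimes> z \<otimes> y" using * that by (simp add: m_assoc Z_commute[of y])
    then show ?thesis using * that by (simp add: m_assoc Z_commute[of x z])
  qed
  then show ?thesis using * by (intro ZI) simp_all
qed
lemma inv_Z [simp]: "x \<in> Z \<Longrightarrow> inv x \<in> Z"
proof -
  assume x: "x \<in> Z"
  have "inv x \<otimes> y = y \<otimes> inv x" if "y \<in> carrier K" for y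
  proof -
    have "x \<otimes> (y \<otimes> inv x) = y \<otimes> x \<otimes> inv x"
      using Z_commute[OF x that] x that by (simp add: m_assoc[symmetric])
    then have "x \<otimes> (y \<otimes> inv x) = y" using x that by (simp add: m_assoc)
    then have "inv x \<otimes> (x \<otimes> (y \<otimes> inv x)) = inv x \<otimes> y" by simp
    then show ?thesis using x that by simp
  qed
  then show ?thesis using x by (intro ZI) simp_all
qed
lemma nat_pow_Z [simp]: "x \<in> Z \<Longrightarrow> x [^] (n::nat) \<in> Z" by (induction n) auto
lemma int_pow_Z [simp]: "x \<in> Z \<Longrightarrow> x [^] (n::int) \<in> Z" 
  by (cases n rule: int_cases2) (simp_all add: int_pow_int int_pow_neg_int)
lemma Z_left_commute: "z \<in> Z \<Longrightarrow> x \<in> carrier K \<Longrightarrow> y \<in> carrier K \<Longrightarrow> x \<otimes> (z \<otimes> y) = z \<otimes> (x \<otimes> y)"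
  using Z_commute[of z x] by (simp add: m_assoc[symmetric])

lemma comm_mult_left:
  assumes "x \<in> carrier K" "y \<in> carrier K" "z \<in> carrier K"
  shows "commutator K (x \<otimes> y) z = commutator K x z \<otimes> commutator K y z"
proof -
  have "commutator K (x \<otimes> y) z = x \<otimes> commutator K y z \<otimes> (z \<otimes> inv x \<otimes> inv z)"
    using assms by (simp add: commutator_def m_assoc inv_mult_group)
  also have "\<dots> = commutator K y z \<otimes> commutator K x z"
  proof -
    have "x \<otimes> commutator K y z = commutator K y z \<otimes> x" using assms by (simp add: central)
    moreover have "commutator K x z = x \<otimes> (z \<otimes> inv x \<otimes> inv z)" using assms by (simp add: commutator_def m_assoc)
    ultimately show ?thesis using assms by (simp add: m_assoc)
  qed
  also have "\<dots> = commutator K x z \<otimes> commutator K y z" using assms by (intro central) auto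
  finally show ?thesis .
qed

lemma comm_mult_right:
  assumes "x \<in> carrier K" "y \<in> carrier K" "z \<in> carrier K"
  shows "commutator K x (y \<otimes> z) = commutator K x y \<otimes> commutator K x z"
proof -
  have "commutator K x (y \<otimes> z) = inv (commutator K (y \<otimes> z) x)" using assms by (simp add: inv_commutator)
  also have "\<dots> = inv (commutator K z x) \<otimes> inv (commutator K y x)"
    using assms by (simp add: comm_mult_left inv_mult_group)
  also have "\<dots> = commutator K x y \<otimes> commutator K x z"
    using assms by (simp add: inv_commutator) (intro central; simp)
  finally show ?thesis .
qed

lemma comm_one_right [simp]: "x \<in> carrier K \<Longrightarrow> commutator K x \<one> = \<one>" by (simp add: commutator_def)
lemma comm_one_left [simp]: "x \<in> carrier K \<Longrightarrow> commutator K \<one> x = \<one>" by (simp add: commutator_def)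
lemma comm_self [simp]: "x \<in> carrier K \<Longrightarrow> commutator K x x = \<one>" by (simp add: commutator_def m_assoc)

lemma comm_pow_left: "x \<in> carrier K \<Longrightarrow> y \<in> carrier K \<Longrightarrow> commutator K (x [^] (n::nat)) y = commutator K x y [^] n"
  by (induction n) (auto simp: comm_mult_left)
lemma comm_pow_right: "x \<in> carrier K \<Longrightarrow> y \<in> carrier K \<Longrightarrow> commutator K x (y [^] (n::nat)) = commutator K x y [^] n"
  by (induction n) (auto simp: comm_mult_right)

lemma comm_inv_left: "x \<in> carrier K \<Longrightarrow> y \<in> carrier K \<Longrightarrow> commutator K (inv x) y = inv (commutator K x y)"
proof -
  assume a: "x \<in> carrier K" "y \<in> carrier K"
  then have "commutator K (inv x) y \<otimes> commutator K x y = \<one>" using comm_mult_left[of "inv x" x y] by simp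
  then show ?thesis using a by (metis commutator_closed inv_closed inv_equality)
qed

definition bracket :: "'c \<times> 'c \<Rightarrow> 'a" where "bracket p = commutator K (val (fst p)) (val (snd p))"

lemma bracket_Z: "p \<in> A \<times> A \<Longrightarrow> bracket p \<in> Z" by (auto simp: bracket_def)

definition zeta_on :: "('c \<times> 'c) list \<Rightarrow> ('c \<times> 'c \<Rightarrow> int) \<Rightarrow> 'a" where
  "zeta_on ps E = word_eval K (map (\<lambda>p. bracket p [^] E p) ps)"

lemma zeta_on_Nil [simp]: "zeta_on [] E = \<one>"
  and zeta_on_Cons: "zeta_on (p # ps) E = bracket p [^] E p \<otimes> zeta_on ps E"
  by (simp_all add: zeta_on_def)

lemma zeta_on_Z: "set ps \<subseteq> A \<times> A \<Longrightarrow> zeta_on ps E \<in> Z"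
proof (induction ps)
  case (Cons p ps)
  then have "bracket p \<in> Z" by (intro bracket_Z) simp
  then show ?case using Cons by (simp add: zeta_on_Cons)
qed simp

lemma zeta_on_add:
  "set ps \<subseteq> A \<times> A \<Longrightarrow> zeta_on ps (\<lambda>p. E p + F p) = zeta_on ps E \<otimes> zeta_on ps F"
proof (induction ps)
  case (Cons p ps)
  then have b: "bracket p \<in> Z" and z: "zeta_on ps E \<in> Z" "zeta_on ps F \<in> Z"
    by (auto intro: bracket_Z zeta_on_Z)
  then show ?case using Cons
    by (simp add: zeta_on_Cons int_pow_mult m_assoc Z_left_commute[of "bracket p [^] F p"])
qed simp

lemma zeta_on_zero: "set ps \<subseteq> A \<times> A \<Longrightarrow> (\<And>p. p \<in> set ps \<Longrightarrow> E p = 0) \<Longrightarrow> zeta_on ps E = \<one>"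
  by (induction ps) (auto simp: zeta_on_Cons)

lemma zeta_on_single:
  "set ps \<subseteq> A \<times> A \<Longrightarrow> distinct ps \<Longrightarrow> p \<in> set ps \<Longrightarrow> (\<And>q. q \<noteq> p \<Longrightarrow> E q = 0) \<Longrightarrow>
     zeta_on ps E = bracket p [^] E p"
proof (induction ps)
  case (Cons q ps)
  show ?case
  proof (cases "q = p")
    case True
    have "zeta_on ps E = \<one>"
    proof (rule zeta_on_zero)
      show "set ps \<subseteq> A \<times> A" using Cons.prems by auto
      fix r assume "r \<in> set ps"
      then have "r \<noteq> p" using Cons.prems(2) True by auto
      then show "E r = 0" by (rule Cons.prems(4))
    qed
    then show ?thesis using True Cons bracket_Z[of p] by (simp add: zeta_on_Cons)
  next
    case False
    have "zeta_on ps E = bracket p [^] E p"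
      by (rule Cons.IH) (use Cons.prems False in auto)
    then show ?thesis using Cons.prems(1) Cons.prems(4)[OF False] bracket_Z[of q] bracket_Z[of p] Cons.prems(3) False
      by (auto simp: zeta_on_Cons)
  qed
qed simp

definition pairs where "pairs = (SOME ps. distinct ps \<and> set ps = A \<times> A)"

lemma pairs: "distinct pairs" "set pairs = A \<times> A"
proof -
  have "\<exists>ps. distinct ps \<and> set ps = A \<times> A"
    using finite_distinct_list[of "A \<times> A"] finite_A by blast
  then have "distinct pairs \<and> set pairs = A \<times> A" unfolding pairs_def by (rule someI_ex)
  then show "distinct pairs" "set pairs = A \<times> A" by auto
qed

text \<open>\<open>zeta E\<close> is the central product of the basic commutators \<open>[a, b]\<close> with exponents \<open>E (a, b)\<close>.\<close>

definition zeta where "zeta E = zeta_on pairs E"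

lemma zeta_Z [simp]: "zeta E \<in> Z" unfolding zeta_def by (rule zeta_on_Z) (simp add: pairs)
lemma zeta_closed [simp]: "zeta E \<in> carrier K" by simp
lemma zeta_add: "zeta (\<lambda>p. E p + F p) = zeta E \<otimes> zeta F"
  unfolding zeta_def by (rule zeta_on_add) (simp add: pairs)
lemma zeta_zero: "(\<And>p. p \<in> A \<times> A \<Longrightarrow> E p = 0) \<Longrightarrow> zeta E = \<one>"
  unfolding zeta_def by (rule zeta_on_zero) (simp_all add: pairs)
lemma zeta_single: "p \<in> A \<times> A \<Longrightarrow> zeta (\<lambda>q. if q = p then e else 0) = bracket p [^] (e::int)"
  unfolding zeta_def by (subst zeta_on_single[of _ p]) (simp_all add: pairs)
lemma zeta_minus: "zeta (\<lambda>p. - E p) = inv (zeta E)"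
proof -
  have "zeta (\<lambda>p. - E p) \<otimes> zeta E = \<one>" using zeta_add[of "\<lambda>p. - E p" E] zeta_zero by simp
  then show ?thesis by (metis inv_equality zeta_closed)
qed

definition pv :: "'c list \<Rightarrow> 'a" where "pv w = word_eval K (map val w)"

lemma pv_Nil [simp]: "pv [] = \<one>" and pv_Cons [simp]: "pv (c # w) = val c \<otimes> pv w"
  by (simp_all add: pv_def)
lemma pv_closed [simp]: "w \<in> lists A \<Longrightarrow> pv w \<in> carrier K" by (induction w) auto
lemma pv_append [simp]: "u \<in> lists A \<Longrightarrow> v \<in> lists A \<Longrightarrow> pv (u @ v) = pv u \<otimes> pv v"
  by (induction u) (auto simp: m_assoc)

definition wlen :: "'c list \<Rightarrow> nat" where "wlen w = sum_list (map wt w)"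
lemma wlen_simps [simp]: "wlen [] = 0" "wlen (c # w) = wt c + wlen w" "wlen (u @ v) = wlen u + wlen v"
  by (simp_all add: wlen_def)

definition row :: "'c \<Rightarrow> ('c \<Rightarrow> int) \<Rightarrow> 'c \<times> 'c \<Rightarrow> int" where
  "row a f p = (if fst p = a then f (snd p) else 0)"

text \<open>A run \<open>(c, t)\<close> stands for the power \<open>c\<^sup>t\<close>.\<close>

definition rv :: "('c \<times> nat) list \<Rightarrow> 'a" where
  "rv rs = word_eval K (map (\<lambda>r. val (fst r) [^] snd r) rs)"

definition rcnt :: "('c \<times> nat) list \<Rightarrow> 'c \<Rightarrow> nat" where
  "rcnt rs b = (\<Sum>r\<leftarrow>rs. if fst r = b then snd r else 0)"

lemma rv_simps [simp]: "rv [] = \<one>" "rv (r # rs) = val (fst r) [^] snd r \<otimes> rv rs"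
  by (simp_all add: rv_def)
lemma rv_closed [simp]: "fst ` set rs \<subseteq> A \<Longrightarrow> rv rs \<in> carrier K" by (induction rs) auto
lemma rcnt_simps [simp]: "rcnt [] b = 0" "rcnt (r # rs) b = (if fst r = b then snd r else 0) + rcnt rs b"
  "rcnt (rs @ rs') b = rcnt rs b + rcnt rs' b"
  by (simp_all add: rcnt_def)

lemma row_add: "zeta (row a (\<lambda>b. f b + g b)) = zeta (row a f) \<otimes> zeta (row a g)"
proof -
  have "row a (\<lambda>b. f b + g b) = (\<lambda>p. row a f p + row a g p)" by (auto simp: row_def)
  then show ?thesis by (simp add: zeta_add)
qed

lemma row_single: "a \<in> A \<Longrightarrow> b \<in> A \<Longrightarrow>
  zeta (row a (\<lambda>c. if c = b then e else 0)) = commutator K (val a) (val b) [^] (e::int)"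
proof -
  assume "a \<in> A" "b \<in> A"
  moreover have "row a (\<lambda>c. if c = b then e else 0) = (\<lambda>q. if q = (a, b) then e else 0)"
    by (auto simp: row_def)
  ultimately show ?thesis using zeta_single[of "(a, b)" e] by (simp add: bracket_def)
qed

lemma comm_runs:
  assumes "a \<in> A" "fst ` set rs \<subseteq> A"
  shows "commutator K (val a [^] (t::nat)) (rv rs) = zeta (row a (\<lambda>b. int (t * rcnt rs b)))"
  using assms(2)
proof (induction rs)
  case Nil
  have "zeta (row a (\<lambda>b. 0)) = \<one>" by (rule zeta_zero) (simp add: row_def)
  then show ?case using assms(1) by simp
next
  case (Cons r rs)
  then have r: "fst r \<in> A" "fst ` set rs \<subseteq> A" by auto
  have "commutator K (val a [^] t) (rv (r # rs))
     = commutator K (val a [^] t) (val (fst r) [^] snd r) \<otimes> commutator K (val a [^] t) (rv rs)"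
    using assms(1) r by (simp add: comm_mult_right)
  also have "commutator K (val a [^] t) (val (fst r) [^] snd r) = commutator K (val a) (val (fst r)) [^] (t * snd r)"
    using assms(1) r by (simp add: comm_pow_left comm_pow_right nat_pow_pow mult.commute)
  also have "\<dots> = zeta (row a (\<lambda>c. if c = fst r then int (t * snd r) else 0))"
    using assms(1) r by (simp only: row_single int_pow_int)
  finally have "commutator K (val a [^] t) (rv (r # rs))
     = zeta (row a (\<lambda>b. (if b = fst r then int (t * snd r) else 0) + int (t * rcnt rs b)))"
    using Cons.IH r row_add by simp
  also have "(\<lambda>b. (if b = fst r then int (t * snd r) else 0) + int (t * rcnt rs b))
      = (\<lambda>b. int (t * rcnt (r # rs) b))"
    by (auto simp: algebra_simps)
  finally show ?case .
qed

lemma pv_rv: "pv w = rv (map (\<lambda>c. (c, Suc 0)) w)" if "w \<in> lists A"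
  using that by (induction w) auto
lemma rcnt_letters: "rcnt (map (\<lambda>c. (c, Suc 0)) w) b = count_list w b"
  by (induction w) auto

text \<open>Moving a letter \<open>x\<close> to the end costs one commutator \<open>[x, b]\<close> for each letter \<open>b\<close> that it passes; all error
  bounds below have this shape: the exponent at \<open>(a, b)\<close> is bounded by the number of \<open>b\<close>.\<close>

lemma pv_move:
  assumes "us \<in> lists A" "x \<in> A" "vs \<in> lists A"
  shows "pv (us @ x # vs) = pv (us @ vs @ [x]) \<otimes> zeta (row x (\<lambda>b. int (count_list vs b)))"
proof -
  have s: "fst ` set (map (\<lambda>c. (c, Suc 0)) vs) \<subseteq> A" using assms(3) by (auto simp: in_lists_conv_set)
  have c: "commutator K (val x) (pv vs) = zeta (row x (\<lambda>b. int (count_list vs b)))"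
    using comm_runs[OF assms(2) s, of 1] assms pv_rv[OF assms(3)] by (simp add: rcnt_letters)
  have "pv (us @ x # vs) = pv us \<otimes> (val x \<otimes> pv vs)" using assms by simp
  also have "val x \<otimes> pv vs = commutator K (val x) (pv vs) \<otimes> (pv vs \<otimes> val x)"
    using assms by (intro commutator_swap) auto
  also have "\<dots> = pv vs \<otimes> val x \<otimes> commutator K (val x) (pv vs)" using assms by (intro central) auto
  finally show ?thesis using assms unfolding c by (simp add: m_assoc)
qed

lemma pv_extract:
  assumes "w \<in> lists A" "mset u \<subseteq># mset w"
  shows "\<exists>v E. v \<in> lists A \<and> mset w = mset v + mset u \<and> pv w = pv (v @ u) \<otimes> zeta E \<and>
    (\<forall>a b. \<bar>E (a, b)\<bar> \<le> int (length u * count_list w b))"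
  using assms(2)
proof (induction u)
  case Nil
  have "zeta (\<lambda>_. 0) = \<one>" by (rule zeta_zero) simp
  then show ?case using assms(1) by (intro exI[of _ w] exI[of _ "\<lambda>_. 0"]) auto
next
  case (Cons x u)
  have "mset u \<subseteq># mset w" using Cons.prems mset_subset_eq_insertD[of x "mset u" "mset w"]
    by (simp add: subset_mset.less_imp_le)
  then obtain v E where v: "v \<in> lists A" "mset w = mset v + mset u" "pv w = pv (v @ u) \<otimes> zeta E"
    "\<And>a b. \<bar>E (a, b)\<bar> \<le> int (length u * count_list w b)" using Cons.IH by blast
  have "{#x#} + mset u \<subseteq># mset v + mset u" using Cons.prems v(2) by simp
  then have "{#x#} \<subseteq># mset v" by (simp only: subset_mset.add_le_cancel_right)
  then have "x \<in># mset v" by simp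
  then obtain us vs where uv: "v = us @ x # vs" by (metis in_multiset_in_set split_list)
  have l: "us \<in> lists A" "vs \<in> lists A" "x \<in> A" using v(1) uv by auto
  have u: "u \<in> lists A"
  proof -
    have "set u \<subseteq> set w" using v(2) by (metis mset_subset_eq_add_right set_mset_mono set_mset_mset)
    then show ?thesis using assms(1) by (auto simp: in_lists_conv_set)
  qed
  define F where "F = row x (\<lambda>b. int (count_list vs b))"
  have "pv (v @ u) = pv v \<otimes> pv u" by (rule pv_append[OF v(1) u])
  also have "pv v = pv (us @ vs @ [x]) \<otimes> zeta F" unfolding uv F_def by (rule pv_move[OF l(1,3,2)])
  finally have "pv w = pv (us @ vs @ [x]) \<otimes> zeta F \<otimes> pv u \<otimes> zeta E" using v(3) by simp
  also have "\<dots> = pv ((us @ vs) @ x # u) \<otimes> (zeta E \<otimes> zeta F)"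
  proof -
    have "zeta F \<otimes> (pv u \<otimes> zeta E) = pv u \<otimes> (zeta E \<otimes> zeta F)"
      using u Z_commute[of "zeta F" "pv u \<otimes> zeta E"] by (simp add: m_assoc)
    then show ?thesis using l u by (simp add: m_assoc)
  qed
  also have "\<dots> = pv ((us @ vs) @ x # u) \<otimes> zeta (\<lambda>p. E p + F p)" by (simp add: zeta_add)
  finally have 1: "pv w = pv ((us @ vs) @ x # u) \<otimes> zeta (\<lambda>p. E p + F p)" .
  have "\<bar>E (a, b) + F (a, b)\<bar> \<le> int (length (x # u) * count_list w b)" for a b
  proof -
    have "count_list vs b \<le> count_list w b"
    proof -
      have "count (mset vs) b \<le> count (mset w) b" using v(2) uv by simp
      then show ?thesis by (simp add: count_mset)
    qed
    then have "\<bar>F (a, b)\<bar> \<le> int (count_list w b)" by (simp add: F_def row_def)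
    then show ?thesis using v(4)[of a b] by (simp add: algebra_simps)
  qed
  then show ?case using 1 l v(2) uv by (intro exI[of _ "us @ vs"] exI[of _ "\<lambda>p. E p + F p"]) auto
qed

text \<open>Congruence modulo the derived subgroup is expressed through the existence of a central correction \<open>zeta E\<close>,
  which the later arguments estimate.\<close>

definition nonopt :: "'c list \<Rightarrow> bool" where
  "nonopt w \<longleftrightarrow> (\<exists>w'\<in>lists A. wlen w' < wlen w \<and> (\<exists>E. pv w = pv w' \<otimes> zeta E))"

lemma wlen_mset: "mset w = mset u \<Longrightarrow> wlen w = wlen u"
  unfolding wlen_def by (metis mset_map sum_mset_sum_list)

lemma nonopt_mono:
  assumes "w \<in> lists A" "mset u \<subseteq># mset w" "nonopt u"
  shows "nonopt w"
proof -
  obtain v E where v: "v \<in> lists A" "mset w = mset v + mset u" "pv w = pv (v @ u) \<otimes> zeta E"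
    using pv_extract[OF assms(1,2)] by blast
  obtain u' F where u': "u' \<in> lists A" "wlen u' < wlen u" "pv u = pv u' \<otimes> zeta F"
    using assms(3) unfolding nonopt_def by blast
  have u: "u \<in> lists A"
  proof -
    have "set u \<subseteq> set w" using v(2) by (metis mset_subset_eq_add_right set_mset_mono set_mset_mset)
    then show ?thesis using assms(1) by (auto simp: in_lists_conv_set)
  qed
  have "pv w = pv (v @ u') \<otimes> zeta (\<lambda>p. F p + E p)"
    using v u u' by (simp add: zeta_add m_assoc)
  moreover have "wlen w = wlen (v @ u)" using v(2) by (intro wlen_mset) simp
  ultimately show ?thesis using u' v unfolding nonopt_def
    by (intro bexI[of _ "v @ u'"] conjI exI[of _ "\<lambda>p. F p + E p"]) auto
qed

text \<open>Reading from the left, a block is closed as soon as it becomes nonoptimal, so that it is optimal up to its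
  last letter.\<close>

lemma greedy_blocks:
  assumes "w \<in> lists A"
  shows "\<exists>bs t. w = concat bs @ t \<and> \<not> nonopt t \<and> (\<forall>b\<in>set bs. b \<noteq> [] \<and> nonopt b \<and> \<not> nonopt (butlast b))"
  using assms
proof (induction w rule: rev_induct)
  case Nil
  have "\<not> nonopt []" by (simp add: nonopt_def)
  then show ?case by (intro exI[of _ "[]"]) auto
next
  case (snoc x w)
  then obtain bs t where *: "w = concat bs @ t" "\<not> nonopt t" "\<forall>b\<in>set bs. b \<noteq> [] \<and> nonopt b \<and> \<not> nonopt (butlast b)"
    by auto
  show ?case
  proof (cases "nonopt (t @ [x])")
    case True
    have "\<not> nonopt []" by (simp add: nonopt_def)
    then show ?thesis using True * by (intro exI[of _ "bs @ [t @ [x]]"] exI[of _ "[]"]) auto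
  next
    case False
    then show ?thesis using * by (intro exI[of _ bs] exI[of _ "t @ [x]"]) auto
  qed
qed

end

context class2_group
begin

text \<open>For \<open>b \<noteq> a\<close>, \<open>sc a b rs\<close> counts the pairs of an occurrence of \<open>a\<close> and a later occurrence of \<open>b\<close>; it is the
  exponent of \<open>[a, b]\<close> created when all \<open>a\<close> are moved to the end.\<close>

primrec sc :: "'c \<Rightarrow> 'c \<Rightarrow> ('c \<times> nat) list \<Rightarrow> nat" where
  "sc a b [] = 0"
| "sc a b (r # rs) = (if fst r = a then snd r * rcnt rs b else 0) + sc a b rs"

abbreviation off :: "'c \<Rightarrow> ('c \<times> nat) list \<Rightarrow> ('c \<times> nat) list" where
  "off a rs \<equiv> filter (\<lambda>r. fst r \<noteq> a) rs"

lemma rcnt_off: "rcnt (off a rs) b = (if b = a then 0 else rcnt rs b)"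
  by (induction rs) auto

lemma row_zero: "(\<And>b. b \<in> A \<Longrightarrow> f b = 0) \<Longrightarrow> zeta (row a f) = \<one>"
  by (rule zeta_zero) (auto simp: row_def)

lemma rv_gather:
  assumes "a \<in> A" "fst ` set rs \<subseteq> A"
  shows "rv rs = rv (off a rs) \<otimes> val a [^] rcnt rs a \<otimes> zeta (row a (\<lambda>b. if b = a then 0 else int (sc a b rs)))"
  using assms(2)
proof (induction rs)
  case Nil
  then show ?case using assms(1) row_zero[of "\<lambda>b. 0"] by (simp cong: if_cong)
next
  case (Cons r rs)
  then have r: "fst r \<in> A" "fst ` set rs \<subseteq> A" "fst ` set (off a rs) \<subseteq> A" by auto
  let ?f = "\<lambda>b. if b = a then 0 else int (sc a b rs)"
  note IH = Cons.IH[OF r(2)]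
  show ?case
  proof (cases "fst r = a")
    case True
    let ?n = "snd r"
    let ?g = "\<lambda>b. int (?n * rcnt (off a rs) b)"
    have "rv (r # rs) = (val a [^] ?n \<otimes> rv (off a rs)) \<otimes> (val a [^] rcnt rs a \<otimes> zeta (row a ?f))"
      using True IH assms(1) r by (simp add: m_assoc)
    also have "val a [^] ?n \<otimes> rv (off a rs) = zeta (row a ?g) \<otimes> (rv (off a rs) \<otimes> val a [^] ?n)"
      using comm_runs[OF assms(1) r(3), of ?n] commutator_swap[of "val a [^] ?n" "rv (off a rs)"] assms(1) r
      by simp
    also have "\<dots> = rv (off a rs) \<otimes> val a [^] ?n \<otimes> zeta (row a ?g)"
      using assms(1) r by (intro Z_commute) auto
    also have "\<dots> \<otimes> (val a [^] rcnt rs a \<otimes> zeta (row a ?f))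
        = rv (off a rs) \<otimes> (val a [^] ?n \<otimes> val a [^] rcnt rs a) \<otimes> (zeta (row a ?g) \<otimes> zeta (row a ?f))"
      using assms(1) r Z_left_commute[of "zeta (row a ?g)" "val a [^] rcnt rs a"] by (simp add: m_assoc)
    also have "zeta (row a ?g) \<otimes> zeta (row a ?f) = zeta (row a (\<lambda>b. ?g b + ?f b))"
      by (simp add: row_add)
    also have "(\<lambda>b. ?g b + ?f b) = (\<lambda>b. if b = a then 0 else int (sc a b (r # rs)))"
      using True by (auto simp: rcnt_off)
    finally show ?thesis using True assms(1) by (simp add: nat_pow_mult)
  next
    case False
    then have "(\<lambda>b. if b = a then 0 else int (sc a b (r # rs))) = ?f" by auto
    then show ?thesis using False IH assms(1) r by (simp only: rv_simps filter.simps rcnt_simps) (simp add: m_assoc)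
  qed
qed

text \<open>Only the numbers \<open>t j\<close> of letters \<open>a\<close> standing in the gaps between the other runs matter for the scattering
  numbers \<open>sc a b\<close>, which are linear in \<open>t\<close>.\<close>

lemma gap_weights:
  "\<exists>t. (\<Sum>j\<le>length (off a rs). t j) = rcnt rs a \<and>
     (\<forall>b. b \<noteq> a \<longrightarrow> sc a b rs = (\<Sum>j\<le>length (off a rs). t j * rcnt (drop j (off a rs)) b))"
proof (induction rs)
  case Nil
  show ?case by (intro exI[of _ "\<lambda>_. 0"]) simp
next
  case (Cons r rs)
  then obtain t where t: "(\<Sum>j\<le>length (off a rs). t j) = rcnt rs a"
    "\<And>b. b \<noteq> a \<Longrightarrow> sc a b rs = (\<Sum>j\<le>length (off a rs). t j * rcnt (drop j (off a rs)) b)" by blast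
  show ?case
  proof (cases "fst r = a")
    case True
    define t' where "t' j = (if j = 0 then snd r else 0) + t j" for j
    have "(\<Sum>j\<le>length (off a rs). t' j) = snd r + rcnt rs a"
      using t(1) by (simp add: t'_def sum.distrib)
    moreover have "(\<Sum>j\<le>length (off a rs). t' j * rcnt (drop j (off a rs)) b) = snd r * rcnt rs b + sc a b rs"
      if "b \<noteq> a" for b
    proof -
      have "(\<Sum>j\<le>length (off a rs). t' j * rcnt (drop j (off a rs)) b)
         = (\<Sum>j\<le>length (off a rs). if j = 0 then snd r * rcnt (drop j (off a rs)) b else 0) + sc a b rs"
        unfolding t(2)[OF that] sum.distrib[symmetric]
        by (rule sum.cong) (auto simp: t'_def algebra_simps)
      then show ?thesis using that by (simp add: rcnt_off)
    qed
    ultimately show ?thesis using True by (intro exI[of _ t']) simp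
  next
    case False
    define t' where "t' j = (case j of 0 \<Rightarrow> 0 | Suc i \<Rightarrow> t i)" for j
    have "(\<Sum>j\<le>Suc (length (off a rs)). t' j) = rcnt rs a"
      using t(1) by (simp add: t'_def sum.atMost_Suc_shift del: sum.atMost_Suc)
    moreover have "(\<Sum>j\<le>Suc (length (off a rs)). t' j * rcnt (drop j (r # off a rs)) b) = sc a b rs"
      if "b \<noteq> a" for b
      using t(2)[OF that] by (simp add: t'_def sum.atMost_Suc_shift del: sum.atMost_Suc)
    ultimately show ?thesis using False by (intro exI[of _ t']) simp
  qed
qed

fun ins :: "'c \<Rightarrow> (nat \<Rightarrow> nat) \<Rightarrow> ('c \<times> nat) list \<Rightarrow> ('c \<times> nat) list" where
  "ins a t [] = (if t 0 = 0 then [] else [(a, t 0)])"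
| "ins a t (r # rs) = (if t 0 = 0 then [] else [(a, t 0)]) @ r # ins a (\<lambda>j. t (Suc j)) rs"

lemma ins_props:
  assumes "a \<notin> fst ` set rs"
  shows "off a (ins a t rs) = rs" "rcnt (ins a t rs) a = (\<Sum>j\<le>length rs. t j)"
    "b \<noteq> a \<Longrightarrow> rcnt (ins a t rs) b = rcnt rs b"
    "b \<noteq> a \<Longrightarrow> sc a b (ins a t rs) = (\<Sum>j\<le>length rs. t j * rcnt (drop j rs) b)"
    "length (filter (\<lambda>r. fst r = a) (ins a t rs)) = card {j. j \<le> length rs \<and> t j \<noteq> 0}"
    "c \<noteq> a \<Longrightarrow> length (filter (\<lambda>r. fst r = c) (ins a t rs)) = length (filter (\<lambda>r. fst r = c) rs)"
    "fst ` set (ins a t rs) \<subseteq> insert a (fst ` set rs)"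
proof -
  have off0: "off a rs = rs" if "a \<notin> fst ` set rs" for rs :: "('c \<times> nat) list"
    using that by (auto simp: filter_id_conv)
  have sc0: "rcnt rs a = 0 \<and> length (filter (\<lambda>r. fst r = a) rs) = 0" if "a \<notin> fst ` set rs" for rs :: "('c \<times> nat) list"
    using that by (induction rs) auto
  show "off a (ins a t rs) = rs" using assms by (induction rs arbitrary: t) auto
  show "rcnt (ins a t rs) a = (\<Sum>j\<le>length rs. t j)"
    using assms by (induction rs arbitrary: t) (auto simp: sum.atMost_Suc_shift simp del: sum.atMost_Suc)
  show c: "b \<noteq> a \<Longrightarrow> rcnt (ins a t rs) b = rcnt rs b" for b t rs
    by (induction rs arbitrary: t) auto
  show "b \<noteq> a \<Longrightarrow> sc a b (ins a t rs) = (\<Sum>j\<le>length rs. t j * rcnt (drop j rs) b)"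
    using assms by (induction rs arbitrary: t) (auto simp: c sum.atMost_Suc_shift simp del: sum.atMost_Suc)
  show "length (filter (\<lambda>r. fst r = a) (ins a t rs)) = card {j. j \<le> length rs \<and> t j \<noteq> 0}"
    using assms
  proof (induction rs arbitrary: t)
    case Nil
    have "{j. j \<le> 0 \<and> t j \<noteq> 0} = (if t 0 = 0 then {} else {0})"
      by (auto intro!: gr0I)
    then show ?case by (auto simp del: le_zero_eq)
  next
    case (Cons r rs)
    have "{j. j \<le> Suc (length rs) \<and> t j \<noteq> 0} = (if t 0 = 0 then {} else {0}) \<union> Suc ` {j. j \<le> length rs \<and> t (Suc j) \<noteq> 0}"
    proof (rule Set.set_eqI)
      fix j
      show "j \<in> {j. j \<le> Suc (length rs) \<and> t j \<noteq> 0} \<longleftrightarrow>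
          j \<in> (if t 0 = 0 then {} else {0}) \<union> Suc ` {j. j \<le> length rs \<and> t (Suc j) \<noteq> 0}"
        by (cases j) auto
    qed
    moreover have "card (Suc ` {j. j \<le> length rs \<and> t (Suc j) \<noteq> 0}) = card {j. j \<le> length rs \<and> t (Suc j) \<noteq> 0}"
      by (rule card_image) simp
    moreover have "finite {j. j \<le> length rs \<and> t (Suc j) \<noteq> 0}" by simp
    ultimately have "card {j. j \<le> Suc (length rs) \<and> t j \<noteq> 0}
        = (if t 0 = 0 then 0 else 1) + card {j. j \<le> length rs \<and> t (Suc j) \<noteq> 0}"
      by (auto simp: card_insert_if)
    then show ?case using Cons by auto
  qed
  show "c \<noteq> a \<Longrightarrow> length (filter (\<lambda>r. fst r = c) (ins a t rs)) = length (filter (\<lambda>r. fst r = c) rs)"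
    by (induction rs arbitrary: t) auto
  show "fst ` set (ins a t rs) \<subseteq> insert a (fst ` set rs)"
    by (induction rs arbitrary: t) auto
qed

text \<open>Redistributing the letters \<open>a\<close> among the gaps by \<open>few_positions\<close> leaves boundedly many runs of \<open>a\<close> and nearly
  preserves the scattering numbers, so the resulting error at \<open>(a, b)\<close> is linear in the number of \<open>b\<close>.\<close>

lemma collapse_letter:
  assumes a: "a \<in> A" and rs: "fst ` set rs \<subseteq> A"
  shows "\<exists>rs' E. fst ` set rs' \<subseteq> A \<and> (\<forall>b. rcnt rs' b = rcnt rs b) \<and>
    length (filter (\<lambda>r. fst r = a) rs') \<le> card A + 2 \<and>
    (\<forall>c. c \<noteq> a \<longrightarrow> length (filter (\<lambda>r. fst r = c) rs') = length (filter (\<lambda>r. fst r = c) rs)) \<and>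
    rv rs = rv rs' \<otimes> zeta E \<and> (\<forall>c b. \<bar>E (c, b)\<bar> \<le> int ((card A + 1) * rcnt rs b))"
proof -
  let ?R = "off a rs" and ?n = "length (off a rs)"
  have R: "a \<notin> fst ` set ?R" "fst ` set ?R \<subseteq> A" using rs by auto
  obtain t where t: "(\<Sum>j\<le>?n. t j) = rcnt rs a"
    "\<And>b. b \<noteq> a \<Longrightarrow> sc a b rs = (\<Sum>j\<le>?n. t j * rcnt (drop j ?R) b)" using gap_weights by blast
  have dr: "rcnt (drop j xs) b \<le> rcnt xs b" for j b and xs :: "('c \<times> nat) list"
    by (metis append_take_drop_id le_add2 rcnt_simps(3))
  have cA: "card (A - {a}) \<le> card A" using finite_A by (simp add: card_mono)
  have "rcnt (drop j ?R) b \<le> rcnt rs b" if "b \<in> A - {a}" for j b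
    using dr[of j ?R b] that by (simp add: rcnt_off)
  then obtain s where s: "(\<Sum>j\<le>?n. s j) = (\<Sum>j\<le>?n. t j)" "card {j. j \<le> ?n \<and> s j \<noteq> 0} \<le> card (A - {a}) + 2"
    "\<And>b. b \<in> A - {a} \<Longrightarrow> \<bar>int (\<Sum>j\<le>?n. t j * rcnt (drop j ?R) b) - int (\<Sum>j\<le>?n. s j * rcnt (drop j ?R) b)\<bar>
       \<le> int ((card (A - {a}) + 1) * rcnt rs b)"
    using few_positions[of "A - {a}" ?n "\<lambda>j b. rcnt (drop j ?R) b" "rcnt rs" t] finite_A by auto
  define rs' where "rs' = ins a s ?R"
  note ip = ins_props[OF R(1), where t = s, folded rs'_def]
  let ?f = "\<lambda>b. if b = a then 0 else int (sc a b rs)" and ?g = "\<lambda>b. if b = a then 0 else int (sc a b rs')"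
  define h where "h b = (if b \<in> A then ?f b - ?g b else 0)" for b
  have rs'A: "fst ` set rs' \<subseteq> A" using ip(7) R(2) a by blast
  have cnt: "rcnt rs' b = rcnt rs b" for b
    using ip(2) ip(3)[of b] s(1) t(1) by (cases "b = a") (auto simp: rcnt_off)
  have "zeta (row a ?f) = zeta (row a (\<lambda>b. ?g b + (?f b - ?g b)))" by simp
  also have "\<dots> = zeta (row a ?g) \<otimes> zeta (row a (\<lambda>b. ?f b - ?g b))" by (rule row_add)
  also have "zeta (row a (\<lambda>b. ?f b - ?g b)) = zeta (row a (\<lambda>b. h b + (?f b - ?g b - h b)))" by simp
  also have "\<dots> = zeta (row a h) \<otimes> zeta (row a (\<lambda>b. ?f b - ?g b - h b))" by (rule row_add)
  also have "zeta (row a (\<lambda>b. ?f b - ?g b - h b)) = \<one>" by (rule row_zero) (simp add: h_def)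
  finally have z: "zeta (row a ?f) = zeta (row a ?g) \<otimes> zeta (row a h)" by simp
  have "rv rs = rv ?R \<otimes> val a [^] rcnt rs a \<otimes> (zeta (row a ?g) \<otimes> zeta (row a h))"
    using rv_gather[OF a rs] z by simp
  also have "\<dots> = (rv ?R \<otimes> val a [^] rcnt rs a \<otimes> zeta (row a ?g)) \<otimes> zeta (row a h)"
    using a R by (simp add: m_assoc)
  also have "rv ?R \<otimes> val a [^] rcnt rs a \<otimes> zeta (row a ?g) = rv rs'"
    using rv_gather[OF a rs'A] ip(1) cnt by simp
  finally have 1: "rv rs = rv rs' \<otimes> zeta (row a h)" .
  have 2: "\<bar>row a h (c, b)\<bar> \<le> int ((card A + 1) * rcnt rs b)" for c b
  proof (cases "b \<in> A - {a}")
    case True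
    have "\<bar>h b\<bar> = \<bar>int (\<Sum>j\<le>?n. t j * rcnt (drop j ?R) b) - int (\<Sum>j\<le>?n. s j * rcnt (drop j ?R) b)\<bar>"
      using True t(2)[of b] ip(4)[of b] by (simp add: h_def)
    also have "\<dots> \<le> int ((card (A - {a}) + 1) * rcnt rs b)" using s(3) True by blast
    also have "\<dots> \<le> int ((card A + 1) * rcnt rs b)" using cA by (intro zle_int[THEN iffD2] mult_right_mono) auto
    finally show ?thesis by (simp add: row_def)
  qed (auto simp: row_def h_def)
  have 3: "length (filter (\<lambda>r. fst r = c) rs') = length (filter (\<lambda>r. fst r = c) rs)" if "c \<noteq> a" for c
  proof -
    have "filter (\<lambda>r. fst r = c) ?R = filter (\<lambda>r. fst r = c) rs" using that by (auto intro: filter_cong)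
    then show ?thesis using ip(6)[OF that] by simp
  qed
  have 4: "length (filter (\<lambda>r. fst r = a) rs') \<le> card A + 2" using ip(5) s(2) cA by simp
  show ?thesis using rs'A cnt 4 3 1 2 by blast
qed

lemma collapse_letters:
  assumes "finite Y" "Y \<subseteq> A" "fst ` set rs \<subseteq> A"
  shows "\<exists>rs' E. fst ` set rs' \<subseteq> A \<and> (\<forall>b. rcnt rs' b = rcnt rs b) \<and>
    (\<forall>c\<in>Y. length (filter (\<lambda>r. fst r = c) rs') \<le> card A + 2) \<and>
    rv rs = rv rs' \<otimes> zeta E \<and> (\<forall>c b. \<bar>E (c, b)\<bar> \<le> int (card Y * (card A + 1) * rcnt rs b))"
  using assms(1,2)
proof (induction Y rule: finite_induct)
  case empty
  have "zeta (\<lambda>_. 0) = \<one>" by (rule zeta_zero) simp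
  then show ?case using assms(3) by (intro exI[of _ rs] exI[of _ "\<lambda>_. 0"]) auto
next
  case (insert a Y)
  then obtain rs1 E where 1: "fst ` set rs1 \<subseteq> A" "\<And>b. rcnt rs1 b = rcnt rs b"
    "\<forall>c\<in>Y. length (filter (\<lambda>r. fst r = c) rs1) \<le> card A + 2"
    "rv rs = rv rs1 \<otimes> zeta E" "\<And>c b. \<bar>E (c, b)\<bar> \<le> int (card Y * (card A + 1) * rcnt rs b)" by auto
  obtain rs2 F where 2: "fst ` set rs2 \<subseteq> A" "\<And>b. rcnt rs2 b = rcnt rs1 b"
    "length (filter (\<lambda>r. fst r = a) rs2) \<le> card A + 2"
    "\<And>c. c \<noteq> a \<Longrightarrow> length (filter (\<lambda>r. fst r = c) rs2) = length (filter (\<lambda>r. fst r = c) rs1)"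
    "rv rs1 = rv rs2 \<otimes> zeta F" "\<And>c b. \<bar>F (c, b)\<bar> \<le> int ((card A + 1) * rcnt rs1 b)"
    using collapse_letter[of a rs1] insert.prems 1(1) by auto
  have "rv rs = rv rs2 \<otimes> zeta (\<lambda>p. F p + E p)"
    using 1 2 by (simp add: zeta_add m_assoc)
  moreover have "\<bar>F (c, b) + E (c, b)\<bar> \<le> int (card (insert a Y) * (card A + 1) * rcnt rs b)" for c b
    using 1(5)[of c b] 2(6)[of c b] 1(2) insert.hyps by (simp add: algebra_simps)
  moreover have "\<forall>c\<in>insert a Y. length (filter (\<lambda>r. fst r = c) rs2) \<le> card A + 2"
    using 2(3,4) 1(3) by (metis insertE)
  ultimately show ?case using 1(2) 2(1,2)
    by (intro exI[of _ rs2] exI[of _ "\<lambda>p. F p + E p"]) auto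
qed

lemma length_by_letter:
  assumes "finite X" "fst ` set rs \<subseteq> X"
  shows "length rs = (\<Sum>c\<in>X. length (filter (\<lambda>r. fst r = c) rs))"
  using assms(2)
proof (induction rs)
  case (Cons r rs)
  have "(\<Sum>c\<in>X. length (filter (\<lambda>q. fst q = c) (r # rs)))
      = (\<Sum>c\<in>X. (if fst r = c then 1 else 0) + length (filter (\<lambda>q. fst q = c) rs))"
    by (rule sum.cong) auto
  then show ?case using Cons assms(1) by (simp add: sum.distrib)
qed simp

text \<open>A word becomes a bounded number of powers of letters, up to an error at \<open>(a, b)\<close> that is linear in the number
  of \<open>b\<close>. This bound is what conjugations can absorb.\<close>

lemma collapse:
  assumes "w \<in> lists A"
  shows "\<exists>rs E. fst ` set rs \<subseteq> A \<and> (\<forall>b. rcnt rs b = count_list w b) \<and> length rs \<le> card A * (card A + 2) \<and>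
    pv w = rv rs \<otimes> zeta E \<and> (\<forall>c b. \<bar>E (c, b)\<bar> \<le> int (card A * (card A + 1) * count_list w b))"
proof -
  let ?rs = "map (\<lambda>c. (c, Suc 0)) w"
  have w: "fst ` set ?rs \<subseteq> A" using assms by (auto simp: in_lists_conv_set)
  obtain rs E where *: "fst ` set rs \<subseteq> A" "\<And>b. rcnt rs b = rcnt ?rs b"
    "\<forall>c\<in>A. length (filter (\<lambda>r. fst r = c) rs) \<le> card A + 2"
    "rv ?rs = rv rs \<otimes> zeta E" "\<And>c b. \<bar>E (c, b)\<bar> \<le> int (card A * (card A + 1) * rcnt ?rs b)"
    using collapse_letters[OF finite_A subset_refl w] by blast
  have "length rs \<le> (\<Sum>c\<in>A. card A + 2)"
    unfolding length_by_letter[OF finite_A *(1)] by (rule sum_mono) (use * in auto)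
  then show ?thesis using * pv_rv[OF assms] by (intro exI[of _ rs] exI[of _ E]) (simp add: rcnt_letters)
qed

subsection \<open>Twisted runs\<close>

text \<open>A twisted run \<open>(x, c, t)\<close> stands for \<open>x c\<^sup>t x\<^sup>-\<^sup>1\<close>.\<close>

definition tval :: "('a \<times> 'c \<times> nat) list \<Rightarrow> 'a" where
  "tval its = word_eval K (map (\<lambda>(x, c, t). x \<otimes> val c [^] t \<otimes> inv x) its)"

definition tcnt :: "('a \<times> 'c \<times> nat) list \<Rightarrow> 'c \<Rightarrow> nat" where
  "tcnt its b = (\<Sum>(x, c, t)\<leftarrow>its. if c = b then t else 0)"

lemma tval_simps [simp]: "tval [] = \<one>" "tval ((x, c, t) # its) = x \<otimes> val c [^] t \<otimes> inv x \<otimes> tval its"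
  by (simp_all add: tval_def)
lemma tcnt_simps [simp]: "tcnt [] b = 0" "tcnt ((x, c, t) # its) b = (if c = b then t else 0) + tcnt its b"
  by (simp_all add: tcnt_def)

definition titems :: "'a set \<Rightarrow> ('a \<times> 'c \<times> nat) set" where "titems X = X \<times> A \<times> UNIV"

lemma tval_closed: "X \<subseteq> carrier K \<Longrightarrow> its \<in> lists (titems X) \<Longrightarrow> tval its \<in> carrier K"
  by (induction its) (auto simp: titems_def)

lemma conj_twist:
  assumes "x \<in> carrier K" "g \<in> carrier K" "b \<in> A"
  shows "(x \<otimes> g) \<otimes> val b [^] (t::nat) \<otimes> inv (x \<otimes> g) = x \<otimes> val b [^] t \<otimes> inv x \<otimes> commutator K g (val b) [^] t"
proof -
  have "(x \<otimes> g) \<otimes> val b [^] t \<otimes> inv (x \<otimes> g) = x \<otimes> (commutator K g (val b [^] t) \<otimes> val b [^] t) \<otimes> inv x"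
    using assms by (simp add: commutator_def m_assoc inv_mult_group)
  also have "\<dots> = x \<otimes> (val b [^] t \<otimes> commutator K g (val b [^] t)) \<otimes> inv x"
    using assms by (simp add: Z_commute)
  also have "\<dots> = x \<otimes> val b [^] t \<otimes> inv x \<otimes> commutator K g (val b [^] t)"
    using assms Z_commute[of "commutator K g (val b [^] t)" "inv x"] by (simp add: m_assoc)
  finally show ?thesis using assms by (simp add: comm_pow_right)
qed

text \<open>Conjugating \<open>b\<^sup>r\<close> by \<open>g\<close> multiplies by \<open>[g, b]\<^sup>r\<close>; the run in which the count of letters \<open>b\<close> passes \<open>r\<close>
  is split in two.\<close>

lemma twist_once:
  assumes g: "g \<in> carrier K" and b: "b \<in> A" and X: "X \<subseteq> carrier K"
    and "its \<in> lists (titems X)" "r \<le> tcnt its b"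
  shows "\<exists>its'. its' \<in> lists (titems (X \<union> (\<lambda>x. x \<otimes> g) ` X)) \<and> (\<forall>c. tcnt its' c = tcnt its c) \<and>
    length its' \<le> length its + 1 \<and> tval its' = tval its \<otimes> commutator K g (val b) [^] r"
  using assms(4,5)
proof (induction its arbitrary: r)
  case Nil
  then show ?case using g b by (intro exI[of _ "[]"]) auto
next
  case (Cons it its)
  obtain x c t where it: "it = (x, c, t)" by (cases it) auto
  have "it \<in> titems X" and its: "its \<in> lists (titems X)" using Cons.hyps by simp_all
  then have xc: "x \<in> X" "x \<in> carrier K" "c \<in> A" "its \<in> lists (titems X)"
    using it X its unfolding titems_def by auto
  have tc: "tval its \<in> carrier K" using tval_closed[OF X xc(4)] .
  let ?Y = "X \<union> (\<lambda>x. x \<otimes> g) ` X" and ?k = "commutator K g (val b)"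
  have k: "?k [^] (n::nat) \<in> Z" for n using g b by simp
  have Yc: "?Y \<subseteq> carrier K" using X g by auto
  have mono: "l \<in> lists (titems ?Y)" if "l \<in> lists (titems X)" for l
    using that by (rule subsetD[OF lists_mono, rotated]) (auto simp: titems_def)
  consider (skip) "c \<noteq> b" | (whole) "c = b" "t \<le> r" | (split) "c = b" "r < t" by linarith
  then show ?case
  proof cases
    case skip
    then obtain its' where *: "its' \<in> lists (titems ?Y)" "\<forall>c. tcnt its' c = tcnt its c"
      "length its' \<le> length its + 1" "tval its' = tval its \<otimes> ?k [^] r"
      using Cons.IH[of r] Cons.prems it xc by auto
    show ?thesis using * it xc tc k g b
      by (intro exI[of _ "it # its'"]) (auto simp: m_assoc titems_def)
  next
    case whole
    then have "r - t \<le> tcnt its b" using Cons.prems it by simp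
    then obtain its' where *: "its' \<in> lists (titems ?Y)" "\<forall>c. tcnt its' c = tcnt its c"
      "length its' \<le> length its + 1" "tval its' = tval its \<otimes> ?k [^] (r - t)"
      using Cons.IH[of "r - t"] xc by blast
    have "?k [^] t \<otimes> (tval its \<otimes> ?k [^] (r - t)) = tval its \<otimes> (?k [^] t \<otimes> ?k [^] (r - t))"
      using Z_left_commute[OF k[of t] tc] k[of "r - t"] by simp
    also have "?k [^] t \<otimes> ?k [^] (r - t) = ?k [^] r" using whole g b by (simp add: nat_pow_mult)
    finally have e: "?k [^] t \<otimes> (tval its \<otimes> ?k [^] (r - t)) = tval its \<otimes> ?k [^] r" .
    have "tval ((x \<otimes> g, b, t) # its') = tval (it # its) \<otimes> ?k [^] r"
      using * e it whole xc tc k g b conj_twist[OF xc(2) g b, of t] by (simp add: m_assoc)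
    then show ?thesis using * it whole xc b
      by (intro exI[of _ "(x \<otimes> g, b, t) # its'"]) (auto simp: titems_def)
  next
    case split
    have "x \<otimes> g \<otimes> val b [^] r \<otimes> inv (x \<otimes> g) \<otimes> (x \<otimes> val b [^] (t - r) \<otimes> inv x)
        = x \<otimes> val b [^] r \<otimes> inv x \<otimes> (?k [^] r \<otimes> (x \<otimes> val b [^] (t - r) \<otimes> inv x))"
      unfolding conj_twist[OF xc(2) g b] using xc b k[of r] by (simp add: m_assoc)
    also have "?k [^] r \<otimes> (x \<otimes> val b [^] (t - r) \<otimes> inv x) = x \<otimes> val b [^] (t - r) \<otimes> inv x \<otimes> ?k [^] r"
      using xc b by (intro Z_commute k) auto
    also have "x \<otimes> val b [^] r \<otimes> inv x \<otimes> (x \<otimes> val b [^] (t - r) \<otimes> inv x \<otimes> ?k [^] r)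
        = x \<otimes> (val b [^] r \<otimes> val b [^] (t - r)) \<otimes> inv x \<otimes> ?k [^] r"
      using xc b k[of r] by (simp add: m_assoc)
    also have "val b [^] r \<otimes> val b [^] (t - r) = val b [^] t" using split b by (simp add: nat_pow_mult)
    finally have e: "x \<otimes> g \<otimes> val b [^] r \<otimes> inv (x \<otimes> g) \<otimes> (x \<otimes> val b [^] (t - r) \<otimes> inv x)
       = x \<otimes> val b [^] t \<otimes> inv x \<otimes> ?k [^] r" .
    have "tval ((x \<otimes> g, b, r) # (x, b, t - r) # its)
       = x \<otimes> g \<otimes> val b [^] r \<otimes> inv (x \<otimes> g) \<otimes> (x \<otimes> val b [^] (t - r) \<otimes> inv x) \<otimes> tval its"
      using xc g b tc by (simp add: m_assoc)
    also have "\<dots> = tval (it # its) \<otimes> ?k [^] r"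
      unfolding e using it split xc tc k[of r] b Z_commute[OF k[of r] tc] by (simp add: m_assoc)
    finally show ?thesis using it split xc b mono[OF xc(4)]
      by (intro exI[of _ "(x \<otimes> g, b, r) # (x, b, t - r) # its"]) (auto simp: titems_def)
  qed
qed

definition gens where "gens = val ` A \<union> (\<lambda>c. inv (val c)) ` A"

text \<open>The ball in the letter generators and their inverses, from which the conjugating elements are taken.\<close>

definition Bl :: "nat \<Rightarrow> 'a set" where "Bl k = {word_eval K gs | gs. gs \<in> lists gens \<and> length gs \<le> k}"

lemma gens_carrier: "gens \<subseteq> carrier K" by (auto simp: gens_def)

lemma Bl_carrier: "Bl k \<subseteq> carrier K"
  unfolding Bl_def using gens_carrier by (auto simp: in_lists_conv_set intro!: word_eval_closed)

lemma Bl_mult_gen: "x \<in> Bl k \<Longrightarrow> g \<in> gens \<Longrightarrow> x \<otimes> g \<in> Bl (Suc k)"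
proof -
  assume "x \<in> Bl k" "g \<in> gens"
  then obtain gs where gs: "gs \<in> lists gens" "length gs \<le> k" "x = word_eval K gs" by (auto simp: Bl_def)
  have "word_eval K (gs @ [g]) = x \<otimes> g"
    using gs \<open>g \<in> gens\<close> gens_carrier by (subst word_eval_append) (auto simp: in_lists_conv_set)
  then show ?thesis unfolding Bl_def using gs \<open>g \<in> gens\<close>
    by (intro CollectI exI[of _ "gs @ [g]"]) auto
qed

lemma Bl_mono: "k \<le> l \<Longrightarrow> Bl k \<subseteq> Bl l" unfolding Bl_def by auto

lemma finite_Bl: "finite (Bl k)"
proof -
  have "finite {gs. set gs \<subseteq> gens \<and> length gs \<le> k}"
    by (rule finite_lists_length_le) (simp add: gens_def finite_A)
  then have "finite (word_eval K ` {gs. set gs \<subseteq> gens \<and> length gs \<le> k})" by simp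
  moreover have "Bl k \<subseteq> word_eval K ` {gs. set gs \<subseteq> gens \<and> length gs \<le> k}"
    by (auto simp: Bl_def in_lists_conv_set)
  ultimately show ?thesis by (rule finite_subset[rotated])
qed

lemma twist_pair_pos:
  assumes a: "g \<in> gens" and b: "b \<in> A" and "its \<in> lists (titems (Bl k))" "e \<le> C * tcnt its b"
  shows "\<exists>its'. its' \<in> lists (titems (Bl (k + C))) \<and> (\<forall>c. tcnt its' c = tcnt its c) \<and>
    length its' \<le> length its + C \<and> tval its' = tval its \<otimes> commutator K g (val b) [^] e"
  using assms(4)
proof (induction C arbitrary: e)
  case 0
  then show ?case using assms tval_closed[OF Bl_carrier assms(3)] by (intro exI[of _ its]) auto
next
  case (Suc C)
  have g: "g \<in> carrier K" using a gens_carrier by blast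
  define r where "r = min e (tcnt its b)"
  have "e - r \<le> C * tcnt its b" using Suc.prems by (cases "e \<le> tcnt its b") (auto simp: r_def min_def)
  then obtain its1 where 1: "its1 \<in> lists (titems (Bl (k + C)))" "\<forall>c. tcnt its1 c = tcnt its c"
    "length its1 \<le> length its + C" "tval its1 = tval its \<otimes> commutator K g (val b) [^] (e - r)"
    using Suc.IH[of "e - r"] by blast
  have "r \<le> tcnt its1 b" using 1(2) by (simp add: r_def)
  then obtain its2 where 2: "its2 \<in> lists (titems (Bl (k + C) \<union> (\<lambda>x. x \<otimes> g) ` Bl (k + C)))" "\<forall>c. tcnt its2 c = tcnt its1 c"
    "length its2 \<le> length its1 + 1" "tval its2 = tval its1 \<otimes> commutator K g (val b) [^] r"
    using twist_once[OF g b Bl_carrier 1(1)] by blast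
  have "Bl (k + C) \<union> (\<lambda>x. x \<otimes> g) ` Bl (k + C) \<subseteq> Bl (k + Suc C)"
    using Bl_mult_gen[OF _ a] Bl_mono[of "k + C" "k + Suc C"] by auto
  then have "its2 \<in> lists (titems (Bl (k + Suc C)))"
    using 2(1) by (elim subsetD[OF lists_mono, rotated]) (auto simp: titems_def)
  moreover have "commutator K g (val b) [^] (e - r) \<otimes> commutator K g (val b) [^] r = commutator K g (val b) [^] e"
    using g b by (simp add: nat_pow_mult r_def)
  then have "tval its2 = tval its \<otimes> commutator K g (val b) [^] e"
    using 1 2 g b tval_closed[OF Bl_carrier assms(3)] by (simp add: m_assoc)
  ultimately show ?case using 1 2 by (intro exI[of _ its2]) auto
qed

lemma twist_pair:
  assumes a: "a \<in> A" and b: "b \<in> A" and its: "its \<in> lists (titems (Bl k))" and e: "\<bar>e\<bar> \<le> int (C * tcnt its b)"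
  shows "\<exists>its'. its' \<in> lists (titems (Bl (k + C))) \<and> (\<forall>c. tcnt its' c = tcnt its c) \<and>
    length its' \<le> length its + C \<and> tval its' = tval its \<otimes> bracket (a, b) [^] (e::int)"
proof (cases "0 \<le> e")
  case True
  then have "bracket (a, b) [^] e = commutator K (val a) (val b) [^] nat e"
    by (simp add: bracket_def int_pow_int[symmetric])
  moreover have "val a \<in> gens" "nat e \<le> C * tcnt its b" using a e True by (auto simp: gens_def nat_le_iff)
  ultimately show ?thesis using twist_pair_pos[OF _ b its, of "val a" "nat e" C] by simp
next
  case False
  have "bracket (a, b) [^] e = bracket (a, b) [^] (- int (nat (- e)))" using False by simp
  also have "\<dots> = inv (bracket (a, b) [^] nat (- e))"
    using bracket_Z[of "(a, b)"] a b by (intro int_pow_neg_int) simp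
  also have "\<dots> = commutator K (inv (val a)) (val b) [^] nat (- e)"
    using a b by (simp add: bracket_def comm_inv_left nat_pow_inv)
  finally have "bracket (a, b) [^] e = commutator K (inv (val a)) (val b) [^] nat (- e)" .
  moreover have "inv (val a) \<in> gens" "nat (- e) \<le> C * tcnt its b" using a e False by (auto simp: gens_def nat_le_iff)
  ultimately show ?thesis using twist_pair_pos[OF _ b its, of "inv (val a)" "nat (- e)" C] by simp
qed

text \<open>An error \<open>zeta E\<close> with \<open>\<bar>E (a, b)\<bar>\<close> bounded by a multiple of the number of \<open>b\<close> is absorbed by conjugating runs
  with elements of bounded length, without changing the letter counts.\<close>

lemma twist_all:
  assumes "set ps \<subseteq> A \<times> A" "its \<in> lists (titems (Bl k))" "\<And>a b. \<bar>E (a, b)\<bar> \<le> int (C * tcnt its b)"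
  shows "\<exists>its'. its' \<in> lists (titems (Bl (k + length ps * C))) \<and> (\<forall>c. tcnt its' c = tcnt its c) \<and>
    length its' \<le> length its + length ps * C \<and> tval its' = tval its \<otimes> zeta_on ps E"
  using assms(1)
proof (induction ps)
  case Nil
  then show ?case using assms(2) tval_closed[OF Bl_carrier assms(2)] by (intro exI[of _ its]) auto
next
  case (Cons p ps)
  then obtain its1 where 1: "its1 \<in> lists (titems (Bl (k + length ps * C)))" "\<forall>c. tcnt its1 c = tcnt its c"
    "length its1 \<le> length its + length ps * C" "tval its1 = tval its \<otimes> zeta_on ps E" by auto
  obtain a b where p: "p = (a, b)" "a \<in> A" "b \<in> A" using Cons.prems by (cases p) auto
  obtain its2 where 2: "its2 \<in> lists (titems (Bl (k + length ps * C + C)))" "\<forall>c. tcnt its2 c = tcnt its1 c"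
    "length its2 \<le> length its1 + C" "tval its2 = tval its1 \<otimes> bracket (a, b) [^] E (a, b)"
    using twist_pair[OF p(2,3) 1(1), of "E (a, b)" C] assms(3)[of a b] 1(2) by auto
  have z: "bracket (a, b) \<in> Z" "zeta_on ps E \<in> Z" using bracket_Z[of "(a, b)"] p zeta_on_Z Cons.prems by auto
  then have "tval its2 = tval its \<otimes> zeta_on (p # ps) E"
    using 1 2 p tval_closed[OF Bl_carrier assms(2)] Z_commute[of "zeta_on ps E" "bracket (a, b) [^] E (a, b)"]
    by (simp add: zeta_on_Cons m_assoc)
  moreover have "k + length ps * C + C = k + length (p # ps) * C" by simp
  ultimately show ?case using 1 2 by (intro exI[of _ its2]) (auto simp: algebra_simps)
qed

end

section \<open>Minimal nonoptimal words and the class-two reduction\<close>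

text \<open>Dickson's lemma, by passing to a subsequence that is nondecreasing in one multiplicity after the other.\<close>

lemma dickson_subsequence:
  fixes f :: "nat \<Rightarrow> 'b multiset"
  assumes "finite B" "\<And>i. set_mset (f i) \<subseteq> B"
  shows "\<exists>g :: nat \<Rightarrow> nat. strict_mono g \<and> (\<forall>i j. i \<le> j \<longrightarrow> f (g i) \<subseteq># f (g j))"
proof -
  have "\<exists>g :: nat \<Rightarrow> nat. strict_mono g \<and> (\<forall>x\<in>B. \<forall>i j. i \<le> j \<longrightarrow> count (f (g i)) x \<le> count (f (g j)) x)"
    using assms(1)
  proof (induction B rule: finite_induct)
    case empty
    show ?case by (intro exI[of _ "\<lambda>i. i"]) (auto simp: strict_mono_def)
  next
    case (insert x B)
    then obtain g :: "nat \<Rightarrow> nat" where g: "strict_mono g"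
      "\<And>y i j. y \<in> B \<Longrightarrow> i \<le> j \<Longrightarrow> count (f (g i)) y \<le> count (f (g j)) y" by blast
    define h where "h i = count (f (g i)) x" for i
    obtain r :: "nat \<Rightarrow> nat" where r: "strict_mono r" "monoseq (\<lambda>n. h (r n))"
      using seq_monosub[of h] by blast
    have "\<exists>q::nat \<Rightarrow> nat. strict_mono q \<and> (\<forall>i j. i \<le> j \<longrightarrow> h (q i) \<le> h (q j))"
    proof (cases "\<forall>m. \<forall>n\<ge>m. h (r m) \<le> h (r n)")
      case True
      then show ?thesis using r(1) by blast
    next
      case False
      then have dec: "\<forall>m. \<forall>n\<ge>m. h (r n) \<le> h (r m)" using r(2) unfolding monoseq_def by blast
      obtain N where N: "\<And>n. h (r N) \<le> h (r n)"
        using ex_has_least_nat[of "\<lambda>_. True" 0 "\<lambda>n. h (r n)"] by auto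
      have "h (r (N + i)) = h (r N)" for i using N[of "N + i"] dec le_add1[of N i] by (meson le_antisym)
      moreover have "strict_mono (\<lambda>i. r (N + i))" using r(1) by (simp add: strict_mono_def)
      ultimately show ?thesis by (metis order_refl)
    qed
    then obtain q :: "nat \<Rightarrow> nat" where q: "strict_mono q" "\<And>i j. i \<le> j \<Longrightarrow> h (q i) \<le> h (q j)" by blast
    have "strict_mono (\<lambda>i. g (q i))" using g(1) q(1) by (simp add: strict_mono_def)
    moreover have "count (f (g (q i))) y \<le> count (f (g (q j))) y" if "y \<in> insert x B" "i \<le> j" for y i j
    proof (cases "y = x")
      case True
      then show ?thesis using q(2)[OF that(2)] by (simp add: h_def)
    next
      case False
      have "q i \<le> q j" using q(1) that(2) by (simp add: strict_mono_less_eq)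
      then show ?thesis using g(2) False that(1) by blast
    qed
    ultimately show ?case by (intro exI[of _ "\<lambda>i. g (q i)"]) blast
  qed
  then obtain g :: "nat \<Rightarrow> nat" where g: "strict_mono g"
    "\<And>x i j. x \<in> B \<Longrightarrow> i \<le> j \<Longrightarrow> count (f (g i)) x \<le> count (f (g j)) x" by blast
  have "f (g i) \<subseteq># f (g j)" if "i \<le> j" for i j
  proof (rule mset_subset_eqI)
    fix x
    show "count (f (g i)) x \<le> count (f (g j)) x"
    proof (cases "x \<in> B")
      case False
      then have "x \<notin># f (g i)" using assms(2) by blast
      then show ?thesis by (simp add: not_in_iff)
    qed (use g(2) that in blast)
  qed
  then show ?thesis using g(1) by blast
qed

lemma bounded_minimal_submultisets:
  fixes Q :: "'b multiset \<Rightarrow> bool"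
  assumes "finite B"
  shows "\<exists>b. \<forall>M. set_mset M \<subseteq> B \<longrightarrow> Q M \<longrightarrow> (\<exists>N. N \<subseteq># M \<and> Q N \<and> size N \<le> b)"
proof -
  define Min where "Min = {M. set_mset M \<subseteq> B \<and> Q M \<and> (\<forall>N. N \<subset># M \<longrightarrow> \<not> Q N)}"
  have "finite Min"
  proof (rule ccontr)
    assume "infinite Min"
    then obtain f :: "nat \<Rightarrow> 'b multiset" where f: "inj f" "range f \<subseteq> Min"
      using infinite_countable_subset by blast
    then have "\<And>i. set_mset (f i) \<subseteq> B" unfolding Min_def by blast
    then obtain g :: "nat \<Rightarrow> nat" where g: "strict_mono g" "\<And>i j. i \<le> j \<Longrightarrow> f (g i) \<subseteq># f (g j)"
      using dickson_subsequence[OF assms, of f] by blast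
    have "g 0 \<noteq> g 1" using g(1) by (simp add: strict_mono_eq)
    then have "f (g 0) \<noteq> f (g 1)" using f(1) by (simp add: inj_eq)
    then have "f (g 0) \<subset># f (g 1)" using g(2)[of 0 1] by (simp add: subset_mset.less_le)
    moreover have "f (g 0) \<in> Min" "f (g 1) \<in> Min" using f(2) by auto
    ultimately show False unfolding Min_def by blast
  qed
  have ex: "\<exists>N. N \<subseteq># M \<and> N \<in> Min" if "set_mset M \<subseteq> B" "Q M" for M
    using that
  proof (induction "size M" arbitrary: M rule: less_induct)
    case less
    show ?case
    proof (cases "M \<in> Min")
      case False
      then obtain N where N: "N \<subset># M" "Q N" using less.prems unfolding Min_def by blast
      then have "set_mset N \<subseteq> B" using less.prems by (meson set_mset_mono subset_mset.less_imp_le subset_trans)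
      then obtain N' where "N' \<subseteq># N" "N' \<in> Min" using less.hyps[of N] N mset_subset_size by blast
      then show ?thesis using N by (meson subset_mset.less_imp_le subset_mset.order_trans)
    qed auto
  qed
  have "\<exists>b. \<forall>N\<in>Min. size N \<le> b"
    using \<open>finite Min\<close> by (meson finite_imageI finite_nat_set_iff_bounded_le imageI)
  then obtain b where "\<forall>N\<in>Min. size N \<le> b" by blast
  moreover have "Q N" if "N \<in> Min" for N using that by (simp add: Min_def)
  ultimately show ?thesis using ex by meson
qed

context class2_group
begin

text \<open>Nonoptimality passes to larger multisets, so Dickson's lemma reduces it to words of bounded length.\<close>

lemma bounded_nonopt:
  "\<exists>b. \<forall>w\<in>lists A. nonopt w \<longrightarrow> (\<exists>u\<in>lists A. mset u \<subseteq># mset w \<and> nonopt u \<and> length u \<le> b)"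
proof -
  let ?Q = "\<lambda>M. \<exists>u\<in>lists A. mset u = M \<and> nonopt u"
  obtain b where b: "\<And>M. set_mset M \<subseteq> A \<Longrightarrow> ?Q M \<Longrightarrow> \<exists>N. N \<subseteq># M \<and> ?Q N \<and> size N \<le> b"
    using bounded_minimal_submultisets[OF finite_A, of ?Q] by blast
  have "\<exists>u\<in>lists A. mset u \<subseteq># mset w \<and> nonopt u \<and> length u \<le> b" if w: "w \<in> lists A" "nonopt w" for w
  proof -
    have sub: "set_mset (mset w) \<subseteq> A" using w(1) by (auto simp: in_lists_conv_set)
    have "?Q (mset w)" using w by (intro bexI[of _ w]) auto
    from b[OF sub this] obtain N where N: "N \<subseteq># mset w" "?Q N" "size N \<le> b" by (elim exE conjE)
    from N(2) obtain u where "u \<in> lists A" "mset u = N" "nonopt u" by (elim bexE conjE)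
    then show ?thesis using N by (intro bexI[of _ u]) auto
  qed
  then show ?thesis by blast
qed

lemma bounded_improvement:
  "\<exists>C. \<forall>u\<in>lists A. length u \<le> b \<longrightarrow> nonopt u \<longrightarrow>
     (\<exists>u'\<in>lists A. wlen u' < wlen u \<and> (\<exists>E. pv u = pv u' \<otimes> zeta E \<and> (\<forall>p. \<bar>E p\<bar> \<le> int C)))"
proof -
  let ?U = "{u. set u \<subseteq> A \<and> length u \<le> b}"
  have fin: "finite ?U" by (rule finite_lists_length_le[OF finite_A])
  let ?P = "\<lambda>C u. \<exists>u'\<in>lists A. wlen u' < wlen u \<and> (\<exists>E. pv u = pv u' \<otimes> zeta E \<and> (\<forall>p. \<bar>E p\<bar> \<le> int C))"
  have ex: "\<exists>C. ?P C u" if nu: "nonopt u" for u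
  proof -
    obtain u' E where u': "u' \<in> lists A" "wlen u' < wlen u" "pv u = pv u' \<otimes> zeta E"
      using nu unfolding nonopt_def by blast
    define F where "F p = (if p \<in> A \<times> A then E p else 0)" for p
    have "zeta E = zeta (\<lambda>p. F p + (E p - F p))" by simp
    also have "\<dots> = zeta F \<otimes> zeta (\<lambda>p. E p - F p)" by (rule zeta_add)
    also have "zeta (\<lambda>p. E p - F p) = \<one>" by (rule zeta_zero) (simp add: F_def)
    finally have "zeta E = zeta F" by simp
    have "finite ((\<lambda>p. nat \<bar>E p\<bar>) ` (A \<times> A))" using finite_A by simp
    then obtain C where C: "\<And>p. p \<in> A \<times> A \<Longrightarrow> nat \<bar>E p\<bar> \<le> C"
      by (meson finite_nat_set_iff_bounded_le imageI)
    have "\<bar>F p\<bar> \<le> int C" for p using C[of p] by (auto simp: F_def)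
    then show ?thesis using u' \<open>zeta E = zeta F\<close> by (intro exI[of _ C] bexI[of _ u'] conjI exI[of _ F]) auto
  qed
  define c where "c u = (SOME C. ?P C u)" for u
  have c: "?P (c u) u" if "nonopt u" for u
    unfolding c_def by (rule someI_ex[OF ex[OF that]])
  have "finite (c ` ?U)" using fin by (rule finite_imageI)
  then obtain C where C: "\<forall>x\<in>c ` ?U. x \<le> C" unfolding finite_nat_set_iff_bounded_le by (elim exE)
  have "?P C u" if u: "u \<in> lists A" "length u \<le> b" "nonopt u" for u
  proof -
    have "u \<in> ?U" using u by (auto simp: in_lists_conv_set)
    then have "c u \<le> C" using C by (intro bspec[OF C] imageI)
    moreover obtain u' E where "u' \<in> lists A" "wlen u' < wlen u" "pv u = pv u' \<otimes> zeta E" "\<forall>p. \<bar>E p\<bar> \<le> int (c u)"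
      using c[OF u(3)] by blast
    moreover have "int (c u) \<le> int C" using \<open>c u \<le> C\<close> by simp
    ultimately show ?thesis by (intro bexI[of _ u'] conjI exI[of _ E]) (auto intro: order_trans[of _ "int (c u)"])
  qed
  then show ?thesis by blast
qed

text \<open>A nonoptimal word is shortened inside a subword of bounded length, moved to the end. Only boundedly many
  letters move, hence the error is linear in the letter counts, and no count drops by more than a constant.\<close>

lemma improve_block:
  "\<exists>C. \<forall>w\<in>lists A. nonopt w \<longrightarrow> (\<exists>w' E. w' \<in> lists A \<and> wlen w' < wlen w \<and> pv w = pv w' \<otimes> zeta E \<and>
     (\<forall>a b. \<bar>E (a, b)\<bar> \<le> int (C * count_list w b + C)) \<and> (\<forall>b. count_list w b \<le> count_list w' b + C))"
proof -
  obtain m where m: "\<And>w. w \<in> lists A \<Longrightarrow> nonopt w \<Longrightarrow>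
      \<exists>u\<in>lists A. mset u \<subseteq># mset w \<and> nonopt u \<and> length u \<le> m"
    using bounded_nonopt by blast
  obtain D where D: "\<And>u. u \<in> lists A \<Longrightarrow> length u \<le> m \<Longrightarrow> nonopt u \<Longrightarrow>
     \<exists>u'\<in>lists A. wlen u' < wlen u \<and> (\<exists>E. pv u = pv u' \<otimes> zeta E \<and> (\<forall>p. \<bar>E p\<bar> \<le> int D))"
    using bounded_improvement[of m] by blast
  have "\<exists>w' E. w' \<in> lists A \<and> wlen w' < wlen w \<and> pv w = pv w' \<otimes> zeta E \<and>
     (\<forall>a b. \<bar>E (a, b)\<bar> \<le> int ((m + D) * count_list w b + (m + D))) \<and> (\<forall>b. count_list w b \<le> count_list w' b + (m + D))"
    if w: "w \<in> lists A" "nonopt w" for w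
  proof -
    obtain u where u: "u \<in> lists A" "mset u \<subseteq># mset w" "nonopt u" "length u \<le> m" using m[OF w] by blast
    obtain u' E where u': "u' \<in> lists A" "wlen u' < wlen u" "pv u = pv u' \<otimes> zeta E" "\<And>p. \<bar>E p\<bar> \<le> int D"
      using D[OF u(1,4,3)] by blast
    obtain v F where v: "v \<in> lists A" "mset w = mset v + mset u" "pv w = pv (v @ u) \<otimes> zeta F"
      "\<And>a b. \<bar>F (a, b)\<bar> \<le> int (length u * count_list w b)"
      using pv_extract[OF w(1) u(2)] by blast
    have "pv w = pv (v @ u') \<otimes> zeta (\<lambda>p. E p + F p)"
      using v u u' by (simp add: zeta_add m_assoc)
    moreover have "wlen w = wlen (v @ u)" using v(2) by (intro wlen_mset) simp
    then have "wlen (v @ u') < wlen w" using u' by simp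
    moreover have "\<bar>E (a, b) + F (a, b)\<bar> \<le> int ((m + D) * count_list w b + (m + D))" for a b
    proof -
      have "\<bar>E (a, b) + F (a, b)\<bar> \<le> \<bar>E (a, b)\<bar> + \<bar>F (a, b)\<bar>" by (rule abs_triangle_ineq)
      also have "\<dots> \<le> int D + int (length u * count_list w b)" using u'(4) v(4) by (intro add_mono) auto
      also have "length u * count_list w b \<le> (m + D) * count_list w b" using u(4) by (intro mult_right_mono) auto
      finally show ?thesis by simp
    qed
    moreover have "count_list w b \<le> count_list (v @ u') b + (m + D)" for b
    proof -
      have "count_list w b = count_list v b + count_list u b"
        using v(2) by (metis count_mset count_union)
      moreover have "count_list u b \<le> length u" by (rule count_le_length)
      moreover have "count_list (v @ u') b = count_list v b + count_list u' b" by simp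
      ultimately show ?thesis using u(4) by linarith
    qed
    ultimately show ?thesis using v(1) u'(1)
      by (intro exI[of _ "v @ u'"] exI[of _ "\<lambda>p. E p + F p"]) auto
  qed
  then show ?thesis by (intro exI[of _ "m + D"]) blast
qed

lemma improve_blocks:
  "\<exists>C. \<forall>ws. set ws \<subseteq> lists A \<longrightarrow> (\<forall>w\<in>set ws. nonopt w) \<longrightarrow>
    (\<exists>w' E. w' \<in> lists A \<and> wlen w' + length ws \<le> wlen (concat ws) \<and> pv (concat ws) = pv w' \<otimes> zeta E \<and>
     (\<forall>a b. \<bar>E (a, b)\<bar> \<le> int (C * count_list (concat ws) b + C * length ws)) \<and>
     (\<forall>b. count_list (concat ws) b \<le> count_list w' b + C * length ws))"
proof -
  obtain C where C: "\<And>w. w \<in> lists A \<Longrightarrow> nonopt w \<Longrightarrow>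
     \<exists>w' E. w' \<in> lists A \<and> wlen w' < wlen w \<and> pv w = pv w' \<otimes> zeta E \<and>
     (\<forall>a b. \<bar>E (a, b)\<bar> \<le> int (C * count_list w b + C)) \<and> (\<forall>b. count_list w b \<le> count_list w' b + C)"
    using improve_block by blast
  have "\<exists>w' E. w' \<in> lists A \<and> wlen w' + length ws \<le> wlen (concat ws) \<and> pv (concat ws) = pv w' \<otimes> zeta E \<and>
     (\<forall>a b. \<bar>E (a, b)\<bar> \<le> int (C * count_list (concat ws) b + C * length ws)) \<and>
     (\<forall>b. count_list (concat ws) b \<le> count_list w' b + C * length ws)"
    if "set ws \<subseteq> lists A" "\<forall>w\<in>set ws. nonopt w" for ws
    using that
  proof (induction ws)
    case Nil
    have "zeta (\<lambda>_. 0) = \<one>" by (rule zeta_zero) simp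
    then show ?case by (intro exI[of _ "[]"] exI[of _ "\<lambda>_. 0"]) auto
  next
    case (Cons w ws)
    then obtain v E where v: "v \<in> lists A" "wlen v + length ws \<le> wlen (concat ws)" "pv (concat ws) = pv v \<otimes> zeta E"
      "\<And>a b. \<bar>E (a, b)\<bar> \<le> int (C * count_list (concat ws) b + C * length ws)"
      "\<And>b. count_list (concat ws) b \<le> count_list v b + C * length ws" by auto
    obtain w' F where w': "w' \<in> lists A" "wlen w' < wlen w" "pv w = pv w' \<otimes> zeta F"
      "\<And>a b. \<bar>F (a, b)\<bar> \<le> int (C * count_list w b + C)" "\<And>b. count_list w b \<le> count_list w' b + C"
      using C[of w] Cons.prems by auto
    have l: "concat ws \<in> lists A" "w \<in> lists A" using Cons.prems by (auto simp: in_lists_conv_set)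
    have "zeta F \<otimes> (pv v \<otimes> zeta E) = pv v \<otimes> (zeta E \<otimes> zeta F)"
      using v(1) Z_commute[of "zeta F" "pv v \<otimes> zeta E"] by (simp add: m_assoc)
    then have "pv (concat (w # ws)) = pv (w' @ v) \<otimes> zeta (\<lambda>p. E p + F p)"
      using l v w' by (simp add: zeta_add m_assoc)
    moreover have "\<bar>E (a, b) + F (a, b)\<bar> \<le> int (C * count_list (concat (w # ws)) b + C * length (w # ws))" for a b
      using v(4)[of a b] w'(4)[of a b] by (simp add: algebra_simps)
    moreover have "count_list (concat (w # ws)) b \<le> count_list (w' @ v) b + C * length (w # ws)" for b
      using v(5)[of b] w'(5)[of b] by simp
    ultimately show ?case using v w' by (intro exI[of _ "w' @ v"] exI[of _ "\<lambda>p. E p + F p"]) auto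
  qed
  then show ?thesis by (intro exI[of _ C]) blast
qed

definition runs_twist :: "('c \<times> nat) list \<Rightarrow> ('a \<times> 'c \<times> nat) list" where
  "runs_twist rs = map (\<lambda>r. (\<one>, fst r, snd r)) rs"

lemma runs_twist:
  assumes "fst ` set rs \<subseteq> A"
  shows "runs_twist rs \<in> lists (titems (Bl 0))" "tcnt (runs_twist rs) b = rcnt rs b" "tval (runs_twist rs) = rv rs"
    "length (runs_twist rs) = length rs"
proof -
  have "\<one> \<in> Bl 0" by (auto simp: Bl_def)
  then show "runs_twist rs \<in> lists (titems (Bl 0))"
    using assms by (induction rs) (auto simp: runs_twist_def titems_def)
  show "tcnt (runs_twist rs) b = rcnt rs b" by (induction rs) (auto simp: runs_twist_def)
  show "tval (runs_twist rs) = rv rs" using assms by (induction rs) (auto simp: runs_twist_def)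
  show "length (runs_twist rs) = length rs" by (simp add: runs_twist_def)
qed

lemma wlen_count: "w \<in> lists A \<Longrightarrow> wlen w = (\<Sum>c\<in>A. wt c * count_list w c)"
proof (induction w)
  case (Cons x w)
  have "(\<Sum>c\<in>A. wt c * count_list (x # w) c) = (\<Sum>c\<in>A. (if x = c then wt c else 0) + wt c * count_list w c)"
    by (rule sum.cong) auto
  then show ?case using Cons finite_A by (simp add: sum.distrib)
qed simp

lemma split_error:
  fixes e :: int
  assumes "\<bar>e\<bar> \<le> x + y" "0 \<le> x" "0 \<le> y"
  obtains f g where "e = f + g" "\<bar>f\<bar> \<le> x" "\<bar>g\<bar> \<le> y"
proof -
  have "e = max (- x) (min x e) + (e - max (- x) (min x e))" "\<bar>max (- x) (min x e)\<bar> \<le> x"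
    "\<bar>e - max (- x) (min x e)\<bar> \<le> y" using assms by linarith+
  then show thesis using that by blast
qed

text \<open>Every nonoptimal block saves at least one unit of weight. The accumulated error at \<open>(a, b)\<close> is linear in the
  number of \<open>b\<close> plus the number of blocks: the first part is absorbed by twisting, and only the second part
  remains. The number of runs, of conjugators and their lengths are bounded independently of the word.\<close>

theorem class2_reduction:
  "\<exists>C. \<forall>ws t. set ws \<subseteq> lists A \<longrightarrow> t \<in> lists A \<longrightarrow> (\<forall>w\<in>set ws. nonopt w) \<longrightarrow>
    (\<exists>its E. its \<in> lists (titems (Bl C)) \<and> length its \<le> C \<and>
       (\<Sum>c\<in>A. wt c * tcnt its c) + length ws \<le> wlen (concat ws @ t) \<and>
       pv (concat ws @ t) = tval its \<otimes> zeta E \<and> (\<forall>p. \<bar>E p\<bar> \<le> int (C * length ws)))"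
proof -
  obtain C where C: "\<And>ws. set ws \<subseteq> lists A \<Longrightarrow> \<forall>w\<in>set ws. nonopt w \<Longrightarrow>
    \<exists>w' E. w' \<in> lists A \<and> wlen w' + length ws \<le> wlen (concat ws) \<and> pv (concat ws) = pv w' \<otimes> zeta E \<and>
     (\<forall>a b. \<bar>E (a, b)\<bar> \<le> int (C * count_list (concat ws) b + C * length ws)) \<and>
     (\<forall>b. count_list (concat ws) b \<le> count_list w' b + C * length ws)"
    using improve_blocks by blast
  define M where "M = card A * (card A + 1)"
  define K0 where "K0 = card A * (card A + 2) + length pairs * (C + M)"
  define L where "L = K0 + (C * C + C)"
  have "\<exists>its E. its \<in> lists (titems (Bl L)) \<and> length its \<le> L \<and>
       (\<Sum>c\<in>A. wt c * tcnt its c) + length ws \<le> wlen (concat ws @ t) \<and>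
       pv (concat ws @ t) = tval its \<otimes> zeta E \<and> (\<forall>p. \<bar>E p\<bar> \<le> int (L * length ws))"
    if ws: "set ws \<subseteq> lists A" "t \<in> lists A" "\<forall>w\<in>set ws. nonopt w" for ws t
  proof -
    let ?k = "length ws"
    obtain v E where v: "v \<in> lists A" "wlen v + ?k \<le> wlen (concat ws)" "pv (concat ws) = pv v \<otimes> zeta E"
      "\<And>a b. \<bar>E (a, b)\<bar> \<le> int (C * count_list (concat ws) b + C * ?k)"
      "\<And>b. count_list (concat ws) b \<le> count_list v b + C * ?k" using C[OF ws(1,3)] by blast
    have cw: "concat ws \<in> lists A" using ws(1) by (auto simp: in_lists_conv_set)
    let ?u = "v @ t"
    have u: "?u \<in> lists A" using v(1) ws(2) by simp
    obtain rs F where rs: "fst ` set rs \<subseteq> A" "\<And>b. rcnt rs b = count_list ?u b" "length rs \<le> card A * (card A + 2)"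
      "pv ?u = rv rs \<otimes> zeta F" "\<And>a b. \<bar>F (a, b)\<bar> \<le> int (M * count_list ?u b)"
      using collapse[OF u] unfolding M_def by blast
    have "zeta E \<otimes> pv t = pv t \<otimes> zeta E" using ws(2) by (intro Z_commute) auto
    then have "pv (concat ws @ t) = pv ?u \<otimes> zeta E"
      using v cw ws(2) by (simp add: m_assoc)
    also have "\<dots> = rv rs \<otimes> zeta (\<lambda>p. F p + E p)" using rs by (simp add: zeta_add m_assoc)
    finally have p1: "pv (concat ws @ t) = rv rs \<otimes> zeta (\<lambda>p. F p + E p)" .
    have bound: "\<bar>F (a, b) + E (a, b)\<bar> \<le> int ((C + M) * count_list ?u b) + int ((C * C + C) * ?k)" for a b
    proof -
      have "C * count_list (concat ws) b \<le> C * count_list ?u b + C * C * ?k"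
      proof -
        have "count_list (concat ws) b \<le> count_list ?u b + C * ?k" using v(5)[of b] by simp
        then have "C * count_list (concat ws) b \<le> C * (count_list ?u b + C * ?k)" by (intro mult_left_mono) auto
        then show ?thesis by (simp add: algebra_simps)
      qed
      then have "int (C * count_list (concat ws) b + C * ?k) \<le> int (C * count_list ?u b + C * C * ?k + C * ?k)"
        by (intro zle_int[THEN iffD2] add_right_mono)
      then have "\<bar>F (a, b) + E (a, b)\<bar> \<le> int (M * count_list ?u b) + int (C * count_list ?u b + C * C * ?k + C * ?k)"
        using v(4)[of a b] rs(5)[of a b] by linarith
      then show ?thesis by (simp add: algebra_simps)
    qed
    have "\<forall>p. \<exists>f g. F p + E p = f + g \<and> \<bar>f\<bar> \<le> int ((C + M) * count_list ?u (snd p)) \<and> \<bar>g\<bar> \<le> int ((C * C + C) * ?k)"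
    proof
      fix p
      show "\<exists>f g. F p + E p = f + g \<and> \<bar>f\<bar> \<le> int ((C + M) * count_list ?u (snd p)) \<and> \<bar>g\<bar> \<le> int ((C * C + C) * ?k)"
        using split_error[OF bound[of "fst p" "snd p"]] by (metis of_nat_0_le_iff prod.collapse)
    qed
    then obtain f g where fg: "\<And>p. F p + E p = f p + g p"
      "\<And>p. \<bar>f p\<bar> \<le> int ((C + M) * count_list ?u (snd p))" "\<And>p. \<bar>g p\<bar> \<le> int ((C * C + C) * ?k)"
      by metis
    obtain its where its: "its \<in> lists (titems (Bl (0 + length pairs * (C + M))))"
      "\<And>c. tcnt its c = tcnt (runs_twist rs) c" "length its \<le> length (runs_twist rs) + length pairs * (C + M)"
      "tval its = tval (runs_twist rs) \<otimes> zeta_on pairs f"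
      using twist_all[of pairs "runs_twist rs" 0 f "C + M"] runs_twist[OF rs(1)] pairs(2) fg(2) rs(2) by auto
    have K: "Bl (0 + length pairs * (C + M)) \<subseteq> Bl L" by (rule Bl_mono) (simp add: L_def K0_def)
    have "its \<in> lists (titems (Bl L))"
      using its(1) by (rule subsetD[OF lists_mono, rotated]) (use K in \<open>auto simp: titems_def\<close>)
    moreover have "length its \<le> L" using its(3) runs_twist(4)[OF rs(1)] rs(3) by (simp add: L_def K0_def)
    moreover have "(\<Sum>c\<in>A. wt c * tcnt its c) + ?k \<le> wlen (concat ws @ t)"
    proof -
      have "(\<Sum>c\<in>A. wt c * tcnt its c) = wlen ?u"
        unfolding wlen_count[OF u] by (rule sum.cong) (simp_all add: its(2) runs_twist(2)[OF rs(1)] rs(2))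
      then show ?thesis using v(2) by simp
    qed
    moreover have "pv (concat ws @ t) = tval its \<otimes> zeta g"
    proof -
      have "zeta (\<lambda>p. F p + E p) = zeta f \<otimes> zeta g" using fg(1) zeta_add[of f g] by simp
      then show ?thesis using p1 its(4) runs_twist(3)[OF rs(1)] rs(1) by (simp add: zeta_def[symmetric] m_assoc)
    qed
    moreover have "\<bar>g p\<bar> \<le> int (L * ?k)" for p
    proof -
      have "(C * C + C) * ?k \<le> L * ?k" by (intro mult_right_mono) (auto simp: L_def)
      then show ?thesis using fg(3)[of p] by linarith
    qed
    ultimately show ?thesis by blast
  qed
  then show ?thesis by (intro exI[of _ L]) blast
qed

end

section \<open>The lower central series\<close>

context group
begin

lemma hall_witt:
  assumes "a \<in> carrier G" "b \<in> carrier G" "c \<in> carrier G"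
  shows "commutator G (commutator G a b) (b \<otimes> c \<otimes> inv b) \<otimes>
     commutator G (commutator G b c) (c \<otimes> a \<otimes> inv c) \<otimes>
     commutator G (commutator G c a) (a \<otimes> b \<otimes> inv a) = \<one>"
  using assms by (simp add: commutator_def m_assoc inv_mult_group)

lemma commutator_mult_left:
  assumes "x \<in> carrier G" "y \<in> carrier G" "z \<in> carrier G"
  shows "commutator G (x \<otimes> y) z = commutator G x (commutator G y z) \<otimes> commutator G y z \<otimes> commutator G x z"
  using assms by (simp add: commutator_def m_assoc inv_mult_group)

lemma commutator_mult_right:
  assumes "x \<in> carrier G" "y \<in> carrier G" "z \<in> carrier G"
  shows "commutator G x (y \<otimes> z) = commutator G x y \<otimes> commutator G y (commutator G x z) \<otimes> commutator G x z"
  using assms by (simp add: commutator_def m_assoc inv_mult_group)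

lemma commutator_conj:
  assumes "x \<in> carrier G" "y \<in> carrier G" "g \<in> carrier G"
  shows "g \<otimes> commutator G x y \<otimes> inv g = commutator G (g \<otimes> x \<otimes> inv g) (g \<otimes> y \<otimes> inv g)"
  using assms by (simp add: commutator_def m_assoc inv_mult_group)

end

context finite_index_pair
begin

abbreviation \<Gamma> :: "nat \<Rightarrow> 'a set" where "\<Gamma> i \<equiv> lower_central G H i"

definition comms :: "nat \<Rightarrow> 'a set" where
  "comms k = {commutator G x y | x y. x \<in> \<Gamma> k \<and> y \<in> H}"

lemma Gamma_Suc: "\<Gamma> (Suc k) = generate G (comms k)"
proof -
  have "(\<Union>x\<in>\<Gamma> k. \<Union>y\<in>H. {x \<otimes> y \<otimes> inv x \<otimes> inv y}) = comms k"
    by (auto simp: comms_def commutator_def)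
  then show ?thesis by simp
qed

declare lower_central.simps(2) [simp del]

lemma Gamma_normal: "\<Gamma> k \<lhd> G" and Gamma_H: "\<Gamma> k \<subseteq> H"
proof (induction k)
  case 0
  { case 1 show ?case by (simp add: normal_H) }
  { case 2 show ?case by simp }
next
  case (Suc k)
  interpret N: normal "\<Gamma> k" G by (rule Suc.IH(1))
  have sub: "comms k \<subseteq> \<Gamma> k"
  proof
    fix z assume "z \<in> comms k"
    then obtain x y where xy: "x \<in> \<Gamma> k" "y \<in> H" "z = commutator G x y" by (auto simp: comms_def)
    have c: "x \<in> carrier G" "y \<in> carrier G" using xy N.subset by auto
    have "x \<otimes> (y \<otimes> inv x \<otimes> inv y) \<in> \<Gamma> k"
      by (intro N.m_closed N.inv_op_closed2 N.m_inv_closed xy c)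
    then show "z \<in> \<Gamma> k" using xy c by (simp add: commutator_def m_assoc)
  qed
  have "generate G (comms k) \<lhd> G"
  proof (rule normal_generateI)
    show "comms k \<subseteq> carrier G" using sub N.subset by blast
  next
    fix h g assume h: "h \<in> comms k" and g: "g \<in> carrier G"
    obtain x y where xy: "x \<in> \<Gamma> k" "y \<in> H" "h = commutator G x y" using h by (auto simp: comms_def)
    have c: "x \<in> carrier G" "y \<in> carrier G" using xy N.subset by auto
    show "g \<otimes> h \<otimes> inv g \<in> comms k"
      unfolding comms_def using xy commutator_conj[OF c g] N.inv_op_closed2[OF g xy(1)] H.inv_op_closed2[OF g xy(2)] by blast
  qed
  { case 1 show ?case unfolding Gamma_Suc by fact }
  { case 2
    have "generate G (comms k) \<subseteq> \<Gamma> k" using sub N.subgroup_axioms by (rule generate_subgroup_incl)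
    then show ?case unfolding Gamma_Suc using Suc.IH(2) by blast }
qed

lemma Gamma_subgroup: "subgroup (\<Gamma> k) G" by (rule normal_imp_subgroup[OF Gamma_normal])
lemma Gamma_carrier [simp]: "x \<in> \<Gamma> k \<Longrightarrow> x \<in> carrier G" using Gamma_H[of k] by auto
lemma Gamma_mult [simp]: "x \<in> \<Gamma> k \<Longrightarrow> y \<in> \<Gamma> k \<Longrightarrow> x \<otimes> y \<in> \<Gamma> k" using Gamma_subgroup[of k] by (rule subgroup.m_closed)
lemma Gamma_inv [simp]: "x \<in> \<Gamma> k \<Longrightarrow> inv x \<in> \<Gamma> k" using Gamma_subgroup[of k] by (rule subgroup.m_inv_closed)
lemma Gamma_one [simp]: "\<one> \<in> \<Gamma> k" using Gamma_subgroup[of k] by (rule subgroup.one_closed)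
lemma Gamma_conj: "x \<in> \<Gamma> k \<Longrightarrow> g \<in> carrier G \<Longrightarrow> g \<otimes> x \<otimes> inv g \<in> \<Gamma> k"
  using Gamma_normal[of k] by (simp add: normal.inv_op_closed2)
lemma Gamma_conj': "x \<in> \<Gamma> k \<Longrightarrow> g \<in> carrier G \<Longrightarrow> inv g \<otimes> x \<otimes> g \<in> \<Gamma> k"
  using Gamma_normal[of k] by (simp add: normal.inv_op_closed1)

lemma commutator_Gamma_H: "x \<in> \<Gamma> k \<Longrightarrow> y \<in> H \<Longrightarrow> commutator G x y \<in> \<Gamma> (Suc k)"
  unfolding Gamma_Suc comms_def by (intro generate.incl) blast

lemma Gamma_Suc_subset: "\<Gamma> (Suc k) \<subseteq> \<Gamma> k"
proof -
  have "comms k \<subseteq> \<Gamma> k"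
  proof
    fix z assume "z \<in> comms k"
    then obtain x y where xy: "x \<in> \<Gamma> k" "y \<in> H" "z = commutator G x y" by (auto simp: comms_def)
    have c: "x \<in> carrier G" "y \<in> carrier G" using xy by auto
    have "x \<otimes> (y \<otimes> inv x \<otimes> inv y) \<in> \<Gamma> k" using xy c by (intro Gamma_mult Gamma_conj) auto
    then show "z \<in> \<Gamma> k" using xy c by (simp add: commutator_def m_assoc)
  qed
  then show ?thesis unfolding Gamma_Suc using Gamma_subgroup by (rule generate_subgroup_incl)
qed

lemma Gamma_antimono: "i \<le> j \<Longrightarrow> \<Gamma> j \<subseteq> \<Gamma> i"
  by (rule lift_Suc_antimono_le[of "\<lambda>i. \<Gamma> i"]) (rule Gamma_Suc_subset)

lemma generate_induct_in [consumes 1, case_names one incl inv mult]: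
  assumes "z \<in> generate G A" "P \<one>" "\<And>h. h \<in> A \<Longrightarrow> P h" "\<And>h. h \<in> A \<Longrightarrow> P (inv h)"
    "\<And>x y. x \<in> generate G A \<Longrightarrow> y \<in> generate G A \<Longrightarrow> P x \<Longrightarrow> P y \<Longrightarrow> P (x \<otimes> y)"
  shows "P z"
  using assms(1) by (induction rule: generate.induct) (use assms in auto)

lemma comms_carrier: "comms k \<subseteq> carrier G"
  by (auto simp: comms_def)

text \<open>The three subgroups lemma, through the Hall-Witt identity.\<close>

lemma commutator_Gamma: "x \<in> \<Gamma> i \<Longrightarrow> z \<in> \<Gamma> j \<Longrightarrow> commutator G x z \<in> \<Gamma> (Suc (i + j))"
proof (induction j arbitrary: i x z)
  case 0
  then show ?case using commutator_Gamma_H by simp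
next
  case (Suc j)
  let ?M = "\<Gamma> (Suc (i + Suc j))"
  have gen: "commutator G x (commutator G y h) \<in> ?M" if x: "x \<in> \<Gamma> i" and y: "y \<in> \<Gamma> j" and h: "h \<in> H" for x y h
  proof -
    have c: "x \<in> carrier G" "y \<in> carrier G" "h \<in> carrier G" using x y h by auto
    define a where "a = inv h \<otimes> x \<otimes> h"
    have a: "a \<in> \<Gamma> i" "a \<in> carrier G" using Gamma_conj'[OF x c(3)] by (auto simp: a_def)
    have xa: "x = h \<otimes> a \<otimes> inv h" using c by (simp add: a_def m_assoc)
    let ?P = "commutator G (commutator G a y) (y \<otimes> h \<otimes> inv y)"
    let ?R = "commutator G (commutator G h a) (a \<otimes> y \<otimes> inv a)"
    have P: "?P \<in> ?M"
      using Suc.IH[OF a(1) y] H.inv_op_closed2[OF c(2) h] commutator_Gamma_H[of "commutator G a y" "Suc (i + j)"] by simp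
    have "commutator G h a \<in> \<Gamma> (Suc i)"
      using commutator_Gamma_H[OF a(1) h] inv_commutator[OF a(2) c(3)] Gamma_inv by metis
    then have R: "?R \<in> ?M" using Suc.IH[of "commutator G h a" "Suc i"] Gamma_conj[OF y a(2)] by simp
    have Q: "?P \<otimes> commutator G (commutator G y h) x \<otimes> ?R = \<one>"
      using hall_witt[OF a(2) c(2,3)] xa by simp
    have pc: "?P \<in> carrier G" "?R \<in> carrier G" "commutator G (commutator G y h) x \<in> carrier G" using P R c by auto
    have "commutator G (commutator G y h) x = inv ?P \<otimes> (?P \<otimes> commutator G (commutator G y h) x \<otimes> ?R) \<otimes> inv ?R"
      using pc by (simp add: m_assoc)
    also have "\<dots> = inv ?P \<otimes> inv ?R" unfolding Q using pc by simp
    finally have "commutator G (commutator G y h) x \<in> ?M" using P R by simp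
    then have "inv (commutator G (commutator G y h) x) \<in> ?M" by simp
    then show ?thesis using c by (simp only: inv_commutator commutator_closed)
  qed
  have "z \<in> generate G (comms j)" using Suc.prems(2) unfolding Gamma_Suc .
  then have "\<forall>x\<in>\<Gamma> i. commutator G x z \<in> ?M"
  proof (induction rule: generate_induct_in)
    case one
    then show ?case by (auto simp: commutator_def)
  next
    case (incl h)
    then show ?case using gen by (auto simp: comms_def)
  next
    case (inv h)
    show ?case
    proof
      fix x assume x: "x \<in> \<Gamma> i"
      have hc: "h \<in> carrier G" "x \<in> carrier G" using inv comms_carrier x by auto
      have "commutator G x h \<in> ?M" using inv gen x by (auto simp: comms_def)
      then have "inv h \<otimes> inv (commutator G x h) \<otimes> h \<in> ?M" using hc by (intro Gamma_conj' Gamma_inv)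
      then show "commutator G x (inv h) \<in> ?M" using hc by (simp add: commutator_def m_assoc inv_mult_group)
    qed
  next
    case (mult y z)
    show ?case
    proof
      fix x assume x: "x \<in> \<Gamma> i"
      have c: "x \<in> carrier G" "y \<in> carrier G" "z \<in> carrier G"
        using x mult generate_in_carrier[OF comms_carrier] by auto
      have "commutator G x (y \<otimes> z) = commutator G x y \<otimes> (y \<otimes> commutator G x z \<otimes> inv y)"
        using c by (simp add: commutator_def m_assoc inv_mult_group)
      then show "commutator G x (y \<otimes> z) \<in> ?M" using x mult c Gamma_conj[of "commutator G x z"] by auto
    qed
  qed
  then show ?case using Suc.prems(1) by blast
qed

text \<open>Left-normed commutators of loop values.\<close>

primrec T :: "nat \<Rightarrow> 'a set" where
  "T 0 = loop_val ` loops"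
| "T (Suc k) = {commutator G t x | t x. t \<in> T k \<and> x \<in> loop_val ` loops}"

declare T.simps [simp del]

lemma T_Suc: "T (Suc k) = {commutator G t x | t x. t \<in> T k \<and> x \<in> T 0}"
  by (simp add: T.simps)

lemma T0_H: "T 0 \<subseteq> H" by (auto simp: T.simps loop_val_H)

lemma T_Gamma: "T k \<subseteq> \<Gamma> k"
proof (induction k)
  case 0
  then show ?case using T0_H by simp
next
  case (Suc k)
  show ?case
  proof
    fix z assume "z \<in> T (Suc k)"
    then obtain t x where "t \<in> T k" "x \<in> T 0" "z = commutator G t x" unfolding T_Suc by blast
    then show "z \<in> \<Gamma> (Suc k)" using T0_H Suc commutator_Gamma_H[of t k x] by blast
  qed
qed

lemma T_carrier: "T k \<subseteq> carrier G" using T_Gamma[of k] by auto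

lemma finite_T: "finite (T k)"
proof (induction k)
  case 0
  then show ?case by (simp add: T.simps finite_loops)
next
  case (Suc k)
  have "T (Suc k) = (\<lambda>(t, x). commutator G t x) ` (T k \<times> T 0)" by (auto simp: T_Suc)
  then show ?case using Suc by (simp add: T.simps finite_loops)
qed

lemma H_induct [consumes 1, case_names one mult]:
  assumes "h \<in> H" "P \<one>" "\<And>t h. t \<in> T 0 \<Longrightarrow> h \<in> H \<Longrightarrow> P h \<Longrightarrow> P (t \<otimes> h)"
  shows "P h"
proof -
  obtain cs where cs: "cs \<in> lists loops" "h = loops_val cs" using H_loops[OF assms(1)] .
  have "P (loops_val cs)" using cs(1)
    by (induction cs) (use assms(2,3) loops_val_H in \<open>auto simp: T.simps\<close>)
  then show ?thesis using cs by simp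
qed

definition TG :: "nat \<Rightarrow> 'a set" where
  "TG k = {u \<otimes> n | u n. u \<in> generate G (T k) \<and> n \<in> \<Gamma> (Suc k)}"

lemma generate_T_carrier: "u \<in> generate G (T k) \<Longrightarrow> u \<in> carrier G"
  using generate_in_carrier[OF T_carrier] .

lemma TG_mult: "x \<in> TG k \<Longrightarrow> y \<in> TG k \<Longrightarrow> x \<otimes> y \<in> TG k"
proof -
  assume "x \<in> TG k" "y \<in> TG k"
  then obtain u n v m where *: "u \<in> generate G (T k)" "n \<in> \<Gamma> (Suc k)" "x = u \<otimes> n"
    "v \<in> generate G (T k)" "m \<in> \<Gamma> (Suc k)" "y = v \<otimes> m" unfolding TG_def by blast
  have c: "u \<in> carrier G" "v \<in> carrier G" "n \<in> carrier G" "m \<in> carrier G"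
    using * generate_T_carrier by auto
  have "x \<otimes> y = (u \<otimes> v) \<otimes> ((inv v \<otimes> n \<otimes> v) \<otimes> m)" using * c by (simp add: m_assoc)
  moreover have "inv v \<otimes> n \<otimes> v \<otimes> m \<in> \<Gamma> (Suc k)" using * c by (intro Gamma_mult Gamma_conj') auto
  ultimately show ?thesis unfolding TG_def using * generate.eng[of u G "T k" v] by blast
qed

lemma TG_Gamma: "\<Gamma> (Suc k) \<subseteq> TG k"
proof
  fix n assume n: "n \<in> \<Gamma> (Suc k)"
  then have "n = \<one> \<otimes> n" by (simp)
  then show "n \<in> TG k" unfolding TG_def using n generate.one by blast
qed

lemma generate_TG: "generate G (T k) \<subseteq> TG k"
proof
  fix u assume u: "u \<in> generate G (T k)"
  then have "u = u \<otimes> \<one>" using generate_T_carrier by simp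
  then show "u \<in> TG k" unfolding TG_def using u Gamma_one by blast
qed

lemma TG_inv: "x \<in> TG k \<Longrightarrow> inv x \<in> TG k"
proof -
  assume "x \<in> TG k"
  then obtain u n where *: "u \<in> generate G (T k)" "n \<in> \<Gamma> (Suc k)" "x = u \<otimes> n" unfolding TG_def by blast
  have c: "u \<in> carrier G" "n \<in> carrier G" using * generate_T_carrier by auto
  have "inv x = inv n \<otimes> inv u" using * c by (simp add: inv_mult_group)
  moreover have "inv n \<in> TG k" using TG_Gamma * Gamma_inv by blast
  moreover have "inv u \<in> TG k" using generate_TG generate_m_inv_closed[OF T_carrier] * by blast
  ultimately show ?thesis using TG_mult by simp
qed

text \<open>The basic commutators \<open>T k\<close> generate \<open>\<Gamma> k\<close> modulo \<open>\<Gamma> (k + 1)\<close>, since commutators are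
  bimultiplicative modulo the next term.\<close>

lemma Gamma_TG: "\<Gamma> k \<subseteq> TG k"
proof (induction k)
  case 0
  show ?case
  proof
    fix h assume "h \<in> \<Gamma> 0"
    then have "h \<in> H" by simp
    then have "h \<in> generate G (T 0)"
    proof (induction rule: H_induct)
      case one
      then show ?case by (rule generate.one)
    next
      case (mult t h)
      then show ?case by (simp add: generate.eng generate.incl)
    qed
    then show "h \<in> TG 0" using generate_TG by blast
  qed
next
  case (Suc k)
  let ?Q = "TG (Suc k)"
  have up: "x \<in> ?Q" if "x \<in> \<Gamma> (Suc (Suc k))" for x using that TG_Gamma by blast
  have base: "commutator G t h \<in> ?Q" if t: "t \<in> T k" and h: "h \<in> H" for t h
    using h
  proof (induction rule: H_induct)
    case one
    have "t \<in> carrier G" using t T_carrier by blast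
    then have "commutator G t \<one> = \<one>" by (simp add: commutator_def)
    then show ?case using up by simp
  next
    case (mult x h)
    have c: "t \<in> carrier G" "x \<in> carrier G" "h \<in> carrier G" "x \<in> H" "t \<in> \<Gamma> k"
      using subsetD[OF T_carrier t] mult(1,2) subsetD[OF T0_H mult(1)] subsetD[OF T_Gamma t] by simp_all
    have "commutator G t x \<in> T (Suc k)" unfolding T_Suc using t mult(1) by blast
    then have 1: "commutator G t x \<in> ?Q" by (intro subsetD[OF generate_TG] generate.incl)
    have "commutator G x (commutator G t h) \<in> \<Gamma> (Suc (0 + Suc k))"
      using c commutator_Gamma_H[OF c(5) mult(2)] by (intro commutator_Gamma) simp_all
    then have "commutator G x (commutator G t h) \<in> ?Q" using up by simp
    then show ?case unfolding commutator_mult_right[OF c(1,2,3)] using 1 mult by (intro TG_mult)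
  qed
  have main: "commutator G y h \<in> ?Q" if y: "y \<in> \<Gamma> k" and h: "h \<in> H" for y h
  proof -
    obtain u n where *: "u \<in> generate G (T k)" "n \<in> \<Gamma> (Suc k)" "y = u \<otimes> n"
      using y Suc unfolding TG_def by blast
    have gen: "commutator G u h \<in> ?Q \<and> u \<in> \<Gamma> k" using *(1)
    proof (induction rule: generate_induct_in)
      case one
      have "commutator G \<one> h = \<one>" using h by (simp add: commutator_def)
      then show ?case using up by simp
    next
      case (incl t)
      then show ?case using base h T_Gamma by blast
    next
      case (inv t)
      have c: "t \<in> carrier G" "h \<in> carrier G" "t \<in> \<Gamma> k" using inv T_carrier h T_Gamma by auto
      let ?c = "commutator G t h"
      have "commutator G (inv t) h = commutator G (inv t) (inv ?c) \<otimes> inv ?c"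
        using c by (simp add: commutator_def m_assoc inv_mult_group)
      moreover have "commutator G (inv t) (inv ?c) \<in> \<Gamma> (Suc (k + Suc k))"
        using c commutator_Gamma_H[OF c(3) h] by (intro commutator_Gamma Gamma_inv)
      then have "commutator G (inv t) (inv ?c) \<in> ?Q" using up Gamma_antimono[of "Suc (Suc k)" "Suc (k + Suc k)"] by auto
      ultimately show ?case using base[OF inv h] TG_mult TG_inv c by simp
    next
      case (mult x y)
      have c: "x \<in> carrier G" "y \<in> carrier G" "h \<in> carrier G"
        using mult h generate_T_carrier by auto
      have "commutator G x (commutator G y h) \<in> \<Gamma> (Suc (k + Suc k))"
        using mult h commutator_Gamma_H by (intro commutator_Gamma) auto
      then have "commutator G x (commutator G y h) \<in> ?Q" using up Gamma_antimono[of "Suc (Suc k)" "Suc (k + Suc k)"] by auto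
      then show ?case unfolding commutator_mult_left[OF c] using mult TG_mult by simp
    qed
    have c: "u \<in> carrier G" "n \<in> carrier G" "h \<in> carrier G" using * h generate_T_carrier by auto
    have nh: "commutator G n h \<in> \<Gamma> (Suc (Suc k))" using * h commutator_Gamma_H by blast
    have "commutator G u (commutator G n h) \<in> \<Gamma> (Suc (k + Suc (Suc k)))"
      using gen nh by (intro commutator_Gamma) auto
    then have "commutator G u (commutator G n h) \<in> ?Q" using up Gamma_antimono[of "Suc (Suc k)" "Suc (k + Suc (Suc k))"] by auto
    then show ?thesis unfolding *(3) commutator_mult_left[OF c] using up[OF nh] gen TG_mult by simp
  qed
  show ?case
  proof
    fix z assume "z \<in> \<Gamma> (Suc k)"
    then have "z \<in> generate G (comms k)" unfolding Gamma_Suc .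
    then show "z \<in> ?Q"
    proof (induction rule: generate_induct_in)
      case one
      then show ?case using up by simp
    next
      case (incl h)
      then show ?case using main by (auto simp: comms_def)
    next
      case (inv h)
      then show ?case using main TG_inv by (auto simp: comms_def)
    next
      case (mult x y)
      then show ?case using TG_mult by blast
    qed
  qed
qed

end

text \<open>Elimination of one coordinate: subtracting a multiple of a vector with least positive entry there reduces to the
  sublattice on which the coordinate vanishes, and increases the other entries only linearly.\<close>

lemma undistorted_lattice:
  fixes L :: "('b \<Rightarrow> int) set"
  assumes "finite Y" "\<And>e t. e \<in> L \<Longrightarrow> t \<notin> Y \<Longrightarrow> e t = 0"
    and add: "\<And>e f. e \<in> L \<Longrightarrow> f \<in> L \<Longrightarrow> (\<lambda>t. e t + f t) \<in> L" and minus: "\<And>e. e \<in> L \<Longrightarrow> (\<lambda>t. - e t) \<in> L"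
  shows "\<exists>Bs C. finite Bs \<and> Bs \<subseteq> L \<and> (\<forall>e\<in>L. \<exists>bs. set bs \<subseteq> Bs \<and> (\<forall>t. e t = (\<Sum>b\<leftarrow>bs. b t)) \<and>
    int (length bs) \<le> int C * (\<Sum>t\<in>Y. \<bar>e t\<bar>))"
  using assms
proof (induction Y arbitrary: L rule: finite_induct)
  case empty
  have "\<forall>e\<in>L. \<exists>bs. set bs \<subseteq> {} \<and> (\<forall>t. e t = (\<Sum>b\<leftarrow>bs. b t)) \<and> int (length bs) \<le> int 0 * (\<Sum>t\<in>{}. \<bar>e t\<bar>)"
    using empty by (intro ballI exI[of _ "[]"]) auto
  then show ?case by (intro exI[of _ "{}"] exI[of _ 0]) auto
next
  case (insert y Y)
  note add = insert.prems(2) and minus = insert.prems(3)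
  define L0 where "L0 = {e \<in> L. e y = 0}"
  have supp: "e t = 0" if "e \<in> L0" "t \<notin> Y" for e t
    using insert.prems(1)[of e t] that unfolding L0_def by (cases "t = y") auto
  have add0: "(\<lambda>t. e t + f t) \<in> L0" if "e \<in> L0" "f \<in> L0" for e f
    using add[of e f] that unfolding L0_def by simp
  have minus0: "(\<lambda>t. - e t) \<in> L0" if "e \<in> L0" for e
    using minus[of e] that unfolding L0_def by simp
  have "\<exists>Bs C. finite Bs \<and> Bs \<subseteq> L0 \<and> (\<forall>e\<in>L0. \<exists>bs. set bs \<subseteq> Bs \<and> (\<forall>t. e t = (\<Sum>b\<leftarrow>bs. b t)) \<and>
    int (length bs) \<le> int C * (\<Sum>t\<in>Y. \<bar>e t\<bar>))"
    by (rule insert.IH[of L0]) (erule (1) supp, erule (1) add0, erule minus0)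
  then obtain Bs C where BC0: "finite Bs" "Bs \<subseteq> L0" "\<forall>e\<in>L0. \<exists>bs. set bs \<subseteq> Bs \<and> (\<forall>t. e t = (\<Sum>b\<leftarrow>bs. b t)) \<and>
    int (length bs) \<le> int C * (\<Sum>t\<in>Y. \<bar>e t\<bar>)" by (elim exE conjE)
  note BC = BC0(1,2) BC0(3)[THEN bspec]
  show ?case
  proof (cases "L = L0")
    case True
    have "\<exists>bs. set bs \<subseteq> Bs \<and> (\<forall>t. e t = (\<Sum>b\<leftarrow>bs. b t)) \<and>
        int (length bs) \<le> int C * (\<Sum>t\<in>insert y Y. \<bar>e t\<bar>)" if e: "e \<in> L" for e
    proof -
      have e0: "e \<in> L0" using e True by blast
      then have "(\<Sum>t\<in>insert y Y. \<bar>e t\<bar>) = (\<Sum>t\<in>Y. \<bar>e t\<bar>)"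
        using insert.hyps by (simp add: L0_def)
      then show ?thesis using BC(3)[OF e0] by metis
    qed
    then show ?thesis using BC(1,2) unfolding True[symmetric] by blast
  next
    case False
    then obtain u0 where u0: "u0 \<in> L" "u0 y \<noteq> 0" unfolding L0_def by blast
    have "\<exists>d>0. \<exists>u\<in>L. u y = int d"
    proof (cases "u0 y > 0")
      case True
      then show ?thesis using u0 by (intro exI[of _ "nat (u0 y)"]) auto
    next
      case False
      then show ?thesis using u0 minus[OF u0(1)]
        by (intro exI[of _ "nat (- u0 y)"] conjI bexI[of _ "\<lambda>t. - u0 t"]) auto
    qed
    then have ex: "\<exists>d. d > 0 \<and> (\<exists>u\<in>L. u y = int d)" by blast
    define d where "d = (LEAST d. d > 0 \<and> (\<exists>u\<in>L. u y = int d))"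
    have d0: "d > 0 \<and> (\<exists>u\<in>L. u y = int d)" unfolding d_def by (rule LeastI_ex[OF ex])
    have least: "d \<le> d'" if "d' > 0" "\<exists>u\<in>L. u y = int d'" for d'
      unfolding d_def using that by (intro Least_le conjI)
    have d: "d > 0" "\<exists>u\<in>L. u y = int d" using d0 by auto
    from d(2) obtain u where u: "u \<in> L" "u y = int d" by blast
    have nscale: "(\<lambda>t. e t + int n * f t) \<in> L" if "e \<in> L" "f \<in> L" for e f n
    proof (induction n)
      case (Suc n)
      have "(\<lambda>t. (e t + int n * f t) + f t) \<in> L" by (rule add[OF Suc that(2)])
      then show ?case by (simp add: algebra_simps)
    qed (use that in simp)
    have scale: "(\<lambda>t. e t - a * u t) \<in> L" if "e \<in> L" for e and a :: int
    proof (cases "a \<ge> 0")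
      case True
      then show ?thesis using nscale[OF that minus[OF u(1)], of "nat a"] by simp
    next
      case False
      then show ?thesis using nscale[OF that u(1), of "nat (- a)"] by simp
    qed
    have dvd: "e y mod int d = 0" if "e \<in> L" for e
    proof (rule ccontr)
      assume nz: "e y mod int d \<noteq> 0"
      have m: "e y - (e y div int d) * int d = e y mod int d" by (simp add: minus_div_mult_eq_mod)
      have pos: "0 < e y mod int d" "e y mod int d < int d"
        using nz d(1) pos_mod_sign[of "int d" "e y"] pos_mod_bound[of "int d" "e y"] by linarith+
      have "(\<lambda>t. e t - (e y div int d) * u t) y = int (nat (e y mod int d))" using u(2) m pos by simp
      then have "\<exists>v\<in>L. v y = int (nat (e y mod int d))"
        using scale[OF that, of "e y div int d"] by (rule bexI)
      then have "d \<le> nat (e y mod int d)" using pos by (intro least) auto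
      then show False using pos by linarith
    qed
    define U where "U = (\<Sum>t\<in>Y. \<bar>u t\<bar>)"
    have U0: "0 \<le> U" by (simp add: U_def sum_nonneg)
    define C' where "C' = C * (1 + nat U) + 1"
    let ?Bs = "insert u (insert (\<lambda>t. - u t) Bs)"
    have "\<exists>bs. set bs \<subseteq> ?Bs \<and> (\<forall>t. e t = (\<Sum>b\<leftarrow>bs. b t)) \<and> int (length bs) \<le> int C' * (\<Sum>t\<in>insert y Y. \<bar>e t\<bar>)"
      if e: "e \<in> L" for e
    proof -
      define a where "a = e y div int d"
      have ad: "e y = a * int d" using dvd[OF e] by (auto simp: a_def)
      have "\<bar>a\<bar> * 1 \<le> \<bar>a\<bar> * int d" using d(1) by (intro mult_left_mono) auto
      then have ale: "\<bar>a\<bar> \<le> \<bar>e y\<bar>" by (simp add: ad abs_mult)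
      define f where "f t = e t - a * u t" for t
      have "f = (\<lambda>t. e t - a * u t)" by (rule ext) (simp add: f_def)
      then have f: "f \<in> L0" using scale[OF e, of a] ad u(2) by (simp add: L0_def)
      then obtain bs where bs: "set bs \<subseteq> Bs" "\<And>t. f t = (\<Sum>b\<leftarrow>bs. b t)" "int (length bs) \<le> int C * (\<Sum>t\<in>Y. \<bar>f t\<bar>)"
        using BC(3) by blast
      define cs where "cs = replicate (nat \<bar>a\<bar>) (if a \<ge> 0 then u else (\<lambda>t. - u t))"
      have "(\<Sum>b\<leftarrow>cs. b t) = a * u t" for t
        by (auto simp: cs_def sum_list_replicate map_replicate)
      then have 1: "e t = (\<Sum>b\<leftarrow>bs @ cs. b t)" for t using bs(2)[of t] by (simp add: f_def)
      have 2: "set (bs @ cs) \<subseteq> ?Bs" using bs(1) by (auto simp: cs_def)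
      have "(\<Sum>t\<in>Y. \<bar>f t\<bar>) \<le> (\<Sum>t\<in>Y. \<bar>e t\<bar> + \<bar>a\<bar> * \<bar>u t\<bar>)"
        by (rule sum_mono) (use abs_triangle_ineq4 in \<open>auto simp: f_def abs_mult[symmetric]\<close>)
      also have "\<dots> = (\<Sum>t\<in>Y. \<bar>e t\<bar>) + \<bar>a\<bar> * U" by (simp add: sum.distrib sum_distrib_left U_def)
      finally have fs: "(\<Sum>t\<in>Y. \<bar>f t\<bar>) \<le> (\<Sum>t\<in>Y. \<bar>e t\<bar>) + \<bar>a\<bar> * U" .
      let ?s = "\<Sum>t\<in>Y. \<bar>e t\<bar>" and ?r = "\<bar>e y\<bar>"
      have s0: "0 \<le> ?s" by (simp add: sum_nonneg)
      have "\<bar>a\<bar> * U \<le> ?r * U" using ale U0 by (intro mult_right_mono)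
      then have "int C * (\<Sum>t\<in>Y. \<bar>f t\<bar>) \<le> int C * (?s + ?r * U)" using fs by (intro mult_left_mono) auto
      also have "\<dots> \<le> int C * ((1 + U) * (?r + ?s))"
        using U0 s0 by (intro mult_left_mono) (auto simp: algebra_simps)
      finally have cbound: "int C * (\<Sum>t\<in>Y. \<bar>f t\<bar>) \<le> int C * ((1 + U) * (?r + ?s))" .
      have "int (length (bs @ cs)) = int (length bs) + \<bar>a\<bar>" by (simp add: cs_def)
      then have "int (length (bs @ cs)) \<le> int C * ((1 + U) * (?r + ?s)) + (?r + ?s)"
        using bs(3) ale s0 cbound by linarith
      also have "\<dots> = int C' * (\<Sum>t\<in>insert y Y. \<bar>e t\<bar>)"
        using insert.hyps U0 by (simp add: C'_def algebra_simps)
      finally show ?thesis using 1 2 by blast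
    qed
    moreover have "finite ?Bs" "?Bs \<subseteq> L" using BC u minus[OF u(1)] by (auto simp: L0_def)
    ultimately show ?thesis by blast
  qed
qed

section \<open>Sizes of elements along the lower central series\<close>

text \<open>A letter \<open>(i, t, \<epsilon>)\<close> stands for \<open>t\<^sup>\<epsilon>\<close> with \<open>t\<close> a commutator of level \<open>i\<close>, that is in \<open>T i\<close>.\<close>

type_synonym 'g letter = "nat \<times> 'g \<times> int"

abbreviation lev :: "'g letter \<Rightarrow> nat" where "lev l \<equiv> fst l"
abbreviation base :: "'g letter \<Rightarrow> 'g" where "base l \<equiv> fst (snd l)"
abbreviation sgnl :: "'g letter \<Rightarrow> int" where "sgnl l \<equiv> snd (snd l)"

definition es :: "nat \<Rightarrow> 'g letter list \<Rightarrow> 'g \<Rightarrow> int" where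
  "es i L t = (\<Sum>l\<leftarrow>L. if lev l = i \<and> base l = t then sgnl l else 0)"

lemma es_simps [simp]: "es i [] t = 0"
  "es i (l # L) t = (if lev l = i \<and> base l = t then sgnl l else 0) + es i L t"
  "es i (L @ M) t = es i L t + es i M t"
  by (simp_all add: es_def)

lemma es_zero: "(\<And>l. l \<in> set L \<Longrightarrow> lev l \<noteq> i) \<Longrightarrow> es i L t = 0"
  by (induction L) auto

text \<open>Letters of level \<open>i\<close> weigh \<open>m\<^sup>-\<^sup>(\<^sup>i\<^sup>+\<^sup>1\<^sup>)\<close>, the inverse of the number of them that a ball of radius \<open>m\<close> can produce.
  An element of length \<open>m\<close> thus has bounded cost, and bounded cost is the invariant of the collection process.\<close>

definition cost :: "real \<Rightarrow> 'g letter list \<Rightarrow> real" where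
  "cost m L = (\<Sum>l\<leftarrow>L. (1 / m) ^ Suc (lev l))"

lemma cost_simps [simp]: "cost m [] = 0" "cost m (l # L) = (1 / m) ^ Suc (lev l) + cost m L"
  "cost m (L @ M) = cost m L + cost m M"
  by (simp_all add: cost_def)

lemma cost_nonneg: "m \<ge> 1 \<Longrightarrow> 0 \<le> cost m L"
  by (induction L) auto

locale nilpotent_pair = finite_index_pair +
  fixes c :: nat
  assumes nilp: "lower_central G H c = {\<one>}"
begin

definition Lt :: "nat \<Rightarrow> 'a letter set" where
  "Lt i = {l. i \<le> lev l \<and> lev l < c \<and> base l \<in> T (lev l) \<and> (sgnl l = 1 \<or> sgnl l = -1)}"

definition Ly :: "nat \<Rightarrow> 'a set \<Rightarrow> 'a letter set" where
  "Ly i Y = {l \<in> Lt i. lev l = i \<longrightarrow> base l \<in> Y}"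

definition lval :: "'a letter \<Rightarrow> 'a" where "lval l = base l [^] sgnl l"

definition wval :: "'a letter list \<Rightarrow> 'a" where "wval L = word_eval G (map lval L)"

lemma finite_Lt: "finite (Lt i)"
proof (rule finite_subset)
  show "Lt i \<subseteq> Sigma {..<c} (\<lambda>k. T k \<times> {1, -1})" by (auto simp: Lt_def)
qed (use finite_T in auto)

lemma lval_Gamma: "l \<in> Lt i \<Longrightarrow> lval l \<in> \<Gamma> (lev l)"
proof -
  assume "l \<in> Lt i"
  then have "base l \<in> \<Gamma> (lev l)" and s: "sgnl l = 1 \<or> sgnl l = -1" using T_Gamma by (auto simp: Lt_def)
  then have "base l [^] (1::int) \<in> \<Gamma> (lev l)" "base l [^] (-1::int) \<in> \<Gamma> (lev l)"
    by (simp_all add: int_pow_neg)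
  then show ?thesis using s unfolding lval_def by metis
qed

lemma Lt_mono: "j \<le> i \<Longrightarrow> Lt i \<subseteq> Lt j" by (auto simp: Lt_def)
lemma Ly_Lt: "Ly i Y \<subseteq> Lt i" by (auto simp: Ly_def)
lemma Lt_Suc_Ly: "Lt (Suc i) \<subseteq> Ly i Y" by (auto simp: Ly_def Lt_def)
lemma Ly_empty: "Ly i {} = Lt (Suc i)" by (auto simp: Ly_def Lt_def)
lemma Ly_T: "Ly i (T i) = Lt i" by (auto simp: Ly_def Lt_def)

lemma lval_closed: "l \<in> Lt i \<Longrightarrow> lval l \<in> carrier G" using lval_Gamma[of l i] Gamma_carrier by blast

lemma wval_simps [simp]: "wval [] = \<one>" "wval (l # L) = lval l \<otimes> wval L" by (simp_all add: wval_def)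

lemma wval_Gamma: "L \<in> lists (Lt i) \<Longrightarrow> wval L \<in> \<Gamma> i"
proof (induction L)
  case (Cons l L)
  then have "i \<le> lev l" by (auto simp: Lt_def)
  then have "lval l \<in> \<Gamma> i" using lval_Gamma[of l i] Cons Gamma_antimono by auto
  then show ?case using Cons by simp
qed simp

lemma wval_closed: "L \<in> lists (Lt i) \<Longrightarrow> wval L \<in> carrier G" using wval_Gamma[of L i] Gamma_carrier by blast

lemma wval_append: "L \<in> lists (Lt i) \<Longrightarrow> M \<in> lists (Lt i) \<Longrightarrow> wval (L @ M) = wval L \<otimes> wval M"
  by (induction L) (auto simp: m_assoc lval_closed wval_closed)

definition linv :: "'a letter \<Rightarrow> 'a letter" where "linv l = (lev l, base l, - sgnl l)"

lemma linv: "l \<in> Lt i \<Longrightarrow> linv l \<in> Lt i" "l \<in> Lt i \<Longrightarrow> lval (linv l) = inv (lval l)"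
proof -
  assume l: "l \<in> Lt i"
  then show "linv l \<in> Lt i" by (auto simp: linv_def Lt_def)
  have "base l \<in> carrier G" using l T_carrier by (auto simp: Lt_def)
  then show "lval (linv l) = inv (lval l)" by (simp add: lval_def linv_def int_pow_neg)
qed

lemma wval_inverse: "L \<in> lists (Lt i) \<Longrightarrow>
  rev (map linv L) \<in> lists (Lt i) \<and> wval (rev (map linv L)) = inv (wval L) \<and> cost m (rev (map linv L)) = cost m L"
proof (induction L)
  case (Cons l L)
  have "wval (rev (map linv L) @ [linv l]) = inv (wval L) \<otimes> inv (lval l)"
    using Cons linv[of l i] by (subst wval_append[of _ i]) (auto simp: lval_closed)
  moreover have "cost m [linv l] = cost m [l]" by (simp add: linv_def)
  ultimately show ?case using Cons linv[of l i] by (auto simp: inv_mult_group lval_closed wval_closed)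
qed simp

lemma generate_T_letters:
  assumes "k < c" "u \<in> generate G (T k)"
  shows "\<exists>L\<in>lists (Lt k). wval L = u"
  using assms(2)
proof (induction rule: generate_induct_in)
  case one
  then show ?case by (intro bexI[of _ "[]"]) auto
next
  case (incl t)
  have t: "t \<in> carrier G" using incl T_carrier by blast
  have "(k, t, 1) \<in> Lt k" using incl assms(1) by (simp add: Lt_def)
  then show ?case using t by (intro bexI[of _ "[(k, t, 1)]"]) (simp_all add: lval_def)
next
  case (inv t)
  have t: "t \<in> carrier G" using inv T_carrier by blast
  have "(k, t, -1) \<in> Lt k" using inv assms(1) by (simp add: Lt_def)
  then show ?case using t by (intro bexI[of _ "[(k, t, -1)]"]) (simp_all add: lval_def int_pow_neg)
next
  case (mult x y)
  then obtain L M where "L \<in> lists (Lt k)" "wval L = x" "M \<in> lists (Lt k)" "wval M = y" by blast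
  then show ?case using wval_append[of L k M] by (intro bexI[of _ "L @ M"]) auto
qed

lemma Gamma_letters: "x \<in> \<Gamma> k \<Longrightarrow> \<exists>L\<in>lists (Lt k). wval L = x"
proof (induction "c - k" arbitrary: k x)
  case 0
  then have "x \<in> \<Gamma> c" using Gamma_antimono[of c k] by auto
  then show ?case using nilp by (intro bexI[of _ "[]"]) auto
next
  case (Suc d)
  then have k: "k < c" "d = c - Suc k" by auto
  obtain u n where un: "u \<in> generate G (T k)" "n \<in> \<Gamma> (Suc k)" "x = u \<otimes> n"
    using Gamma_TG[of k] Suc.prems unfolding TG_def by blast
  obtain L where L: "L \<in> lists (Lt k)" "wval L = u" using generate_T_letters[OF k(1) un(1)] by blast
  obtain M where M: "M \<in> lists (Lt (Suc k))" "wval M = n" using Suc.hyps(1)[OF k(2) un(2)] by blast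
  have "M \<in> lists (Lt k)" using M(1) lists_mono[OF Lt_mono[of k "Suc k"]] by auto
  then show ?case using wval_append[OF L(1), of M] L M un by (intro bexI[of _ "L @ M"]) auto
qed

text \<open>The correction of level at least \<open>lev l + lev t + 1\<close> that a letter \<open>l\<close> acquires when it is conjugated by \<open>t\<close>.\<close>

definition cword :: "'a letter \<Rightarrow> 'a letter \<Rightarrow> 'a letter list" where
  "cword l t = (SOME L. L \<in> lists (Lt (Suc (lev l + lev t))) \<and> lval l \<otimes> wval L = inv (lval t) \<otimes> lval l \<otimes> lval t)"

lemma cword:
  assumes "l \<in> Lt 0" "t \<in> Lt 0"
  shows "cword l t \<in> lists (Lt (Suc (lev l + lev t)))"
    "lval l \<otimes> wval (cword l t) = inv (lval t) \<otimes> lval l \<otimes> lval t"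
proof -
  have g: "lval l \<in> \<Gamma> (lev l)" "lval t \<in> \<Gamma> (lev t)" using assms lval_Gamma by auto
  then have cc: "lval l \<in> carrier G" "lval t \<in> carrier G" by auto
  have "commutator G (inv (lval l)) (inv (lval t)) \<in> \<Gamma> (Suc (lev l + lev t))"
    using g by (intro commutator_Gamma) auto
  then obtain L where L: "L \<in> lists (Lt (Suc (lev l + lev t)))" "wval L = commutator G (inv (lval l)) (inv (lval t))"
    using Gamma_letters by blast
  have "lval l \<otimes> wval L = inv (lval t) \<otimes> lval l \<otimes> lval t"
    unfolding L(2) using cc by (simp add: commutator_def m_assoc)
  then have "\<exists>L. L \<in> lists (Lt (Suc (lev l + lev t))) \<and> lval l \<otimes> wval L = inv (lval t) \<otimes> lval l \<otimes> lval t"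
    using L(1) by blast
  from someI_ex[OF this] show "cword l t \<in> lists (Lt (Suc (lev l + lev t)))"
    "lval l \<otimes> wval (cword l t) = inv (lval t) \<otimes> lval l \<otimes> lval t" unfolding cword_def by auto
qed

definition Bc :: nat where "Bc = Max (insert 0 ((\<lambda>(l, t). length (cword l t)) ` (Lt 0 \<times> Lt 0)))"

lemma Bc: "l \<in> Lt 0 \<Longrightarrow> t \<in> Lt 0 \<Longrightarrow> length (cword l t) \<le> Bc"
proof -
  assume "l \<in> Lt 0" "t \<in> Lt 0"
  then have "length (cword l t) \<in> (\<lambda>(l, t). length (cword l t)) ` (Lt 0 \<times> Lt 0)" by force
  then show ?thesis unfolding Bc_def using finite_Lt by (intro Max_ge) auto
qed

lemma cost_le:
  assumes "m \<ge> 1" "L \<in> lists (Lt i)"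
  shows "cost m L \<le> real (length L) * (1 / m) ^ Suc i"
  using assms(2)
proof (induction L)
  case (Cons l L)
  have "(1 / m) ^ Suc (lev l) \<le> (1 / m) ^ Suc i"
    using Cons assms(1) by (intro power_decreasing) (auto simp: Lt_def)
  then show ?case using Cons by (simp add: algebra_simps del: power_Suc)
qed simp

text \<open>Conjugating by a letter of level \<open>i\<close> multiplies the weighted cost by at most
  \<open>1 + Bc / m\<^sup>i\<^sup>+\<^sup>1\<close>; hence conjugating by \<open>K m\<^sup>i\<^sup>+\<^sup>1\<close> such letters costs a constant factor only.\<close>

lemma conj_letters:
  assumes m: "m \<ge> 1" and t: "t \<in> Lt 0" and L: "L \<in> lists (Ly i Y)"
  shows "\<exists>L'\<in>lists (Ly i Y). wval L' = inv (lval t) \<otimes> wval L \<otimes> lval t \<and> es i L' = es i L \<and>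
    cost m L' \<le> cost m L * (1 + real Bc * (1 / m) ^ Suc (lev t))"
  using L
proof (induction L)
  case Nil
  then show ?case using lval_closed[OF t] by (intro bexI[of _ "[]"]) auto
next
  case (Cons l L)
  then obtain L' where L': "L' \<in> lists (Ly i Y)" "wval L' = inv (lval t) \<otimes> wval L \<otimes> lval t" "es i L' = es i L"
    "cost m L' \<le> cost m L * (1 + real Bc * (1 / m) ^ Suc (lev t))" by auto
  have l: "l \<in> Ly i Y" "l \<in> Lt i" "l \<in> Lt 0" "i \<le> lev l" "L \<in> lists (Lt i)"
    using Cons Ly_Lt[of i Y] lists_mono[OF Ly_Lt[of i Y]] by (auto simp: Ly_def Lt_def)
  let ?w = "cword l t"
  note cw = cword[OF l(3) t]
  have w: "?w \<in> lists (Lt (Suc i))"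
    using cw(1) lists_mono[OF Lt_mono[of "Suc i" "Suc (lev l + lev t)"]] l(4) by auto
  then have w': "?w \<in> lists (Ly i Y)" "?w \<in> lists (Lt i)" using lists_mono[OF Lt_Suc_Ly[of i Y]] lists_mono[OF Lt_mono[of i "Suc i"]] by auto
  have "lev x \<noteq> i" if "x \<in> set ?w" for x using w that by (auto simp: in_lists_conv_set Lt_def)
  then have es0: "es i ?w x = 0" for x by (rule es_zero)
  have L'i: "L' \<in> lists (Lt i)" using L'(1) lists_mono[OF Ly_Lt[of i Y]] by auto
  have cc: "lval t \<in> carrier G" "lval l \<in> carrier G" "wval L \<in> carrier G" "wval ?w \<in> carrier G"
    using lval_closed t l wval_closed w by blast+
  have "wval (l # ?w @ L') = (lval l \<otimes> wval ?w) \<otimes> wval L'"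
    using wval_append[OF w'(2) L'i] cc wval_closed[OF L'i] by (simp add: m_assoc)
  also have "\<dots> = inv (lval t) \<otimes> wval (l # L) \<otimes> lval t"
    unfolding cw(2) L'(2) using cc by (simp add: m_assoc)
  finally have 1: "wval (l # ?w @ L') = inv (lval t) \<otimes> wval (l # L) \<otimes> lval t" .
  have "cost m ?w \<le> real (length ?w) * (1 / m) ^ Suc (Suc (lev l + lev t))"
    using cost_le[OF m cw(1)] .
  also have "\<dots> \<le> real Bc * (1 / m) ^ Suc (Suc (lev l + lev t))"
    using Bc[OF l(3) t] m by (intro mult_right_mono) auto
  also have "\<dots> = (1 / m) ^ Suc (lev l) * (real Bc * (1 / m) ^ Suc (lev t))"
    by (simp add: power_add)
  finally have "cost m (l # ?w @ L') \<le> cost m (l # L) * (1 + real Bc * (1 / m) ^ Suc (lev t))"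
    using L'(4) by (simp add: algebra_simps del: power_Suc)
  moreover have "es i (l # ?w @ L') = es i (l # L)" using L'(3) es0 by auto
  ultimately show ?case using 1 l(1) w'(1) L'(1) by (intro bexI[of _ "l # ?w @ L'"]) auto
qed

definition occ :: "nat \<Rightarrow> 'a \<Rightarrow> 'a letter list \<Rightarrow> nat" where
  "occ i t L = length (filter (\<lambda>l. lev l = i \<and> base l = t) L)"

text \<open>Collecting all letters \<open>t\<^sup>\<plusminus>\<^sup>1\<close> on the left conjugates the rest once for each occurrence; \<open>occ_cost\<close> bounds the number of
  occurrences, so that the last factor stays bounded.\<close>

lemma collect_one:
  assumes m: "m \<ge> 1" and t: "t \<in> T i" "t \<notin> Y" and L: "L \<in> lists (Ly i (insert t Y))"
  shows "\<exists>L'\<in>lists (Ly i Y). wval L = t [^] es i L t \<otimes> wval L' \<and> (\<forall>x\<in>Y. es i L' x = es i L x) \<and>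
    cost m L' \<le> cost m L * (1 + real Bc * (1 / m) ^ Suc i) ^ occ i t L"
  using L
proof (induction L rule: rev_induct)
  case Nil
  then show ?case using t T_carrier by (intro bexI[of _ "[]"]) auto
next
  case (snoc l L)
  let ?q = "1 + real Bc * (1 / m) ^ Suc i"
  have q: "1 \<le> ?q" using m by simp
  obtain L' where L': "L' \<in> lists (Ly i Y)" "wval L = t [^] es i L t \<otimes> wval L'" "\<And>x. x \<in> Y \<Longrightarrow> es i L' x = es i L x"
    "cost m L' \<le> cost m L * ?q ^ occ i t L" using snoc by auto
  have l: "l \<in> Ly i (insert t Y)" "l \<in> Lt i" "l \<in> Lt 0" and Li: "L \<in> lists (Lt i)" "[l] \<in> lists (Lt i)"
    using snoc.prems Ly_Lt[of i "insert t Y"] lists_mono[OF Ly_Lt[of i "insert t Y"]] by (auto simp: Ly_def Lt_def)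
  have L'i: "L' \<in> lists (Lt i)" using L'(1) lists_mono[OF Ly_Lt[of i Y]] by auto
  have tc: "t \<in> carrier G" using t T_carrier by blast
  have cc: "lval l \<in> carrier G" "wval L' \<in> carrier G" using lval_closed l(3) wval_closed[OF L'i] by auto
  have wv: "wval (L @ [l]) = t [^] es i L t \<otimes> (wval L' \<otimes> lval l)"
    using wval_append[OF Li] L'(2) cc tc by (simp add: m_assoc)
  show ?case
  proof (cases "lev l = i \<and> base l = t")
    case True
    obtain M where M: "M \<in> lists (Ly i Y)" "wval M = inv (lval l) \<otimes> wval L' \<otimes> lval l" "es i M = es i L'"
      "cost m M \<le> cost m L' * (1 + real Bc * (1 / m) ^ Suc (lev l))"
      using conj_letters[OF m l(3) L'(1)] by blast
    have Mc: "wval M \<in> carrier G" using wval_closed[OF subsetD[OF lists_mono[OF Ly_Lt] M(1)]] .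
    have "es i (L @ [l]) t = es i L t + sgnl l" "lval l = t [^] sgnl l" using True by (auto simp: lval_def)
    then have "t [^] es i (L @ [l]) t \<otimes> wval M = t [^] es i L t \<otimes> (lval l \<otimes> wval M)"
      using tc Mc by (simp add: int_pow_mult m_assoc del: es_simps)
    also have "lval l \<otimes> wval M = wval L' \<otimes> lval l" unfolding M(2) using cc by (simp add: m_assoc)
    finally have 1: "wval (L @ [l]) = t [^] es i (L @ [l]) t \<otimes> wval M" using wv by simp
    have "cost m M \<le> cost m L' * ?q" using M(4) True by simp
    also have "\<dots> \<le> (cost m L * ?q ^ occ i t L) * ?q" using L'(4) q by (intro mult_right_mono) auto
    also have "\<dots> = cost m L * ?q ^ occ i t (L @ [l])" using True by (simp add: occ_def)
    also have "\<dots> \<le> cost m (L @ [l]) * ?q ^ occ i t (L @ [l])"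
      using q m by (intro mult_right_mono) auto
    finally have 2: "cost m M \<le> cost m (L @ [l]) * ?q ^ occ i t (L @ [l])" .
    have "es i M x = es i (L @ [l]) x" if "x \<in> Y" for x
      using M(3) L'(3)[OF that] True t(2) that by auto
    then show ?thesis using 1 2 M(1) by (intro bexI[of _ M] conjI ballI)
  next
    case False
    have "wval (L' @ [l]) = wval L' \<otimes> lval l" using wval_append[OF L'i Li(2)] cc by simp
    then have 1: "wval (L @ [l]) = t [^] es i (L @ [l]) t \<otimes> wval (L' @ [l])" using wv False by auto
    have "cost m (L' @ [l]) \<le> cost m L * ?q ^ occ i t L + (1 / m) ^ Suc (lev l) * 1" using L'(4) by simp
    also have "\<dots> \<le> cost m L * ?q ^ occ i t L + (1 / m) ^ Suc (lev l) * ?q ^ occ i t L"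
      using q m one_le_power[OF q] by (intro add_left_mono mult_left_mono) auto
    also have "\<dots> = cost m (L @ [l]) * ?q ^ occ i t (L @ [l])" using False by (auto simp: occ_def algebra_simps)
    finally have 2: "cost m (L' @ [l]) \<le> cost m (L @ [l]) * ?q ^ occ i t (L @ [l])" .
    have "L' @ [l] \<in> lists (Ly i Y)" using L'(1) l(1) False by (auto simp: Ly_def)
    moreover have "es i (L' @ [l]) x = es i (L @ [l]) x" if "x \<in> Y" for x using L'(3)[OF that] by simp
    ultimately show ?thesis using 1 2 by (intro bexI[of _ "L' @ [l]"] conjI ballI)
  qed
qed

lemma occ_cost: "m \<ge> 1 \<Longrightarrow> real (occ i t L) * (1 / m) ^ Suc i \<le> cost m L"
proof (induction L)
  case Nil
  then show ?case by (simp add: occ_def)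
next
  case (Cons l L)
  have nn: "0 \<le> (1 / m) ^ Suc (lev l)" using Cons.prems by simp
  show ?case
  proof (cases "lev l = i \<and> base l = t")
    case True
    then show ?thesis using Cons by (auto simp: occ_def algebra_simps simp del: power_Suc)
  next
    case False
    then have o: "occ i t (l # L) = occ i t L" by (auto simp: occ_def)
    have "cost m (l # L) = (1 / m) ^ Suc (lev l) + cost m L" by simp
    then show ?thesis unfolding o using Cons.IH[OF Cons.prems] nn by linarith
  qed
qed

lemma es_occ: "L \<in> lists (Lt i) \<Longrightarrow> \<bar>es j L t\<bar> \<le> int (occ j t L)"
proof (induction L)
  case (Cons l L)
  then have "\<bar>sgnl l\<bar> \<le> 1" by (auto simp: Lt_def)
  then show ?case using Cons by (auto simp: occ_def)
qed (simp add: occ_def)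

definition pw :: "'a list \<Rightarrow> ('a \<Rightarrow> int) \<Rightarrow> 'a" where
  "pw ts e = word_eval G (map (\<lambda>t. t [^] e t) ts)"

lemma pw_simps [simp]: "pw [] e = \<one>" "pw (t # ts) e = t [^] e t \<otimes> pw ts e" by (simp_all add: pw_def)

lemma pw_closed: "set ts \<subseteq> carrier G \<Longrightarrow> pw ts e \<in> carrier G" by (induction ts) auto

lemma pw_cong: "(\<And>t. t \<in> set ts \<Longrightarrow> e t = f t) \<Longrightarrow> pw ts e = pw ts f" by (induction ts) auto

lemma collect_all:
  assumes "distinct ts" "set ts \<subseteq> T i"
  shows "\<forall>K. \<exists>K'. \<forall>m\<ge>1. \<forall>L\<in>lists (Ly i (set ts)). cost m L \<le> K \<longrightarrow>
    (\<exists>L'\<in>lists (Lt (Suc i)). wval L = pw ts (es i L) \<otimes> wval L' \<and> cost m L' \<le> K')"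
  using assms
proof (induction ts)
  case Nil
  show ?case
  proof (intro allI exI ballI impI)
    fix K m :: real and L :: "'a letter list"
    assume "1 \<le> m" "L \<in> lists (Ly i (set []))" "cost m L \<le> K"
    then show "\<exists>L'\<in>lists (Lt (Suc i)). wval L = pw [] (es i L) \<otimes> wval L' \<and> cost m L' \<le> K"
      using wval_closed[of L "Suc i"] by (intro bexI[of _ L]) (auto simp: Ly_empty)
  qed
next
  case (Cons t ts)
  show ?case
  proof
    fix K
    let ?K1 = "K * exp (real Bc * K)"
    obtain K' where K': "\<And>m L. m \<ge> 1 \<Longrightarrow> L \<in> lists (Ly i (set ts)) \<Longrightarrow> cost m L \<le> ?K1 \<Longrightarrow>
      \<exists>L'\<in>lists (Lt (Suc i)). wval L = pw ts (es i L) \<otimes> wval L' \<and> cost m L' \<le> K'"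
      using Cons by fastforce
    have "\<exists>L'\<in>lists (Lt (Suc i)). wval L = pw (t # ts) (es i L) \<otimes> wval L' \<and> cost m L' \<le> K'"
      if m: "m \<ge> 1" and L: "L \<in> lists (Ly i (set (t # ts)))" and K: "cost m L \<le> K" for m L
    proof -
      let ?q = "1 + real Bc * (1 / m) ^ Suc i"
      obtain M where M: "M \<in> lists (Ly i (set ts))" "wval L = t [^] es i L t \<otimes> wval M"
        "\<And>x. x \<in> set ts \<Longrightarrow> es i M x = es i L x" "cost m M \<le> cost m L * ?q ^ occ i t L"
        using collect_one[OF m, of t i "set ts" L] Cons.prems L by auto
      have "?q ^ occ i t L \<le> exp (real Bc * (1 / m) ^ Suc i) ^ occ i t L"
        using m by (intro power_mono exp_ge_add_one_self) auto
      also have "\<dots> = exp (real Bc * (real (occ i t L) * (1 / m) ^ Suc i))"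
        by (simp add: exp_of_nat_mult[symmetric] algebra_simps)
      also have "\<dots> \<le> exp (real Bc * K)"
        using occ_cost[OF m, of i t L] K by (simp add: mult_left_mono del: power_Suc)
      finally have "cost m L * ?q ^ occ i t L \<le> ?K1"
        using K cost_nonneg[OF m, of L] m by (intro mult_mono) auto
      then have "cost m M \<le> ?K1" using M(4) by linarith
      then obtain L' where L': "L' \<in> lists (Lt (Suc i))" "wval M = pw ts (es i M) \<otimes> wval L'" "cost m L' \<le> K'"
        using K'[OF m M(1)] by blast
      have tc: "t \<in> carrier G" "set ts \<subseteq> carrier G" using Cons.prems T_carrier[of i] by auto
      have "pw ts (es i M) = pw ts (es i L)" using M(3) by (rule pw_cong)
      then have "wval L = pw (t # ts) (es i L) \<otimes> wval L'"
        using M(2) L'(2) tc pw_closed[OF tc(2)] wval_closed[OF L'(1)] by (simp add: m_assoc)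
      then show ?thesis using L' by blast
    qed
    then show "\<exists>K'. \<forall>m\<ge>1. \<forall>L\<in>lists (Ly i (set (t # ts))). cost m L \<le> K \<longrightarrow>
      (\<exists>L'\<in>lists (Lt (Suc i)). wval L = pw (t # ts) (es i L) \<otimes> wval L' \<and> cost m L' \<le> K')" by blast
  qed
qed

definition ex :: "nat \<Rightarrow> 'a list \<Rightarrow> ('a \<Rightarrow> int) \<Rightarrow> 'a letter list" where
  "ex i ts e = concat (map (\<lambda>t. replicate (nat \<bar>e t\<bar>) (i, t, sgn (e t))) ts)"

lemma ex_props:
  assumes "i < c" "set ts \<subseteq> T i"
  shows "ex i ts e \<in> lists (Lt i)" "wval (ex i ts e) = pw ts e"
    "distinct ts \<Longrightarrow> t \<in> set ts \<Longrightarrow> es i (ex i ts e) t = e t"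
proof -
  have rep: "replicate (nat \<bar>e t\<bar>) (i, t, sgn (e t)) \<in> lists (Lt i)" if "t \<in> T i" for t
    using that assms(1) by (cases "e t = 0") (auto simp: in_lists_conv_set Lt_def sgn_if)
  show 1: "ex i ts e \<in> lists (Lt i)" using assms(2) by (induction ts) (use rep in \<open>auto simp: ex_def\<close>)
  have wrep: "wval (replicate (nat \<bar>e t\<bar>) (i, t, sgn (e t))) = t [^] e t" if "t \<in> T i" for t
  proof -
    have tc: "t \<in> carrier G" using that T_carrier by blast
    have "wval (replicate (nat \<bar>e t\<bar>) (i, t, sgn (e t))) = (t [^] sgn (e t)) [^] int (nat \<bar>e t\<bar>)"
      using tc by (simp add: wval_def lval_def word_eval_replicate int_pow_int)
    also have "\<dots> = t [^] (sgn (e t) * int (nat \<bar>e t\<bar>))" using tc by (simp only: int_pow_pow)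
    also have "sgn (e t) * int (nat \<bar>e t\<bar>) = e t" by (simp add: sgn_mult_abs)
    finally show ?thesis .
  qed
  show "wval (ex i ts e) = pw ts e" using assms(2)
  proof (induction ts)
    case (Cons t ts)
    have "ex i (t # ts) e = replicate (nat \<bar>e t\<bar>) (i, t, sgn (e t)) @ ex i ts e" by (simp add: ex_def)
    moreover have "ex i ts e \<in> lists (Lt i)" if "set ts \<subseteq> T i" for ts
      using that by (induction ts) (use rep in \<open>auto simp: ex_def\<close>)
    ultimately show ?case using Cons wrep[of t] wval_append[OF rep[of t], of "ex i ts e"] by auto
  qed (simp add: ex_def)
  have erep: "es i (replicate k (i, t, z)) x = (if x = t then int k * z else 0)" for k t z x
    by (induction k) (auto simp: algebra_simps)
  show "distinct ts \<Longrightarrow> t \<in> set ts \<Longrightarrow> es i (ex i ts e) t = e t"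
  proof (induction ts)
    case (Cons x ts)
    have out: "t \<notin> set ts \<Longrightarrow> es i (ex i ts e) t = 0" for ts by (induction ts) (auto simp: ex_def erep)
    have "es i (ex i (x # ts) e) t = (if t = x then \<bar>e x\<bar> * sgn (e x) else 0) + es i (ex i ts e) t"
      by (simp add: ex_def erep)
    then show ?case using Cons out[of ts] by (auto simp: abs_mult_sgn)
  qed simp
qed

end

context finite_index_pair
begin

lemma Gamma_coset_mult:
  "x \<in> carrier G \<Longrightarrow> y \<in> carrier G \<Longrightarrow> \<Gamma> k #> (x \<otimes> y) = (\<Gamma> k #> x) \<otimes>\<^bsub>G Mod \<Gamma> k\<^esub> (\<Gamma> k #> y)"
  using normal.rcos_sum[OF Gamma_normal] by (simp add: FactGroup_def)

lemma Gamma_coset_eq_iff: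
  "x \<in> carrier G \<Longrightarrow> y \<in> carrier G \<Longrightarrow> \<Gamma> k #> x = \<Gamma> k #> y \<longleftrightarrow> x \<otimes> inv y \<in> \<Gamma> k"
  by (rule normal_coset_eq_iff[OF Gamma_normal])

lemma Gamma_coset_absorb:
  assumes "n \<in> \<Gamma> k" "x \<in> carrier G"
  shows "\<Gamma> k #> (x \<otimes> n) = \<Gamma> k #> x" "\<Gamma> k #> (n \<otimes> x) = \<Gamma> k #> x"
proof -
  show "\<Gamma> k #> (x \<otimes> n) = \<Gamma> k #> x"
    using assms Gamma_conj[of n k x] by (subst Gamma_coset_eq_iff) auto
  show "\<Gamma> k #> (n \<otimes> x) = \<Gamma> k #> x"
    using assms by (subst Gamma_coset_eq_iff) (auto simp: m_assoc)
qed

lemma Gamma_coset_mult_cong: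
  assumes "x \<in> carrier G" "y \<in> carrier G" "x' \<in> carrier G" "y' \<in> carrier G"
    "\<Gamma> k #> x = \<Gamma> k #> x'" "\<Gamma> k #> y = \<Gamma> k #> y'"
  shows "\<Gamma> k #> (x \<otimes> y) = \<Gamma> k #> (x' \<otimes> y')"
  using assms by (simp add: Gamma_coset_mult)

lemma Gamma_coset_inv_cong:
  assumes "x \<in> carrier G" "y \<in> carrier G" "\<Gamma> k #> x = \<Gamma> k #> y"
  shows "\<Gamma> k #> inv x = \<Gamma> k #> inv y"
proof -
  have "x \<otimes> inv y \<in> \<Gamma> k" using assms Gamma_coset_eq_iff by blast
  then have "inv (x \<otimes> inv y) \<in> \<Gamma> k" by simp
  then have "inv y \<otimes> inv (x \<otimes> inv y) \<otimes> inv (inv y) \<in> \<Gamma> k" using assms by (intro Gamma_conj) auto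
  moreover have "inv y \<otimes> inv (x \<otimes> inv y) \<otimes> inv (inv y) = inv x \<otimes> y"
    using assms by (simp add: inv_mult_group m_assoc)
  ultimately show ?thesis using assms by (subst Gamma_coset_eq_iff) auto
qed

lemma Gamma_coset_decomp:
  assumes "x \<in> carrier G" "y \<in> carrier G" "\<Gamma> k #> x = \<Gamma> k #> y"
  shows "inv y \<otimes> x \<in> \<Gamma> k"
proof -
  have "x \<otimes> inv y \<in> \<Gamma> k" using assms Gamma_coset_eq_iff by blast
  then have "inv y \<otimes> (x \<otimes> inv y) \<otimes> y \<in> \<Gamma> k" using assms by (intro Gamma_conj') auto
  then show ?thesis using assms by (simp add: m_assoc)
qed

lemma coset_commutator_pow_left:
  assumes "y \<in> \<Gamma> i" "z \<in> H"
  shows "\<Gamma> (Suc (Suc i)) #> commutator G (y [^] (a::nat)) z = \<Gamma> (Suc (Suc i)) #> (commutator G y z [^] a)"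
proof (induction a)
  case 0
  then show ?case using assms by (simp add: commutator_def)
next
  case (Suc a)
  have c: "y \<in> carrier G" "z \<in> carrier G" using assms by auto
  have ya: "y [^] a \<in> \<Gamma> i" using assms(1) by (induction a) auto
  have k: "commutator G y z \<in> \<Gamma> (Suc i)" using assms commutator_Gamma_H by blast
  have "commutator G (y [^] a) (commutator G y z) \<in> \<Gamma> (Suc (i + Suc i))" using ya k by (rule commutator_Gamma)
  then have n: "commutator G (y [^] a) (commutator G y z) \<in> \<Gamma> (Suc (Suc i))"
    using Gamma_antimono[of "Suc (Suc i)" "Suc (i + Suc i)"] by auto
  have "commutator G (y [^] Suc a) z = commutator G (y [^] a) (commutator G y z) \<otimes> (commutator G y z \<otimes> commutator G (y [^] a) z)"
    using commutator_mult_left[of "y [^] a" y z] c by (simp add: m_assoc)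
  then have "\<Gamma> (Suc (Suc i)) #> commutator G (y [^] Suc a) z = \<Gamma> (Suc (Suc i)) #> (commutator G y z \<otimes> commutator G (y [^] a) z)"
    using Gamma_coset_absorb(2)[OF n] c by simp
  also have "\<dots> = \<Gamma> (Suc (Suc i)) #> (commutator G y z \<otimes> commutator G y z [^] a)"
    using c Suc by (intro Gamma_coset_mult_cong) auto
  finally show ?case using c by (metis commutator_closed nat_pow_Suc2)
qed

lemma coset_commutator_pow_right:
  assumes "y \<in> \<Gamma> i" "z \<in> H"
  shows "\<Gamma> (Suc (Suc i)) #> commutator G y (z [^] (b::nat)) = \<Gamma> (Suc (Suc i)) #> (commutator G y z [^] b)"
proof (induction b)
  case 0
  then show ?case using assms by (simp add: commutator_def)
next
  case (Suc b)
  have c: "y \<in> carrier G" "z \<in> carrier G" using assms by auto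
  have zb: "z [^] b \<in> \<Gamma> 0" using assms(2) by (induction b) auto
  have k: "commutator G y z \<in> \<Gamma> (Suc i)" using assms commutator_Gamma_H by blast
  have n: "commutator G (z [^] b) (commutator G y z) \<in> \<Gamma> (Suc (Suc i))" using commutator_Gamma[OF zb k] by simp
  have "commutator G y (z [^] Suc b) = commutator G y (z [^] b) \<otimes> (commutator G (z [^] b) (commutator G y z) \<otimes> commutator G y z)"
    using commutator_mult_right[of y "z [^] b" z] c by (simp add: m_assoc)
  moreover have "\<Gamma> (Suc (Suc i)) #> (commutator G y (z [^] b) \<otimes> (commutator G (z [^] b) (commutator G y z) \<otimes> commutator G y z))
      = \<Gamma> (Suc (Suc i)) #> (commutator G y z [^] b \<otimes> commutator G y z)"
    by (rule Gamma_coset_mult_cong) (use Suc c n Gamma_coset_absorb(2)[OF n, of "commutator G y z"] in simp_all)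
  ultimately have "\<Gamma> (Suc (Suc i)) #> commutator G y (z [^] Suc b) = \<Gamma> (Suc (Suc i)) #> (commutator G y z [^] b \<otimes> commutator G y z)"
    by simp
  then show ?case by simp
qed

lemma coset_pow_cong:
  assumes "x \<in> carrier G" "y \<in> carrier G" "\<Gamma> k #> x = \<Gamma> k #> y"
  shows "\<Gamma> k #> (x [^] (n::nat)) = \<Gamma> k #> (y [^] n)"
proof (induction n)
  case (Suc n)
  have "\<Gamma> k #> (x [^] n \<otimes> x) = \<Gamma> k #> (y [^] n \<otimes> y)"
    by (rule Gamma_coset_mult_cong) (use assms Suc in simp_all)
  then show ?case by simp
qed simp

text \<open>The \<open>E\<close>-th power of an \<open>(i + 1)\<close>-fold commutator is short: writing \<open>E\<close> in base \<open>q\<close> one uses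
  \<open>[x\<^sup>a, y\<^sup>q] \<equiv> [x, y]\<^sup>a\<^sup>q\<close> and induction for \<open>x\<^sup>a\<close>.\<close>

lemma short_powers:
  "t \<in> T i \<Longrightarrow> \<exists>C. \<forall>q\<ge>1. \<forall>E\<le>q ^ Suc i. \<exists>g\<in>ball (C * q). \<Gamma> (Suc i) #> (t [^] (E::nat)) = \<Gamma> (Suc i) #> g"
proof (induction i arbitrary: t)
  case 0
  then have "t \<in> carrier G" using T_carrier by blast
  then obtain d where d: "t \<in> ball d" using carrier_ball by blast
  have "t [^] E \<in> ball (d * q)" if "E \<le> q ^ Suc 0" for E q
    using that by (intro ball_mono[OF ball_pow[OF d, of E]]) (simp add: mult.commute)
  then show ?case by blast
next
  case (Suc i)
  obtain s x where t: "t = commutator G s x" "s \<in> T i" "x \<in> T 0" using Suc.prems by (auto simp: T_Suc)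
  have sx: "s \<in> \<Gamma> i" "x \<in> H" using t T_Gamma T0_H by auto
  have c: "s \<in> carrier G" "x \<in> carrier G" "t \<in> carrier G" using sx t by auto
  obtain C where C: "\<And>q E. q \<ge> 1 \<Longrightarrow> E \<le> q ^ Suc i \<Longrightarrow> \<exists>g\<in>ball (C * q). \<Gamma> (Suc i) #> (s [^] (E::nat)) = \<Gamma> (Suc i) #> g"
    using Suc.IH[OF t(2)] by blast
  obtain d e where d: "x \<in> ball d" and e: "s \<in> ball e" using carrier_ball c by blast
  obtain I where I: "\<And>n g. g \<in> ball n \<Longrightarrow> inv g \<in> ball (I * n)" using ball_inv by blast
  define D where "D = (C + d + I * C + I * d) + (e + d + I * e + I * d)"
  have "\<exists>g\<in>ball (D * q). \<Gamma> (Suc (Suc i)) #> (t [^] E) = \<Gamma> (Suc (Suc i)) #> g"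
    if q: "q \<ge> 1" and E: "E \<le> q ^ Suc (Suc i)" for q E :: nat
  proof -
    let ?M = "\<Gamma> (Suc (Suc i))"
    define a b where "a = E div q" and "b = E mod q"
    have ab: "E = a * q + b" "b < q" using q by (auto simp: a_def b_def)
    have "a \<le> q ^ Suc (Suc i) div q" unfolding a_def using E by (rule div_le_mono)
    then have "a \<le> q ^ Suc i" using q by simp
    then obtain g where g: "g \<in> ball (C * q)" "\<Gamma> (Suc i) #> (s [^] a) = \<Gamma> (Suc i) #> g" using C[OF q] by blast
    have gc: "g \<in> carrier G" using g ball_carrier by blast
    have sa: "s [^] a \<in> \<Gamma> i" using sx by (induction a) auto
    have xq: "x [^] q \<in> H" using sx by (induction q) auto
    define n where "n = inv g \<otimes> s [^] a"
    have n: "n \<in> \<Gamma> (Suc i)" unfolding n_def using Gamma_coset_decomp g gc c by blast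
    have gn: "s [^] a = g \<otimes> n" using gc c by (simp add: n_def)
    have nx: "commutator G n (x [^] q) \<in> ?M" using n xq commutator_Gamma_H by blast
    have gnx: "commutator G g (commutator G n (x [^] q)) \<in> ?M"
    proof -
      have "(g \<otimes> commutator G n (x [^] q) \<otimes> inv g) \<otimes> inv (commutator G n (x [^] q)) \<in> ?M"
        using nx gc by (intro Gamma_mult Gamma_conj Gamma_inv)
      then show ?thesis by (simp only: commutator_def)
    qed
    have ncarr: "n \<in> carrier G" "x [^] q \<in> carrier G" using n c by auto
    have "?M #> commutator G (s [^] a) (x [^] q) = ?M #> commutator G g (x [^] q)"
      unfolding gn commutator_mult_left[OF gc ncarr]
      using Gamma_coset_absorb(2)[OF Gamma_mult[OF gnx nx]] gc ncarr by simp
    moreover have "?M #> commutator G (s [^] a) (x [^] q) = ?M #> (t [^] (a * q))"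
    proof -
      have "?M #> commutator G (s [^] a) (x [^] q) = ?M #> (commutator G (s [^] a) x [^] q)"
        using sa sx by (intro coset_commutator_pow_right)
      also have "\<dots> = ?M #> ((t [^] a) [^] q)"
        unfolding t(1) using c sx by (intro coset_pow_cong coset_commutator_pow_left) auto
      finally show ?thesis using c by (simp add: nat_pow_pow)
    qed
    ultimately have 1: "?M #> (t [^] (a * q)) = ?M #> commutator G g (x [^] q)" by simp
    have 2: "?M #> (t [^] b) = ?M #> commutator G s (x [^] b)"
      unfolding t(1) using coset_commutator_pow_right[OF sx] by simp
    have "?M #> (t [^] E) = ?M #> (t [^] (a * q) \<otimes> t [^] b)" unfolding ab(1) using c by (simp add: nat_pow_mult)
    also have "\<dots> = ?M #> (commutator G g (x [^] q) \<otimes> commutator G s (x [^] b))"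
      using 1 2 c gc by (intro Gamma_coset_mult_cong) auto
    finally have 3: "?M #> (t [^] E) = \<dots>" .
    have bx: "x [^] q \<in> ball (q * d)" "x [^] b \<in> ball (q * d)"
      using ball_pow[OF d] ball_mono[OF ball_pow[OF d, of b], of "q * d"] ab(2) by auto
    have eq: "s \<in> ball (e * q)" using q by (intro ball_mono[OF e]) simp
    have "commutator G g (x [^] q) \<otimes> commutator G s (x [^] b) \<in>
       ball ((C * q + q * d + I * (C * q) + I * (q * d)) + (e * q + q * d + I * (e * q) + I * (q * d)))"
      unfolding commutator_def by (intro ball_mult I g bx eq)
    moreover have "(C * q + q * d + I * (C * q) + I * (q * d)) + (e * q + q * d + I * (e * q) + I * (q * d)) = D * q"
      by (simp add: D_def algebra_simps)
    ultimately show ?thesis using 3 by auto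
  qed
  then show ?case by blast
qed

end

context nilpotent_pair
begin

lemma wval_mod:
  assumes "distinct ts" "set ts = T i" "L \<in> lists (Lt i)"
  shows "\<exists>n\<in>\<Gamma> (Suc i). wval L = pw ts (es i L) \<otimes> n"
proof -
  obtain K' where K': "\<And>m M. m \<ge> 1 \<Longrightarrow> M \<in> lists (Ly i (set ts)) \<Longrightarrow> cost m M \<le> cost 1 L \<Longrightarrow>
    \<exists>L'\<in>lists (Lt (Suc i)). wval M = pw ts (es i M) \<otimes> wval L' \<and> cost m L' \<le> K'"
    using collect_all[OF assms(1), of i] assms(2) by blast
  have "L \<in> lists (Ly i (set ts))" using assms by (simp add: Ly_T)
  then obtain L' where "L' \<in> lists (Lt (Suc i))" "wval L = pw ts (es i L) \<otimes> wval L'" using K'[of 1 L] by auto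
  then show ?thesis using wval_Gamma by blast
qed

lemma enum_T: obtains ts where "distinct ts" "set ts = T i"
  using finite_distinct_list[OF finite_T] by blast

lemma pw_zero: "set ts \<subseteq> carrier G \<Longrightarrow> pw ts (\<lambda>_. 0) = \<one>" by (induction ts) auto

lemma wval_concat:
  "(\<And>b. b \<in> set bs \<Longrightarrow> f b \<in> lists (Lt i)) \<Longrightarrow>
    concat (map f bs) \<in> lists (Lt i) \<and> wval (concat (map f bs)) = word_eval G (map (\<lambda>b. wval (f b)) bs)"
proof (induction bs)
  case (Cons b bs)
  then show ?case using wval_append[of "f b" i "concat (map f bs)"] by auto
qed simp

lemma length_concat_le: "(\<And>b. b \<in> set bs \<Longrightarrow> length (f b) \<le> r) \<Longrightarrow> length (concat (map f bs)) \<le> length bs * r"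
  by (induction bs) (auto intro: add_mono)

lemma es_concat: "es i (concat (map f bs)) t = (\<Sum>b\<leftarrow>bs. es i (f b) t)"
  by (induction bs) auto

text \<open>The relations among the generators of \<open>\<Gamma> i / \<Gamma> (i + 1)\<close> form a finitely generated, undistorted
  lattice, so a power product lying in \<open>\<Gamma> (i + 1)\<close> is rewritten there at bounded weighted cost.\<close>

lemma relation_cost:
  assumes i: "i < c" and ts: "distinct ts" "set ts = T i"
  shows "\<forall>K. \<exists>K'. \<forall>m\<ge>1. \<forall>e. (\<forall>t\<in>T i. real_of_int \<bar>e t\<bar> * (1 / m) ^ Suc i \<le> K) \<longrightarrow> pw ts e \<in> \<Gamma> (Suc i) \<longrightarrow>
    (\<exists>N\<in>lists (Lt (Suc i)). wval N = pw ts e \<and> cost m N \<le> K')"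
proof -
  have tsc: "set ts \<subseteq> carrier G" "set ts \<subseteq> T i" using ts T_carrier[of i] by auto
  define \<Lambda> where "\<Lambda> = {e. (\<forall>t. t \<notin> T i \<longrightarrow> e t = 0) \<and> pw ts e \<in> \<Gamma> (Suc i)}"
  have pwc: "pw ts e \<in> carrier G" for e by (rule pw_closed[OF tsc(1)])
  have two: "\<exists>n\<in>\<Gamma> (Suc i). pw ts e \<otimes> pw ts f = pw ts (\<lambda>t. e t + f t) \<otimes> n" for e f
  proof -
    have L: "ex i ts e @ ex i ts f \<in> lists (Lt i)" using ex_props(1)[OF i tsc(2)] by simp
    have "pw ts (es i (ex i ts e @ ex i ts f)) = pw ts (\<lambda>t. e t + f t)"
      using ex_props(3)[OF i tsc(2) ts(1)] by (intro pw_cong) simp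
    moreover have "wval (ex i ts e @ ex i ts f) = pw ts e \<otimes> pw ts f"
      using wval_append[of "ex i ts e" i "ex i ts f"] ex_props(1,2)[OF i tsc(2)] by simp
    ultimately show ?thesis using wval_mod[OF ts L] by simp
  qed
  have add: "(\<lambda>t. e t + f t) \<in> \<Lambda>" if "e \<in> \<Lambda>" "f \<in> \<Lambda>" for e f
  proof -
    obtain n where n: "n \<in> \<Gamma> (Suc i)" "pw ts e \<otimes> pw ts f = pw ts (\<lambda>t. e t + f t) \<otimes> n" using two by blast
    have "pw ts (\<lambda>t. e t + f t) = pw ts e \<otimes> pw ts f \<otimes> inv n" using n pwc by (simp add: m_assoc)
    moreover have "pw ts e \<in> \<Gamma> (Suc i)" "pw ts f \<in> \<Gamma> (Suc i)" using that unfolding \<Lambda>_def by auto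
    then have "pw ts e \<otimes> pw ts f \<otimes> inv n \<in> \<Gamma> (Suc i)" using n(1) by (intro Gamma_mult Gamma_inv)
    ultimately show ?thesis using that unfolding \<Lambda>_def by auto
  qed
  have minus: "(\<lambda>t. - e t) \<in> \<Lambda>" if "e \<in> \<Lambda>" for e
  proof -
    obtain n where n: "n \<in> \<Gamma> (Suc i)" "pw ts e \<otimes> pw ts (\<lambda>t. - e t) = pw ts (\<lambda>t. e t + - e t) \<otimes> n" using two by blast
    then have "pw ts e \<otimes> pw ts (\<lambda>t. - e t) = n" using pw_zero[OF tsc(1)] by simp
    then have "inv (pw ts e) \<otimes> (pw ts e \<otimes> pw ts (\<lambda>t. - e t)) = inv (pw ts e) \<otimes> n" by simp
    then have "pw ts (\<lambda>t. - e t) = inv (pw ts e) \<otimes> n" using pwc by simp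
    moreover have "inv (pw ts e) \<otimes> n \<in> \<Gamma> (Suc i)" using that n unfolding \<Lambda>_def by auto
    ultimately show ?thesis using that unfolding \<Lambda>_def by auto
  qed
  have supp: "e t = 0" if "e \<in> \<Lambda>" "t \<notin> T i" for e t using that unfolding \<Lambda>_def by blast
  have "\<exists>Bs C. finite Bs \<and> Bs \<subseteq> \<Lambda> \<and> (\<forall>e\<in>\<Lambda>. \<exists>bs. set bs \<subseteq> Bs \<and> (\<forall>t. e t = (\<Sum>b\<leftarrow>bs. b t)) \<and>
    int (length bs) \<le> int C * (\<Sum>t\<in>T i. \<bar>e t\<bar>))"
    by (rule undistorted_lattice[OF finite_T[of i], of \<Lambda>]) (erule (1) supp, erule (1) add, erule minus)
  then obtain Bs C where BC: "finite Bs" "Bs \<subseteq> \<Lambda>"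
    "\<forall>e\<in>\<Lambda>. \<exists>bs. set bs \<subseteq> Bs \<and> (\<forall>t. e t = (\<Sum>b\<leftarrow>bs. b t)) \<and> int (length bs) \<le> int C * (\<Sum>t\<in>T i. \<bar>e t\<bar>)"
    by (elim exE conjE)
  have "\<forall>b\<in>Bs. \<exists>N. N \<in> lists (Lt (Suc i)) \<and> wval N = pw ts b"
    using BC(2) Gamma_letters unfolding \<Lambda>_def by blast
  then obtain R where R: "\<And>b. b \<in> Bs \<Longrightarrow> R b \<in> lists (Lt (Suc i))" "\<And>b. b \<in> Bs \<Longrightarrow> wval (R b) = pw ts b" by metis
  have "finite ((\<lambda>b. length (R b)) ` Bs)" "finite ((\<lambda>b. length (ex i ts b)) ` Bs)" using BC(1) by auto
  then obtain r x where r: "\<forall>y\<in>(\<lambda>b. length (R b)) ` Bs. y \<le> r" and x: "\<forall>y\<in>(\<lambda>b. length (ex i ts b)) ` Bs. y \<le> x"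
    unfolding finite_nat_set_iff_bounded_le by blast
  show ?thesis
  proof
    fix K :: real
    define K0 where "K0 = real C * (real (card (T i)) * max K 0)"
    obtain K1 where K1: "\<And>m L. m \<ge> 1 \<Longrightarrow> L \<in> lists (Ly i (set ts)) \<Longrightarrow> cost m L \<le> K0 * real x \<Longrightarrow>
      \<exists>L'\<in>lists (Lt (Suc i)). wval L = pw ts (es i L) \<otimes> wval L' \<and> cost m L' \<le> K1"
      using collect_all[OF ts(1) tsc(2)] by blast
    have "\<exists>N\<in>lists (Lt (Suc i)). wval N = pw ts e \<and> cost m N \<le> K0 * real r + K1"
      if m: "m \<ge> 1" and e: "\<And>t. t \<in> T i \<Longrightarrow> real_of_int \<bar>e t\<bar> * (1 / m) ^ Suc i \<le> K" and pe: "pw ts e \<in> \<Gamma> (Suc i)" for m e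
    proof -
      define f where "f t = (if t \<in> T i then e t else 0)" for t
      have pf: "pw ts f = pw ts e" using ts(2) by (intro pw_cong) (simp add: f_def)
      have "f \<in> \<Lambda>" using pe pf by (simp add: \<Lambda>_def f_def)
      then obtain bs where bs: "set bs \<subseteq> Bs" "\<And>t. f t = (\<Sum>b\<leftarrow>bs. b t)" "int (length bs) \<le> int C * (\<Sum>t\<in>T i. \<bar>f t\<bar>)"
        using BC(3) by blast
      let ?p = "(1 / m) ^ Suc i"
      have p: "0 \<le> ?p" "(1 / m) ^ Suc (Suc i) \<le> ?p" using m by (auto intro!: power_decreasing simp del: power_Suc)
      have lb: "real (length bs) * ?p \<le> K0"
      proof -
        have "real_of_int (int (length bs)) \<le> real_of_int (int C * (\<Sum>t\<in>T i. \<bar>f t\<bar>))" using bs(3) by (rule of_int_le_iff[THEN iffD2])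
        then have "real (length bs) \<le> real C * (\<Sum>t\<in>T i. real_of_int \<bar>f t\<bar>)" by simp
        then have "real (length bs) * ?p \<le> (real C * (\<Sum>t\<in>T i. real_of_int \<bar>f t\<bar>)) * ?p" using p(1) by (rule mult_right_mono)
        also have "\<dots> = real C * (\<Sum>t\<in>T i. real_of_int \<bar>f t\<bar> * ?p)" by (simp only: sum_distrib_right mult.assoc)
        also have "\<dots> \<le> real C * (\<Sum>t\<in>T i. max K 0)"
          using e by (intro mult_left_mono sum_mono) (auto simp: f_def intro: order_trans[OF _ max.cobounded1] simp del: power_Suc)
        finally show ?thesis by (simp add: K0_def)
      qed
      have exb: "ex i ts b \<in> lists (Lt i)" for b by (rule ex_props(1)[OF i tsc(2)])
      let ?M = "concat (map (ex i ts) bs)" and ?N = "concat (map R bs)"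
      have M: "?M \<in> lists (Lt i)" "wval ?M = word_eval G (map (pw ts) bs)"
        using wval_concat[of bs "ex i ts" i] exb ex_props(2)[OF i tsc(2)] by auto
      have N: "?N \<in> lists (Lt (Suc i))" "wval ?N = word_eval G (map (pw ts) bs)"
      proof -
        have e: "map (\<lambda>b. wval (R b)) bs = map (pw ts) bs" using R(2) bs(1) by (auto intro!: map_cong)
        have l: "R b \<in> lists (Lt (Suc i))" if "b \<in> set bs" for b using R(1) bs(1) that by blast
        show "?N \<in> lists (Lt (Suc i))" "wval ?N = word_eval G (map (pw ts) bs)"
          using wval_concat[of bs R "Suc i", OF l] unfolding e by blast+
      qed
      have "cost m ?M \<le> real (length ?M) * ?p" by (rule cost_le[OF m M(1)])
      also have "\<dots> \<le> real (length bs * x) * ?p"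
        using length_concat_le[of bs "ex i ts" x] x bs(1) p(1) by (intro mult_right_mono) (auto simp del: of_nat_mult)
      also have "\<dots> = (real (length bs) * ?p) * real x" by simp
      also have "\<dots> \<le> K0 * real x" using lb by (intro mult_right_mono) auto
      finally have cM: "cost m ?M \<le> K0 * real x" .
      have "cost m ?N \<le> real (length ?N) * (1 / m) ^ Suc (Suc i)" by (rule cost_le[OF m N(1)])
      also have "\<dots> \<le> real (length bs * r) * ?p"
        using length_concat_le[of bs R r] r bs(1) p m by (intro mult_mono) (auto simp del: of_nat_mult power_Suc)
      also have "\<dots> = (real (length bs) * ?p) * real r" by simp
      also have "\<dots> \<le> K0 * real r" using lb by (intro mult_right_mono) auto
      finally have cN: "cost m ?N \<le> K0 * real r" .
      have "?M \<in> lists (Ly i (set ts))" using M(1) ts(2) by (simp add: Ly_T)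
      then obtain L' where L': "L' \<in> lists (Lt (Suc i))" "wval ?M = pw ts (es i ?M) \<otimes> wval L'" "cost m L' \<le> K1"
        using K1[OF m _ cM] by blast
      have "pw ts (es i ?M) = pw ts e"
      proof (rule pw_cong)
        fix t assume t: "t \<in> set ts"
        have "es i ?M t = (\<Sum>b\<leftarrow>bs. es i (ex i ts b) t)" by (rule es_concat)
        also have "\<dots> = (\<Sum>b\<leftarrow>bs. b t)" using ex_props(3)[OF i tsc(2) ts(1) t] by simp
        also have "\<dots> = e t" using bs(2)[of t] t ts(2) by (simp add: f_def)
        finally show "es i ?M t = e t" .
      qed
      then have "wval ?N = pw ts e \<otimes> wval L'" using L'(2) M(2) N(2) by simp
      then have v: "pw ts e = wval ?N \<otimes> inv (wval L')" using pwc wval_closed[OF L'(1)] by (simp add: m_assoc)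
      let ?L = "?N @ rev (map linv L')"
      note wi = wval_inverse[OF L'(1), of m]
      have "wval ?L = pw ts e" using v wval_append[OF N(1), of "rev (map linv L')"] wi by simp
      moreover have "cost m ?L \<le> K0 * real r + K1" using cN L'(3) wi by simp
      ultimately show ?thesis using N(1) wi by (intro bexI[of _ ?L]) auto
    qed
    then show "\<exists>K'. \<forall>m\<ge>1. \<forall>e. (\<forall>t\<in>T i. real_of_int \<bar>e t\<bar> * (1 / m) ^ Suc i \<le> K) \<longrightarrow> pw ts e \<in> \<Gamma> (Suc i) \<longrightarrow>
      (\<exists>N\<in>lists (Lt (Suc i)). wval N = pw ts e \<and> cost m N \<le> K')"
      by (intro exI[of _ "K0 * real r + K1"]) blast
  qed
qed

lemma descend:
  assumes i: "i < c"
  shows "\<exists>K'. \<forall>m\<ge>1. \<forall>L\<in>lists (Lt i). cost m L \<le> K \<longrightarrow> wval L \<in> \<Gamma> (Suc i) \<longrightarrow>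
    (\<exists>L'\<in>lists (Lt (Suc i)). wval L' = wval L \<and> cost m L' \<le> K')"
proof -
  obtain ts where ts: "distinct ts" "set ts = T i" by (rule enum_T)
  have tsc: "set ts \<subseteq> carrier G" using ts T_carrier[of i] by auto
  obtain K1 where K1: "\<And>m L. m \<ge> 1 \<Longrightarrow> L \<in> lists (Ly i (set ts)) \<Longrightarrow> cost m L \<le> K \<Longrightarrow>
      \<exists>L'\<in>lists (Lt (Suc i)). wval L = pw ts (es i L) \<otimes> wval L' \<and> cost m L' \<le> K1"
    using collect_all[OF ts(1), of i] ts(2) by blast
  obtain K2 where K2: "\<And>m e. m \<ge> 1 \<Longrightarrow> \<forall>t\<in>T i. real_of_int \<bar>e t\<bar> * (1 / m) ^ Suc i \<le> K \<Longrightarrow> pw ts e \<in> \<Gamma> (Suc i) \<Longrightarrow>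
    \<exists>N\<in>lists (Lt (Suc i)). wval N = pw ts e \<and> cost m N \<le> K2"
    using relation_cost[OF i ts] by blast
  have "\<exists>L'\<in>lists (Lt (Suc i)). wval L' = wval L \<and> cost m L' \<le> K2 + K1"
    if m: "m \<ge> 1" and L: "L \<in> lists (Lt i)" "cost m L \<le> K" "wval L \<in> \<Gamma> (Suc i)" for m L
  proof -
    obtain L1 where L1: "L1 \<in> lists (Lt (Suc i))" "wval L = pw ts (es i L) \<otimes> wval L1" "cost m L1 \<le> K1"
      using K1[OF m, of L] L ts(2) by (auto simp: Ly_T)
    have pc: "pw ts (es i L) \<in> carrier G" by (rule pw_closed[OF tsc])
    have "pw ts (es i L) = wval L \<otimes> inv (wval L1)" using L1 pc wval_closed[OF L1(1)] by (simp add: m_assoc)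
    then have pm: "pw ts (es i L) \<in> \<Gamma> (Suc i)" using L(3) wval_Gamma[OF L1(1)] by simp
    have "real_of_int \<bar>es i L t\<bar> * (1 / m) ^ Suc i \<le> K" for t
    proof -
      have "real_of_int \<bar>es i L t\<bar> \<le> real_of_int (int (occ i t L))" using es_occ[OF L(1)] by (rule of_int_le_iff[THEN iffD2])
      then have "real_of_int \<bar>es i L t\<bar> * (1 / m) ^ Suc i \<le> real (occ i t L) * (1 / m) ^ Suc i"
        using m by (intro mult_right_mono) auto
      then show ?thesis using occ_cost[OF m, of i t L] L(2) by linarith
    qed
    then obtain N where N: "N \<in> lists (Lt (Suc i))" "wval N = pw ts (es i L)" "cost m N \<le> K2"
      using K2[OF m _ pm] by blast
    show ?thesis using N L1 wval_append[OF N(1) L1(1)] by (intro bexI[of _ "N @ L1"]) auto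
  qed
  then show ?thesis by blast
qed

text \<open>A word of length \<open>m\<close> has bounded cost in level zero letters. Descending one level at a time, the letters of
  level \<open>i\<close> are collected and their power product, which lies in \<open>\<Gamma> (i + 1)\<close>, is rewritten in letters of higher level at bounded cost.\<close>

lemma Gamma_cost:
  "i \<le> c \<Longrightarrow> \<exists>K. \<forall>m\<ge>1. \<forall>h\<in>\<Gamma> i \<inter> ball m. \<exists>L\<in>lists (Lt i). wval L = h \<and> cost (real m) L \<le> K"
proof (induction i)
  case 0
  have "\<exists>L\<in>lists (Lt 0). wval L = h \<and> cost (real m) L \<le> 1" if m: "m \<ge> 1" and h: "h \<in> \<Gamma> 0 \<inter> ball m" for m h
  proof (cases "c = 0")
    case True
    then show ?thesis using h nilp by (intro bexI[of _ "[]"]) auto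
  next
    case False
    obtain w where w: "w \<in> lists S" "length w \<le> m" "h = word_eval G w" using h by (auto simp: ball_def)
    obtain cs where cs: "cs \<in> lists loops" "h = loops_val cs" "length w = loops_len cs"
      using H_word_loops[OF w(1)] h w(3) by auto
    let ?L = "map (\<lambda>c. (0::nat, loop_val c, 1::int)) cs"
    have 1: "?L \<in> lists (Lt 0)" using cs(1) False by (auto simp: in_lists_conv_set Lt_def T.simps)
    have 2: "wval ?L = h" unfolding cs(2) using cs(1)
      by (induction cs) (auto simp: lval_def loop_val_H)
    have "cost (real m) ?L \<le> real (length ?L) * (1 / real m) ^ Suc 0" using cost_le[OF _ 1, of "real m"] m by simp
    also have "\<dots> \<le> 1" using length_le_loops_len[OF cs(1)] cs(3) w(2) m by (simp add: field_simps)
    finally show ?thesis using 1 2 by blast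
  qed
  then show ?case by blast
next
  case (Suc i)
  then obtain K where K: "\<And>m h. m \<ge> 1 \<Longrightarrow> h \<in> \<Gamma> i \<inter> ball m \<Longrightarrow> \<exists>L\<in>lists (Lt i). wval L = h \<and> cost (real m) L \<le> K" by auto
  obtain K' where K': "\<And>m L. m \<ge> 1 \<Longrightarrow> L \<in> lists (Lt i) \<Longrightarrow> cost m L \<le> K \<Longrightarrow> wval L \<in> \<Gamma> (Suc i) \<Longrightarrow>
    \<exists>L'\<in>lists (Lt (Suc i)). wval L' = wval L \<and> cost m L' \<le> K'"
    using descend[of i K] Suc.prems by auto
  have "\<exists>L\<in>lists (Lt (Suc i)). wval L = h \<and> cost (real m) L \<le> K'" if m: "m \<ge> 1" and h: "h \<in> \<Gamma> (Suc i) \<inter> ball m" for m h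
  proof -
    have "h \<in> \<Gamma> i \<inter> ball m" using h Gamma_Suc_subset by auto
    then obtain L where L: "L \<in> lists (Lt i)" "wval L = h" "cost (real m) L \<le> K" using K[OF m] by blast
    then show ?thesis using K'[of "real m" L] m h by auto
  qed
  then show ?case by blast
qed

lemma wval_level_part:
  "L \<in> lists (Lt i) \<Longrightarrow> \<exists>n\<in>\<Gamma> (Suc i). wval L = wval (filter (\<lambda>l. lev l = i) L) \<otimes> n"
proof (induction L)
  case (Cons l L)
  then obtain n where n: "n \<in> \<Gamma> (Suc i)" "wval L = wval (filter (\<lambda>l. lev l = i) L) \<otimes> n" by auto
  have F: "filter (\<lambda>l. lev l = i) L \<in> lists (Lt i)" using Cons by (auto simp: in_lists_conv_set)
  have l: "l \<in> Lt i" using Cons by simp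
  have cc: "lval l \<in> carrier G" "wval (filter (\<lambda>l. lev l = i) L) \<in> carrier G" "n \<in> carrier G"
    using lval_closed[OF l] wval_closed[OF F] n by auto
  show ?case
  proof (cases "lev l = i")
    case True
    then show ?thesis using n cc by (intro bexI[of _ n]) (simp_all add: m_assoc)
  next
    case False
    then have "l \<in> Lt (Suc i)" using l by (auto simp: Lt_def)
    then have "lval l \<in> \<Gamma> (Suc i)" using lval_Gamma[of l "Suc i"] Gamma_antimono[of "Suc i" "lev l"] by (auto simp: Lt_def)
    then have "inv (wval (filter (\<lambda>l. lev l = i) L)) \<otimes> lval l \<otimes> wval (filter (\<lambda>l. lev l = i) L) \<otimes> n \<in> \<Gamma> (Suc i)"
      using n cc by (intro Gamma_mult Gamma_conj') auto
    then show ?thesis using n cc False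
      by (intro bexI[of _ "inv (wval (filter (\<lambda>l. lev l = i) L)) \<otimes> lval l \<otimes> wval (filter (\<lambda>l. lev l = i) L) \<otimes> n"])
         (simp_all add: m_assoc)
  qed
qed (auto intro!: bexI[of _ \<one>])

lemma level_part_cost: "m \<ge> 1 \<Longrightarrow> real (length (filter (\<lambda>l. lev l = i) L)) * (1 / m) ^ Suc i \<le> cost m L"
proof (induction L)
  case (Cons l L)
  have nn: "0 \<le> (1 / m) ^ Suc (lev l)" using Cons.prems by simp
  have e: "cost m (l # L) = (1 / m) ^ Suc (lev l) + cost m L" by simp
  show ?case
  proof (cases "lev l = i")
    case True
    then show ?thesis using Cons by (auto simp: algebra_simps simp del: power_Suc)
  next
    case False
    then have f: "filter (\<lambda>l. lev l = i) (l # L) = filter (\<lambda>l. lev l = i) L" by simp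
    show ?thesis unfolding f using Cons.IH[OF Cons.prems] nn e by linarith
  qed
qed simp

text \<open>Of the letters given by \<open>Gamma_cost\<close> only those of level \<open>i\<close> matter modulo \<open>\<Gamma> (i + 1)\<close>, and bounded cost means
  that there are \<open>O (m\<^sup>i\<^sup>+\<^sup>1)\<close> of them.\<close>

lemma Gamma_size:
  "\<exists>K::nat. \<forall>m\<ge>1. \<forall>h\<in>\<Gamma> i \<inter> ball m. \<exists>L\<in>lists (Lt i). (\<forall>l\<in>set L. lev l = i) \<and>
     length L \<le> K * m ^ Suc i \<and> \<Gamma> (Suc i) #> h = \<Gamma> (Suc i) #> wval L"
proof (cases "i \<le> c")
  case True
  then obtain K where K: "\<And>m h. m \<ge> 1 \<Longrightarrow> h \<in> \<Gamma> i \<inter> ball m \<Longrightarrow> \<exists>L\<in>lists (Lt i). wval L = h \<and> cost (real m) L \<le> K"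
    using Gamma_cost by blast
  have "\<exists>L\<in>lists (Lt i). (\<forall>l\<in>set L. lev l = i) \<and> length L \<le> nat \<lceil>K\<rceil> * m ^ Suc i \<and> \<Gamma> (Suc i) #> h = \<Gamma> (Suc i) #> wval L"
    if m: "m \<ge> 1" and h: "h \<in> \<Gamma> i \<inter> ball m" for m h
  proof -
    obtain L where L: "L \<in> lists (Lt i)" "wval L = h" "cost (real m) L \<le> K" using K[OF m h] by blast
    let ?F = "filter (\<lambda>l. lev l = i) L"
    obtain n where n: "n \<in> \<Gamma> (Suc i)" "wval L = wval ?F \<otimes> n" using wval_level_part[OF L(1)] by blast
    have F: "?F \<in> lists (Lt i)" using L by (auto simp: in_lists_conv_set)
    have "\<Gamma> (Suc i) #> h = \<Gamma> (Suc i) #> wval ?F"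
      using Gamma_coset_absorb(1)[OF n(1) wval_closed[OF F]] n L by simp
    moreover have "length ?F \<le> nat \<lceil>K\<rceil> * m ^ Suc i"
    proof -
      have "real (length ?F) * (1 / real m) ^ Suc i \<le> K" using level_part_cost[of "real m" i L] m L(3) by linarith
      also have "K \<le> real (nat \<lceil>K\<rceil>)" by linarith
      finally have "real (length ?F) * (1 / real m) ^ Suc i * real m ^ Suc i \<le> real (nat \<lceil>K\<rceil>) * real m ^ Suc i"
        by (rule mult_right_mono) simp
      moreover have "(1 / real m) ^ Suc i * real m ^ Suc i = 1" using m by (simp add: power_mult_distrib[symmetric] del: power_Suc)
      ultimately have "real (length ?F) \<le> real (nat \<lceil>K\<rceil> * m ^ Suc i)" by (simp add: mult.assoc del: power_Suc)
      then show ?thesis by (simp only: of_nat_le_iff)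
    qed
    ultimately show ?thesis using F by (intro bexI[of _ ?F]) auto
  qed
  then show ?thesis by blast
next
  case False
  then have "\<Gamma> i \<subseteq> {\<one>}" using Gamma_antimono[of c i] nilp by auto
  then show ?thesis by (intro exI[of _ 0] allI impI ballI bexI[of _ "[]"]) auto
qed

lemma short_power_product:
  assumes "set ts \<subseteq> T i"
  shows "\<exists>C. \<forall>q\<ge>1. \<forall>e. (\<forall>t\<in>set ts. \<bar>e t\<bar> \<le> int (q ^ Suc i)) \<longrightarrow>
    (\<exists>g\<in>ball (C * q). \<Gamma> (Suc i) #> pw ts e = \<Gamma> (Suc i) #> g)"
  using assms
proof (induction ts)
  case Nil
  show ?case using one_ball by (intro exI[of _ 0]) auto
next
  case (Cons t ts)
  have sub: "set ts \<subseteq> T i" using Cons.prems by simp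
  obtain C where C: "\<And>q e. q \<ge> 1 \<Longrightarrow> \<forall>t\<in>set ts. \<bar>e t\<bar> \<le> int (q ^ Suc i) \<Longrightarrow>
    \<exists>g\<in>ball (C * q). \<Gamma> (Suc i) #> pw ts e = \<Gamma> (Suc i) #> g" using Cons.IH[OF sub] by blast
  obtain D where D: "\<And>q E. q \<ge> 1 \<Longrightarrow> E \<le> q ^ Suc i \<Longrightarrow> \<exists>g\<in>ball (D * q). \<Gamma> (Suc i) #> (t [^] (E::nat)) = \<Gamma> (Suc i) #> g"
    using short_powers[of t i] Cons.prems by auto
  obtain I where I: "\<And>n g. g \<in> ball n \<Longrightarrow> inv g \<in> ball (I * n)" using ball_inv by blast
  have tc: "t \<in> carrier G" "set ts \<subseteq> carrier G" using Cons.prems T_carrier[of i] by auto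
  have "\<exists>g\<in>ball ((D + I * D + C) * q). \<Gamma> (Suc i) #> pw (t # ts) e = \<Gamma> (Suc i) #> g"
    if q: "q \<ge> 1" and e: "\<forall>t\<in>set (t # ts). \<bar>e t\<bar> \<le> int (q ^ Suc i)" for q e
  proof -
    have "nat \<bar>e t\<bar> \<le> q ^ Suc i" using e by (simp add: nat_le_iff del: power_Suc)
    then obtain g where g: "g \<in> ball (D * q)" "\<Gamma> (Suc i) #> (t [^] nat \<bar>e t\<bar>) = \<Gamma> (Suc i) #> g" using D[OF q] by blast
    have gc: "g \<in> carrier G" using g ball_carrier by blast
    have "\<exists>g'\<in>ball (D * q + I * (D * q)). \<Gamma> (Suc i) #> (t [^] e t) = \<Gamma> (Suc i) #> g'"
    proof (cases "e t \<ge> 0")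
      case True
      then have "t [^] e t = t [^] nat \<bar>e t\<bar>" by (simp add: int_pow_int[symmetric])
      then show ?thesis using g by (intro bexI[of _ g]) (auto intro: ball_mono)
    next
      case False
      have "t [^] e t = t [^] (- int (nat \<bar>e t\<bar>))" using False by simp
      also have "\<dots> = inv (t [^] nat \<bar>e t\<bar>)" using tc by (intro int_pow_neg_int)
      finally have "\<Gamma> (Suc i) #> (t [^] e t) = \<Gamma> (Suc i) #> inv g"
        using Gamma_coset_inv_cong[OF _ gc g(2)] tc by simp
      then show ?thesis using I[OF g(1)] by (intro bexI[of _ "inv g"]) (auto intro: ball_mono)
    qed
    then obtain g' where g': "g' \<in> ball (D * q + I * (D * q))" "\<Gamma> (Suc i) #> (t [^] e t) = \<Gamma> (Suc i) #> g'" by blast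
    obtain f where f: "f \<in> ball (C * q)" "\<Gamma> (Suc i) #> pw ts e = \<Gamma> (Suc i) #> f" using C[OF q, of e] e by auto
    have "\<Gamma> (Suc i) #> pw (t # ts) e = \<Gamma> (Suc i) #> (g' \<otimes> f)"
      using g' f tc pw_closed[OF tc(2)] ball_carrier by (simp add: Gamma_coset_mult_cong)
    moreover have "g' \<otimes> f \<in> ball ((D + I * D + C) * q)"
      using ball_mult[OF g'(1) f(1)] by (simp add: algebra_simps)
    ultimately show ?thesis by blast
  qed
  then show ?case by blast
qed

lemma short_letters:
  "\<exists>C. \<forall>q\<ge>1. \<forall>L\<in>lists (Lt i). length L \<le> q ^ Suc i \<longrightarrow> (\<exists>g\<in>ball (C * q). \<Gamma> (Suc i) #> wval L = \<Gamma> (Suc i) #> g)"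
proof -
  obtain ts where ts: "distinct ts" "set ts = T i" by (rule enum_T)
  have tsc: "set ts \<subseteq> carrier G" using ts T_carrier[of i] by auto
  obtain C where C: "\<And>q e. q \<ge> 1 \<Longrightarrow> \<forall>t\<in>set ts. \<bar>e t\<bar> \<le> int (q ^ Suc i) \<Longrightarrow>
    \<exists>g\<in>ball (C * q). \<Gamma> (Suc i) #> pw ts e = \<Gamma> (Suc i) #> g"
    using short_power_product[of ts i] ts(2) by blast
  have "\<exists>g\<in>ball (C * q). \<Gamma> (Suc i) #> wval L = \<Gamma> (Suc i) #> g"
    if q: "q \<ge> 1" and L: "L \<in> lists (Lt i)" "length L \<le> q ^ Suc i" for q L
  proof -
    obtain n where n: "n \<in> \<Gamma> (Suc i)" "wval L = pw ts (es i L) \<otimes> n" using wval_mod[OF ts L(1)] by blast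
    have "\<bar>es i L t\<bar> \<le> int (q ^ Suc i)" for t
    proof -
      have "occ i t L \<le> length L" by (simp add: occ_def)
      then have "int (occ i t L) \<le> int (q ^ Suc i)" using L(2) by (simp del: power_Suc)
      then show ?thesis using es_occ[OF L(1), of i t] by linarith
    qed
    then show ?thesis using C[OF q, of "es i L"] Gamma_coset_absorb(1)[OF n(1) pw_closed[OF tsc]] n(2) by auto
  qed
  then show ?thesis by blast
qed

text \<open>A product of \<open>N\<close> elements of \<open>\<Gamma> i\<close> of length at most \<open>m\<close> agrees modulo \<open>\<Gamma> (i + 1)\<close> with an element of
  length \<open>O (q)\<close>, where \<open>q\<^sup>i\<^sup>+\<^sup>1 \<ge> K N m\<^sup>i\<^sup>+\<^sup>1\<close>.\<close>

theorem cheap_Gamma_product: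
  "\<exists>K C. \<forall>m\<ge>1. \<forall>q\<ge>1. \<forall>zs. set zs \<subseteq> \<Gamma> i \<inter> ball m \<longrightarrow> K * length zs * m ^ Suc i \<le> q ^ Suc i \<longrightarrow>
    (\<exists>g\<in>ball (C * q). \<Gamma> (Suc i) #> word_eval G zs = \<Gamma> (Suc i) #> g)"
proof -
  obtain K :: nat where K: "\<And>m h. m \<ge> 1 \<Longrightarrow> h \<in> \<Gamma> i \<inter> ball m \<Longrightarrow> \<exists>L\<in>lists (Lt i). (\<forall>l\<in>set L. lev l = i) \<and>
     length L \<le> K * m ^ Suc i \<and> \<Gamma> (Suc i) #> h = \<Gamma> (Suc i) #> wval L"
    using Gamma_size[of i] by blast
  obtain C where C: "\<And>q L. q \<ge> 1 \<Longrightarrow> L \<in> lists (Lt i) \<Longrightarrow> length L \<le> q ^ Suc i \<Longrightarrow>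
     \<exists>g\<in>ball (C * q). \<Gamma> (Suc i) #> wval L = \<Gamma> (Suc i) #> g" using short_letters[of i] by blast
  have merge: "\<exists>L\<in>lists (Lt i). length L \<le> length zs * (K * m ^ Suc i) \<and> \<Gamma> (Suc i) #> word_eval G zs = \<Gamma> (Suc i) #> wval L"
    if m: "m \<ge> 1" and zs: "set zs \<subseteq> \<Gamma> i \<inter> ball m" for m zs
    using zs
  proof (induction zs)
    case (Cons z zs)
    have sub: "set zs \<subseteq> \<Gamma> i \<inter> ball m" "z \<in> \<Gamma> i \<inter> ball m" using Cons.prems by auto
    obtain L where L: "L \<in> lists (Lt i)" "length L \<le> length zs * (K * m ^ Suc i)" "\<Gamma> (Suc i) #> word_eval G zs = \<Gamma> (Suc i) #> wval L"
      using Cons.IH[OF sub(1)] by blast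
    obtain M where M: "M \<in> lists (Lt i)" "length M \<le> K * m ^ Suc i" "\<Gamma> (Suc i) #> z = \<Gamma> (Suc i) #> wval M"
      using K[OF m sub(2)] by blast
    have "set zs \<subseteq> carrier G" "z \<in> carrier G" using sub Gamma_carrier by blast+
    then have "\<Gamma> (Suc i) #> (z \<otimes> word_eval G zs) = \<Gamma> (Suc i) #> (wval M \<otimes> wval L)"
      by (intro Gamma_coset_mult_cong M(3) L(3) word_eval_closed wval_closed[OF L(1)] wval_closed[OF M(1)])
    then have "\<Gamma> (Suc i) #> word_eval G (z # zs) = \<Gamma> (Suc i) #> wval (M @ L)"
      unfolding wval_append[OF M(1) L(1)] word_eval_Cons .
    moreover have "length (M @ L) \<le> length (z # zs) * (K * m ^ Suc i)" using L(2) M(2) by (simp del: power_Suc)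
    moreover have "M @ L \<in> lists (Lt i)" using L(1) M(1) by simp
    ultimately show ?case by blast
  next
    case Nil
    show ?case by (rule bexI[of _ "[]"]) simp_all
  qed
  have "\<exists>g\<in>ball (C * q). \<Gamma> (Suc i) #> word_eval G zs = \<Gamma> (Suc i) #> g"
    if mq: "m \<ge> 1" "q \<ge> 1" and zs: "set zs \<subseteq> \<Gamma> i \<inter> ball m" and le: "K * length zs * m ^ Suc i \<le> q ^ Suc i" for m q zs
  proof -
    obtain L where L: "L \<in> lists (Lt i)" "length L \<le> length zs * (K * m ^ Suc i)"
      "\<Gamma> (Suc i) #> word_eval G zs = \<Gamma> (Suc i) #> wval L" using merge[OF mq(1) zs] by blast
    have "length L \<le> q ^ Suc i" using L(2) le by (simp add: mult.commute mult.left_commute del: power_Suc)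
    then show ?thesis using C[OF mq(2) L(1)] L(3) by simp
  qed
  then show ?thesis by blast
qed

end

section \<open>The class-two quotient\<close>

context finite_index_pair
begin

definition K2 :: "'a set monoid" where "K2 = (G\<lparr>carrier := H\<rparr>) Mod \<Gamma> 2"

definition qt :: "'a \<Rightarrow> 'a set" where "qt x = \<Gamma> 2 #> x"

lemma group_K2: "group K2"
proof -
  have "\<Gamma> 2 \<lhd> G\<lparr>carrier := H\<rparr>"
    using normal_restrict_supergroup[OF H.subgroup_axioms Gamma_normal Gamma_H] .
  then show ?thesis unfolding K2_def by (rule normal.factorgroup_is_group)
qed

lemma qt_mult: "x \<in> carrier G \<Longrightarrow> y \<in> carrier G \<Longrightarrow> qt x \<otimes>\<^bsub>K2\<^esub> qt y = qt (x \<otimes> y)"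
  using normal.rcos_sum[OF Gamma_normal, of x y 2] by (simp add: K2_def qt_def)

lemma carrier_K2: "carrier K2 = qt ` H"
  by (auto simp: K2_def FactGroup_def RCOSETS_def qt_def)

lemma one_K2: "\<one>\<^bsub>K2\<^esub> = qt \<one>"
  using Gamma_H[of 2] H.subset by (simp add: K2_def qt_def)

lemma qt_in [simp]: "x \<in> H \<Longrightarrow> qt x \<in> carrier K2" by (simp add: carrier_K2)

lemma inv_K2: "x \<in> H \<Longrightarrow> inv\<^bsub>K2\<^esub> (qt x) = qt (inv x)"
proof -
  assume x: "x \<in> H"
  interpret K: group K2 by (rule group_K2)
  have "qt (inv x) \<otimes>\<^bsub>K2\<^esub> qt x = \<one>\<^bsub>K2\<^esub>" using x by (simp add: qt_mult one_K2)
  then show ?thesis using x by (intro K.inv_equality) simp_all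
qed

lemma commutator_K2: "x \<in> H \<Longrightarrow> y \<in> H \<Longrightarrow> commutator K2 (qt x) (qt y) = qt (commutator G x y)"
  by (simp add: commutator_def[of K2] inv_K2 qt_mult commutator_def[of G])

lemma qt_pow: "x \<in> H \<Longrightarrow> qt x [^]\<^bsub>K2\<^esub> (n::nat) = qt (x [^] n)"
  by (induction n) (simp_all add: one_K2 qt_mult)

lemma H_pow: "x \<in> H \<Longrightarrow> x [^] (n::nat) \<in> H"
  by (induction n) auto

lemma qt_word: "set xs \<subseteq> H \<Longrightarrow> word_eval K2 (map qt xs) = qt (word_eval G xs)"
proof (induction xs)
  case Nil
  then show ?case by (simp add: word_eval_def one_K2)
next
  case (Cons x xs)
  then have "word_eval G xs \<in> carrier G" by (intro word_eval_closed) auto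
  moreover have "word_eval K2 (map qt (x # xs)) = qt x \<otimes>\<^bsub>K2\<^esub> word_eval K2 (map qt xs)" by (simp add: word_eval_def)
  ultimately show ?case using Cons by (simp add: qt_mult)
qed

lemma class2_K2: "class2_group K2 loops (\<lambda>c. qt (loop_val c))"
proof -
  interpret K: group K2 by (rule group_K2)
  show ?thesis
  proof
    show "finite loops" by (rule finite_loops)
  next
    fix c assume "c \<in> loops"
    then show "qt (loop_val c) \<in> carrier K2" by (simp add: loop_val_H)
  next
    fix x y z assume "x \<in> carrier K2" "y \<in> carrier K2" "z \<in> carrier K2"
    then obtain a b d where abd: "a \<in> H" "b \<in> H" "d \<in> H" "x = qt a" "y = qt b" "z = qt d" by (auto simp: carrier_K2)
    let ?k = "commutator G a b"
    have k: "?k \<in> \<Gamma> 1" "?k \<in> H" using abd commutator_Gamma_H[of a 0 b] Gamma_H[of 1] by auto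
    have "commutator G ?k d \<in> \<Gamma> 2" using commutator_Gamma_H[OF k(1) abd(3)] by (simp add: numeral_2_eq_2)
    then have "qt (commutator G ?k d \<otimes> (d \<otimes> ?k)) = qt (d \<otimes> ?k)"
      unfolding qt_def using abd k by (intro Gamma_coset_absorb(2)) auto
    then have "qt (?k \<otimes> d) = qt (d \<otimes> ?k)" using commutator_swap[of ?k d] abd k by simp
    then show "commutator K2 x y \<otimes>\<^bsub>K2\<^esub> z = z \<otimes>\<^bsub>K2\<^esub> commutator K2 x y"
      using abd k by (simp add: commutator_K2 qt_mult)
  qed
qed

end

sublocale finite_index_pair \<subseteq> C2: class2_group K2 loops "\<lambda>c. qt (loop_val c)" loop_len
  by (rule class2_K2)

context finite_index_pair
begin

lemma pv_loops: "cs \<in> lists loops \<Longrightarrow> C2.pv cs = qt (loops_val cs)"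
proof -
  assume cs: "cs \<in> lists loops"
  have "C2.pv cs = word_eval K2 (map qt (map loop_val cs))" by (simp add: C2.pv_def comp_def)
  also have "\<dots> = qt (loops_val cs)" unfolding loops_val_def
    using cs by (intro qt_word) (auto simp: in_lists_conv_set loop_val_H)
  finally show ?thesis .
qed

lemma wlen_loops: "C2.wlen cs = loops_len cs"
  by (simp add: C2.wlen_def loops_len_def)

lemma bracket_loops: "a \<in> loops \<Longrightarrow> b \<in> loops \<Longrightarrow> C2.bracket (a, b) = qt (commutator G (loop_val a) (loop_val b))"
  by (simp add: C2.bracket_def commutator_K2 loop_val_H)

lemma bracket_power_ball:
  assumes "p \<in> loops \<times> loops"
  shows "\<exists>C. \<forall>q\<ge>1. \<forall>e. \<bar>e\<bar> \<le> int (q ^ 2) \<longrightarrow> (\<exists>g\<in>H \<inter> ball (C * q). C2.bracket p [^]\<^bsub>K2\<^esub> (e::int) = qt g)"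
proof -
  obtain a b where p: "p = (a, b)" "a \<in> loops" "b \<in> loops" using assms by (cases p) auto
  let ?t = "commutator G (loop_val a) (loop_val b)"
  have tH: "?t \<in> H" using p loop_val_H Gamma_H[of 1] commutator_Gamma_H[of "loop_val a" 0 "loop_val b"] by auto
  have "?t \<in> T 1" using p by (auto simp: T_Suc T.simps(1) One_nat_def[symmetric] simp del: One_nat_def intro!: T_Suc[of 0, simplified, THEN equalityD2, THEN subsetD])
  then obtain C where C: "\<And>q E. q \<ge> 1 \<Longrightarrow> E \<le> q ^ Suc 1 \<Longrightarrow> \<exists>g\<in>ball (C * q). \<Gamma> (Suc 1) #> (?t [^] (E::nat)) = \<Gamma> (Suc 1) #> g"
    using short_powers[of ?t 1] by blast
  obtain I where I: "\<And>n g. g \<in> ball n \<Longrightarrow> inv g \<in> ball (I * n)" using ball_inv by blast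
  have "\<exists>g\<in>H \<inter> ball ((C + I * C) * q). C2.bracket p [^]\<^bsub>K2\<^esub> e = qt g" if q: "q \<ge> 1" and e: "\<bar>e\<bar> \<le> int (q ^ 2)" for q e
  proof -
    have "nat \<bar>e\<bar> \<le> q ^ Suc 1" using e by (simp add: nat_le_iff power2_eq_square)
    then obtain g where g: "g \<in> ball (C * q)" "\<Gamma> (Suc 1) #> (?t [^] nat \<bar>e\<bar>) = \<Gamma> (Suc 1) #> g" using C[OF q] by blast
    have gc: "g \<in> carrier G" using g ball_carrier by blast
    have tp: "?t [^] nat \<bar>e\<bar> \<in> H" using tH by (rule H_pow)
    have "inv (?t [^] nat \<bar>e\<bar>) \<otimes> g \<in> H"
      using Gamma_coset_decomp[OF gc _ g(2)[symmetric]] tp Gamma_H[of "Suc 1"] by auto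
    then have "?t [^] nat \<bar>e\<bar> \<otimes> (inv (?t [^] nat \<bar>e\<bar>) \<otimes> g) \<in> H" using tp by blast
    then have gH: "g \<in> H" using tp gc by simp
    have qg: "qt (?t [^] nat \<bar>e\<bar>) = qt g" using g(2) by (simp add: qt_def numeral_2_eq_2)
    have bp: "C2.bracket p = qt ?t" using p bracket_loops by simp
    show ?thesis
    proof (cases "e \<ge> 0")
      case True
      then have "C2.bracket p [^]\<^bsub>K2\<^esub> e = C2.bracket p [^]\<^bsub>K2\<^esub> nat \<bar>e\<bar>" by (simp add: int_pow_int[symmetric])
      also have "\<dots> = qt g" unfolding bp using qt_pow[OF tH] qg by simp
      finally show ?thesis using gH g(1) by (intro bexI[of _ g]) (auto intro: ball_mono)
    next
      case False
      have "C2.bracket p [^]\<^bsub>K2\<^esub> e = C2.bracket p [^]\<^bsub>K2\<^esub> (- int (nat \<bar>e\<bar>))" using False by simp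
      also have "\<dots> = inv\<^bsub>K2\<^esub> (C2.bracket p [^]\<^bsub>K2\<^esub> nat \<bar>e\<bar>)" unfolding bp using tH by (intro C2.int_pow_neg_int) simp
      also have "\<dots> = qt (inv g)" unfolding bp using qt_pow[OF tH] qg gH by (simp add: inv_K2)
      finally have r: "C2.bracket p [^]\<^bsub>K2\<^esub> e = qt (inv g)" .
      have "inv g \<in> ball ((C + I * C) * q)" using I[OF g(1)] by (rule ball_mono) (simp add: algebra_simps)
      then show ?thesis using r gH by (intro bexI[of _ "inv g"]) auto
    qed
  qed
  then show ?thesis by blast
qed

text \<open>Since \<open>[a\<^sup>q, b\<^sup>q] = [a, b]\<^sup>q\<^sup>*\<^sup>q\<close>, central errors with exponents at most \<open>q\<^sup>2\<close> have length \<open>O (q)\<close>.\<close>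

lemma zeta_on_ball:
  assumes "set ps \<subseteq> loops \<times> loops"
  shows "\<exists>C. \<forall>q\<ge>1. \<forall>E. (\<forall>p. \<bar>E p\<bar> \<le> int (q ^ 2)) \<longrightarrow> (\<exists>g\<in>H \<inter> ball (C * q). C2.zeta_on ps E = qt g)"
  using assms
proof (induction ps)
  case Nil
  have "\<exists>g\<in>H \<inter> ball (0 * q). C2.zeta_on [] E = qt g" for q E
    using one_ball by (intro bexI[of _ \<one>]) (auto simp: one_K2)
  then show ?case by blast
next
  case (Cons p ps)
  have sub: "set ps \<subseteq> loops \<times> loops" "p \<in> loops \<times> loops" using Cons.prems by auto
  obtain C where C: "\<And>q E. q \<ge> 1 \<Longrightarrow> \<forall>p. \<bar>E p\<bar> \<le> int (q ^ 2) \<Longrightarrow> \<exists>g\<in>H \<inter> ball (C * q). C2.zeta_on ps E = qt g"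
    using Cons.IH[OF sub(1)] by blast
  obtain D where D: "\<And>q e. q \<ge> 1 \<Longrightarrow> \<bar>e\<bar> \<le> int (q ^ 2) \<Longrightarrow> \<exists>g\<in>H \<inter> ball (D * q). C2.bracket p [^]\<^bsub>K2\<^esub> (e::int) = qt g"
    using bracket_power_ball[OF sub(2)] by blast
  have "\<exists>g\<in>H \<inter> ball ((D + C) * q). C2.zeta_on (p # ps) E = qt g" if q: "q \<ge> 1" and E: "\<forall>p. \<bar>E p\<bar> \<le> int (q ^ 2)" for q E
  proof -
    obtain g where g: "g \<in> H" "g \<in> ball (C * q)" "C2.zeta_on ps E = qt g" using C[OF q E] by blast
    obtain f where f: "f \<in> H" "f \<in> ball (D * q)" "C2.bracket p [^]\<^bsub>K2\<^esub> E p = qt f" using D[OF q, of "E p"] E by blast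
    have "f \<otimes> g \<in> ball ((D + C) * q)" using ball_mult[OF f(2) g(2)] by (simp add: algebra_simps)
    moreover have "C2.zeta_on (p # ps) E = qt (f \<otimes> g)" using f g by (simp add: C2.zeta_on_Cons qt_mult)
    ultimately show ?thesis using f g by (intro bexI[of _ "f \<otimes> g"]) auto
  qed
  then show ?case by blast
qed

lemma Bl_realise: "\<exists>R. \<forall>x\<in>C2.Bl C. \<exists>h\<in>H \<inter> ball R. x = qt h"
proof -
  have "\<forall>x\<in>C2.Bl C. \<exists>h. h \<in> H \<and> x = qt h" using C2.Bl_carrier[of C] by (auto simp: carrier_K2)
  then obtain f where f: "\<And>x. x \<in> C2.Bl C \<Longrightarrow> f x \<in> H \<and> x = qt (f x)" by metis
  have "finite (f ` C2.Bl C)" using C2.finite_Bl by simp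
  moreover have "f ` C2.Bl C \<subseteq> carrier G" using f by auto
  ultimately obtain R where "f ` C2.Bl C \<subseteq> ball R" using finite_in_ball by blast
  then show ?thesis using f by blast
qed

text \<open>A run of a loop \<open>c = (p, a)\<close> is read as \<open>p a\<^sup>t p\<^sup>-\<^sup>1\<close>, so a twisted run costs its weighted length
  up to a constant.\<close>

lemma tval_realise:
  "\<exists>R. \<forall>its\<in>lists (C2.titems (C2.Bl C)).
     \<exists>g\<in>H \<inter> ball ((\<Sum>c\<in>loops. loop_len c * C2.tcnt its c) + length its * R). C2.tval its = qt g"
proof -
  obtain R0 where R0: "\<And>x. x \<in> C2.Bl C \<Longrightarrow> \<exists>h\<in>H \<inter> ball R0. x = qt h" using Bl_realise[of C] by blast
  obtain I where I: "\<And>n g. g \<in> ball n \<Longrightarrow> inv g \<in> ball (I * n)" using ball_inv by blast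
  let ?m = "card (rcosets H)"
  define R where "R = R0 + ?m + I * ?m + I * R0"
  have "\<exists>g\<in>H \<inter> ball ((\<Sum>c\<in>loops. loop_len c * C2.tcnt its c) + length its * R). C2.tval its = qt g"
    if "its \<in> lists (C2.titems (C2.Bl C))" for its
    using that
  proof (induction its)
    case Nil
    then show ?case using one_ball by (intro bexI[of _ \<one>]) (auto simp: one_K2)
  next
    case (Cons it its)
    obtain x c t where it: "it = (x, c, t)" by (cases it)
    have xc: "x \<in> C2.Bl C" "c \<in> loops" using Cons.hyps it by (auto simp: C2.titems_def)
    obtain g where g: "g \<in> H" "g \<in> ball ((\<Sum>c\<in>loops. loop_len c * C2.tcnt its c) + length its * R)" "C2.tval its = qt g"
      using Cons.IH by blast
    obtain h where h: "h \<in> H" "h \<in> ball R0" "x = qt h" using R0[OF xc(1)] by blast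
    note lr = loop_realise[OF xc(2)]
    have lv: "loop_val c \<in> H" by (rule loop_val_H[OF xc(2)])
    let ?p = "word_eval G (fst c)" and ?a = "word_eval G (snd c)"
    have pc: "?p \<in> carrier G" "?a \<in> carrier G" using lr(1,2) eval_closed by auto
    have pb: "?p \<in> ball ?m" using eval_ball[OF lr(1)] lr(3) ball_mono by simp
    have ab: "?a [^] t \<in> ball (t * loop_len c)" using ball_pow[OF eval_ball[OF lr(2)]] by (simp add: loop_len_def)
    let ?y = "h \<otimes> (?p \<otimes> ?a [^] t \<otimes> inv ?p) \<otimes> inv h"
    have yb: "?y \<in> ball (R0 + (?m + t * loop_len c + I * ?m) + I * R0)" by (intro ball_mult I h pb ab)
    have pa: "?p \<otimes> ?a [^] t \<otimes> inv ?p = loop_val c [^] t" using lr(4)[of t] pc lv by (simp add: m_assoc)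
    have lt: "loop_val c [^] t \<in> H" using lv by (rule H_pow)
    have yH: "?y \<in> H" unfolding pa using h lt by simp
    have "C2.tval (it # its) = qt ?y \<otimes>\<^bsub>K2\<^esub> qt g"
      unfolding it pa using g h lt lv by (simp add: qt_pow inv_K2 qt_mult)
    then have 1: "C2.tval (it # its) = qt (?y \<otimes> g)" using yH g by (simp add: qt_mult)
    have "(\<Sum>d\<in>loops. loop_len d * C2.tcnt (it # its) d)
        = (\<Sum>d\<in>loops. (if c = d then loop_len d * t else 0) + loop_len d * C2.tcnt its d)"
      unfolding it by (rule sum.cong) (auto simp: algebra_simps)
    also have "\<dots> = loop_len c * t + (\<Sum>d\<in>loops. loop_len d * C2.tcnt its d)"
      using finite_loops xc(2) by (simp add: sum.distrib)
    finally have s: "(\<Sum>d\<in>loops. loop_len d * C2.tcnt (it # its) d) = loop_len c * t + (\<Sum>d\<in>loops. loop_len d * C2.tcnt its d)" .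
    have "?y \<otimes> g \<in> ball ((R0 + (?m + t * loop_len c + I * ?m) + I * R0) + ((\<Sum>c\<in>loops. loop_len c * C2.tcnt its c) + length its * R))"
      by (rule ball_mult[OF yb g(2)])
    then have "?y \<otimes> g \<in> ball ((\<Sum>d\<in>loops. loop_len d * C2.tcnt (it # its) d) + length (it # its) * R)"
      by (rule ball_mono) (simp add: s R_def algebra_simps)
    then show ?case using 1 yH g by (intro bexI[of _ "?y \<otimes> g"]) auto
  qed
  then show ?thesis by blast
qed

lemma ball_word: "g \<in> ball n \<Longrightarrow> \<exists>w\<in>lists S. word_eval G w = g \<and> length w \<le> n"
  by (auto simp: ball_def)

lemma sqrt_tradeoff:
  fixes D k :: real
  assumes "0 \<le> D" "0 \<le> k"
  shows "D * sqrt k \<le> k / 2 + D ^ 2 / 2"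
proof -
  have "0 \<le> (sqrt k - D) ^ 2" by simp
  also have "\<dots> = k - 2 * D * sqrt k + D ^ 2" using assms by (simp add: power2_diff)
  finally show ?thesis by simp
qed

text \<open>The saving \<open>k\<close> dominates the cost \<open>O (\<surd>k)\<close> of the remaining central error.\<close>

theorem class2_saving:
  "\<exists>C::nat. \<forall>w\<in>lists S. \<forall>cs u ws t. word_eval G w = loops_val cs \<otimes> word_eval G u \<longrightarrow> length w = loops_len cs + length u \<longrightarrow>
     u \<in> lists S \<longrightarrow> cs = concat ws @ t \<longrightarrow> set ws \<subseteq> lists loops \<longrightarrow> t \<in> lists loops \<longrightarrow> (\<forall>b\<in>set ws. C2.nonopt b) \<longrightarrow>
     (\<exists>w'\<in>lists S. \<Gamma> 2 #> word_eval G w' = \<Gamma> 2 #> word_eval G w \<and> real (length w') + real (length ws) / 2 \<le> real (length w) + real C)"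
proof -
  obtain C where C: "\<And>ws t. set ws \<subseteq> lists loops \<Longrightarrow> t \<in> lists loops \<Longrightarrow> \<forall>b\<in>set ws. C2.nonopt b \<Longrightarrow>
    \<exists>its E. its \<in> lists (C2.titems (C2.Bl C)) \<and> length its \<le> C \<and>
       (\<Sum>c\<in>loops. loop_len c * C2.tcnt its c) + length ws \<le> C2.wlen (concat ws @ t) \<and>
       C2.pv (concat ws @ t) = C2.tval its \<otimes>\<^bsub>K2\<^esub> C2.zeta E \<and> (\<forall>p. \<bar>E p\<bar> \<le> int (C * length ws))"
    using C2.class2_reduction by blast
  obtain R where R: "\<And>its. its \<in> lists (C2.titems (C2.Bl C)) \<Longrightarrow>
     \<exists>g\<in>H \<inter> ball ((\<Sum>c\<in>loops. loop_len c * C2.tcnt its c) + length its * R). C2.tval its = qt g"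
    using tval_realise[of C] by blast
  have "set C2.pairs \<subseteq> loops \<times> loops" using C2.pairs(2) by simp
  then obtain D where D: "\<And>q E. q \<ge> 1 \<Longrightarrow> \<forall>p. \<bar>E p\<bar> \<le> int (q ^ 2) \<Longrightarrow> \<exists>g\<in>H \<inter> ball (D * q). C2.zeta E = qt g"
    using zeta_on_ball[of C2.pairs] unfolding C2.zeta_def by blast
  define W where "W = nat \<lceil>(real D * sqrt (real C)) ^ 2 / 2\<rceil>"
  have W: "(real D * sqrt (real C)) ^ 2 / 2 \<le> real W" unfolding W_def by (rule real_nat_ceiling_ge)
  define F where "F = C * R + D * 2 + W"
  have "\<exists>w'\<in>lists S. \<Gamma> 2 #> word_eval G w' = \<Gamma> 2 #> word_eval G w \<and> real (length w') + real (length ws) / 2 \<le> real (length w) + real F"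
    if w: "w \<in> lists S" "word_eval G w = loops_val cs \<otimes> word_eval G u" "length w = loops_len cs + length u" "u \<in> lists S"
     and cs: "cs = concat ws @ t" "set ws \<subseteq> lists loops" "t \<in> lists loops" "\<forall>b\<in>set ws. C2.nonopt b" for w cs u ws t
  proof -
    let ?k = "length ws"
    obtain its E where its: "its \<in> lists (C2.titems (C2.Bl C))" "length its \<le> C"
       "(\<Sum>c\<in>loops. loop_len c * C2.tcnt its c) + ?k \<le> loops_len cs"
       "C2.pv cs = C2.tval its \<otimes>\<^bsub>K2\<^esub> C2.zeta E" "\<And>p. \<bar>E p\<bar> \<le> int (C * ?k)"
      using C[OF cs(2-4)] unfolding cs(1) wlen_loops by blast
    have csl: "cs \<in> lists loops" unfolding cs(1) using cs(2,3) by (auto simp: in_lists_conv_set)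
    define q where "q = nat \<lceil>sqrt (real (C * ?k))\<rceil> + 1"
    have "0 \<le> sqrt (real (C * ?k))" by simp
    then have qs: "sqrt (real (C * ?k)) \<le> real q" "real q \<le> sqrt (real (C * ?k)) + 2" unfolding q_def by linarith+
    have "real (C * ?k) \<le> real q ^ 2" using qs(1) by (metis real_sqrt_ge_zero real_sqrt_pow2 of_nat_0_le_iff power_mono)
    then have "C * ?k \<le> q ^ 2" by (metis of_nat_le_iff of_nat_power)
    then have "int (C * ?k) \<le> int (q ^ 2)" by (simp only: of_nat_le_iff)
    then have "\<forall>p. \<bar>E p\<bar> \<le> int (q ^ 2)" using its(5) order_trans by blast
    then obtain z where z: "z \<in> H" "z \<in> ball (D * q)" "C2.zeta E = qt z" using D[of q E] by (auto simp: q_def)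
    obtain g where g: "g \<in> H" "g \<in> ball ((\<Sum>c\<in>loops. loop_len c * C2.tcnt its c) + length its * R)" "C2.tval its = qt g"
      using R[OF its(1)] by blast
    have "g \<otimes> z \<in> ball (((\<Sum>c\<in>loops. loop_len c * C2.tcnt its c) + length its * R) + D * q)"
      by (rule ball_mult[OF g(2) z(2)])
    from ball_word[OF this] obtain v where v: "v \<in> lists S" "word_eval G v = g \<otimes> z"
      "length v \<le> ((\<Sum>c\<in>loops. loop_len c * C2.tcnt its c) + length its * R) + D * q" by blast
    have "qt (loops_val cs) = qt g \<otimes>\<^bsub>K2\<^esub> qt z" using its(4) g(3) z(3) pv_loops[OF csl] by metis
    also have "\<dots> = qt (g \<otimes> z)" using g(1) z(1) by (intro qt_mult) auto
    finally have "qt (loops_val cs) = qt (g \<otimes> z)" .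
    then have gz: "\<Gamma> 2 #> word_eval G v = \<Gamma> 2 #> loops_val cs" unfolding qt_def v(2) by (rule sym)
    have "\<Gamma> 2 #> (word_eval G v \<otimes> word_eval G u) = \<Gamma> 2 #> (loops_val cs \<otimes> word_eval G u)"
      by (intro Gamma_coset_mult_cong gz refl eval_closed v(1) w(4) H_carrier loops_val_H csl)
    then have "\<Gamma> 2 #> word_eval G (v @ u) = \<Gamma> 2 #> word_eval G w"
      unfolding eval_append[OF v(1) w(4)] w(2) .
    moreover have "real (length (v @ u)) + real ?k / 2 \<le> real (length w) + real F"
    proof -
      have "length its * R \<le> C * R" using its(2) by (rule mult_right_mono) simp
      then have "length v + ?k \<le> loops_len cs + C * R + D * q" using v(3) its(3) by linarith
      then have "real (length v + ?k) \<le> real (loops_len cs + C * R + D * q)" by (simp only: of_nat_le_iff)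
      then have 1: "real (length v) + real ?k \<le> real (loops_len cs) + real (C * R) + real D * real q" by simp
      have "real D * real q \<le> real D * (sqrt (real (C * ?k)) + 2)" using qs(2) by (rule mult_left_mono) simp
      also have "\<dots> = (real D * sqrt (real C)) * sqrt (real ?k) + real (D * 2)" by (simp add: real_sqrt_mult algebra_simps)
      also have "(real D * sqrt (real C)) * sqrt (real ?k) \<le> real ?k / 2 + (real D * sqrt (real C)) ^ 2 / 2"
        by (rule sqrt_tradeoff) auto
      finally have "real D * real q \<le> real ?k / 2 + (real D * sqrt (real C)) ^ 2 / 2 + real (D * 2)" by simp
      moreover have "real F = real (C * R) + real (D * 2) + real W" by (simp add: F_def)
      moreover have "real (length (v @ u)) = real (length v) + real (length u)" "real (length w) = real (loops_len cs) + real (length u)"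
        using w(3) by auto
      ultimately show ?thesis using 1 W by linarith
    qed
    ultimately show ?thesis using v(1) w(4) by (intro bexI[of _ "v @ u"]) auto
  qed
  then show ?thesis by (intro exI[of _ F]) blast
qed

end

section \<open>The polytope of simple cycles\<close>

locale projected_pair = nilpotent_pair +
  fixes \<phi> :: "'a set \<Rightarrow> real ^ 'd"
  assumes phi: "\<phi> \<in> iso (abelianization G H) (int_lattice :: (real ^ 'd) monoid)"
begin

definition pr :: "'a \<Rightarrow> real ^ 'd" where "pr h = ab_proj G H \<phi> h"

lemmas ab_props = ab_proj_props[OF group_axioms normal_H phi, folded pr_def]

lemma pr_image: "pr ` H = {v. \<forall>i. v $ i \<in> \<int>}"
proof -
  have "pr = ab_proj G H \<phi>" by (rule ext) (simp add: pr_def)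
  then show ?thesis using ab_proj_props(2)[OF group_axioms normal_H phi] by simp
qed

lemma pr_mult: "x \<in> H \<Longrightarrow> y \<in> H \<Longrightarrow> pr (x \<otimes> y) = pr x + pr y" by (rule ab_props(1))

lemma pr_one [simp]: "pr \<one> = 0"
  using pr_mult[of \<one> \<one>] by simp

lemma pr_inv: "x \<in> H \<Longrightarrow> pr (inv x) = - pr x"
  using pr_mult[of "inv x" x] by (simp add: eq_neg_iff_add_eq_0)

lemma pr_zero_iff: "x \<in> H \<Longrightarrow> pr x = 0 \<longleftrightarrow> x \<in> isolator G H"
  using ab_props(3)[of x \<one>] by simp

lemma derived_Gamma: "derived G H = \<Gamma> 1"
  by (simp add: derived_def lower_central.simps)

lemma pr_zero_torsion:
  assumes "x \<in> H" "pr x = 0"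
  shows "\<exists>n::nat. n > 0 \<and> x [^] n \<in> \<Gamma> 1"
  using assms pr_zero_iff[of x] by (auto simp: isolator_def derived_Gamma)

lemma pr_Gamma: "x \<in> \<Gamma> 1 \<Longrightarrow> pr x = 0"
proof -
  assume x: "x \<in> \<Gamma> 1"
  then have xH: "x \<in> H" using Gamma_H[of 1] by blast
  have "x [^] (1::nat) \<in> derived G H" using x xH by (simp add: derived_Gamma)
  then have "x \<in> isolator G H" unfolding isolator_def using xH by blast
  then show ?thesis using pr_zero_iff xH by simp
qed

lemma pr_coset: "x \<in> H \<Longrightarrow> y \<in> H \<Longrightarrow> \<Gamma> 1 #> x = \<Gamma> 1 #> y \<Longrightarrow> pr x = pr y"
proof -
  assume *: "x \<in> H" "y \<in> H" "\<Gamma> 1 #> x = \<Gamma> 1 #> y"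
  then have "x \<otimes> inv y \<in> \<Gamma> 1" using Gamma_coset_eq_iff by auto
  then have "pr (x \<otimes> inv y) = 0" by (rule pr_Gamma)
  then show ?thesis using * by (simp add: pr_mult pr_inv)
qed

lemma coset1_commute:
  assumes "x \<in> H" "y \<in> H"
  shows "\<Gamma> 1 #> (x \<otimes> y) = \<Gamma> 1 #> (y \<otimes> x)"
proof -
  have "commutator G x y \<in> \<Gamma> 1" using commutator_Gamma_H[of x 0 y] assms by simp
  then show ?thesis using commutator_swap[of x y] Gamma_coset_absorb(2)[of "commutator G x y" 1 "y \<otimes> x"] assms by simp
qed

lemma coset1_cong:
  assumes "x \<in> H" "y \<in> H" "x' \<in> H" "y' \<in> H" "\<Gamma> 1 #> x = \<Gamma> 1 #> x'" "\<Gamma> 1 #> y = \<Gamma> 1 #> y'"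
  shows "\<Gamma> 1 #> (x \<otimes> y) = \<Gamma> 1 #> (x' \<otimes> y')"
  using assms by (intro Gamma_coset_mult_cong) auto

lemma word_H: "set xs \<subseteq> H \<Longrightarrow> word_eval G xs \<in> H"
  by (induction xs) auto

lemma coset1_word_perm:
  "set xs \<subseteq> H \<Longrightarrow> mset xs = mset ys \<Longrightarrow> \<Gamma> 1 #> word_eval G xs = \<Gamma> 1 #> word_eval G ys"
proof (induction xs arbitrary: ys)
  case Nil
  then show ?case by simp
next
  case (Cons x xs)
  then have "x \<in># mset ys" by (metis list.set_intros(1) set_mset_mset)
  then obtain us vs where ys: "ys = us @ x # vs" by (metis set_mset_mset split_list)
  have sub: "set ys \<subseteq> H" using Cons.prems by (metis set_mset_mset)
  have u: "word_eval G us \<in> H" "word_eval G vs \<in> H" "x \<in> H" "set us \<subseteq> carrier G" "set vs \<subseteq> carrier G"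
    using sub ys H_carrier by (auto intro!: word_H)
  have "mset xs = mset (us @ vs)" using Cons.prems ys by simp
  then have IH: "\<Gamma> 1 #> word_eval G xs = \<Gamma> 1 #> word_eval G (us @ vs)" using Cons by simp
  have xsH: "word_eval G xs \<in> H" using Cons.prems by (intro word_H) auto
  have "\<Gamma> 1 #> (x \<otimes> word_eval G xs) = \<Gamma> 1 #> (x \<otimes> (word_eval G us \<otimes> word_eval G vs))"
    using IH u xsH by (intro coset1_cong) (auto simp: word_eval_append)
  also have "x \<otimes> (word_eval G us \<otimes> word_eval G vs) = (x \<otimes> word_eval G us) \<otimes> word_eval G vs" using u by (simp add: m_assoc)
  also have "\<Gamma> 1 #> \<dots> = \<Gamma> 1 #> ((word_eval G us \<otimes> x) \<otimes> word_eval G vs)"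
    by (rule coset1_cong) (use u coset1_commute[of x "word_eval G us"] in simp_all)
  also have "(word_eval G us \<otimes> x) \<otimes> word_eval G vs = word_eval G ys"
    unfolding ys using u by (simp add: word_eval_append m_assoc)
  finally show ?case by simp
qed

text \<open>Words over finitely many torsion elements of \<open>H / \<Gamma> 1\<close> represent finitely many classes: in a shortest
  word no letter occurs more often than its order.\<close>

lemma torsion_words_bounded:
  assumes "finite X" "X \<subseteq> H" "\<And>x. x \<in> X \<Longrightarrow> \<exists>n::nat. n > 0 \<and> x [^] n \<in> \<Gamma> 1"
  shows "\<exists>b. \<forall>xs\<in>lists X. \<exists>ys\<in>lists X. length ys \<le> b \<and> \<Gamma> 1 #> word_eval G xs = \<Gamma> 1 #> word_eval G ys"
proof -
  obtain od where od: "\<And>x. x \<in> X \<Longrightarrow> (od x :: nat) > 0" "\<And>x. x \<in> X \<Longrightarrow> x [^] od x \<in> \<Gamma> 1" using assms(3) by metis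
  have "\<exists>ys\<in>lists X. length ys \<le> (\<Sum>x\<in>X. od x) \<and> \<Gamma> 1 #> word_eval G xs = \<Gamma> 1 #> word_eval G ys" if "xs \<in> lists X" for xs
    using that
  proof (induction "length xs" arbitrary: xs rule: less_induct)
    case less
    show ?case
    proof (cases "\<forall>x\<in>X. count_list xs x \<le> od x")
      case True
      have "length xs = (\<Sum>x\<in>X. count_list xs x)"
        using sum_count_set[of xs X] less.prems assms(1) by (auto simp: in_lists_conv_set subset_iff)
      also have "\<dots> \<le> (\<Sum>x\<in>X. od x)" using True by (intro sum_mono) auto
      finally show ?thesis using less.prems by blast
    next
      case False
      then obtain x where x: "x \<in> X" "od x < count_list xs x" by (auto simp: not_le)
      have "mset (replicate (od x) x) \<subseteq># mset xs"
        using x by (simp add: count_mset count_le_replicate_mset_subset_eq[symmetric])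
      then obtain M where M: "mset xs = mset (replicate (od x) x) + M" by (metis subset_mset.le_iff_add)
      obtain zs where zs: "mset zs = M" using ex_mset by blast
      have m: "mset xs = mset (replicate (od x) x @ zs)" using M zs by simp
      then have zl: "zs \<in> lists X" using less.prems by (metis Un_subset_iff in_lists_conv_set set_append set_mset_mset subset_code(1))
      have "length xs = od x + length zs" using arg_cong[OF m, of size] by simp
      then have "length zs < length xs" using od(1)[OF x(1)] by simp
      then obtain ys where ys: "ys \<in> lists X" "length ys \<le> (\<Sum>x\<in>X. od x)" "\<Gamma> 1 #> word_eval G zs = \<Gamma> 1 #> word_eval G ys"
        using less.hyps zl by blast
      have xH: "x \<in> H" "set xs \<subseteq> H" "set zs \<subseteq> H" using x assms(2) less.prems zl by (auto simp: in_lists_conv_set)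
      have "\<Gamma> 1 #> word_eval G xs = \<Gamma> 1 #> word_eval G (replicate (od x) x @ zs)" by (rule coset1_word_perm[OF xH(2) m])
      also have "word_eval G (replicate (od x) x @ zs) = x [^] od x \<otimes> word_eval G zs"
        using xH by (subst word_eval_append) (auto simp: word_eval_replicate)
      also have "\<Gamma> 1 #> \<dots> = \<Gamma> 1 #> word_eval G zs" using od(2)[OF x(1)] word_H[OF xH(3)] by (intro Gamma_coset_absorb(2)) auto
      finally show ?thesis using ys by auto
    qed
  qed
  then show ?thesis by blast
qed

text \<open>The classes in question form the torsion subgroup of the finitely generated abelian group \<open>H / \<Gamma> 1\<close>. In terms
  of exponents of the loop values, the kernel of \<open>pr\<close> is a lattice, so finitely many torsion elements generate it.\<close>

lemma finite_torsion:
  "\<exists>D\<subseteq>H. finite D \<and> (\<forall>h\<in>H. pr h = 0 \<longrightarrow> (\<exists>d\<in>D. \<Gamma> 1 #> h = \<Gamma> 1 #> d))"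
proof (cases "c = 0")
  case True
  then have "H = {\<one>}" using nilp by simp
  then show ?thesis by (intro exI[of _ H]) auto
next
  case False
  obtain ts where ts: "distinct ts" "set ts = T 0" by (rule enum_T)
  have tsc: "set ts \<subseteq> carrier G" "set ts \<subseteq> T 0" using ts T_carrier[of 0] by auto
  have c0: "0 < c" using False by simp
  have S0: "Suc 0 = (1::nat)" by simp
  have wH: "wval L \<in> H" if "L \<in> lists (Lt 0)" for L using wval_Gamma[OF that] by simp
  have md: "\<Gamma> 1 #> wval L = \<Gamma> 1 #> pw ts (es 0 L)" if L: "L \<in> lists (Lt 0)" for L
  proof -
    obtain n where "n \<in> \<Gamma> (Suc 0)" "wval L = pw ts (es 0 L) \<otimes> n" using wval_mod[OF ts L] by blast
    then show ?thesis using Gamma_coset_absorb(1)[of n 1 "pw ts (es 0 L)"] pw_closed[OF tsc(1)] by simp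
  qed
  note exp = ex_props[OF c0 tsc(2)]
  have pwH: "pw ts e \<in> H" for e using wH[OF exp(1)[of e]] exp(2) by simp
  have two: "\<Gamma> 1 #> (pw ts e \<otimes> pw ts f) = \<Gamma> 1 #> pw ts (\<lambda>t. e t + f t)" for e f
  proof -
    have L: "ex 0 ts e @ ex 0 ts f \<in> lists (Lt 0)" using exp(1) by simp
    have "wval (ex 0 ts e @ ex 0 ts f) = pw ts e \<otimes> pw ts f"
      using wval_append[of "ex 0 ts e" 0 "ex 0 ts f"] exp(1,2) by simp
    moreover have "pw ts (es 0 (ex 0 ts e @ ex 0 ts f)) = pw ts (\<lambda>t. e t + f t)"
      using exp(3)[OF ts(1)] by (intro pw_cong) simp
    ultimately show ?thesis using md[OF L] by simp
  qed
  have prp: "pr (pw ts (\<lambda>t. e t + f t)) = pr (pw ts e) + pr (pw ts f)" for e f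
    using pr_coset[OF _ pwH two[of e f]] pwH pr_mult by simp
  define \<Lambda> where "\<Lambda> = {e. (\<forall>t. t \<notin> T 0 \<longrightarrow> e t = 0) \<and> pr (pw ts e) = 0}"
  have add: "(\<lambda>t. e t + f t) \<in> \<Lambda>" if "e \<in> \<Lambda>" "f \<in> \<Lambda>" for e f using that prp[of e f] by (simp add: \<Lambda>_def)
  have minus: "(\<lambda>t. - e t) \<in> \<Lambda>" if "e \<in> \<Lambda>" for e
    using that prp[of e "\<lambda>t. - e t"] pw_zero[OF tsc(1)] by (simp add: \<Lambda>_def)
  have supp: "e t = 0" if "e \<in> \<Lambda>" "t \<notin> T 0" for e t using that unfolding \<Lambda>_def by blast
  have "\<exists>Bs C. finite Bs \<and> Bs \<subseteq> \<Lambda> \<and> (\<forall>e\<in>\<Lambda>. \<exists>bs. set bs \<subseteq> Bs \<and> (\<forall>t. e t = (\<Sum>b\<leftarrow>bs. b t)) \<and>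
    int (length bs) \<le> int C * (\<Sum>t\<in>T 0. \<bar>e t\<bar>))"
    by (rule undistorted_lattice[OF finite_T[of 0], of \<Lambda>]) (erule (1) supp, erule (1) add, erule minus)
  then obtain Bs C where BC: "finite Bs" "Bs \<subseteq> \<Lambda>"
    "\<forall>e\<in>\<Lambda>. \<exists>bs. set bs \<subseteq> Bs \<and> (\<forall>t. e t = (\<Sum>b\<leftarrow>bs. b t)) \<and> int (length bs) \<le> int C * (\<Sum>t\<in>T 0. \<bar>e t\<bar>)"
    by (elim exE conjE)
  let ?X = "pw ts ` Bs"
  have X: "finite ?X" "?X \<subseteq> H" using BC(1) pwH by auto
  have Xt: "\<exists>n::nat. n > 0 \<and> x [^] n \<in> \<Gamma> 1" if "x \<in> ?X" for x
    using that BC(2) pr_zero_torsion pwH unfolding \<Lambda>_def by blast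
  obtain b where b: "\<And>xs. xs \<in> lists ?X \<Longrightarrow> \<exists>ys\<in>lists ?X. length ys \<le> b \<and> \<Gamma> 1 #> word_eval G xs = \<Gamma> 1 #> word_eval G ys"
    using torsion_words_bounded[OF X Xt] by blast
  define D where "D = word_eval G ` {ys. set ys \<subseteq> ?X \<and> length ys \<le> b}"
  have finD: "finite D" unfolding D_def using finite_lists_length_le[OF X(1)] by blast
  have DH: "D \<subseteq> H" unfolding D_def using X(2) word_H by blast
  have "\<exists>d\<in>D. \<Gamma> 1 #> h = \<Gamma> 1 #> d" if h: "h \<in> H" "pr h = 0" for h
  proof -
    obtain L where L: "L \<in> lists (Lt 0)" "wval L = h" using Gamma_letters[of h 0] h by auto
    define e where "e t = (if t \<in> T 0 then es 0 L t else 0)" for t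
    have pe: "pw ts (es 0 L) = pw ts e" by (rule pw_cong) (simp add: e_def ts(2))
    have he: "\<Gamma> 1 #> h = \<Gamma> 1 #> pw ts e" using md[OF L(1)] L(2) pe by simp
    have "e \<in> \<Lambda>" using pr_coset[OF h(1) pwH he] h(2) by (simp add: \<Lambda>_def e_def)
    then obtain bs where bs: "set bs \<subseteq> Bs" "\<And>t. e t = (\<Sum>b\<leftarrow>bs. b t)" using BC(3) by blast
    let ?M = "concat (map (ex 0 ts) bs)"
    have M: "?M \<in> lists (Lt 0)" "wval ?M = word_eval G (map (pw ts) bs)"
      using wval_concat[of bs "ex 0 ts" 0] exp(1,2) by auto
    have "pw ts (es 0 ?M) = pw ts e"
    proof (rule pw_cong)
      fix t assume t: "t \<in> set ts"
      show "es 0 ?M t = e t" unfolding es_concat bs(2) using exp(3)[OF ts(1) t] by simp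
    qed
    then have 1: "\<Gamma> 1 #> h = \<Gamma> 1 #> word_eval G (map (pw ts) bs)" using md[OF M(1)] M(2) he by simp
    have "map (pw ts) bs \<in> lists ?X" using bs(1) by (auto simp: in_lists_conv_set)
    then obtain ys where ys: "ys \<in> lists ?X" "length ys \<le> b" "\<Gamma> 1 #> word_eval G (map (pw ts) bs) = \<Gamma> 1 #> word_eval G ys"
      using b by blast
    have "word_eval G ys \<in> D" unfolding D_def using ys(1,2) by (auto simp: in_lists_conv_set)
    then show ?thesis using 1 ys(3) by auto
  qed
  then show ?thesis using finD DH by blast
qed

lemma finite_integer_box: "finite {v :: real ^ 'd. (\<forall>i. v $ i \<in> \<int>) \<and> norm v \<le> r}"
proof (rule finite_subset)
  let ?I = "(of_int ` {- \<lceil>r\<rceil>..\<lceil>r\<rceil>}) :: real set"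
  show "{v :: real ^ 'd. (\<forall>i. v $ i \<in> \<int>) \<and> norm v \<le> r} \<subseteq> (\<lambda>f. \<chi> i. f i) ` (UNIV \<rightarrow>\<^sub>E ?I)"
  proof clarify
    fix v :: "real ^ 'd" assume v: "\<forall>i. v $ i \<in> \<int>" "norm v \<le> r"
    have "v $ i \<in> ?I" for i
    proof -
      obtain z where z: "v $ i = of_int z" using v(1) by (meson Ints_cases)
      have "\<bar>v $ i\<bar> \<le> r" using component_le_norm_cart[of v i] v(2) by linarith
      then have "\<bar>real_of_int z\<bar> \<le> r" using z by simp
      then have "z \<in> {- \<lceil>r\<rceil>..\<lceil>r\<rceil>}" by (simp add: abs_le_iff le_ceiling_iff) linarith
      then show ?thesis using z by blast
    qed
    then have "(\<lambda>i. v $ i) \<in> UNIV \<rightarrow>\<^sub>E ?I" by auto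
    moreover have "v = (\<chi> i. v $ i)" by simp
    ultimately show "v \<in> (\<lambda>f. \<chi> i. f i) ` (UNIV \<rightarrow>\<^sub>E ?I)" by blast
  qed
  show "finite ((\<lambda>f. \<chi> i. f i) ` (UNIV \<rightarrow>\<^sub>E ?I))" by (intro finite_imageI finite_PiE) auto
qed

text \<open>Finitely many integer points of norm at most \<open>r\<close> times finitely many torsion classes leave finitely many
  classes modulo \<open>\<Gamma> 1\<close>.\<close>

lemma near_origin_cheap:
  "\<exists>b. \<forall>h\<in>H. norm (pr h) \<le> r \<longrightarrow> (\<exists>cs\<in>lists loops. loops_len cs \<le> b \<and> \<Gamma> 1 #> h = \<Gamma> 1 #> loops_val cs)"
proof -
  obtain D where D: "D \<subseteq> H" "finite D" "\<And>h. h \<in> H \<Longrightarrow> pr h = 0 \<Longrightarrow> \<exists>d\<in>D. \<Gamma> 1 #> h = \<Gamma> 1 #> d"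
    using finite_torsion by blast
  let ?V = "{v :: real ^ 'd. (\<forall>i. v $ i \<in> \<int>) \<and> norm v \<le> r}"
  have "\<forall>v\<in>?V. \<exists>h. h \<in> H \<and> pr h = v"
  proof
    fix v assume "v \<in> ?V"
    then have "v \<in> pr ` H" unfolding pr_image by simp
    then show "\<exists>h. h \<in> H \<and> pr h = v" by (elim imageE) (rule exI, simp)
  qed
  from bchoice[OF this] obtain f where f: "\<And>v. v \<in> ?V \<Longrightarrow> f v \<in> H \<and> pr (f v) = v" by blast
  let ?Y = "(\<lambda>(d, v). d \<otimes> f v) ` (D \<times> ?V)"
  have finY: "finite ?Y" using D(2) finite_integer_box by blast
  have YH: "?Y \<subseteq> H" using D(1) f by auto
  have "\<forall>y\<in>H. \<exists>cs. cs \<in> lists loops \<and> y = loops_val cs"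
  proof (rule ballI)
    fix y assume "y \<in> H"
    then obtain cs where "cs \<in> lists loops" "y = loops_val cs" by (rule H_loops)
    then show "\<exists>cs. cs \<in> lists loops \<and> y = loops_val cs" by (intro exI conjI)
  qed
  from bchoice[OF this] obtain g where g: "\<And>y. y \<in> H \<Longrightarrow> g y \<in> lists loops \<and> y = loops_val (g y)" by blast
  have "finite ((\<lambda>y. loops_len (g y)) ` ?Y)" using finY by simp
  then obtain b where b: "\<forall>x\<in>(\<lambda>y. loops_len (g y)) ` ?Y. x \<le> b" unfolding finite_nat_set_iff_bounded_le by blast
  have "\<exists>cs\<in>lists loops. loops_len cs \<le> b \<and> \<Gamma> 1 #> h = \<Gamma> 1 #> loops_val cs" if h: "h \<in> H" "norm (pr h) \<le> r" for h
  proof -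
    have V: "pr h \<in> ?V" using h imageI[OF h(1), of pr] unfolding pr_image by simp
    note fv = f[OF V]
    let ?f = "f (pr h)"
    have "pr (h \<otimes> inv ?f) = 0" using fv h by (simp add: pr_mult pr_inv)
    then obtain d where d: "d \<in> D" "\<Gamma> 1 #> (h \<otimes> inv ?f) = \<Gamma> 1 #> d" using D(3)[of "h \<otimes> inv ?f"] fv h by auto
    have dH: "d \<in> H" using d D by blast
    have "\<Gamma> 1 #> ((h \<otimes> inv ?f) \<otimes> ?f) = \<Gamma> 1 #> (d \<otimes> ?f)" using d fv h dH by (intro coset1_cong) auto
    then have 1: "\<Gamma> 1 #> h = \<Gamma> 1 #> (d \<otimes> ?f)" using fv h by (simp add: m_assoc)
    have y: "d \<otimes> ?f \<in> ?Y" using d V by force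
    then have gy: "g (d \<otimes> ?f) \<in> lists loops" "d \<otimes> ?f = loops_val (g (d \<otimes> ?f))" using g YH by blast+
    have "loops_len (g (d \<otimes> ?f)) \<le> b" using b y by blast
    then show ?thesis using gy 1 by auto
  qed
  then show ?thesis by blast
qed

text \<open>This identifies the central corrections \<open>zeta E\<close> with the classes of \<open>\<Gamma> 1\<close>, so that nonoptimality is a
  statement modulo \<open>\<Gamma> 1 = [H, H]\<close>.\<close>

lemma Gamma1_zeta: "x \<in> \<Gamma> 1 \<Longrightarrow> \<exists>E. qt x = C2.zeta E"
proof -
  have HK: "\<exists>cs\<in>lists loops. qt h = C2.pv cs" if "h \<in> H" for h
    using H_loops[OF that] pv_loops by metis
  have cc: "\<exists>E. commutator K2 (qt (loop_val a)) (C2.pv ds) = C2.zeta E" if "a \<in> loops" "ds \<in> lists loops" for a ds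
  proof -
    have s: "fst ` set (map (\<lambda>c. (c, Suc 0)) ds) \<subseteq> loops" using that(2) by (auto simp: in_lists_conv_set)
    show ?thesis using C2.comm_runs[OF that(1) s, of 1] C2.pv_rv[OF that(2)] that(1) by (auto simp: loop_val_H)
  qed
  have pc: "\<exists>E. commutator K2 (C2.pv cs) (C2.pv ds) = C2.zeta E" if a: "cs \<in> lists loops" and b: "ds \<in> lists loops" for cs ds
    using a
  proof (induction cs rule: list.induct)
    case Nil
    have "C2.zeta (\<lambda>_. 0) = \<one>\<^bsub>K2\<^esub>" by (rule C2.zeta_zero) simp
    then show ?case using b by (metis C2.comm_one_left C2.pv_Nil C2.pv_closed)
  next
    case (Cons a cs)
    have ac: "a \<in> loops" "cs \<in> lists loops" using Cons.prems by auto
    obtain E where E: "commutator K2 (C2.pv cs) (C2.pv ds) = C2.zeta E" using Cons.IH[OF ac(2)] by (elim exE)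
    obtain F where F: "commutator K2 (qt (loop_val a)) (C2.pv ds) = C2.zeta F" using cc[OF ac(1) b] by (elim exE)
    then have "commutator K2 (C2.pv (a # cs)) (C2.pv ds) = C2.zeta (\<lambda>p. F p + E p)"
      using E F ac b by (simp add: C2.comm_mult_left C2.zeta_add loop_val_H)
    then show ?case by blast
  qed
  assume "x \<in> \<Gamma> 1"
  then have "x \<in> generate G (comms 0)" using Gamma_Suc[of 0] by simp
  then show ?thesis
  proof (induction rule: generate_induct_in)
    case one
    have "C2.zeta (\<lambda>_. 0) = \<one>\<^bsub>K2\<^esub>" by (rule C2.zeta_zero) simp
    then show ?case by (metis one_K2)
  next
    case (incl h)
    then obtain x y where "x \<in> H" "y \<in> H" "h = commutator G x y" by (auto simp: comms_def)
    then show ?case using pc HK commutator_K2 by metis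
  next
    case (inv h)
    then obtain x y where xy: "x \<in> H" "y \<in> H" "h = commutator G x y" by (auto simp: comms_def)
    then obtain E where E: "qt h = C2.zeta E" using pc HK commutator_K2 by metis
    have "h \<in> H" using xy commutator_Gamma_H[of x 0 y] Gamma_H[of 1] by auto
    then have "qt (inv h) = C2.zeta (\<lambda>p. - E p)" using E by (simp add: C2.zeta_minus inv_K2[symmetric])
    then show ?case by blast
  next
    case (mult x y)
    have "x \<in> carrier G" "y \<in> carrier G" using mult generate_in_carrier[OF comms_carrier] by auto
    moreover obtain E F where "qt x = C2.zeta E" "qt y = C2.zeta F" using mult by (elim exE)
    ultimately have "qt (x \<otimes> y) = C2.zeta (\<lambda>p. E p + F p)" by (simp add: qt_mult[symmetric] C2.zeta_add)
    then show ?case by (rule exI[of _ "\<lambda>p. E p + F p"])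
  qed
qed

lemma nonoptI:
  assumes "cs \<in> lists loops" "ds \<in> lists loops" "loops_len ds < loops_len cs" "\<Gamma> 1 #> loops_val cs = \<Gamma> 1 #> loops_val ds"
  shows "C2.nonopt cs"
proof -
  have H: "loops_val cs \<in> H" "loops_val ds \<in> H" using assms loops_val_H by auto
  have "inv (loops_val ds) \<otimes> loops_val cs \<in> \<Gamma> 1" using Gamma_coset_decomp assms(4) H by auto
  then obtain E where E: "qt (inv (loops_val ds) \<otimes> loops_val cs) = C2.zeta E" using Gamma1_zeta by blast
  have "qt (loops_val cs) = qt (loops_val ds \<otimes> (inv (loops_val ds) \<otimes> loops_val cs))" using H by simp
  also have "\<dots> = qt (loops_val ds) \<otimes>\<^bsub>K2\<^esub> C2.zeta E" using qt_mult[of "loops_val ds" "inv (loops_val ds) \<otimes> loops_val cs"] H E by simp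
  finally have "C2.pv cs = C2.pv ds \<otimes>\<^bsub>K2\<^esub> C2.zeta E" using assms pv_loops by simp
  then show ?thesis unfolding C2.nonopt_def wlen_loops using assms by blast
qed

definition pt :: "'a list \<times> 'a list \<Rightarrow> real ^ 'd" where
  "pt l = pr (loop_val l) /\<^sub>R real (loop_len l)"

definition Pol :: "(real ^ 'd) set" where "Pol = convex hull (pt ` loops)"

lemma pr_loop: "l \<in> loops \<Longrightarrow> pr (loop_val l) = real (loop_len l) *\<^sub>R pt l"
  using loop_len_pos[of l] by (simp add: pt_def)

lemma pt_Pol: "l \<in> loops \<Longrightarrow> pt l \<in> Pol" unfolding Pol_def by (intro hull_inc) blast

lemma convex_Pol: "convex Pol" by (simp add: Pol_def)

lemma loops_len_pos: "cs \<in> lists loops \<Longrightarrow> cs \<noteq> [] \<Longrightarrow> 0 < loops_len cs"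
  by (cases cs) (auto dest: loop_len_pos)

text \<open>The normalised value of a sequence of loops is the average of the points of its loops weighted by their
  lengths; hence it lies in the polytope.\<close>

lemma mean_Cons:
  assumes "l \<in> loops" "cs \<in> lists loops" "cs \<noteq> []"
  defines "u \<equiv> real (loop_len l) / real (loops_len (l # cs))" and "v \<equiv> real (loops_len cs) / real (loops_len (l # cs))"
  shows "pr (loops_val (l # cs)) /\<^sub>R real (loops_len (l # cs)) = u *\<^sub>R pt l + v *\<^sub>R (pr (loops_val cs) /\<^sub>R real (loops_len cs))"
    "0 < u" "0 < v" "u + v = 1"
proof -
  have p: "0 < loop_len l" "0 < loops_len cs" using assms loop_len_pos loops_len_pos by auto
  show "0 < u" "0 < v" using p by (auto simp: u_def v_def)
  have "real (loop_len l) + real (loops_len cs) = real (loops_len (l # cs))" by simp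
  then show "u + v = 1" unfolding u_def v_def add_divide_distrib[symmetric] using p by simp
  have "pr (loops_val (l # cs)) = real (loop_len l) *\<^sub>R pt l + pr (loops_val cs)"
    using assms by (simp add: pr_mult loop_val_H loops_val_H pr_loop)
  then show "pr (loops_val (l # cs)) /\<^sub>R real (loops_len (l # cs)) = u *\<^sub>R pt l + v *\<^sub>R (pr (loops_val cs) /\<^sub>R real (loops_len cs))"
    using p by (simp add: u_def v_def scaleR_add_right divide_inverse mult.commute)
qed

lemma mean_in_Pol:
  assumes "cs \<in> lists loops" "cs \<noteq> []"
  shows "pr (loops_val cs) /\<^sub>R real (loops_len cs) \<in> Pol"
  using assms
proof (induction cs rule: list.induct)
  case (Cons l cs)
  show ?case
  proof (cases "cs = []")
    case True
    then show ?thesis using Cons pt_Pol[of l] loop_val_H[of l] by (simp add: pt_def)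
  next
    case False
    have l: "l \<in> loops" "cs \<in> lists loops" using Cons.prems by auto
    show ?thesis unfolding mean_Cons(1)[OF l False]
      using mean_Cons(2,3)[OF l False]
      by (intro convexD[OF convex_Pol pt_Pol[OF l(1)] Cons.IH[OF l(2) False]] mean_Cons(4)[OF l False] less_imp_le)
  qed
qed simp

lemma face_contains_all:
  assumes "D face_of Pol" "cs \<in> lists loops" "cs \<noteq> []" "pr (loops_val cs) /\<^sub>R real (loops_len cs) \<in> D" "l \<in> set cs"
  shows "pt l \<in> D"
  using assms(2-5)
proof (induction cs rule: list.induct)
  case (Cons a cs)
  show ?case
  proof (cases "cs = []")
    case True
    then show ?thesis using Cons loop_val_H[of a] by (simp add: pt_def)
  next
    case False
    have a: "a \<in> loops" "cs \<in> lists loops" using Cons.prems by auto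
    let ?y = "pr (loops_val cs) /\<^sub>R real (loops_len cs)"
    let ?u = "real (loop_len a) / real (loops_len (a # cs))" and ?v = "real (loops_len cs) / real (loops_len (a # cs))"
    note mc = mean_Cons[OF a False]
    have z: "?u *\<^sub>R pt a + ?v *\<^sub>R ?y \<in> D" using Cons.prems(3) unfolding mc(1) .
    have P: "pt a \<in> Pol" "?y \<in> Pol" using pt_Pol[OF a(1)] mean_in_Pol[OF a(2) False] by auto
    have "pt a \<in> D \<and> ?y \<in> D"
    proof (cases "pt a = ?y")
      case True
      have "?u *\<^sub>R pt a + ?v *\<^sub>R ?y = (?u + ?v) *\<^sub>R pt a" unfolding True[symmetric] by (simp only: scaleR_add_left)
      then show ?thesis using z mc(4) True by simp
    next
      case False
      have u1: "?u = 1 - ?v" using mc(4) by linarith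
      have "?u *\<^sub>R pt a + ?v *\<^sub>R ?y \<in> open_segment (pt a) ?y"
        unfolding in_segment(2) using False mc(2-4) u1 by (intro conjI exI[of _ ?v]) auto
      then show ?thesis using assms(1) P z unfolding face_of_def by blast
    qed
    then show ?thesis using Cons.IH[OF a(2) False] Cons.prems(4) by auto
  qed
qed simp

text \<open>A product of loops representing the identity has mean zero.\<close>

lemma zero_in_Pol: "0 \<in> Pol"
proof -
  have "axis undefined 1 \<in> {v :: real ^ 'd. \<forall>i. v $ i \<in> \<int>}" by (auto simp: axis_def)
  then obtain h where h: "h \<in> H" "pr h = axis undefined 1" using pr_image by (metis imageE)
  obtain cs where cs: "cs \<in> lists loops" "h = loops_val cs" using H_loops[OF h(1)] .
  obtain ds where ds: "ds \<in> lists loops" "inv h = loops_val ds" using H_loops[of "inv h"] h by auto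
  have "cs \<noteq> []" using cs h(2) by (auto simp: axis_eq_0_iff)
  moreover have "loops_val (cs @ ds) = \<one>" using loops_val_append[OF cs(1) ds(1)] cs ds h by (metis H_carrier r_inv)
  ultimately show ?thesis using mean_in_Pol[of "cs @ ds"] cs ds by simp
qed

lemma polyhedron_Pol: "polyhedron Pol"
  unfolding Pol_def using finite_loops by (intro polytope_imp_polyhedron polytope_convex_hull) auto

end

context projected_pair
begin

lemma loops_val_concat_replicate:
  "cs \<in> lists loops \<Longrightarrow> pr (loops_val (concat (replicate n cs))) = real n *\<^sub>R pr (loops_val cs)
     \<and> loops_len (concat (replicate n cs)) = n * loops_len cs \<and> concat (replicate n cs) \<in> lists loops"
proof (induction n)
  case (Suc n)
  then show ?case by (simp add: loops_val_append pr_mult loops_val_H algebra_simps)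
qed simp

lemma pr_loops_concat_map:
  fixes m :: "real ^ 'd \<Rightarrow> nat"
  assumes "\<And>v. v \<in> set vs \<Longrightarrow> s v \<in> loops" "distinct vs"
  defines "ds \<equiv> concat (map (\<lambda>v. replicate (m v) (s v)) vs)"
  shows "ds \<in> lists loops" "loops_len ds = (\<Sum>v\<in>set vs. m v * loop_len (s v))"
    "pr (loops_val ds) = (\<Sum>v\<in>set vs. real (m v * loop_len (s v)) *\<^sub>R pt (s v))"
proof -
  have r: "replicate n l \<in> lists loops \<and> loops_len (replicate n l) = n * loop_len l
      \<and> pr (loops_val (replicate n l)) = real (n * loop_len l) *\<^sub>R pt l" if "l \<in> loops" for n l
    by (induction n) (use that in \<open>simp_all add: pr_mult loop_val_H loops_val_H pr_loop algebra_simps\<close>)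
  have "ds \<in> lists loops \<and> loops_len ds = (\<Sum>v\<in>set vs. m v * loop_len (s v))
    \<and> pr (loops_val ds) = (\<Sum>v\<in>set vs. real (m v * loop_len (s v)) *\<^sub>R pt (s v))"
    unfolding ds_def using assms(1,2)
  proof (induction vs rule: list.induct)
    case (Cons v vs)
    have v: "s v \<in> loops" using Cons.prems by simp
    have IH: "concat (map (\<lambda>v. replicate (m v) (s v)) vs) \<in> lists loops
      \<and> loops_len (concat (map (\<lambda>v. replicate (m v) (s v)) vs)) = (\<Sum>v\<in>set vs. m v * loop_len (s v))
      \<and> pr (loops_val (concat (map (\<lambda>v. replicate (m v) (s v)) vs))) = (\<Sum>v\<in>set vs. real (m v * loop_len (s v)) *\<^sub>R pt (s v))"
      using Cons.prems by (intro Cons.IH) auto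
    show ?case using r[OF v, of "m v"] IH Cons.prems(2)
      by (simp add: loops_val_append pr_mult loops_val_H)
  qed simp
  then show "ds \<in> lists loops" "loops_len ds = (\<Sum>v\<in>set vs. m v * loop_len (s v))"
    "pr (loops_val ds) = (\<Sum>v\<in>set vs. real (m v * loop_len (s v)) *\<^sub>R pt (s v))" by auto
qed

lemma mset_concat_replicate_le:
  assumes "distinct qs" "\<And>l. l \<in> set qs \<Longrightarrow> n \<le> count_list cs l"
  shows "mset (concat (replicate n qs)) \<subseteq># mset cs"
proof (rule mset_subset_eqI)
  fix l
  have "count (mset (concat (replicate n qs))) l = n * count (mset qs) l" by (induction n) auto
  also have "\<dots> \<le> count (mset cs) l"
    using assms(2)[of l] distinct_count_atmost_1[of qs] assms(1) by (auto simp: count_mset)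
  finally show "count (mset (concat (replicate n qs))) l \<le> count (mset cs) l" .
qed

text \<open>If the mean of \<open>qs\<close> can be stretched by \<open>e > 1\<close> inside the polytope, then \<open>N\<close> copies of \<open>qs\<close> have the same
  image under \<open>pr\<close>, up to a bounded error, as a product of loops of total length at most \<open>N L / e\<close>. The bounded error
  costs a bounded number of letters, less than the gain for large \<open>N\<close>.\<close>

lemma inner_mean_nonopt:
  assumes q: "qs \<in> lists loops" "qs \<noteq> []" and "1 < e"
    and y: "e *\<^sub>R (pr (loops_val qs) /\<^sub>R real (loops_len qs)) \<in> Pol"
  shows "\<exists>N. C2.nonopt (concat (replicate N qs))"
proof -
  let ?L = "real (loops_len qs)"
  let ?y = "pr (loops_val qs) /\<^sub>R ?L"
  let ?V = "pt ` loops"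
  have L: "0 < ?L" using loops_len_pos[OF q] by simp
  have finV: "finite ?V" using finite_loops by blast
  obtain u where u: "\<And>v. v \<in> ?V \<Longrightarrow> 0 \<le> u v" "sum u ?V = 1" "(\<Sum>v\<in>?V. u v *\<^sub>R v) = e *\<^sub>R ?y"
    using y unfolding Pol_def convex_hull_finite[OF finV] by blast
  define s where "s = inv_into loops pt"
  have s: "s v \<in> loops" "pt (s v) = v" if "v \<in> ?V" for v
    unfolding s_def using that by (rule inv_into_into, rule f_inv_into_f)
  have lpos: "0 < real (loop_len (s v))" if "v \<in> ?V" for v using loop_len_pos[OF s(1)[OF that]] by simp
  obtain vs where vs: "set vs = ?V" "distinct vs" using finite_distinct_list[OF finV] by blast
  define r where "r = (\<Sum>v\<in>?V. real (loop_len (s v)) * norm v)"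
  obtain b where b: "\<And>h. h \<in> H \<Longrightarrow> norm (pr h) \<le> r \<Longrightarrow> \<exists>cs\<in>lists loops. loops_len cs \<le> b \<and> \<Gamma> 1 #> h = \<Gamma> 1 #> loops_val cs"
    using near_origin_cheap[of r] by blast
  have gap: "0 < ?L - ?L / e" using L \<open>1 < e\<close> by (simp add: field_simps)
  \<comment> \<open>The number of copies for which the gain exceeds the cost \<open>b\<close> of the rounding error.\<close>
  obtain N where N: "real b < real N * (?L - ?L / e)" using reals_Archimedean3[OF gap] by blast
  define x where "x v = real N * ?L * u v / e" for v
  define m where "m v = nat \<lfloor>x v / real (loop_len (s v))\<rfloor>" for v
  let ?cs = "concat (replicate N qs)"
  let ?ds = "concat (map (\<lambda>v. replicate (m v) (s v)) vs)"
  have x0: "0 \<le> x v" if "v \<in> ?V" for v using u(1)[OF that] L \<open>1 < e\<close> by (simp add: x_def)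
  have mb: "real (m v * loop_len (s v)) \<le> x v" "x v \<le> real (m v * loop_len (s v)) + real (loop_len (s v))" if "v \<in> ?V" for v
  proof -
    let ?z = "x v / real (loop_len (s v))"
    have "0 \<le> ?z" using x0[OF that] by simp
    then have "real (m v) \<le> ?z" "?z \<le> real (m v) + 1" unfolding m_def by linarith+
    then show "real (m v * loop_len (s v)) \<le> x v" "x v \<le> real (m v * loop_len (s v)) + real (loop_len (s v))"
      using lpos[OF that] by (simp_all add: field_simps)
  qed
  have sv: "\<And>v. v \<in> set vs \<Longrightarrow> s v \<in> loops" using s(1) vs(1) by simp
  note ds = pr_loops_concat_map[OF sv vs(2), where m = m, unfolded vs(1)]
  note cs = loops_val_concat_replicate[OF q(1), of N]
  have csl: "?cs \<in> lists loops" using cs by simp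
  have sx: "(\<Sum>v\<in>?V. x v *\<^sub>R v) = pr (loops_val ?cs)"
  proof -
    have "(\<Sum>v\<in>?V. x v *\<^sub>R v) = (real N * ?L / e) *\<^sub>R (\<Sum>v\<in>?V. u v *\<^sub>R v)"
      unfolding scaleR_sum_right x_def by (intro sum.cong refl) simp
    also have "\<dots> = pr (loops_val ?cs)" unfolding u(3) using cs L \<open>1 < e\<close> by simp
    finally show ?thesis .
  qed
  have len: "real (loops_len ?ds) \<le> real N * ?L / e"
  proof -
    have "real (loops_len ?ds) = (\<Sum>v\<in>?V. real (m v * loop_len (s v)))" using arg_cong[OF ds(2), where f = real] by simp
    also have "\<dots> \<le> (\<Sum>v\<in>?V. x v)" by (rule sum_mono) (rule mb(1))
    also have "\<dots> = (real N * ?L / e) * sum u ?V" unfolding sum_distrib_left x_def by (intro sum.cong refl) simp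
    finally show ?thesis using u(2) by simp
  qed
  define h where "h = inv (loops_val ?ds) \<otimes> loops_val ?cs"
  have dH: "loops_val ?ds \<in> H" "loops_val ?cs \<in> H" using ds(1) csl loops_val_H by auto
  have hH: "h \<in> H" using dH by (simp add: h_def)
  have "pr h = (\<Sum>v\<in>?V. x v *\<^sub>R v) - (\<Sum>v\<in>?V. real (m v * loop_len (s v)) *\<^sub>R pt (s v))"
    using dH ds(3) sx by (simp add: h_def pr_mult pr_inv)
  also have "\<dots> = (\<Sum>v\<in>?V. (x v - real (m v * loop_len (s v))) *\<^sub>R v)"
    unfolding sum_subtractf[symmetric] by (intro sum.cong refl) (simp only: s(2) scaleR_left_diff_distrib)
  finally have "norm (pr h) \<le> (\<Sum>v\<in>?V. norm ((x v - real (m v * loop_len (s v))) *\<^sub>R v))" by (simp only: norm_sum)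
  also have "\<dots> \<le> r" unfolding r_def
  proof (rule sum_mono)
    fix v assume v: "v \<in> ?V"
    have "\<bar>x v - real (m v * loop_len (s v))\<bar> \<le> real (loop_len (s v))" using mb[OF v] by linarith
    then show "norm ((x v - real (m v * loop_len (s v))) *\<^sub>R v) \<le> real (loop_len (s v)) * norm v"
      unfolding norm_scaleR by (rule mult_right_mono) simp
  qed
  finally obtain es where es: "es \<in> lists loops" "loops_len es \<le> b" "\<Gamma> 1 #> h = \<Gamma> 1 #> loops_val es" using b[OF hH] by blast
  have "loops_val ?cs = loops_val ?ds \<otimes> h" using dH by (simp add: h_def)
  then have "\<Gamma> 1 #> loops_val ?cs = \<Gamma> 1 #> (loops_val ?ds \<otimes> h)" by simp
  also have "\<dots> = \<Gamma> 1 #> (loops_val ?ds \<otimes> loops_val es)" by (rule coset1_cong) (use dH hH es loops_val_H in simp_all)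
  also have "\<dots> = \<Gamma> 1 #> loops_val (?ds @ es)" using loops_val_append[OF ds(1) es(1)] by simp
  finally have eq: "\<Gamma> 1 #> loops_val ?cs = \<Gamma> 1 #> loops_val (?ds @ es)" .
  have l1: "loops_len (?ds @ es) = loops_len ?ds + loops_len es" by simp
  have l2: "real (loops_len ?cs) = real N * ?L" using cs by simp
  have "real (loops_len (?ds @ es)) < real (loops_len ?cs)"
    using N len es(2) unfolding l1 l2 by (simp add: algebra_simps)
  then have "loops_len (?ds @ es) < loops_len ?cs" by (simp only: of_nat_less_iff)
  then have "C2.nonopt ?cs" using ds(1) es(1) eq csl by (intro nonoptI[of _ "?ds @ es"]) auto
  then show ?thesis by blast
qed

text \<open>If the mean is in the relative interior it can be moved away from \<open>0\<close>; otherwise it lies on a facet, which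
  then contains all points entering the mean.\<close>

lemma facet_or_nonopt:
  assumes "Q \<subseteq> loops" "Q \<noteq> {}"
  shows "(\<exists>D. D facet_of Pol \<and> pt ` Q \<subseteq> D) \<or>
    (\<exists>N. \<forall>cs\<in>lists loops. (\<forall>l\<in>Q. N \<le> count_list cs l) \<longrightarrow> C2.nonopt cs)"
proof -
  obtain qs where qs: "set qs = Q" "distinct qs" using finite_distinct_list finite_subset[OF assms(1) finite_loops] by blast
  have q: "qs \<in> lists loops" "qs \<noteq> []" using qs(1) assms by (auto simp: in_lists_conv_set)
  let ?y = "pr (loops_val qs) /\<^sub>R real (loops_len qs)"
  have yP: "?y \<in> Pol" by (rule mean_in_Pol[OF q])
  show ?thesis
  proof (cases "?y \<in> rel_interior Pol")
    case True
    have "Pol \<noteq> {}" using zero_in_Pol by blast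
    then have "\<forall>x\<in>Pol. \<exists>e>1. (1 - e) *\<^sub>R x + e *\<^sub>R ?y \<in> Pol"
      using convex_rel_interior_iff[OF convex_Pol, of ?y] True by simp
    then obtain e where e: "1 < e" "(1 - e) *\<^sub>R 0 + e *\<^sub>R ?y \<in> Pol" using zero_in_Pol by blast
    have "e *\<^sub>R ?y \<in> Pol" using e(2) by simp
    then obtain N where N: "C2.nonopt (concat (replicate N qs))" using inner_mean_nonopt[OF q e(1)] by blast
    have "C2.nonopt cs" if a: "cs \<in> lists loops" "\<forall>l\<in>Q. N \<le> count_list cs l" for cs
      using a qs by (intro C2.nonopt_mono[OF a(1) mset_concat_replicate_le N]) auto
    then show ?thesis by blast
  next
    case False
    then have "?y \<in> \<Union> {F. F facet_of Pol}" using yP rel_boundary_of_polyhedron[OF polyhedron_Pol] by blast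
    then obtain D where D: "D facet_of Pol" "?y \<in> D" by blast
    have "pt l \<in> D" if "l \<in> Q" for l
      using face_contains_all[OF facet_of_imp_face_of[OF D(1)] q D(2)] qs(1) that by simp
    then show ?thesis using D(1) by blast
  qed
qed

lemma frequent_loops_on_facet:
  "\<exists>N. \<forall>cs\<in>lists loops. \<not> C2.nonopt cs \<longrightarrow>
     (\<exists>D. (D = {} \<or> D facet_of Pol) \<and> (\<forall>l\<in>loops. N \<le> count_list cs l \<longrightarrow> pt l \<in> D))"
proof -
  let ?P = "\<lambda>Q N. (\<exists>D. (D = {} \<or> D facet_of Pol) \<and> pt ` Q \<subseteq> D) \<or>
    (\<forall>cs\<in>lists loops. (\<forall>l\<in>Q. N \<le> count_list cs l) \<longrightarrow> C2.nonopt cs)"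
  have "\<exists>N. ?P Q N" if Q: "Q \<subseteq> loops" for Q
  proof (cases "Q = {}")
    case False
    show ?thesis using facet_or_nonopt[OF Q False] by (elim disjE exE) blast+
  qed blast
  then obtain f where f: "\<And>Q. Q \<subseteq> loops \<Longrightarrow> ?P Q (f Q)" by metis
  define N where "N = sum f (Pow loops)"
  have "\<exists>D. (D = {} \<or> D facet_of Pol) \<and> (\<forall>l\<in>loops. N \<le> count_list cs l \<longrightarrow> pt l \<in> D)"
    if cs: "cs \<in> lists loops" "\<not> C2.nonopt cs" for cs
  proof -
    let ?Q = "{l \<in> loops. N \<le> count_list cs l}"
    have "f ?Q \<le> N" unfolding N_def using finite_loops by (intro member_le_sum) auto
    then have "\<forall>l\<in>?Q. f ?Q \<le> count_list cs l" by auto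
    then obtain D where "D = {} \<or> D facet_of Pol" "pt ` ?Q \<subseteq> D" using f[of ?Q] cs by auto
    then show ?thesis by (intro exI[of _ D]) auto
  qed
  then show ?thesis by blast
qed

end

section \<open>Facets and good edges\<close>

context projected_pair
begin

abbreviation act :: "'a set \<Rightarrow> real ^ 'd \<Rightarrow> real ^ 'd" where "act \<equiv> conj_action G H \<phi>"

lemma act_props:
  assumes "X \<in> rcosets H"
  shows act_linear: "linear (act X)"
    and act_pr: "g \<in> X \<Longrightarrow> h \<in> H \<Longrightarrow> act X (pr h) = pr (g \<otimes> h \<otimes> inv g)"
proof -
  have X: "X \<in> carrier (G Mod H)" using assms by (simp add: FactGroup_def)
  note t = theI'[OF conj_action_wd[OF group_axioms normal_H phi X], folded conj_action_def]
  show "linear (act X)" using t by blast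
  show "act X (pr h) = pr (g \<otimes> h \<otimes> inv g)" if "g \<in> X" "h \<in> H" using t that unfolding pr_def by blast
qed

lemma coset_in_rcosets: "g \<in> carrier G \<Longrightarrow> H #> g \<in> rcosets H"
  by (auto simp: RCOSETS_def)

lemma act_coset: "g \<in> carrier G \<Longrightarrow> h \<in> H \<Longrightarrow> act (H #> g) (pr h) = pr (g \<otimes> h \<otimes> inv g)"
  using coset_in_rcosets rcos_self[OF _ H.subgroup_axioms] by (intro act_pr)

lemma linear_eq_on_pr:
  assumes "linear L" "linear M" "\<And>h. h \<in> H \<Longrightarrow> L (pr h) = M (pr h)"
  shows "L = M"
proof (rule linear_eq_stdbasis[OF assms(1,2)])
  fix b :: "real ^ 'd" assume "b \<in> Basis"
  then have "b \<in> pr ` H" unfolding pr_image by (auto simp: Basis_vec_def axis_def)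
  then show "L b = M b" using assms(3) by auto
qed

text \<open>A linear map is determined by its values on \<open>pr ` H\<close>, the integer points.\<close>

lemma act_mult:
  assumes "g \<in> carrier G" "k \<in> carrier G"
  shows "act (H #> g) (act (H #> k) v) = act (H #> (g \<otimes> k)) v"
proof -
  have "act (H #> g) \<circ> act (H #> k) = act (H #> (g \<otimes> k))"
  proof (rule linear_eq_on_pr)
    show "linear (act (H #> g) \<circ> act (H #> k))"
      using assms by (intro linear_compose act_linear coset_in_rcosets)
    show "linear (act (H #> (g \<otimes> k)))" using assms by (intro act_linear coset_in_rcosets) auto
    fix h assume h: "h \<in> H"
    have "k \<otimes> h \<otimes> inv k \<in> H" using H.inv_op_closed2[OF assms(2) h] .
    then show "(act (H #> g) \<circ> act (H #> k)) (pr h) = act (H #> (g \<otimes> k)) (pr h)"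
      using assms h by (simp add: act_coset inv_mult_group m_assoc)
  qed
  then show ?thesis by (metis comp_apply)
qed

lemma act_one: "act H v = v"
proof -
  have "act (H #> \<one>) = id"
  proof (rule linear_eq_on_pr)
    show "linear (act (H #> \<one>))" by (intro act_linear coset_in_rcosets) simp
    show "linear (id :: real ^ 'd \<Rightarrow> _)" by (rule linear_id)
  qed (simp add: act_coset)
  then show ?thesis using coset_mult_one[OF H.subset] by simp
qed

lemma act_inverse:
  assumes "g \<in> carrier G"
  shows "act (H #> inv g) (act (H #> g) v) = v" "act (H #> g) (act (H #> inv g) v) = v"
  using assms coset_mult_one[OF H.subset] by (simp_all add: act_mult act_one)

definition cyc_pt :: "'a list \<Rightarrow> real ^ 'd" where "cyc_pt a = pr (word_eval G a) /\<^sub>R real (length a)"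

lemma cycle_props:
  "a \<in> simple_cycles G H S \<Longrightarrow> a \<in> lists S \<and> a \<noteq> [] \<and> word_eval G a \<in> H"
  by (simp add: simple_cycles_iff)

lemma act_cyc_pt:
  assumes "p \<in> lists S" "a \<in> simple_cycles G H S"
  shows "act (vx p) (cyc_pt a) = pr (loop_val (p, a)) /\<^sub>R real (length a)"
proof -
  have "linear (act (vx p))" using assms(1) vx_in_rcosets act_linear by blast
  then show ?thesis using assms cycle_props[OF assms(2)] unfolding cyc_pt_def
    by (simp add: linear_scale act_coset vx_def loop_val_def)
qed

lemma pt_act: "(p, a) \<in> loops \<Longrightarrow> pt (p, a) = act (vx p) (cyc_pt a)"
  using act_cyc_pt[of p a] by (simp add: loops_def simple_path_def pt_def loop_len_def)

text \<open>Every coset is the end of a simple path, so the orbits of the cycle points under the conjugation action consist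
  of the points of loops.\<close>

lemma act_coset_cyc_pt_loop:
  assumes "X \<in> rcosets H" "a \<in> simple_cycles G H S"
  shows "act X (cyc_pt a) \<in> pt ` loops"
proof -
  obtain p where p: "simple_path p" "X = vx p" using simple_path_to_coset[OF assms(1)] .
  have "(p, a) \<in> loops" using p(1) assms(2) by (simp add: loops_def)
  then show ?thesis using pt_act[of p a] p(2) by (metis imageI)
qed

lemma finite_cycles: "finite (simple_cycles G H S)"
  by (rule finite_simple_cycles[OF finite_S finite_index])

lemma cycle_points_eq: "cycle_points G H \<phi> S = image_mset cyc_pt (mset_set (simple_cycles G H S))"
  by (simp add: cycle_points_def cyc_pt_def[abs_def] pr_def)

lemma cycle_polytope_eq: "cycle_polytope G H \<phi> S = Pol"
proof -
  have "{act X p | X p. X \<in> carrier (G Mod H) \<and> p \<in># cycle_points G H \<phi> S}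
      = {act X p | X p. X \<in> rcosets H \<and> p \<in> cyc_pt ` simple_cycles G H S}"
    using finite_cycles by (simp add: cycle_points_eq FactGroup_def)
  also have "\<dots> = pt ` loops"
  proof (intro Set.set_eqI iffI)
    fix x assume "x \<in> {act X p | X p. X \<in> rcosets H \<and> p \<in> cyc_pt ` simple_cycles G H S}"
    then show "x \<in> pt ` loops" using act_coset_cyc_pt_loop by blast
  next
    fix x assume "x \<in> pt ` loops"
    then obtain p a where pa: "(p, a) \<in> loops" "x = act (vx p) (cyc_pt a)" using pt_act by auto
    then have "vx p \<in> rcosets H" "a \<in> simple_cycles G H S"
      by (auto simp: loops_def simple_path_def vx_in_rcosets)
    then show "x \<in> {act X p | X p. X \<in> rcosets H \<and> p \<in> cyc_pt ` simple_cycles G H S}" using pa(2) by blast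
  qed
  finally show ?thesis unfolding cycle_polytope_def Pol_def by simp
qed

lemma act_Pol_subset:
  assumes g: "g \<in> carrier G"
  shows "act (H #> g) ` Pol \<subseteq> Pol"
proof -
  have lin: "linear (act (H #> g))" using g by (intro act_linear coset_in_rcosets)
  have "act (H #> g) ` (pt ` loops) \<subseteq> pt ` loops"
  proof clarify
    fix p a assume pa: "(p, a) \<in> loops"
    then have p: "p \<in> lists S" "a \<in> simple_cycles G H S" by (auto simp: loops_def simple_path_def)
    have "act (H #> g) (pt (p, a)) = act (H #> (g \<otimes> word_eval G p)) (cyc_pt a)"
      using pa p g by (simp add: pt_act vx_def act_mult)
    moreover have "H #> (g \<otimes> word_eval G p) \<in> rcosets H" using g p by (intro coset_in_rcosets) auto
    ultimately show "act (H #> g) (pt (p, a)) \<in> pt ` loops" using act_coset_cyc_pt_loop p(2) by simp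
  qed
  then show ?thesis unfolding Pol_def convex_hull_linear_image[OF lin] by (rule hull_mono)
qed

lemma act_inj: "g \<in> carrier G \<Longrightarrow> inj (act (H #> g))"
  by (rule inj_on_inverseI[where g = "act (H #> inv g)"]) (simp add: act_inverse)

lemma act_Pol:
  assumes g: "g \<in> carrier G"
  shows "act (H #> g) ` Pol = Pol"
proof
  show "act (H #> g) ` Pol \<subseteq> Pol" by (rule act_Pol_subset[OF g])
  show "Pol \<subseteq> act (H #> g) ` Pol"
  proof
    fix x assume x: "x \<in> Pol"
    have "act (H #> inv g) x \<in> Pol" using act_Pol_subset[of "inv g"] g x by auto
    moreover have "x = act (H #> g) (act (H #> inv g) x)" using g by (simp add: act_inverse)
    ultimately show "x \<in> act (H #> g) ` Pol" by blast
  qed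
qed

lemma act_facet:
  assumes "D facet_of Pol" "g \<in> carrier G"
  shows "act (H #> g) ` D facet_of Pol"
proof -
  have lin: "linear (act (H #> g))" using assms(2) by (intro act_linear coset_in_rcosets)
  note inj = act_inj[OF assms(2)]
  have "act (H #> g) ` D face_of act (H #> g) ` Pol"
    using assms(1) unfolding face_of_linear_image[OF lin inj] facet_of_def by blast
  moreover have "aff_dim (act (H #> g) ` D) = aff_dim D" by (rule aff_dim_injective_linear_image[OF lin inj])
  ultimately show ?thesis using assms(1) unfolding facet_of_def act_Pol[OF assms(2)] by simp
qed

lemma two_cycles_common_facet:
  assumes "a \<in> simple_cycles G H S" "b \<in> simple_cycles G H S" "a \<noteq> b" "D facet_of Pol" "cyc_pt a \<in> D" "cyc_pt b \<in> D"
  shows "two_on_common_facet G H \<phi> S"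
proof -
  have "mset_set {a, b} \<subseteq># mset_set (simple_cycles G H S)"
    using assms finite_cycles by (intro subset_imp_msubset_mset_set) auto
  then have "image_mset cyc_pt (mset_set {a, b}) \<subseteq># cycle_points G H \<phi> S"
    unfolding cycle_points_eq by (rule image_mset_subseteq_mono)
  then have "{#cyc_pt a, cyc_pt b#} \<subseteq># cycle_points G H \<phi> S" using assms(3) by simp
  then show ?thesis unfolding two_on_common_facet_def cycle_polytope_eq using assms(4-6) by blast
qed

text \<open>The empty set takes the place of a facet for optimal sequences in which no loop is frequent.\<close>

definition face :: "(real ^ 'd) set \<Rightarrow> bool" where "face D \<longleftrightarrow> D = {} \<or> D facet_of Pol"

text \<open>The edge labelled \<open>s\<close> at the vertex \<open>X\<close> is good if it starts a cycle whose point, read at \<open>X\<close>, lies in \<open>D\<close>.\<close>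

definition good :: "(real ^ 'd) set \<Rightarrow> 'a set \<Rightarrow> 'a \<Rightarrow> bool" where
  "good D X s \<longleftrightarrow> (\<exists>b\<in>simple_cycles G H S. hd b = s \<and> act X (cyc_pt b) \<in> D)"

text \<open>The inverse of the action of \<open>X\<close> carries \<open>D\<close> to another facet, containing the untranslated points of both cycles.\<close>

lemma good_unique:
  assumes "\<not> two_on_common_facet G H \<phi> S" "face D" "X \<in> rcosets H" "good D X s" "good D X t"
  shows "s = t"
proof -
  obtain a b where ab: "a \<in> simple_cycles G H S" "hd a = s" "act X (cyc_pt a) \<in> D"
    "b \<in> simple_cycles G H S" "hd b = t" "act X (cyc_pt b) \<in> D"
    using assms(4,5) unfolding good_def by blast
  obtain g where g: "g \<in> carrier G" "X = H #> g" using assms(3) by (auto simp: RCOSETS_def)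
  have D: "D facet_of Pol" using assms(2) ab(3) by (auto simp: face_def)
  have f: "act (H #> inv g) ` D facet_of Pol" using act_facet[OF D, of "inv g"] g(1) by simp
  have "cyc_pt a = act (H #> inv g) (act X (cyc_pt a))" "cyc_pt b = act (H #> inv g) (act X (cyc_pt b))"
    using g by (simp_all add: act_inverse)
  then have "cyc_pt a \<in> act (H #> inv g) ` D" "cyc_pt b \<in> act (H #> inv g) ` D" using ab(3,6) by blast+
  then have "a = b" using two_cycles_common_facet[OF ab(1,4) _ f] assms(1) by blast
  then show ?thesis using ab(2,5) by simp
qed

text \<open>A cycle can be started at any of its vertices.\<close>

lemma rotate_cycle:
  assumes a: "a \<in> simple_cycles G H S" and i: "i < length a"
  shows "drop i a @ take i a \<in> simple_cycles G H S"
proof -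
  let ?b = "drop i a @ take i a" and ?n = "length a"
  have al: "a \<in> lists S" "a \<noteq> []" "word_eval G a \<in> H" "inj_on (\<lambda>i. vx (take i a)) {..<?n}"
    using a by (simp_all add: simple_cycles_iff)
  note l = take_lists[OF al(1), of i] drop_lists[OF al(1), of i]
  have bl: "?b \<in> lists S" using l by simp
  have cong: "vx (take i a @ take j ?b) = vx (take ((i + j) mod ?n) a)" if j: "j < ?n" for j
  proof (cases "i + j < ?n")
    case True
    have "take i a @ take j ?b = take (i + j) a" using True i by (simp add: take_add)
    then show ?thesis using True by simp
  next
    case False
    then have "j - (?n - i) = i + j - ?n" "i + j - ?n \<le> i" "?n - i \<le> j" using i j by linarith+
    then have "take j ?b = drop i a @ take (i + j - ?n) a" by (simp add: min_def)
    then have 1: "take i a @ take j ?b = a @ take (i + j - ?n) a" by simp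
    have "vx a = vx []" unfolding vx_Nil using vx_eq_H[OF al(1)] al(3) by blast
    then have "vx (a @ take (i + j - ?n) a) = vx ([] @ take (i + j - ?n) a)"
      using al(1) take_lists by (intro vx_append_cong) auto
    moreover have "(i + j) mod ?n = i + j - ?n" using False i j by (simp add: mod_if)
    ultimately show ?thesis using 1 by simp
  qed
  have "inj_on (\<lambda>j. vx (take j ?b)) {..<length ?b}"
  proof (rule inj_onI)
    fix j k assume jk: "j \<in> {..<length ?b}" "k \<in> {..<length ?b}" "vx (take j ?b) = vx (take k ?b)"
    then have lt: "j < ?n" "k < ?n" by auto
    have "vx (take i a @ take j ?b) = vx (take i a @ take k ?b)"
      using jk(3) vx_prefix_cancel[OF l(1) take_lists[OF bl] take_lists[OF bl]] by blast
    then have "(i + j) mod ?n = (i + k) mod ?n"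
      using inj_onD[OF al(4), of "(i + j) mod ?n" "(i + k) mod ?n"] cong lt al(2) by simp
    then show "j = k" using lt i by (auto simp: mod_if split: if_splits)
  qed
  moreover have "word_eval G ?b \<in> H"
  proof -
    have e: "word_eval G a = word_eval G (take i a) \<otimes> word_eval G (drop i a)"
      using eval_append[OF l] by simp
    have "inv (word_eval G (take i a)) \<otimes> word_eval G a \<otimes> word_eval G (take i a) \<in> H"
      using al(3) l by (intro H.inv_op_closed1) auto
    moreover have "inv (word_eval G (take i a)) \<otimes> word_eval G a \<otimes> word_eval G (take i a) = word_eval G ?b"
      unfolding e using l by (simp add: eval_append m_assoc inv_cancel_left)
    ultimately show ?thesis by simp
  qed
  ultimately show ?thesis using bl al(2) i by (simp add: simple_cycles_iff)
qed

text \<open>Rotating the cycle so that it begins with the given edge does not change the point of the loop, as the rotated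
  cycle is read at the end of a longer path.\<close>

lemma loop_edges_good:
  assumes pa: "(p, a) \<in> loops" "pt (p, a) \<in> D" and i: "i < length a"
  shows "good D (vx (p @ take i a)) (a ! i)"
proof -
  have p: "p \<in> lists S" "a \<in> simple_cycles G H S" using pa(1) by (auto simp: loops_def simple_path_def)
  have al: "a \<in> lists S" using p(2) by (simp add: simple_cycles_iff)
  let ?b = "drop i a @ take i a"
  note b = rotate_cycle[OF p(2) i]
  note l = take_lists[OF al, of i] drop_lists[OF al, of i]
  note e = eval_closed[OF p(1)] eval_closed[OF l(1)] eval_closed[OF l(2)]
  have ea: "word_eval G a = word_eval G (take i a) \<otimes> word_eval G (drop i a)" using eval_append[OF l] by simp
  have "loop_val (p @ take i a, ?b) = loop_val (p, a)"
    unfolding loop_val_def fst_conv snd_conv ea using e l p(1)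
    by (simp add: eval_append inv_mult_group m_assoc)
  then have "act (vx (p @ take i a)) (cyc_pt ?b) = pt (p, a)"
    using act_cyc_pt[OF _ b, of "p @ take i a"] p(1) l i by (simp add: pt_def loop_len_def of_nat_diff)
  moreover have "hd ?b = a ! i" using i by (simp add: hd_drop_conv_nth hd_append)
  ultimately show ?thesis unfolding good_def using b pa(2) by metis
qed

primrec bad :: "(real ^ 'd) set \<Rightarrow> 'a set \<Rightarrow> 'a list \<Rightarrow> nat" where
  "bad D X [] = 0"
| "bad D X (s # w) = (if good D X s then 0 else 1) + bad D (X #> s) w"

lemma vx_snoc: "p \<in> lists S \<Longrightarrow> s \<in> S \<Longrightarrow> vx p #> s = vx (p @ [s])"
  using vx_append[of p "[s]"] S_carrier by (simp add: subsetD)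

lemma bad_append:
  "p \<in> lists S \<Longrightarrow> u \<in> lists S \<Longrightarrow> bad D (vx p) (u @ v) = bad D (vx p) u + bad D (vx (p @ u)) v"
proof (induction u arbitrary: p rule: list.induct)
  case (Cons s u)
  then show ?case using Cons.IH[of "p @ [s]"] by (simp add: vx_snoc)
qed simp

lemma bad_le_length: "bad D X w \<le> length w"
proof (induction w arbitrary: X)
  case (Cons s w)
  show ?case using Cons[of "X #> s"] by simp
qed simp

lemma bad_zero:
  assumes "p \<in> lists S" "w \<in> lists S" "\<And>i. i < length w \<Longrightarrow> good D (vx (p @ take i w)) (w ! i)"
  shows "bad D (vx p) w = 0"
  using assms
proof (induction w arbitrary: p rule: list.induct)
  case (Cons s w)
  have s: "s \<in> S" "w \<in> lists S" using Cons.prems by auto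
  have "bad D (vx (p @ [s])) w = 0"
  proof (rule Cons.IH)
    show "p @ [s] \<in> lists S" "w \<in> lists S" using Cons.prems s by auto
    show "good D (vx ((p @ [s]) @ take i w)) (w ! i)" if "i < length w" for i
      using Cons.prems(3)[of "Suc i"] that by simp
  qed
  moreover have "good D (vx p) s" using Cons.prems(3)[of 0] by simp
  ultimately show ?case using Cons.prems s by (simp add: vx_snoc)
qed simp

lemma bad_loop_zero:
  assumes "(p, a) \<in> loops" "pt (p, a) \<in> D"
  shows "bad D (vx p) a = 0"
proof (rule bad_zero)
  show "p \<in> lists S" "a \<in> lists S" using assms(1) by (auto simp: loops_def simple_path_def simple_cycles_iff)
qed (rule loop_edges_good[OF assms])

text \<open>A popped loop consists of letters read from the same vertices as in the word, so the numbers of bad letters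
  add up.\<close>

lemma run_bad:
  "run u w cs u' \<Longrightarrow> simple_path u \<Longrightarrow>
    bad D H u + bad D (vx u) w = (\<Sum>l\<leftarrow>cs. bad D (vx (fst l)) (snd l)) + bad D H u'"
proof (induction rule: run.induct)
  case (run_push u s w cs u')
  have us: "u \<in> lists S" "s \<in> S" using run_push.hyps(1) by (auto simp: simple_path_def)
  have "bad D H (u @ [s]) = bad D H u + bad D (vx u) [s]"
    using bad_append[of "[]" u D "[s]"] us by (simp add: vx_Nil)
  then show ?case using run_push.IH[OF run_push.hyps(1)] us by (simp add: vx_snoc)
next
  case (run_pop s p q w cs u')
  have pq: "p \<in> lists S" "q \<in> lists S" using run_pop.hyps(2) by (auto simp: simple_path_def)
  have 1: "bad D H (p @ q) = bad D H p + bad D (vx p) q"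
    using bad_append[of "[]" p D q] pq by (simp add: vx_Nil)
  have 2: "bad D (vx p) (q @ [s]) = bad D (vx p) q + bad D (vx (p @ q)) [s]" by (rule bad_append[OF pq])
  have 3: "bad D (vx (p @ q)) (s # w) = bad D (vx (p @ q)) [s] + bad D (vx p) w"
    using vx_snoc[of "p @ q" s] pq run_pop.hyps(1,3) by simp
  have "bad D H p + bad D (vx p) w = (\<Sum>l\<leftarrow>cs. bad D (vx (fst l)) (snd l)) + bad D H u'"
    using run_pop.IH simple_path_prefix[OF run_pop.hyps(2)] by blast
  then show ?case using 1 2 3 by simp
qed simp

end

section \<open>Tame words\<close>

context projected_pair
begin

text \<open>The face and the starting vertex are existentially quantified because they depend on the word; there are only
  finitely many choices.\<close>

definition tame :: "nat \<Rightarrow> 'a list set" where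
  "tame B = {w \<in> lists S. \<exists>D X. face D \<and> X \<in> rcosets H \<and> bad D X w \<le> B}"

lemma simple_cycle_length: "a \<in> simple_cycles G H S \<Longrightarrow> length a \<le> card (rcosets H)"
proof -
  assume "a \<in> simple_cycles G H S"
  then have a: "a \<in> lists S" "inj_on (\<lambda>i. vx (take i a)) {..<length a}" by (auto simp: simple_cycles_iff)
  have "(\<lambda>i. vx (take i a)) ` {..<length a} \<subseteq> rcosets H" using vx_in_rcosets take_lists[OF a(1)] by blast
  then have "card {..<length a} \<le> card (rcosets H)" by (rule card_inj_on_le[OF a(2) _ finite_index])
  then show ?thesis by simp
qed

text \<open>Loops that occur often contribute no bad edges, and each of the others contributes boundedly many.\<close>

lemma optimal_loops_few_bad:
  "\<exists>K. \<forall>cs\<in>lists loops. \<not> C2.nonopt cs \<longrightarrow> (\<exists>D. face D \<and> (\<Sum>l\<leftarrow>cs. bad D (vx (fst l)) (snd l)) \<le> K)"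
proof -
  obtain N where N: "\<And>cs. cs \<in> lists loops \<Longrightarrow> \<not> C2.nonopt cs \<Longrightarrow>
     \<exists>D. (D = {} \<or> D facet_of Pol) \<and> (\<forall>l\<in>loops. N \<le> count_list cs l \<longrightarrow> pt l \<in> D)"
    using frequent_loops_on_facet by blast
  let ?M = "card (rcosets H)"
  have "\<exists>D. face D \<and> (\<Sum>l\<leftarrow>cs. bad D (vx (fst l)) (snd l)) \<le> card loops * (N * ?M)"
    if cs: "cs \<in> lists loops" "\<not> C2.nonopt cs" for cs
  proof -
    obtain D where D: "D = {} \<or> D facet_of Pol" "\<And>l. l \<in> loops \<Longrightarrow> N \<le> count_list cs l \<Longrightarrow> pt l \<in> D"
      using N[OF cs] by blast
    have sub: "set cs \<subseteq> loops" using cs(1) by (auto simp: in_lists_conv_set)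
    have "(\<Sum>l\<leftarrow>cs. bad D (vx (fst l)) (snd l)) = (\<Sum>l\<in>loops. count_list cs l * bad D (vx (fst l)) (snd l))"
      by (rule sum_list_map_eq_sum_count2[OF sub finite_loops])
    also have "\<dots> \<le> (\<Sum>l\<in>loops. N * ?M)"
    proof (rule sum_mono)
      fix l assume l: "l \<in> loops"
      show "count_list cs l * bad D (vx (fst l)) (snd l) \<le> N * ?M"
      proof (cases "N \<le> count_list cs l")
        case True
        then have "bad D (vx (fst l)) (snd l) = 0" using bad_loop_zero[of "fst l" "snd l" D] D(2)[OF l True] l by simp
        then show ?thesis by simp
      next
        case False
        have "bad D (vx (fst l)) (snd l) \<le> ?M"
          using bad_le_length[of D "vx (fst l)" "snd l"] simple_cycle_length[of "snd l"] l
          by (simp add: loops_def mem_Times_iff)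
        then show ?thesis using False by (intro mult_le_mono) auto
      qed
    qed
    also have "\<dots> = card loops * (N * ?M)" by simp
    finally show ?thesis using D(1) by (auto simp: face_def)
  qed
  then show ?thesis by blast
qed

text \<open>The second alternative is the one of a greedy block: its last loop and the simple path left on the stack add
  at most one bad letter for each vertex.\<close>

lemma run_tame:
  "\<exists>B. \<forall>v w cs v'. run v w cs v' \<longrightarrow> simple_path v \<longrightarrow>
     (\<not> C2.nonopt cs \<or> cs \<noteq> [] \<and> \<not> C2.nonopt (butlast cs)) \<longrightarrow> w \<in> tame B"
proof -
  obtain K where K: "\<And>cs. cs \<in> lists loops \<Longrightarrow> \<not> C2.nonopt cs \<Longrightarrow>
      \<exists>D. face D \<and> (\<Sum>l\<leftarrow>cs. bad D (vx (fst l)) (snd l)) \<le> K"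
    using optimal_loops_few_bad by blast
  let ?M = "card (rcosets H)"
  have "w \<in> tame (K + ?M + ?M)"
    if r: "run v w cs v'" "simple_path v" "\<not> C2.nonopt cs \<or> cs \<noteq> [] \<and> \<not> C2.nonopt (butlast cs)" for v w cs v'
  proof -
    note inv = run_invariants[OF r(1,2)]
    have cs: "cs \<in> lists loops" "w \<in> lists S" "simple_path v'" using inv by auto
    have "\<exists>D. face D \<and> (\<Sum>l\<leftarrow>cs. bad D (vx (fst l)) (snd l)) \<le> K + ?M"
    proof (cases "C2.nonopt cs")
      case False
      then obtain D where "face D" "(\<Sum>l\<leftarrow>cs. bad D (vx (fst l)) (snd l)) \<le> K" using K[OF cs(1)] by blast
      then show ?thesis by (intro exI[of _ D]) simp
    next
      case True
      then have b: "cs \<noteq> []" "\<not> C2.nonopt (butlast cs)" using r(3) by auto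
      have e: "cs = butlast cs @ [last cs]" using b(1) by simp
      have l: "butlast cs \<in> lists loops" "last cs \<in> loops" using cs(1) b(1) by (auto simp: in_lists_conv_set dest: in_set_butlastD)
      obtain D where D: "face D" "(\<Sum>l\<leftarrow>butlast cs. bad D (vx (fst l)) (snd l)) \<le> K" using K[OF l(1) b(2)] by blast
      have "bad D (vx (fst (last cs))) (snd (last cs)) \<le> ?M"
        using bad_le_length[of D "vx (fst (last cs))" "snd (last cs)"] simple_cycle_length[of "snd (last cs)"] l(2)
        by (simp add: loops_def mem_Times_iff)
      moreover have "(\<Sum>l\<leftarrow>cs. bad D (vx (fst l)) (snd l))
          = (\<Sum>l\<leftarrow>butlast cs. bad D (vx (fst l)) (snd l)) + bad D (vx (fst (last cs))) (snd (last cs))"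
        by (subst e) simp
      ultimately show ?thesis using D by (intro exI[of _ D]) simp
    qed
    then obtain D where D: "face D" "(\<Sum>l\<leftarrow>cs. bad D (vx (fst l)) (snd l)) \<le> K + ?M" by blast
    have "bad D H v' \<le> ?M" using bad_le_length[of D H v'] simple_path_length[OF cs(3)] by simp
    then have "bad D (vx v) w \<le> K + ?M + ?M" using run_bad[OF r(1,2), of D] D(2) by simp
    moreover have "vx v \<in> rcosets H" using r(2) vx_in_rcosets by (simp add: simple_path_def)
    ultimately show ?thesis unfolding tame_def using D(1) cs(2) by blast
  qed
  then show ?thesis by blast
qed

lemma run_concat_tame:
  assumes B: "\<And>v w cs v'. run v w cs v' \<Longrightarrow> simple_path v \<Longrightarrow>
     \<not> C2.nonopt cs \<or> cs \<noteq> [] \<and> \<not> C2.nonopt (butlast cs) \<Longrightarrow> w \<in> tame B"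
  shows "run v w (concat ws @ t) u \<Longrightarrow> simple_path v \<Longrightarrow> \<not> C2.nonopt t \<Longrightarrow>
    (\<And>b. b \<in> set ws \<Longrightarrow> b \<noteq> [] \<and> \<not> C2.nonopt (butlast b)) \<Longrightarrow>
    \<exists>bs. set bs \<subseteq> tame B \<and> w = concat bs \<and> length bs = Suc (length ws)"
proof (induction ws arbitrary: v w)
  case Nil
  have "w \<in> tame B" using B[of v w t u] Nil by simp
  then show ?case by (intro exI[of _ "[w]"]) simp
next
  case (Cons b ws)
  have "run v w (b @ (concat ws @ t)) u" using Cons.prems(1) by simp
  then obtain w1 w2 v1 where w: "w = w1 @ w2" "run v w1 b v1" "run v1 w2 (concat ws @ t) u"
    using run_split by blast
  have "simple_path v1" using run_invariants[OF w(2) Cons.prems(2)] by blast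
  then obtain bs where bs: "set bs \<subseteq> tame B" "w2 = concat bs" "length bs = Suc (length ws)"
    using Cons.IH[OF w(3)] Cons.prems(3,4) by auto
  have "w1 \<in> tame B" using B[OF w(2) Cons.prems(2)] Cons.prems(4)[of b] by simp
  then show ?case using w(1) bs by (intro exI[of _ "w1 # bs"]) simp
qed

lemma tame_decomposition:
  "\<exists>B. \<exists>C::nat. \<forall>w\<in>lists S. \<exists>bs. \<exists>w'\<in>lists S. set bs \<subseteq> tame B \<and> w = concat bs \<and>
     \<Gamma> 2 #> word_eval G w' = \<Gamma> 2 #> word_eval G w \<and>
     real (length w') + real (length bs) / 2 \<le> real (length w) + real C"
proof -
  obtain B where B: "\<And>v w cs v'. run v w cs v' \<Longrightarrow> simple_path v \<Longrightarrow>
     \<not> C2.nonopt cs \<or> cs \<noteq> [] \<and> \<not> C2.nonopt (butlast cs) \<Longrightarrow> w \<in> tame B"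
    using run_tame by blast
  obtain C :: nat where C: "\<forall>w\<in>lists S. \<forall>cs u ws t. word_eval G w = loops_val cs \<otimes> word_eval G u \<longrightarrow>
     length w = loops_len cs + length u \<longrightarrow> u \<in> lists S \<longrightarrow> cs = concat ws @ t \<longrightarrow> set ws \<subseteq> lists loops \<longrightarrow>
     t \<in> lists loops \<longrightarrow> (\<forall>b\<in>set ws. C2.nonopt b) \<longrightarrow>
     (\<exists>w'\<in>lists S. \<Gamma> 2 #> word_eval G w' = \<Gamma> 2 #> word_eval G w \<and>
        real (length w') + real (length ws) / 2 \<le> real (length w) + real C)"
    using class2_saving by (elim exE)
  have "\<exists>bs. \<exists>w'\<in>lists S. set bs \<subseteq> tame B \<and> w = concat bs \<and>
     \<Gamma> 2 #> word_eval G w' = \<Gamma> 2 #> word_eval G w \<and>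
     real (length w') + real (length bs) / 2 \<le> real (length w) + real (Suc C)" if w: "w \<in> lists S" for w
  proof -
    obtain cs u where r: "run [] w cs u" "cs \<in> lists loops" "simple_path u"
      "word_eval G w = loops_val cs \<otimes> word_eval G u" "length w = loops_len cs + length u"
      using word_run[OF w] .
    obtain ws t where ws: "cs = concat ws @ t" "\<not> C2.nonopt t" "\<And>b. b \<in> set ws \<Longrightarrow> b \<noteq> [] \<and> C2.nonopt b \<and> \<not> C2.nonopt (butlast b)"
      using C2.greedy_blocks[OF r(2)] by blast
    have l: "set ws \<subseteq> lists loops" "t \<in> lists loops" "u \<in> lists S"
    proof -
      have "set (concat ws @ t) \<subseteq> loops" using r(2) unfolding ws(1) lists_eq_set by blast
      then have a: "\<Union> (set ` set ws) \<union> set t \<subseteq> loops" by simp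
      then show "set ws \<subseteq> lists loops" "t \<in> lists loops" unfolding lists_eq_set by blast+
      show "u \<in> lists S" using r(3) by (simp add: simple_path_def)
    qed
    have "\<exists>bs. set bs \<subseteq> tame B \<and> w = concat bs \<and> length bs = Suc (length ws)"
    proof (rule run_concat_tame)
      show "run [] w (concat ws @ t) u" using r(1) unfolding ws(1) .
      show "b \<noteq> [] \<and> \<not> C2.nonopt (butlast b)" if "b \<in> set ws" for b using ws(3)[OF that] by simp
    qed (rule simple_path_Nil ws(2) B; assumption?)+
    then obtain bs where bs: "set bs \<subseteq> tame B" "w = concat bs" "length bs = Suc (length ws)" by blast
    have opt: "\<forall>b\<in>set ws. C2.nonopt b" using ws(3) by simp
    have "\<exists>w'\<in>lists S. \<Gamma> 2 #> word_eval G w' = \<Gamma> 2 #> word_eval G w \<and>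
        real (length w') + real (length ws) / 2 \<le> real (length w) + real C"
      by (rule C[rule_format, OF w r(4,5) l(3) ws(1) l(1,2)]) (rule bspec[OF opt])
    then obtain w' where w': "w' \<in> lists S" "\<Gamma> 2 #> word_eval G w' = \<Gamma> 2 #> word_eval G w"
      "real (length w') + real (length ws) / 2 \<le> real (length w) + real C"
      by (elim bexE conjE)
    show ?thesis using bs w' by (intro exI[of _ bs] bexI[of _ w']) (auto simp: add_divide_distrib)
  qed
  then show ?thesis by blast
qed

lemma coset_step: "X \<in> rcosets H \<Longrightarrow> s \<in> S \<Longrightarrow> X #> s \<in> rcosets H"
proof -
  assume a: "X \<in> rcosets H" "s \<in> S"
  then obtain g where g: "g \<in> carrier G" "X = H #> g" by (auto simp: RCOSETS_def)
  have "X #> s = H #> (g \<otimes> s)" using g a(2) S_carrier H.subset by (simp add: coset_mult_assoc subsetD)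
  then show ?thesis using g a(2) S_carrier by (auto intro!: coset_in_rcosets)
qed

text \<open>A letter is either the unique good one at the current vertex or one of the at most \<open>B\<close> bad ones.\<close>

lemma few_bad_words_count:
  assumes "\<not> two_on_common_facet G H \<phi> S" "face D"
  shows "X \<in> rcosets H \<Longrightarrow> card {w \<in> lists S. length w = n \<and> bad D X w \<le> B} \<le> (1 + card S * n) ^ B"
proof (induction n arbitrary: X B)
  case 0
  have "{w \<in> lists S. length w = 0 \<and> bad D X w \<le> B} = {[]}" by auto
  then show ?case by simp
next
  case (Suc n)
  define W where "W X n B = {w \<in> lists S. length w = n \<and> bad D X w \<le> B}" for X n B
  have finW: "finite (W X n B)" for X n B
    by (rule finite_subset[OF _ finite_lists_length_eq[OF finite_S, of n]]) (auto simp: W_def in_lists_conv_set)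
  have IH: "card (W X n B) \<le> (1 + card S * n) ^ B" if "X \<in> rcosets H" for X B
    using Suc.IH[OF that] by (simp add: W_def)
  let ?gs = "{s \<in> S. good D X s}"
  let ?I = "\<Union>s\<in>?gs. (#) s ` W (X #> s) n B" and ?J = "\<Union>s\<in>S. (#) s ` (if B = 0 then {} else W (X #> s) n (B - 1))"
  have sub: "W X (Suc n) B \<subseteq> ?I \<union> ?J"
  proof
    fix w assume w: "w \<in> W X (Suc n) B"
    then obtain s v where sv: "w = s # v" "length v = n" by (auto simp: W_def length_Suc_conv)
    then have s: "s \<in> S" "v \<in> lists S" "bad D X (s # v) \<le> B" using w by (auto simp: W_def)
    show "w \<in> ?I \<union> ?J"
    proof (cases "good D X s")
      case True
      then have "v \<in> W (X #> s) n B" using s sv(2) by (simp add: W_def)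
      then have "w \<in> ?I" unfolding sv(1) using True s(1) by (intro UN_I[of s]) auto
      then show ?thesis by simp
    next
      case False
      then have "B \<noteq> 0" "v \<in> W (X #> s) n (B - 1)" using s sv(2) by (auto simp: W_def)
      then have "w \<in> ?J" unfolding sv(1) using s(1) by (intro UN_I[of s]) auto
      then show ?thesis by simp
    qed
  qed
  have fingS: "finite ?gs" using finite_S by simp
  have "card ?gs \<le> Suc 0"
    unfolding card_le_Suc0_iff_eq[OF fingS] using good_unique[OF assms Suc.prems] by blast
  then have g1: "card ?gs \<le> 1" by simp
  have cI: "card ?I \<le> (1 + card S * n) ^ B"
  proof -
    have "card ?I \<le> (\<Sum>s\<in>?gs. card ((#) s ` W (X #> s) n B))" by (rule card_UN_le[OF fingS])
    also have "\<dots> \<le> (\<Sum>s\<in>?gs. (1 + card S * n) ^ B)"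
    proof (rule sum_mono)
      fix s assume "s \<in> ?gs"
      then have "X #> s \<in> rcosets H" using coset_step[OF Suc.prems] by blast
      then show "card ((#) s ` W (X #> s) n B) \<le> (1 + card S * n) ^ B"
        using IH card_image_le[OF finW, of "(#) s" "X #> s" n B] le_trans by blast
    qed
    also have "\<dots> \<le> 1 * (1 + card S * n) ^ B" using g1 by (simp add: mult_le_mono1)
    finally show ?thesis by simp
  qed
  have cJ: "card ?J \<le> (if B = 0 then 0 else card S * (1 + card S * n) ^ (B - 1))"
  proof (cases "B = 0")
    case False
    have "card ?J \<le> (\<Sum>s\<in>S. card ((#) s ` W (X #> s) n (B - 1)))" using card_UN_le[OF finite_S] False by simp
    also have "\<dots> \<le> (\<Sum>s\<in>S. (1 + card S * n) ^ (B - 1))"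
    proof (rule sum_mono)
      fix s assume "s \<in> S"
      then have "X #> s \<in> rcosets H" using coset_step[OF Suc.prems] by blast
      then show "card ((#) s ` W (X #> s) n (B - 1)) \<le> (1 + card S * n) ^ (B - 1)"
        using IH card_image_le[OF finW, of "(#) s" "X #> s" n "B - 1"] le_trans by blast
    qed
    finally show ?thesis using False by simp
  qed simp
  have finIJ: "finite (?I \<union> ?J)" using finite_S finW by auto
  have "card (W X (Suc n) B) \<le> card ?I + card ?J"
    using card_mono[OF finIJ sub] card_Un_le[of ?I ?J] by linarith
  also have "\<dots> \<le> (1 + card S * Suc n) ^ B"
  proof (cases B)
    case 0
    then show ?thesis using cI cJ by simp
  next
    case (Suc b)
    have "card ?I + card ?J \<le> (1 + card S * n) ^ b * (1 + card S * n + card S)"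
      using cI cJ Suc by (simp add: algebra_simps)
    also have "\<dots> \<le> (1 + card S * Suc n) ^ b * (1 + card S * Suc n)"
      by (intro mult_le_mono power_mono) auto
    finally show ?thesis using Suc by (simp add: mult.commute)
  qed
  finally show ?case by (simp add: W_def)
qed

lemma tame_count:
  assumes "\<not> two_on_common_facet G H \<phi> S"
  shows "\<exists>A. \<forall>n. card {w \<in> tame B. length w \<le> n} \<le> A * (n + 1) ^ Suc B"
proof -
  let ?Ds = "insert {} {D. D facet_of Pol}"
  let ?R = "rcosets H"
  have finD: "finite ?Ds" using finite_polyhedron_facets[OF polyhedron_Pol] by simp
  define W where "W D X n = {w \<in> lists S. length w = n \<and> bad D X w \<le> B}" for D X n
  have finW: "finite (W D X n)" for D X n
    by (rule finite_subset[OF _ finite_lists_length_eq[OF finite_S, of n]]) (auto simp: W_def in_lists_conv_set)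
  let ?q = "\<lambda>n. (1 + card S * n) ^ B"
  have "card {w \<in> tame B. length w \<le> n} \<le> (card ?Ds * card ?R * (1 + card S) ^ B) * (n + 1) ^ Suc B" for n
  proof -
    have c1: "card (\<Union>k\<in>{..n}. W D X k) \<le> (n + 1) * ?q n" if "D \<in> ?Ds" "X \<in> ?R" for D X
    proof -
      have f: "face D" using that(1) by (auto simp: face_def)
      have "card (\<Union>k\<in>{..n}. W D X k) \<le> (\<Sum>k\<in>{..n}. card (W D X k))" by (rule card_UN_le) simp
      also have "\<dots> \<le> (\<Sum>k\<in>{..n}. ?q n)"
      proof (rule sum_mono)
        fix k assume "k \<in> {..n}"
        then have "?q k \<le> ?q n" by (intro power_mono) auto
        then show "card (W D X k) \<le> ?q n"
          using few_bad_words_count[OF assms f that(2), of k B] unfolding W_def by linarith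
      qed
      finally show ?thesis by simp
    qed
    have c2: "card (\<Union>X\<in>?R. \<Union>k\<in>{..n}. W D X k) \<le> card ?R * ((n + 1) * ?q n)" if "D \<in> ?Ds" for D
    proof -
      have "card (\<Union>X\<in>?R. \<Union>k\<in>{..n}. W D X k) \<le> (\<Sum>X\<in>?R. card (\<Union>k\<in>{..n}. W D X k))" by (rule card_UN_le[OF finite_index])
      also have "\<dots> \<le> (\<Sum>X\<in>?R. (n + 1) * ?q n)" by (rule sum_mono) (rule c1[OF that])
      finally show ?thesis by simp
    qed
    have sub: "{w \<in> tame B. length w \<le> n} \<subseteq> (\<Union>D\<in>?Ds. \<Union>X\<in>?R. \<Union>k\<in>{..n}. W D X k)"
    proof
      fix w assume "w \<in> {w \<in> tame B. length w \<le> n}"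
      then obtain D X where D: "w \<in> lists S" "length w \<le> n" "face D" "X \<in> ?R" "bad D X w \<le> B" by (auto simp: tame_def)
      have "w \<in> W D X (length w)" using D by (simp add: W_def)
      moreover have "D \<in> ?Ds" using D(3) by (simp add: face_def)
      ultimately show "w \<in> (\<Union>D\<in>?Ds. \<Union>X\<in>?R. \<Union>k\<in>{..n}. W D X k)" using D(2,4) by (intro UN_I) auto
    qed
    have "card {w \<in> tame B. length w \<le> n} \<le> card (\<Union>D\<in>?Ds. \<Union>X\<in>?R. \<Union>k\<in>{..n}. W D X k)"
      using finD finite_index finW by (intro card_mono[OF _ sub]) auto
    also have "\<dots> \<le> (\<Sum>D\<in>?Ds. card (\<Union>X\<in>?R. \<Union>k\<in>{..n}. W D X k))" by (rule card_UN_le[OF finD])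
    also have "\<dots> \<le> (\<Sum>D\<in>?Ds. card ?R * ((n + 1) * ?q n))" by (rule sum_mono) (rule c2)
    also have "\<dots> = card ?Ds * (card ?R * ((n + 1) * ?q n))" by simp
    also have "\<dots> \<le> card ?Ds * (card ?R * ((n + 1) * ((1 + card S) * (n + 1)) ^ B))"
      by (intro mult_le_mono2 power_mono) (auto simp: algebra_simps)
    also have "\<dots> = (card ?Ds * card ?R * (1 + card S) ^ B) * (n + 1) ^ Suc B"
      by (simp only: power_mult_distrib power_Suc mult_ac)
    finally show ?thesis .
  qed
  then show ?thesis by blast
qed

end

section \<open>From \<open>\<Gamma> i\<close> to \<open>\<Gamma> (i + 1)\<close>\<close>

lemma cut_into_pieces:
  assumes "m \<ge> (1::nat)"
  shows "\<exists>ps. w = concat ps \<and> (\<forall>p\<in>set ps. length p \<le> m) \<and> length ps * m \<le> length w + m"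
proof (induction "length w" arbitrary: w rule: less_induct)
  case less
  show ?case
  proof (cases "length w \<le> m")
    case True
    then show ?thesis by (intro exI[of _ "[w]"]) auto
  next
    case False
    then have "length (drop m w) < length w" using assms by simp
    then obtain ps where ps: "drop m w = concat ps" "\<forall>p\<in>set ps. length p \<le> m" "length ps * m \<le> length (drop m w) + m"
      using less by blast
    have "w = concat (take m w # ps)" using ps(1) by (metis append_take_drop_id concat.simps(2))
    then show ?thesis using ps(2,3) False by (intro exI[of _ "take m w # ps"]) auto
  qed
qed

text \<open>With pieces of length \<open>m \<approx> X\<^sup>x\<close> the saving lost in the pieces is \<open>X\<^sup>1\<^sup>-\<^sup>x\<^sup>+\<^sup>x\<^sup>\<beta>\<close> and the correction costs
  \<open>X\<^sup>x\<^sup>+\<^sup>(\<^sup>1\<^sup>-\<^sup>x\<^sup>)\<^sup>/\<^sup>s\<close>; the value of \<open>x\<close> is the one for which both exponents are equal.\<close>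

lemma growth_step_exponents:
  fixes X s \<beta> K :: real and m N q :: nat
  assumes X: "1 \<le> X" and s: "1 < s" and \<beta>: "0 \<le> \<beta>" "\<beta> < 1" and K: "0 \<le> K"
  defines "x \<equiv> (1 - 1 / s) / (2 - \<beta> - 1 / s)" and "\<alpha> \<equiv> (1 - 1 / s * \<beta>) / (2 - \<beta> - 1 / s)"
  assumes m: "X powr x \<le> real m" "real m \<le> X powr x + 1" and N: "real N * real m \<le> X + real m"
  shows "real N * (real m + 1) powr \<beta> \<le> 6 * X powr \<alpha>"
    "real m * ((K * real N) powr (1 / s) + 2) \<le> 2 * (2 * K + 3) * X powr \<alpha>"
proof -
  have si: "0 < 1 / s" "1 / s < 1" using s by auto
  have d: "0 < 2 - \<beta> - 1 / s" using si \<beta> by linarith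
  have x0: "0 < x" unfolding x_def using si d by simp
  have x1: "x < 1" unfolding x_def using \<beta> d by simp
  have e1: "1 - x + x * \<beta> = \<alpha>" "x + (1 - x) * (1 / s) = \<alpha>"
  proof -
    have xd: "x * (2 - \<beta> - 1 / s) = 1 - 1 / s" unfolding x_def using d by simp
    have "(1 - x + x * \<beta>) * (2 - \<beta> - 1 / s) = (2 - \<beta> - 1 / s) - (x * (2 - \<beta> - 1 / s)) * (1 - \<beta>)"
      by (simp only: algebra_simps)
    also have "\<dots> = 1 - 1 / s * \<beta>" unfolding xd by (simp add: algebra_simps diff_divide_distrib)
    finally show "1 - x + x * \<beta> = \<alpha>" unfolding \<alpha>_def nonzero_eq_divide_eq[OF less_imp_neq[OF d, symmetric]] .
    have "(x + (1 - x) * (1 / s)) * (2 - \<beta> - 1 / s)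
        = (x * (2 - \<beta> - 1 / s)) * (1 - 1 / s) + (1 / s) * (2 - \<beta> - 1 / s)"
      by (simp only: algebra_simps)
    also have "\<dots> = 1 - 1 / s * \<beta>" unfolding xd by (simp only: algebra_simps)
    finally show "x + (1 - x) * (1 / s) = \<alpha>" unfolding \<alpha>_def nonzero_eq_divide_eq[OF less_imp_neq[OF d, symmetric]] .
  qed
  have p1: "1 \<le> X powr y" if "0 \<le> y" for y using X that by (rule ge_one_powr_ge_zero)
  have px: "1 \<le> X powr x" by (rule p1) (use x0 in simp)
  have mpos: "0 < real m" using px m(1) by linarith
  have N2: "real N \<le> 2 * X powr (1 - x)"
  proof -
    have "real N \<le> X / real m + 1" using N mpos by (simp add: field_simps)
    also have "X / real m \<le> X / X powr x" using m(1) px X by (intro divide_left_mono) auto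
    also have "X / X powr x = X powr (1 - x)" using X by (simp add: powr_diff)
    also have "X powr (1 - x) + 1 \<le> 2 * X powr (1 - x)" using p1[of "1 - x"] x1 by simp
    finally show ?thesis by simp
  qed
  have "(real m + 1) powr \<beta> \<le> (3 * X powr x) powr \<beta>" using m(2) px \<beta> by (intro powr_mono2) auto
  also have "\<dots> = 3 powr \<beta> * X powr (x * \<beta>)" using X by (simp add: powr_mult powr_powr)
  also have "\<dots> \<le> 3 * X powr (x * \<beta>)" using powr_mono[of \<beta> 1 "3::real"] \<beta> by (intro mult_right_mono) auto
  finally have "real N * (real m + 1) powr \<beta> \<le> (2 * X powr (1 - x)) * (3 * X powr (x * \<beta>))"
    using N2 by (intro mult_mono) auto
  also have "\<dots> = 6 * X powr \<alpha>" unfolding e1(1)[symmetric] by (simp add: powr_add)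
  finally show "real N * (real m + 1) powr \<beta> \<le> 6 * X powr \<alpha>" .
  have y: "0 \<le> (1 - x) * (1 / s)" using x1 si by simp
  have "(K * real N) powr (1 / s) \<le> ((2 * K) * X powr (1 - x)) powr (1 / s)"
    using N2 K si mult_left_mono[OF N2 K] by (intro powr_mono2) (auto simp: mult_ac)
  also have "\<dots> = (2 * K) powr (1 / s) * X powr ((1 - x) * (1 / s))" using K X by (simp add: powr_mult powr_powr)
  also have "(2 * K) powr (1 / s) \<le> 2 * K + 1"
  proof (cases "1 \<le> 2 * K")
    case True
    then have "(2 * K) powr (1 / s) \<le> (2 * K) powr 1" using si by (intro powr_mono) auto
    then show ?thesis using True by simp
  next
    case False
    then have "(2 * K) powr (1 / s) \<le> 1" using K si by (intro powr_le1) auto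
    then show ?thesis using K by simp
  qed
  finally have "(K * real N) powr (1 / s) + 2 \<le> (2 * K + 1) * X powr ((1 - x) * (1 / s)) + 2 * X powr ((1 - x) * (1 / s))"
    using p1[OF y] by (simp add: mult_right_mono)
  also have "\<dots> = (2 * K + 3) * X powr ((1 - x) * (1 / s))" by (simp add: algebra_simps)
  finally have "real m * ((K * real N) powr (1 / s) + 2) \<le> (2 * X powr x) * ((2 * K + 3) * X powr ((1 - x) * (1 / s)))"
    using m(2) px by (intro mult_mono) auto
  also have "\<dots> = 2 * (2 * K + 3) * X powr \<alpha>" unfolding e1(2)[symmetric] by (simp only: powr_add mult_ac)
  finally show "real m * ((K * real N) powr (1 / s) + 2) \<le> 2 * (2 * K + 3) * X powr \<alpha>" .
qed

context nilpotent_pair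
begin

text \<open>Modulo \<open>\<Gamma> i\<close>, a word made of \<open>k\<close> pieces from \<open>W\<close>, for a suitable decomposition, can be shortened by \<open>k / 2\<close>
  up to an error of order \<open>n\<^sup>\<alpha>\<close>. When \<open>\<Gamma> i\<close> is trivial a geodesic cannot be shortened, which bounds \<open>k\<close>.\<close>

definition short_mod :: "nat \<Rightarrow> real \<Rightarrow> 'a list set \<Rightarrow> bool" where
  "short_mod i \<alpha> W \<longleftrightarrow> (\<exists>C::nat. \<forall>w\<in>lists S. \<exists>bs. \<exists>w'\<in>lists S. set bs \<subseteq> W \<and> w = concat bs \<and>
     \<Gamma> i #> word_eval G w' = \<Gamma> i #> word_eval G w \<and>
     real (length w') + real (length bs) / 2 \<le> real (length w) + real C * (real (length w) + 1) powr \<alpha>)"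

text \<open>Conjugation by an element of \<open>H\<close> is trivial on \<open>\<Gamma> i / \<Gamma> (i + 1)\<close>, so \<open>g\<close> may be replaced by a representative of its
  coset of bounded length.\<close>

lemma conj_mod_Gamma:
  "\<exists>C. \<forall>g\<in>carrier G. \<forall>z\<in>\<Gamma> i. \<exists>y\<in>\<Gamma> i. \<Gamma> (Suc i) #> (inv g \<otimes> z \<otimes> g) = \<Gamma> (Suc i) #> y \<and>
     (\<forall>m. z \<in> ball m \<longrightarrow> y \<in> ball (m + C))"
proof -
  obtain D where D: "\<And>n g. g \<in> ball n \<Longrightarrow> inv g \<in> ball (D * n)" using ball_inv by blast
  let ?M = "card (rcosets H)"
  have "\<exists>y\<in>\<Gamma> i. \<Gamma> (Suc i) #> (inv g \<otimes> z \<otimes> g) = \<Gamma> (Suc i) #> y \<and> (\<forall>m. z \<in> ball m \<longrightarrow> y \<in> ball (m + (D * ?M + ?M)))"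
    if g: "g \<in> carrier G" and z: "z \<in> \<Gamma> i" for g z
  proof -
    have "H #> g \<in> rcosets H" using g by (auto simp: RCOSETS_def)
    then obtain p where p: "simple_path p" "H #> g = vx p" by (rule simple_path_to_coset)
    have pl: "p \<in> lists S" using p(1) by (simp add: simple_path_def)
    let ?r = "word_eval G p"
    have r: "?r \<in> carrier G" "?r \<in> ball ?M"
      using pl ball_mono[OF eval_ball[OF pl], of ?M] simple_path_length[OF p(1)] by auto
    have zc: "z \<in> carrier G" using z by simp
    define h where "h = g \<otimes> inv ?r"
    have hH: "h \<in> H" using normal_coset_eq_iff[OF normal_H g r(1)] p(2) unfolding h_def vx_def by simp
    have hc: "h \<in> carrier G" using hH by simp
    have gr: "g = h \<otimes> ?r" unfolding h_def using g r by (simp add: m_assoc)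
    let ?y = "inv ?r \<otimes> z \<otimes> ?r"
    have "inv h \<otimes> z \<otimes> h = z \<otimes> commutator G (inv z) (inv h)"
      unfolding commutator_def using zc hc by (simp add: m_assoc)
    moreover have "commutator G (inv z) (inv h) \<in> \<Gamma> (Suc i)" using commutator_Gamma_H[of "inv z" i "inv h"] z hH by simp
    ultimately have "\<Gamma> (Suc i) #> (inv h \<otimes> z \<otimes> h) = \<Gamma> (Suc i) #> z" using Gamma_coset_absorb(1) zc by simp
    then have "\<Gamma> (Suc i) #> (inv ?r \<otimes> (inv h \<otimes> z \<otimes> h) \<otimes> ?r) = \<Gamma> (Suc i) #> ?y"
      using r zc hc by (intro Gamma_coset_mult_cong) auto
    moreover have "inv ?r \<otimes> (inv h \<otimes> z \<otimes> h) \<otimes> ?r = inv g \<otimes> z \<otimes> g"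
      unfolding gr using r zc hc by (simp add: m_assoc inv_mult_group)
    ultimately have 1: "\<Gamma> (Suc i) #> (inv g \<otimes> z \<otimes> g) = \<Gamma> (Suc i) #> ?y" by simp
    have 2: "?y \<in> \<Gamma> i" by (rule Gamma_conj'[OF z r(1)])
    have 3: "?y \<in> ball (m + (D * ?M + ?M))" if "z \<in> ball m" for m
    proof -
      have "?y \<in> ball (D * ?M + m + ?M)" using D[OF r(2)] that r(2) by (intro ball_mult)
      then show ?thesis by (simp add: ac_simps)
    qed
    show ?thesis using 1 2 3 by blast
  qed
  then show ?thesis by blast
qed

text \<open>Moving the errors to the right conjugates them by arbitrarily long words, which by \<open>conj_mod_Gamma\<close> changes
  their lengths by a constant only.\<close>

lemma collect_errors:
  assumes C: "\<forall>g\<in>carrier G. \<forall>z\<in>\<Gamma> i. \<exists>y\<in>\<Gamma> i. \<Gamma> (Suc i) #> (inv g \<otimes> z \<otimes> g) = \<Gamma> (Suc i) #> y \<and>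
     (\<forall>m. z \<in> ball m \<longrightarrow> y \<in> ball (m + C))"
  shows "set ps \<subseteq> carrier G \<times> (\<Gamma> i \<inter> ball m) \<Longrightarrow>
    \<exists>zs. length zs = length ps \<and> set zs \<subseteq> \<Gamma> i \<inter> ball (m + C) \<and>
      \<Gamma> (Suc i) #> word_eval G (map (\<lambda>(g, z). g \<otimes> z) ps) = \<Gamma> (Suc i) #> (word_eval G (map fst ps) \<otimes> word_eval G zs)"
proof (induction ps)
  case (Cons a ps)
  obtain g z where a: "a = (g, z)" by (cases a)
  have gz: "g \<in> carrier G" "z \<in> \<Gamma> i" "z \<in> ball m" using Cons.prems a by auto
  have zc: "z \<in> carrier G" using gz(2) by simp
  obtain zs where zs: "length zs = length ps" "set zs \<subseteq> \<Gamma> i \<inter> ball (m + C)"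
    "\<Gamma> (Suc i) #> word_eval G (map (\<lambda>(g, z). g \<otimes> z) ps) = \<Gamma> (Suc i) #> (word_eval G (map fst ps) \<otimes> word_eval G zs)"
    using Cons by auto
  let ?Q = "word_eval G (map fst ps)" and ?Z = "word_eval G zs"
  have "set (map fst ps) \<subseteq> carrier G" using Cons.prems by auto
  then have Q: "?Q \<in> carrier G" by (rule word_eval_closed)
  have "set zs \<subseteq> carrier G" using zs(2) ball_carrier by blast
  then have Z: "?Z \<in> carrier G" by (rule word_eval_closed)
  have "set (map (\<lambda>(g, z). g \<otimes> z) ps) \<subseteq> carrier G" using Cons.prems ball_carrier by auto
  then have W: "word_eval G (map (\<lambda>(g, z). g \<otimes> z) ps) \<in> carrier G" by (rule word_eval_closed)
  obtain y where y: "y \<in> \<Gamma> i" "\<Gamma> (Suc i) #> (inv ?Q \<otimes> z \<otimes> ?Q) = \<Gamma> (Suc i) #> y" "y \<in> ball (m + C)"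
    using bspec[OF bspec[OF C Q] gz(2)] gz(3) by blast
  have yc: "y \<in> carrier G" using y(1) by simp
  have "\<Gamma> (Suc i) #> word_eval G (map (\<lambda>(g, z). g \<otimes> z) (a # ps)) = \<Gamma> (Suc i) #> ((g \<otimes> z) \<otimes> (?Q \<otimes> ?Z))"
    unfolding a using zs(3) gz(1) zc Q Z W by (simp, intro Gamma_coset_mult_cong) auto
  also have "(g \<otimes> z) \<otimes> (?Q \<otimes> ?Z) = (g \<otimes> ?Q) \<otimes> ((inv ?Q \<otimes> z \<otimes> ?Q) \<otimes> ?Z)"
    using gz(1) zc Q Z by (simp add: m_assoc)
  also have "\<Gamma> (Suc i) #> \<dots> = \<Gamma> (Suc i) #> ((g \<otimes> ?Q) \<otimes> (y \<otimes> ?Z))"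
    using gz(1) zc Q Z yc y(2) by (intro Gamma_coset_mult_cong refl) auto
  finally show ?case using zs(1,2) y(1,3) a by (intro exI[of _ "y # zs"]) auto
qed (simp add: exI[of _ "[]"])

lemma root_count:
  fixes K s :: nat
  assumes "s \<ge> 1"
  defines "t \<equiv> nat \<lceil>(real K) powr (1 / real s)\<rceil> + 1"
  shows "K \<le> t ^ s" "real t \<le> (real K) powr (1 / real s) + 2" "1 \<le> t"
proof -
  let ?z = "(real K) powr (1 / real s)"
  have z: "0 \<le> ?z" by simp
  then have t: "?z \<le> real t" "real t \<le> ?z + 2" unfolding t_def by linarith+
  have "real K = ?z powr real s" using assms by (cases "K = 0") (simp_all add: powr_powr)
  also have "\<dots> = ?z ^ s" using assms by (cases "K = 0") (simp_all add: powr_realpow)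
  also have "\<dots> \<le> real t ^ s" using t(1) z by (rule power_mono)
  finally have "real K \<le> real (t ^ s)" by simp
  then show "K \<le> t ^ s" by (simp only: of_nat_le_iff)
  show "real t \<le> ?z + 2" by (rule t(2))
  show "1 \<le> t" by (simp add: t_def)
qed

text \<open>The pieces are shortened modulo \<open>\<Gamma> i\<close> separately; the errors lie in \<open>\<Gamma> i\<close>, and their product is replaced by a
  short word using \<open>cheap_Gamma_product\<close>.\<close>

lemma short_mod_step:
  assumes sm: "short_mod i \<beta> W" and i: "1 \<le> i" and \<beta>: "0 \<le> \<beta>" "\<beta> < 1"
  defines "s \<equiv> real (Suc i)"
  shows "short_mod (Suc i) ((1 - 1 / s * \<beta>) / (2 - \<beta> - 1 / s)) W"
proof -
  let ?\<alpha> = "(1 - 1 / s * \<beta>) / (2 - \<beta> - 1 / s)" and ?x = "(1 - 1 / s) / (2 - \<beta> - 1 / s)"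
  obtain C :: nat where C: "\<forall>w\<in>lists S. \<exists>bs. \<exists>w'\<in>lists S. set bs \<subseteq> W \<and> w = concat bs \<and>
     \<Gamma> i #> word_eval G w' = \<Gamma> i #> word_eval G w \<and>
     real (length w') + real (length bs) / 2 \<le> real (length w) + real C * (real (length w) + 1) powr \<beta>"
    using sm unfolding short_mod_def by blast
  let ?P = "\<lambda>w x. set (fst x) \<subseteq> W \<and> snd x \<in> lists S \<and> w = concat (fst x) \<and>
     \<Gamma> i #> word_eval G (snd x) = \<Gamma> i #> word_eval G w \<and>
     real (length (snd x)) + real (length (fst x)) / 2 \<le> real (length w) + real C * (real (length w) + 1) powr \<beta>"
  have "\<forall>w\<in>lists S. \<exists>x. ?P w x"
  proof (rule ballI)
    fix w assume "w \<in> lists S"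
    from bspec[OF C this] show "\<exists>x. ?P w x"
    proof (elim exE bexE)
      fix bs w'
      assume "w' \<in> lists S" "set bs \<subseteq> W \<and> w = concat bs \<and> \<Gamma> i #> word_eval G w' = \<Gamma> i #> word_eval G w \<and>
        real (length w') + real (length bs) / 2 \<le> real (length w) + real C * (real (length w) + 1) powr \<beta>"
      then show "\<exists>x. ?P w x" by (intro exI[of _ "(bs, w')"]) (unfold fst_conv snd_conv, blast)
    qed
  qed
  from bchoice[OF this] obtain f where f: "\<And>w. w \<in> lists S \<Longrightarrow> ?P w (f w)" by blast
  obtain K Q where KQ: "\<forall>m\<ge>1. \<forall>q\<ge>1. \<forall>zs. set zs \<subseteq> \<Gamma> i \<inter> ball m \<longrightarrow> K * length zs * m ^ Suc i \<le> q ^ Suc i \<longrightarrow>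
    (\<exists>g\<in>ball (Q * q). \<Gamma> (Suc i) #> word_eval G zs = \<Gamma> (Suc i) #> g)" using cheap_Gamma_product[of i] by (elim exE)
  obtain D where D: "\<And>n g. g \<in> ball n \<Longrightarrow> inv g \<in> ball (D * n)" using ball_inv by blast
  obtain E where E: "\<forall>g\<in>carrier G. \<forall>z\<in>\<Gamma> i. \<exists>y\<in>\<Gamma> i. \<Gamma> (Suc i) #> (inv g \<otimes> z \<otimes> g) = \<Gamma> (Suc i) #> y \<and>
     (\<forall>m. z \<in> ball m \<longrightarrow> y \<in> ball (m + E))" using conj_mod_Gamma[of i] by (elim exE)
  define e where "e = D * (1 + 2 * C) + 1 + E"
  \<comment> \<open>The factors \<open>6\<close> and \<open>2 (2 K + 3)\<close> are those of \<open>growth_step_exponents\<close>.\<close>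
  define C' where "C' = 6 * C + Q * e * (2 * (2 * K + 3))"
  have s1: "1 < s" using i by (simp add: s_def)
  have "\<exists>bs. \<exists>w'\<in>lists S. set bs \<subseteq> W \<and> w = concat bs \<and>
     \<Gamma> (Suc i) #> word_eval G w' = \<Gamma> (Suc i) #> word_eval G w \<and>
     real (length w') + real (length bs) / 2 \<le> real (length w) + real C' * (real (length w) + 1) powr ?\<alpha>"
    if w: "w \<in> lists S" for w
  proof -
    define X where "X = real (length w) + 1"
    have X1: "1 \<le> X" by (simp add: X_def)
    \<comment> \<open>The length of the pieces.\<close>
    define m where "m = nat \<lceil>X powr ?x\<rceil>"
    have Xx: "0 < X powr ?x" using X1 by simp
    have m: "X powr ?x \<le> real m" "real m \<le> X powr ?x + 1" unfolding m_def using Xx by linarith+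
    have m1: "1 \<le> m" using Xx m(1) by (cases m) auto
    obtain ps where ps: "w = concat ps" "\<forall>p\<in>set ps. length p \<le> m" "length ps * m \<le> length w + m"
      using cut_into_pieces[OF m1] by blast
    let ?N = "length ps"
    have "real (?N * m) \<le> real (length w + m)" using ps(3) by (simp only: of_nat_le_iff)
    then have N: "real ?N * real m \<le> X + real m" by (simp add: X_def)
    have pS: "p \<in> lists S" if "p \<in> set ps" for p using w that unfolding ps(1) by (auto simp: in_lists_conv_set)
    let ?g = "\<lambda>p. word_eval G (snd (f p))"
    let ?z = "\<lambda>p. inv (?g p) \<otimes> word_eval G p"
    let ?c = "real C * (real m + 1) powr \<beta>"
    have mb: "(real m + 1) powr \<beta> \<le> 2 * real m"
    proof -
      have "(real m + 1) powr \<beta> \<le> (real m + 1) powr 1" using \<beta> by (intro powr_mono) auto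
      then show ?thesis using m1 by simp
    qed
    have em_eq: "e * m = D * ((1 + 2 * C) * m) + m + E * m" by (simp add: e_def algebra_simps)
    have Em: "E \<le> E * m" using m1 by (cases m) simp_all
    have piece: "?g p \<in> carrier G" "?z p \<in> \<Gamma> i" "?z p \<in> ball (e * m - E)" "?g p \<otimes> ?z p = word_eval G p"
      "real (length (snd (f p))) + real (length (fst (f p))) / 2 \<le> real (length p) + ?c" if p: "p \<in> set ps" for p
    proof -
      note fp = f[OF pS[OF p]] and pl = pS[OF p]
      have lm: "length p \<le> m" using ps(2) p by blast
      show g: "?g p \<in> carrier G" using fp by simp
      show "?z p \<in> \<Gamma> i" using Gamma_coset_decomp[of "word_eval G p" "?g p" i] fp pl by simp
      show "?g p \<otimes> ?z p = word_eval G p" using g pl by (simp add: m_assoc[symmetric])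
      have "(real (length p) + 1) powr \<beta> \<le> (real m + 1) powr \<beta>" using lm \<beta> by (intro powr_mono2) auto
      then have "real C * (real (length p) + 1) powr \<beta> \<le> ?c" by (intro mult_left_mono) auto
      then show b: "real (length (snd (f p))) + real (length (fst (f p))) / 2 \<le> real (length p) + ?c" using fp by linarith
      have "?c \<le> real C * (2 * real m)" using mb by (intro mult_left_mono) auto
      then have "real (length (snd (f p))) \<le> real ((1 + 2 * C) * m)" using b lm by (simp add: algebra_simps)
      then have "length (snd (f p)) \<le> (1 + 2 * C) * m" by (simp only: of_nat_le_iff)
      then have "?g p \<in> ball ((1 + 2 * C) * m)" using fp by (intro ball_mono[OF eval_ball]) auto
      then have 1: "inv (?g p) \<in> ball (D * ((1 + 2 * C) * m))" by (rule D)
      have 2: "word_eval G p \<in> ball m" by (rule ball_mono[OF eval_ball[OF pl] lm])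
      have "?z p \<in> ball (D * ((1 + 2 * C) * m) + m)" by (rule ball_mult[OF 1 2])
      moreover have "D * ((1 + 2 * C) * m) + m \<le> e * m - E" using em_eq Em by linarith
      ultimately show "?z p \<in> ball (e * m - E)" using ball_mono by blast
    qed
    have Eem: "E \<le> e * m" using em_eq Em by linarith
    have "set (map (\<lambda>p. (?g p, ?z p)) ps) \<subseteq> carrier G \<times> (\<Gamma> i \<inter> ball (e * m - E))" using piece(1-3) by auto
    from collect_errors[OF E this] obtain zs where zs: "length zs = ?N" "set zs \<subseteq> \<Gamma> i \<inter> ball (e * m - E + E)"
      "\<Gamma> (Suc i) #> word_eval G (map (\<lambda>(g, z). g \<otimes> z) (map (\<lambda>p. (?g p, ?z p)) ps))
        = \<Gamma> (Suc i) #> (word_eval G (map fst (map (\<lambda>p. (?g p, ?z p)) ps)) \<otimes> word_eval G zs)" by auto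
    have zsb: "set zs \<subseteq> \<Gamma> i \<inter> ball (e * m)" using zs(2) Eem by simp
    have ev: "word_eval G (concat xs) = word_eval G (map (word_eval G) xs)" if "set xs \<subseteq> lists S" for xs
      using that
    proof (induction xs rule: list.induct)
      case (Cons x xs)
      have "concat xs \<in> lists S" using Cons.prems unfolding lists_eq_set by (simp only: set_concat mem_Collect_eq list.set) blast
      then show ?case using Cons by simp
    qed simp
    have M1: "map (\<lambda>(g, z). g \<otimes> z) (map (\<lambda>p. (?g p, ?z p)) ps) = map (word_eval G) ps"
      using piece(4) by simp
    have M2: "word_eval G (map (word_eval G) ps) = word_eval G w" using ev[of ps] subsetI[OF pS] ps(1) by simp
    have M3: "map fst (map (\<lambda>p. (?g p, ?z p)) ps) = map (word_eval G) (map (snd \<circ> f) ps)" by simp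
    have sl: "set (map (snd \<circ> f) ps) \<subseteq> lists S" using f[OF pS] by (simp add: image_subset_iff)
    define v where "v = concat (map (snd \<circ> f) ps)"
    have wz: "\<Gamma> (Suc i) #> word_eval G w = \<Gamma> (Suc i) #> (word_eval G v \<otimes> word_eval G zs)"
      using zs(3) unfolding M1 M2 M3 ev[OF sl, symmetric] v_def[symmetric] .
    have vS: "v \<in> lists S" using sl unfolding v_def lists_eq_set by (simp only: set_concat mem_Collect_eq) blast
    define t where "t = nat \<lceil>(real (K * ?N)) powr (1 / real (Suc i))\<rceil> + 1"
    have t: "K * ?N \<le> t ^ Suc i" "real t \<le> (real (K * ?N)) powr (1 / real (Suc i)) + 2" "1 \<le> t"
      unfolding t_def by (rule root_count; simp)+
    have em: "1 \<le> e * m" using m1 by (simp add: e_def)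
    have "1 \<le> e * m * t" using em t(3) by simp
    moreover have "K * length zs * (e * m) ^ Suc i \<le> (e * m * t) ^ Suc i"
      using mult_le_mono1[OF t(1), of "(e * m) ^ Suc i"] unfolding zs(1) by (simp only: power_mult_distrib mult_ac)
    ultimately obtain g where g: "g \<in> ball (Q * (e * m * t))" "\<Gamma> (Suc i) #> word_eval G zs = \<Gamma> (Suc i) #> g"
      using KQ em zsb by blast
    obtain u where u: "u \<in> lists S" "length u \<le> Q * (e * m * t)" "g = word_eval G u"
      using g(1) unfolding ball_def by blast
    have zc: "word_eval G zs \<in> carrier G" using zsb ball_carrier by (intro word_eval_closed) blast
    have "\<Gamma> (Suc i) #> (word_eval G v \<otimes> word_eval G zs) = \<Gamma> (Suc i) #> (word_eval G v \<otimes> word_eval G u)"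
      using vS u g(2) zc by (intro Gamma_coset_mult_cong) auto
    then have e1: "\<Gamma> (Suc i) #> word_eval G (v @ u) = \<Gamma> (Suc i) #> word_eval G w" using wz vS u(1) by (simp add: eval_append)
    define bs where "bs = concat (map (fst \<circ> f) ps)"
    have bs: "set bs \<subseteq> W" using f[OF pS] unfolding bs_def by (simp add: UN_subset_iff)
    have cb: "concat bs = concat ps"
    proof -
      have "map (concat \<circ> (fst \<circ> f)) ps = map id ps"
      proof (rule map_cong[OF refl])
        fix p assume "p \<in> set ps"
        then show "(concat \<circ> (fst \<circ> f)) p = id p" using f[OF pS, of p] by simp
      qed
      moreover have "concat (concat zss) = concat (map concat zss)" for zss :: "'a list list list"
        by (induction zss) simp_all
      ultimately show ?thesis unfolding bs_def by simp
    qed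
    have sums: "real (length (concat (map (snd \<circ> f) qs))) + real (length (concat (map (fst \<circ> f) qs))) / 2
        \<le> real (length (concat qs)) + real (length qs) * ?c" if "set qs \<subseteq> set ps" for qs
      using that
    proof (induction qs rule: list.induct)
      case (Cons p qs)
      then show ?case using piece(5)[of p] by (simp add: algebra_simps add_divide_distrib)
    qed simp
    have "real ?N * ?c = real C * (real ?N * (real m + 1) powr \<beta>)" by simp
    also have "\<dots> \<le> real C * (6 * X powr ?\<alpha>)"
      by (intro mult_left_mono growth_step_exponents(1)[OF X1 s1 \<beta> _ m N, of 0]) auto
    finally have a1: "real ?N * ?c \<le> real (6 * C) * X powr ?\<alpha>" by simp
    have "real (length u) \<le> real (Q * (e * m * t))" using u(2) by (simp only: of_nat_le_iff)
    also have "\<dots> = real (Q * e) * (real m * real t)" by simp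
    also have "\<dots> \<le> real (Q * e) * (real m * ((real K * real ?N) powr (1 / s) + 2))"
      using t(2) unfolding s_def by (intro mult_left_mono) auto
    also have "\<dots> \<le> real (Q * e) * (2 * (2 * real K + 3) * X powr ?\<alpha>)"
      by (intro mult_left_mono growth_step_exponents(2)[OF X1 s1 \<beta> _ m N]) auto
    finally have a2: "real (length u) \<le> real (Q * e * (2 * (2 * K + 3))) * X powr ?\<alpha>" by simp
    have "real (length (v @ u)) + real (length bs) / 2 \<le> real (length w) + real ?N * ?c + real (length u)"
      using sums[of ps] ps(1) by (simp add: v_def bs_def)
    also have "\<dots> \<le> real (length w) + real C' * X powr ?\<alpha>"
      using a1 a2 unfolding C'_def of_nat_add distrib_right by linarith
    finally have "real (length (v @ u)) + real (length bs) / 2 \<le> real (length w) + real C' * (real (length w) + 1) powr ?\<alpha>"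
      unfolding X_def .
    moreover have "v @ u \<in> lists S" using vS u(1) by simp
    moreover have "w = concat bs" using cb ps(1) by simp
    ultimately show ?thesis using e1 bs by blast
  qed
  then show ?thesis unfolding short_mod_def by blast
qed

end

section \<open>Growth functions\<close>

lemma sum_powers_le: "(\<Sum>i\<le>k. (p::nat) ^ i) \<le> (1 + p) ^ k"
proof (induction k)
  case (Suc k)
  have "p ^ Suc k \<le> p * (1 + p) ^ k" by (simp add: power_mono)
  from add_mono[OF Suc this] show ?case by simp
qed simp

lemma growth_exponent_step:
  assumes "2 \<le> i"
  defines "s \<equiv> real (Suc i)"
  shows "growth_exponent (Suc i) = (1 - 1 / s * growth_exponent i) / (2 - growth_exponent i - 1 / s)"
  using assms by (subst growth_exponent.simps) simp

lemma growth_step_bounds: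
  assumes "1 < (s::real)" "0 \<le> \<beta>" "\<beta> < 1"
  shows "0 < (1 - 1 / s * \<beta>) / (2 - \<beta> - 1 / s)" "(1 - 1 / s * \<beta>) / (2 - \<beta> - 1 / s) < 1"
proof -
  have si: "0 < 1 / s" "1 / s < 1" using assms by auto
  have d: "0 < 2 - \<beta> - 1 / s" using si assms by linarith
  have "1 / s * \<beta> \<le> 1 * \<beta>" using si assms by (intro mult_right_mono) auto
  then have n: "0 < 1 - 1 / s * \<beta>" using assms by linarith
  then show "0 < (1 - 1 / s * \<beta>) / (2 - \<beta> - 1 / s)" using d by simp
  have "0 < (1 - \<beta>) * (1 - 1 / s)" using si assms by simp
  then have "1 - 1 / s * \<beta> < 2 - \<beta> - 1 / s" by (simp add: algebra_simps diff_divide_distrib)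
  then show "(1 - 1 / s * \<beta>) / (2 - \<beta> - 1 / s) < 1" using d by simp
qed

lemma growth_exponent_bounds: "2 \<le> i \<Longrightarrow> 0 \<le> growth_exponent i \<and> growth_exponent i < 1"
proof (induction i rule: nat_induct_at_least)
  case base
  then show ?case by (simp add: growth_exponent.simps)
next
  case (Suc i)
  then have "1 < real (Suc i)" by simp
  then show ?case using growth_step_bounds[of "real (Suc i)" "growth_exponent i"] Suc
    by (simp only: growth_exponent_step) simp
qed

lemma growth_exponent_pos: "3 \<le> i \<Longrightarrow> 0 < growth_exponent i"
proof -
  assume i: "3 \<le> i"
  obtain j where j: "i = Suc j" "2 \<le> j" using i by (cases i) auto
  have "1 < real (Suc j)" using j(2) by simp
  then show ?thesis unfolding j(1) using growth_step_bounds(1)[of "real (Suc j)" "growth_exponent j"] growth_exponent_bounds[OF j(2)] j(2)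
    by (simp only: growth_exponent_step)
qed

text \<open>All constants are moved into the argument: for large \<open>K\<close> the factor \<open>K\<^sup>\<alpha>\<close> dominates the constant in front and
  \<open>ln K \<ge> 1\<close> dominates the additive one.\<close>

lemma growth_le_exp_powr:
  fixes \<alpha> C L b :: real and f :: "nat \<Rightarrow> real"
  assumes "0 < \<alpha>" "\<alpha> < 1" "0 \<le> C" "0 \<le> L" "0 \<le> b"
    and f: "\<And>n. f n \<le> exp (C * (real n + 1) powr \<alpha> * (L + b * ln (real n + 1)))"
  shows "growth_le f (\<lambda>n. exp (real n powr \<alpha> * ln (real n)))"
proof -
  define E where "E = 2 * C * (L + b)"
  define K where "K = nat \<lceil>E powr (1 / \<alpha>)\<rceil> + 3"
  have "3 \<le> K" by (simp add: K_def)
  then have k3: "3 \<le> real K" by simp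
  have E0: "0 \<le> E" using assms by (simp add: E_def)
  have "E powr (1 / \<alpha>) \<le> real K" unfolding K_def by linarith
  then have "(E powr (1 / \<alpha>)) powr \<alpha> \<le> real K powr \<alpha>" using assms by (intro powr_mono2) auto
  then have EK: "E \<le> real K powr \<alpha>" using assms E0 by (cases "E = 0") (simp_all add: powr_powr)
  have lnK: "1 \<le> ln (real K)"
  proof -
    have "exp 1 \<le> real K" using exp_le k3 by linarith
    then show ?thesis using ln_mono[of "exp 1" "real K"] by (simp add: K_def)
  qed
  have "f n \<le> real K * exp (real (K * n) powr \<alpha> * ln (real (K * n))) + real K" if n: "1 \<le> n" for n
  proof -
    have n1: "1 \<le> real n" using n by simp
    have ln0: "0 \<le> ln (real n)" using n1 by simp
    have K0: "0 < real K" using k3 by simp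
    have "(real n + 1) powr \<alpha> \<le> (2 * real n) powr \<alpha>" using n1 assms by (intro powr_mono2) auto
    also have "\<dots> = 2 powr \<alpha> * real n powr \<alpha>" by (simp add: powr_mult)
    also have "\<dots> \<le> 2 * real n powr \<alpha>" using powr_mono[of \<alpha> 1 "2::real"] assms by (intro mult_right_mono) auto
    finally have p: "(real n + 1) powr \<alpha> \<le> 2 * real n powr \<alpha>" .
    have "ln (real n + 1) \<le> ln (2 * real n)" using n1 by simp
    also have "\<dots> = ln 2 + ln (real n)" using n1 by (simp add: ln_mult)
    also have "ln 2 \<le> (1::real)" using ln_2_less_1 by simp
    finally have l: "ln (real n + 1) \<le> 1 + ln (real n)" by simp
    have "L + b * ln (real n + 1) \<le> L + b * (1 + ln (real n))" using l assms by (simp add: mult_left_mono)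
    also have "\<dots> \<le> (L + b) * (1 + ln (real n))" using assms ln0 by (simp add: algebra_simps)
    finally have q: "L + b * ln (real n + 1) \<le> (L + b) * (1 + ln (real n))" .
    have q0: "0 \<le> L + b * ln (real n + 1)" using assms n1 by simp
    have "C * (real n + 1) powr \<alpha> * (L + b * ln (real n + 1)) \<le> C * (2 * real n powr \<alpha>) * ((L + b) * (1 + ln (real n)))"
      using p q q0 assms by (intro mult_mono mult_left_mono) auto
    also have "\<dots> = E * (real n powr \<alpha> * (1 + ln (real n)))" by (simp add: E_def)
    also have "\<dots> \<le> real K powr \<alpha> * (real n powr \<alpha> * (ln (real K) + ln (real n)))"
      using EK E0 lnK ln0 by (intro mult_mono) auto
    also have "\<dots> = real (K * n) powr \<alpha> * ln (real (K * n))" using K0 n1 by (simp add: powr_mult ln_mult)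
    finally have "exp (C * (real n + 1) powr \<alpha> * (L + b * ln (real n + 1))) \<le> exp (real (K * n) powr \<alpha> * ln (real (K * n)))" by simp
    then have "f n \<le> 1 * exp (real (K * n) powr \<alpha> * ln (real (K * n)))" using order_trans[OF f[of n]] by simp
    also have "\<dots> \<le> real K * exp (real (K * n) powr \<alpha> * ln (real (K * n)))" using k3 by (intro mult_right_mono) auto
    finally show ?thesis using K0 by linarith
  qed
  then show ?thesis unfolding growth_le_def by (intro exI[of _ K]) (simp add: K_def)
qed

lemma exponent_sublinear:
  fixes \<alpha> C L b :: real
  assumes "\<alpha> < 1"
  shows "(\<lambda>n. C * (real n + 1) powr \<alpha> * (L + b * ln (real n + 1)) / real n) \<longlonglongrightarrow> 0"
  using assms by real_asymp

lemma subexponentialI: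
  fixes \<alpha> C L b :: real and f :: "nat \<Rightarrow> real"
  assumes "\<alpha> < 1" "\<And>n. 1 \<le> f n"
    and f: "\<And>n. f n \<le> exp (C * (real n + 1) powr \<alpha> * (L + b * ln (real n + 1)))"
  shows "subexponential f"
  unfolding subexponential_def
proof (rule tendsto_sandwich)
  let ?g = "\<lambda>n. C * (real n + 1) powr \<alpha> * (L + b * ln (real n + 1)) / real n"
  show "(\<lambda>_. 1 :: real) \<longlonglongrightarrow> 1" by simp
  show "(\<lambda>n. exp (?g n)) \<longlonglongrightarrow> 1" using tendsto_exp[OF exponent_sublinear[OF assms(1)]] by simp
  show "\<forall>\<^sub>F n in sequentially. 1 \<le> root n (f n)"
    using eventually_gt_at_top[of 0] by eventually_elim (use assms(2) in simp)
  show "\<forall>\<^sub>F n in sequentially. root n (f n) \<le> exp (?g n)"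
    using eventually_gt_at_top[of 0]
  proof eventually_elim
    case (elim n)
    have "root n (f n) \<le> root n (exp (?g n * real n))" using elim f[of n] by simp
    also have "exp (?g n * real n) = exp (?g n) ^ n" by (simp only: exp_of_nat2_mult)
    also have "root n \<dots> = exp (?g n)" using elim by (intro real_root_power_cancel) auto
    finally show ?case .
  qed
qed

text \<open>In a prefix code the first code word is determined by the product.\<close>

lemma concat_inj_prefix_code:
  assumes "\<And>x y z. x \<in> A \<Longrightarrow> y \<in> A \<Longrightarrow> x = y @ z \<Longrightarrow> z = []"
  shows "set xs \<subseteq> A \<Longrightarrow> set ys \<subseteq> A \<Longrightarrow> length xs = length ys \<Longrightarrow> concat xs = concat ys \<Longrightarrow> xs = ys"
proof (induction xs arbitrary: ys)
  case (Cons x xs)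
  obtain y zs where ys: "ys = y # zs" using Cons.prems(3) by (cases ys) auto
  have xy: "x \<in> A" "y \<in> A" "x @ concat xs = y @ concat zs" using Cons.prems ys by auto
  have "x = y"
    using xy(3) unfolding append_eq_append_conv2
  proof (elim exE disjE conjE)
    fix us assume "x = y @ us"
    then show "x = y" using assms[OF xy(1,2), of us] by simp
  next
    fix us assume "x @ us = y"
    then show "x = y" using assms[OF xy(2,1), of us] by simp
  qed
  then show ?case using Cons.IH[of zs] Cons.prems ys xy(3) by simp
qed simp

section \<open>Counting geodesics\<close>

context finite_index_pair
begin

lemma word_norm_le: "w \<in> lists S \<Longrightarrow> word_norm G S (word_eval G w) \<le> length w"
  unfolding word_norm_def by (rule Least_le) blast

lemma geodesic_wordI:
  assumes "w \<in> lists S" "\<And>w'. w' \<in> lists S \<Longrightarrow> word_eval G w' = word_eval G w \<Longrightarrow> length w \<le> length w'"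
  shows "geodesic_word G S w"
proof -
  have "word_norm G S (word_eval G w) = length w"
    unfolding word_norm_def
  proof (rule Least_equality)
    show "\<exists>v\<in>lists S. word_eval G v = word_eval G w \<and> length v = length w" using assms(1) by blast
  qed (use assms(2) in blast)
  then show ?thesis using assms(1) by (simp add: geodesic_word_def)
qed

lemma finite_geodesics: "finite {w. geodesic_word G S w \<and> length w \<le> n}"
  by (rule finite_subset[OF _ finite_lists_length_le[OF finite_S, of n]])
    (auto simp: geodesic_word_def in_lists_conv_set)

lemma geodesic_growth_pos: "1 \<le> geodesic_growth G S n"
proof -
  have "geodesic_word G S []" by (rule geodesic_wordI) auto
  then have "{[]} \<subseteq> {w. geodesic_word G S w \<and> length w \<le> n}" by simp
  from card_mono[OF finite_geodesics this] show ?thesis by (simp add: geodesic_growth_def)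
qed

end

context projected_pair
begin

text \<open>A geodesic satisfies \<open>length w \<le> length w'\<close>, so the saving \<open>length bs / 2\<close> is at most the error term.\<close>

lemma geodesic_pieces:
  assumes "short_mod i \<alpha> W" "\<Gamma> i = {\<one>}" "0 \<le> \<alpha>"
  shows "\<exists>C::nat. \<forall>n. \<forall>w. geodesic_word G S w \<and> length w \<le> n \<longrightarrow>
    (\<exists>bs. set bs \<subseteq> W \<and> w = concat bs \<and> real (length bs) \<le> real C * (real n + 1) powr \<alpha>)"
proof -
  obtain C :: nat where C: "\<forall>w\<in>lists S. \<exists>bs. \<exists>w'\<in>lists S. set bs \<subseteq> W \<and> w = concat bs \<and>
     \<Gamma> i #> word_eval G w' = \<Gamma> i #> word_eval G w \<and>
     real (length w') + real (length bs) / 2 \<le> real (length w) + real C * (real (length w) + 1) powr \<alpha>"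
    using assms(1) unfolding short_mod_def by (elim exE)
  have "\<exists>bs. set bs \<subseteq> W \<and> w = concat bs \<and> real (length bs) \<le> real (2 * C) * (real n + 1) powr \<alpha>"
    if w: "geodesic_word G S w" "length w \<le> n" for w n
  proof -
    have wS: "w \<in> lists S" using w(1) by (simp add: geodesic_word_def)
    from bspec[OF C wS] obtain bs w' where b: "w' \<in> lists S" "set bs \<subseteq> W" "w = concat bs"
      "\<Gamma> i #> word_eval G w' = \<Gamma> i #> word_eval G w"
      "real (length w') + real (length bs) / 2 \<le> real (length w) + real C * (real (length w) + 1) powr \<alpha>"
      by (elim exE bexE conjE)
    have "word_eval G w' = word_eval G w" using b(1,4) wS unfolding assms(2) by (simp add: r_coset_def)
    then have "length w \<le> length w'" using w(1) word_norm_le[OF b(1)] by (simp add: geodesic_word_def)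
    moreover have "real C * (real (length w) + 1) powr \<alpha> \<le> real C * (real n + 1) powr \<alpha>"
      using w(2) assms(3) by (intro mult_left_mono powr_mono2) auto
    ultimately have "real (length bs) \<le> real (2 * C) * (real n + 1) powr \<alpha>" using b(5) by simp
    then show ?thesis using b(2,3) by blast
  qed
  then show ?thesis by blast
qed

lemma geodesic_growth_bound:
  assumes "\<not> two_on_common_facet G H \<phi> S" "short_mod i \<alpha> (tame B)" "\<Gamma> i = {\<one>}" "0 \<le> \<alpha>"
  shows "\<exists>A C::nat. \<forall>n. geodesic_growth G S n \<le> (A * (n + 1) ^ Suc B) ^ nat \<lfloor>real C * (real n + 1) powr \<alpha>\<rfloor> \<and> 1 \<le> A"
proof -
  obtain A where A: "\<And>n. card {w \<in> tame B. length w \<le> n} \<le> A * (n + 1) ^ Suc B" using tame_count[OF assms(1)] by blast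
  obtain C :: nat where C: "\<forall>n. \<forall>w. geodesic_word G S w \<and> length w \<le> n \<longrightarrow>
    (\<exists>bs. set bs \<subseteq> tame B \<and> w = concat bs \<and> real (length bs) \<le> real C * (real n + 1) powr \<alpha>)"
    using geodesic_pieces[OF assms(2-4)] by (elim exE)
  have "geodesic_growth G S n \<le> (Suc A * (n + 1) ^ Suc B) ^ nat \<lfloor>real C * (real n + 1) powr \<alpha>\<rfloor>" for n
  proof -
    let ?T = "{w \<in> tame B. length w \<le> n}" and ?k = "nat \<lfloor>real C * (real n + 1) powr \<alpha>\<rfloor>"
    have finT: "finite ?T"
      by (rule finite_subset[OF _ finite_lists_length_le[OF finite_S, of n]]) (auto simp: tame_def in_lists_conv_set)
    have sub: "{w. geodesic_word G S w \<and> length w \<le> n} \<subseteq> concat ` {bs. set bs \<subseteq> ?T \<and> length bs \<le> ?k}"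
    proof
      fix w assume "w \<in> {w. geodesic_word G S w \<and> length w \<le> n}"
      then have w: "geodesic_word G S w \<and> length w \<le> n" by simp
      then obtain bs where bs: "set bs \<subseteq> tame B" "w = concat bs" "real (length bs) \<le> real C * (real n + 1) powr \<alpha>"
        using C by blast
      have "length b \<le> n" if "b \<in> set bs" for b
      proof -
        have "length b \<le> length (concat bs)" using that by (induction bs) auto
        then show ?thesis using w bs(2) by simp
      qed
      moreover have "length bs \<le> ?k" using bs(3) by linarith
      ultimately show "w \<in> concat ` {bs. set bs \<subseteq> ?T \<and> length bs \<le> ?k}" using bs(1,2) by blast
    qed
    have "geodesic_growth G S n \<le> card (concat ` {bs. set bs \<subseteq> ?T \<and> length bs \<le> ?k})"
      unfolding geodesic_growth_def by (intro card_mono[OF _ sub] finite_imageI finite_lists_length_le finT)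
    also have "\<dots> \<le> card {bs. set bs \<subseteq> ?T \<and> length bs \<le> ?k}" by (intro card_image_le finite_lists_length_le finT)
    also have "\<dots> = (\<Sum>i\<le>?k. card ?T ^ i)" by (rule card_lists_length_le[OF finT])
    also have "\<dots> \<le> (1 + card ?T) ^ ?k" by (rule sum_powers_le)
    also have "\<dots> \<le> (Suc A * (n + 1) ^ Suc B) ^ ?k"
    proof (rule power_mono)
      have "1 \<le> (n + 1) ^ Suc B" by (rule one_le_power) simp
      then show "1 + card ?T \<le> Suc A * (n + 1) ^ Suc B" using A[of n] by simp
    qed simp
    finally show ?thesis .
  qed
  then show ?thesis by (intro exI[of _ "Suc A"] exI[of _ C]) simp
qed

lemma short_mod_growth_exponent:
  assumes "short_mod 2 0 W"
  shows "2 \<le> i \<Longrightarrow> short_mod i (growth_exponent i) W"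
proof (induction i rule: nat_induct_at_least)
  case base
  then show ?case using assms by (simp add: growth_exponent.simps)
next
  case (Suc i)
  then show ?case unfolding growth_exponent_step[OF Suc.hyps]
    using growth_exponent_bounds[OF Suc.hyps] by (intro short_mod_step) auto
qed

text \<open>The base case: modulo \<open>\<Gamma> 2\<close> the error is a constant.\<close>

lemma tame_short_mod: "\<exists>B. short_mod 2 0 (tame B)"
proof -
  obtain B and C :: nat where C: "\<forall>w\<in>lists S. \<exists>bs. \<exists>w'\<in>lists S. set bs \<subseteq> tame B \<and> w = concat bs \<and>
     \<Gamma> 2 #> word_eval G w' = \<Gamma> 2 #> word_eval G w \<and>
     real (length w') + real (length bs) / 2 \<le> real (length w) + real C"
    using tame_decomposition by (elim exE)
  have "(real (length w) + 1) powr 0 = 1" for w :: "'a list" by (simp add: add_pos_nonneg add_nonneg_eq_0_iff)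
  then have "short_mod 2 0 (tame B)" unfolding short_mod_def using C by (intro exI[of _ C]) simp
  then show ?thesis by (rule exI)
qed

lemma upper_growth_bounds:
  assumes "\<not> two_on_common_facet G H \<phi> S" "\<Gamma> i = {\<one>}" "2 \<le> i"
  shows "\<exists>A b C::nat. \<forall>n. geodesic_growth G S n \<le> (A * (n + 1) ^ b) ^ nat \<lfloor>real C * (real n + 1) powr growth_exponent i\<rfloor> \<and> 1 \<le> A"
proof -
  obtain B where B: "short_mod 2 0 (tame B)" using tame_short_mod by blast
  have "0 \<le> growth_exponent i" using growth_exponent_bounds[OF assms(3)] by simp
  from geodesic_growth_bound[OF assms(1) short_mod_growth_exponent[OF B assms(3)] assms(2) this]
  obtain A C :: nat where *: "\<forall>n. geodesic_growth G S n \<le> (A * (n + 1) ^ Suc B) ^ nat \<lfloor>real C * (real n + 1) powr growth_exponent i\<rfloor> \<and> 1 \<le> A"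
    by (elim exE)
  then show ?thesis by (intro exI)
qed

lemma exp_growth_bound:
  assumes "\<not> two_on_common_facet G H \<phi> S" "\<Gamma> i = {\<one>}" "2 \<le> i"
  shows "\<exists>C L b. 0 \<le> C \<and> 0 \<le> L \<and> 0 \<le> b \<and> (\<forall>n. real (geodesic_growth G S n) \<le>
    exp (C * (real n + 1) powr growth_exponent i * (L + b * ln (real n + 1))))"
proof -
  let ?\<alpha> = "growth_exponent i"
  obtain A b C :: nat where ub: "\<And>n. geodesic_growth G S n \<le> (A * (n + 1) ^ b) ^ nat \<lfloor>real C * (real n + 1) powr ?\<alpha>\<rfloor>" "1 \<le> A"
    using upper_growth_bounds[OF assms] by blast
  have "real (geodesic_growth G S n) \<le> exp (real C * (real n + 1) powr ?\<alpha> * (ln (real A) + real b * ln (real n + 1)))" for n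
  proof -
    let ?k = "nat \<lfloor>real C * (real n + 1) powr ?\<alpha>\<rfloor>"
    let ?y = "ln (real A) + real b * ln (real n + 1)"
    have y0: "0 \<le> ?y" using ub(2) by simp
    have z0: "0 \<le> real C * (real n + 1) powr ?\<alpha>" by simp
    have k: "real ?k \<le> real C * (real n + 1) powr ?\<alpha>" using z0 by linarith
    have n0: "0 < real n + 1" by simp
    have "real (A * (n + 1) ^ b) = exp ?y" using ub(2) n0 by (simp add: exp_add exp_of_nat_mult add.commute)
    then have "real ((A * (n + 1) ^ b) ^ ?k) = exp (real ?k * ?y)" by (simp only: of_nat_power exp_of_nat_mult)
    also have "\<dots> \<le> exp (real C * (real n + 1) powr ?\<alpha> * ?y)" using mult_right_mono[OF k y0] by simp
    finally show ?thesis using ub(1)[of n] by (meson of_nat_le_iff order_trans)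
  qed
  then show ?thesis using ub(2) by (intro exI[of _ "real C"] exI[of _ "ln (real A)"] exI[of _ "real b"]) simp
qed

lemma polynomial_growth_bound:
  assumes "\<not> two_on_common_facet G H \<phi> S" "\<Gamma> 2 = {\<one>}"
  shows "polynomially_bounded (\<lambda>n. real (geodesic_growth G S n))"
proof -
  have g2: "growth_exponent 2 = 0" by (simp add: growth_exponent.simps)
  obtain A b C :: nat where ub: "\<And>n. geodesic_growth G S n \<le> (A * (n + 1) ^ b) ^ nat \<lfloor>real C * (real n + 1) powr 0\<rfloor>"
    using upper_growth_bounds[OF assms] unfolding g2 by blast
  let ?p = "([:real A:] * [:1, 1:] ^ b) ^ C"
  have "real (geodesic_growth G S n) \<le> poly ?p (real n)" for n
  proof -
    have "nat \<lfloor>real C * (real n + 1) powr 0\<rfloor> = C" by (simp add: add_nonneg_eq_0_iff)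
    then have "real (geodesic_growth G S n) \<le> real ((A * (n + 1) ^ b) ^ C)" using ub[of n] by (simp only: of_nat_le_iff)
    then show ?thesis by (simp add: add.commute)
  qed
  then show ?thesis unfolding polynomially_bounded_def by blast
qed

text \<open>A loop and a product of loops representing its inverse have mean zero, so a face containing zero contains all
  points of loops.\<close>

lemma zero_not_in_facet:
  assumes "D facet_of Pol"
  shows "0 \<notin> D"
proof
  assume z: "0 \<in> D"
  have "pt l \<in> D" if l: "l \<in> loops" for l
  proof -
    have lH: "loop_val l \<in> H" by (rule loop_val_H[OF l])
    then have "inv (loop_val l) \<in> H" by simp
    then obtain ds where ds: "ds \<in> lists loops" "inv (loop_val l) = loops_val ds" by (rule H_loops)
    have "loops_val (l # ds) = \<one>" using ds(2)[symmetric] lH by simp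
    then have "pr (loops_val (l # ds)) /\<^sub>R real (loops_len (l # ds)) \<in> D" using z by simp
    from face_contains_all[OF facet_of_imp_face_of[OF assms] _ _ this, of l] show ?thesis using l ds(1) by simp
  qed
  then have "Pol \<subseteq> D" unfolding Pol_def
    using face_of_imp_convex[OF facet_of_imp_face_of[OF assms]] by (intro hull_minimal) auto
  then have "D = Pol" using facet_of_imp_subset[OF assms] by blast
  then show False using assms by (simp add: facet_of_irrefl)
qed

text \<open>The functional defining the facet is at most \<open>\<beta>\<close> on the polytope with \<open>\<beta> > 0\<close>, since \<open>0\<close> is in the polytope but on no
  facet. Any word for the same element therefore has at least the length of \<open>concat ws\<close>.\<close>

lemma facet_cycles_geodesic:
  assumes D: "D facet_of Pol" and as: "set ws \<subseteq> simple_cycles G H S" "\<And>a. a \<in> set ws \<Longrightarrow> cyc_pt a \<in> D"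
  shows "geodesic_word G S (concat ws)"
proof -
  obtain f \<beta> where f: "Pol \<subseteq> {x. f \<bullet> x \<le> \<beta>}" "D = Pol \<inter> {x. f \<bullet> x = \<beta>}"
    using facet_of_polyhedron[OF polyhedron_Pol D] by blast
  have "f \<bullet> 0 \<le> \<beta>" using f(1) zero_in_Pol by blast
  moreover have "f \<bullet> 0 \<noteq> \<beta>" using zero_not_in_facet[OF D] zero_in_Pol f(2) by blast
  ultimately have \<beta>: "0 < \<beta>" by simp
  have up: "f \<bullet> pr (loops_val cs) \<le> \<beta> * real (loops_len cs)" if cs: "cs \<in> lists loops" for cs
  proof (cases "cs = []")
    case False
    have L: "0 < real (loops_len cs)" using loops_len_pos[OF cs False] by simp
    have "f \<bullet> (pr (loops_val cs) /\<^sub>R real (loops_len cs)) \<le> \<beta>" using mean_in_Pol[OF cs False] f(1) by blast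
    then show ?thesis using L by (simp add: divide_inverse[symmetric] mult.commute[of "inverse _"] pos_divide_le_eq)
  qed simp
  have low: "concat vs \<in> lists S \<and> word_eval G (concat vs) \<in> H \<and> f \<bullet> pr (word_eval G (concat vs)) = \<beta> * real (length (concat vs))"
    if "set vs \<subseteq> set ws" for vs
    using that
  proof (induction vs rule: list.induct)
    case (Cons a vs)
    have a: "a \<in> simple_cycles G H S" "cyc_pt a \<in> D" using Cons.prems as by auto
    note ap = cycle_props[OF a(1)]
    have la: "0 < real (length a)" using ap by simp
    have "f \<bullet> cyc_pt a = \<beta>" using a(2) f(2) by blast
    then have "f \<bullet> pr (word_eval G a) = \<beta> * real (length a)"
      unfolding cyc_pt_def using la by (simp add: divide_inverse[symmetric] mult.commute[of "inverse _"] divide_eq_eq)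
    then show ?case using Cons ap by (simp add: pr_mult inner_add_right algebra_simps)
  qed simp
  note lw = low[of ws, OF subset_refl]
  show ?thesis
  proof (rule geodesic_wordI)
    show "concat ws \<in> lists S" using lw by blast
    fix w' assume w': "w' \<in> lists S" "word_eval G w' = word_eval G (concat ws)"
    have "word_eval G w' \<in> H" using lw w'(2) by simp
    then obtain cs where cs: "cs \<in> lists loops" "word_eval G w' = loops_val cs" "length w' = loops_len cs"
      using H_word_loops[OF w'(1)] by blast
    have "\<beta> * real (length (concat ws)) = f \<bullet> pr (loops_val cs)" using lw w'(2) cs(2) by simp
    also have "\<dots> \<le> \<beta> * real (length w')" using up[OF cs(1)] cs(3) by simp
    finally have "real (length (concat ws)) \<le> real (length w')" using \<beta> by simp
    then show "length (concat ws) \<le> length w'" by (simp only: of_nat_le_iff)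
  qed
qed

text \<open>A proper prefix that is itself a cycle would revisit the starting vertex.\<close>

lemma simple_cycle_prefix:
  assumes "a \<in> simple_cycles G H S" "b \<in> simple_cycles G H S" "a = b @ z"
  shows "z = []"
proof (rule ccontr)
  assume "z \<noteq> []"
  then have l: "length b < length a" using assms(3) by simp
  have b: "b \<in> lists S" "b \<noteq> []" "word_eval G b \<in> H" using cycle_props[OF assms(2)] by auto
  have "vx (take (length b) a) = vx (take 0 a)" using assms(3) b vx_eq_H[OF b(1)] vx_Nil by simp
  moreover have "inj_on (\<lambda>i. vx (take i a)) {..<length a}" using assms(1) by (simp add: simple_cycles_iff)
  ultimately have "length b = 0" using l by (elim inj_onD) auto
  then show False using b(2) by simp
qed

lemma two_on_common_facetE:
  assumes "two_on_common_facet G H \<phi> S"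
  obtains a b D where "a \<in> simple_cycles G H S" "b \<in> simple_cycles G H S" "a \<noteq> b" "D facet_of Pol" "cyc_pt a \<in> D" "cyc_pt b \<in> D"
proof -
  let ?SC = "simple_cycles G H S"
  obtain p q D where pq: "{#p, q#} \<subseteq># cycle_points G H \<phi> S" "D facet_of Pol" "p \<in> D" "q \<in> D"
    using assms unfolding two_on_common_facet_def cycle_polytope_eq by blast
  have "p \<in># cycle_points G H \<phi> S" using pq(1) by (rule mset_subset_eqD) simp
  then obtain a where a: "a \<in> ?SC" "p = cyc_pt a" using finite_cycles by (auto simp: cycle_points_eq)
  have "mset_set ?SC = add_mset a (mset_set (?SC - {a}))" by (rule mset_set.remove[OF finite_cycles a(1)])
  then have "cycle_points G H \<phi> S = add_mset p (image_mset cyc_pt (mset_set (?SC - {a})))"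
    unfolding cycle_points_eq a(2) by simp
  then have "{#q#} \<subseteq># image_mset cyc_pt (mset_set (?SC - {a}))" using pq(1) by simp
  then have "q \<in># image_mset cyc_pt (mset_set (?SC - {a}))" by simp
  then obtain b where b: "b \<in> ?SC" "b \<noteq> a" "q = cyc_pt b" using finite_cycles by auto
  show thesis using that[OF a(1) b(1) b(2)[symmetric] pq(2)] pq(3,4) a(2) b(3) by simp
qed

lemma exponential_lower_bound:
  assumes "two_on_common_facet G H \<phi> S"
  shows "growth_le (\<lambda>n. exp (real n)) (\<lambda>n. real (geodesic_growth G S n))"
proof -
  obtain a b D where ab: "a \<in> simple_cycles G H S" "b \<in> simple_cycles G H S" "a \<noteq> b" "D facet_of Pol" "cyc_pt a \<in> D" "cyc_pt b \<in> D"
    using two_on_common_facetE[OF assms] .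
  define L where "L = length a + length b"
  have L0: "0 < L" using cycle_props[OF ab(1)] by (simp add: L_def)
  have four: "2 ^ k \<le> geodesic_growth G S (L * k)" for k
  proof -
    let ?X = "{ws. set ws \<subseteq> {a, b} \<and> length ws = k}"
    have "inj_on concat ?X"
    proof (rule inj_onI)
      fix xs ys assume x: "xs \<in> ?X" "ys \<in> ?X" "concat xs = concat ys"
      show "xs = ys"
      proof (rule concat_inj_prefix_code[of "{a, b}"])
        show "z = []" if "x \<in> {a, b}" "y \<in> {a, b}" "x = y @ z" for x y z
          using simple_cycle_prefix[of x y z] that ab(1,2) by blast
      qed (use x in auto)
    qed
    then have "2 ^ k = card (concat ` ?X)" using ab(3) by (simp add: card_image card_lists_length_eq numeral_2_eq_2)
    also have "\<dots> \<le> geodesic_growth G S (L * k)"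
      unfolding geodesic_growth_def
    proof (rule card_mono[OF finite_geodesics], rule image_subsetI)
      fix ws assume "ws \<in> ?X"
      then have ws: "set ws \<subseteq> {a, b}" "length ws = k" by auto
      have "geodesic_word G S (concat ws)" using ws(1) ab by (intro facet_cycles_geodesic[OF ab(4)]) auto
      moreover have "length (concat ws) \<le> L * length ws" using ws(1) by (induction ws) (auto simp: L_def)
      ultimately show "concat ws \<in> {w. geodesic_word G S w \<and> length w \<le> L * k}" using ws(2) by simp
    qed
    finally show ?thesis .
  qed
  have l1: "1 \<le> real (2 * L)" using L0 by linarith
  have "exp (real n) \<le> real (2 * L) * real (geodesic_growth G S (2 * L * n)) + real (2 * L)" for n
  proof -
    have "exp (real n) = exp 1 ^ n" using exp_of_nat_mult[of n "1::real"] by simp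
    also have "\<dots> \<le> 4 ^ n" using exp_le by (intro power_mono) auto
    also have "(4::real) ^ n = real (2 ^ (2 * n))" by (simp add: power_mult)
    also have "\<dots> \<le> real (geodesic_growth G S (2 * L * n))" using four[of "2 * n"] by (simp only: of_nat_le_iff mult_ac)
    also have "\<dots> \<le> real (2 * L) * real (geodesic_growth G S (2 * L * n))"
      using mult_right_mono[OF l1, of "real (geodesic_growth G S (2 * L * n))"] by simp
    finally show ?thesis by (simp add: add_increasing2)
  qed
  then show ?thesis unfolding growth_le_def using L0 by (intro exI[of _ "2 * L"]) simp
qed

end

theorem theorem1:
  fixes G :: "('a, 'b) monoid_scheme"
    and S H :: "'a set"
    and s :: nat
    and \<phi> :: "'a set \<Rightarrow> real ^ 'd"
  assumes "group G"
    and "finite S" and "monoid_generating G S"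
    and "s \<ge> 1"
    and "H \<lhd> G" and "finite (rcosets\<^bsub>G\<^esub> H)"
    and "torsion_free G H" and "step_nilpotent G H s"
    and "\<phi> \<in> iso (abelianization G H) (int_lattice :: (real ^ 'd) monoid)"
  shows "(\<not> two_on_common_facet G H \<phi> S \<longrightarrow>
           subexponential (\<lambda>n. real (geodesic_growth G S n)) \<and>
           (s \<le> 2 \<longrightarrow> polynomially_bounded (\<lambda>n. real (geodesic_growth G S n))) \<and>
           (s \<ge> 3 \<longrightarrow> 0 < growth_exponent s \<and> growth_exponent s < 1 \<and>
              growth_le (\<lambda>n. real (geodesic_growth G S n))
                (\<lambda>n. exp (real n powr growth_exponent s * ln (real n)))))
       \<and> (two_on_common_facet G H \<phi> S \<longrightarrow>
           growth_le (\<lambda>n. exp (real n)) (\<lambda>n. real (geodesic_growth G S n)))"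
proof -
  have nil: "lower_central G H s = {\<one>\<^bsub>G\<^esub>}" using assms(8) by (simp add: step_nilpotent_def)
  interpret group G by fact
  interpret projected_pair G S H s \<phi>
    by (intro projected_pair.intro nilpotent_pair.intro finite_index_pair.intro projected_pair_axioms.intro
      nilpotent_pair_axioms.intro finite_index_pair_axioms.intro) (rule assms nil)+
  \<comment> \<open>The induction on the class starts at two, also when \<open>H\<close> is abelian.\<close>
  define i where "i = max 2 s"
  have i2: "2 \<le> i" by (simp add: i_def)
  have "lower_central G H i \<subseteq> lower_central G H s" by (rule Gamma_antimono) (simp add: i_def)
  then have triv: "lower_central G H i = {\<one>\<^bsub>G\<^esub>}" using Gamma_one[of i] nil by auto
  show ?thesis
  proof (intro conjI impI)
    assume g: "\<not> two_on_common_facet G H \<phi> S"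
    obtain C L b where e: "0 \<le> C" "0 \<le> L" "0 \<le> b" "\<And>n. real (geodesic_growth G S n) \<le>
      exp (C * (real n + 1) powr growth_exponent i * (L + b * ln (real n + 1)))"
      using exp_growth_bound[OF g triv i2] by blast
    note ge = growth_exponent_bounds[OF i2]
    show "subexponential (\<lambda>n. real (geodesic_growth G S n))"
      by (rule subexponentialI[OF _ _ e(4)]) (use ge geodesic_growth_pos in auto)
    show "polynomially_bounded (\<lambda>n. real (geodesic_growth G S n))" if "s \<le> 2"
      using polynomial_growth_bound[OF g] triv that by (simp add: i_def)
    assume s: "s \<ge> 3"
    then have si: "i = s" by (simp add: i_def)
    show p: "0 < growth_exponent s" by (rule growth_exponent_pos[OF s])
    show l: "growth_exponent s < 1" using ge si by simp
    show "growth_le (\<lambda>n. real (geodesic_growth G S n)) (\<lambda>n. exp (real n powr growth_exponent s * ln (real n)))"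
      by (rule growth_le_exp_powr[OF p l e(1-3)]) (rule e(4)[unfolded si])
  next
    assume "two_on_common_facet G H \<phi> S"
    then show "growth_le (\<lambda>n. exp (real n)) (\<lambda>n. real (geodesic_growth G S n))" by (rule exponential_lower_bound)
  qed
qed

end
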